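(* Let $\Gamma$ and $\Omega$ be two Coxeter graphs of spherical type. Let $\Gamma_1,\dots,\Gamma_p$ be the connected components of $\Gamma$ and $\Omega_1,\dots,\Omega_q$ be the connected components of $\Omega$. Then $A[\Gamma]$ and $A[\Omega]$ are commensurable if and only if $p=q$ and, up to a permutation of the indices, $A[\Gamma_i]$ and $A[\Omega_i]$ are commensurable for every $i\in\{1,\dots,p\}$.
   Context: A Coxeter matrix over a finite set $S$ is a matrix $(m_{s,t})_{s,t\in S}$ with entries in $\mathbb{N}\cup\{\infty\}$, $m_{s,s}=1$ for all $s\in S$, and $m_{s,t}=m_{t,s}\ge 2$ for all $s\neq t$. Its Coxeter graph $\Gamma$ has vertex set $S$; two distinct vertices $s,t$ are joined by an edge if $m_{s,t}\ge 3$, and the edge is labeled $m_{s,t}$ if $m_{s,t}\ge 4$. For $m\ge2$, $\Pi(s,t,m)$ denotes the word $sts\cdots$ of length $m$. The Artin group of $\Gamma$ is $A[\Gamma]=\langle S\mid \Pi(s,t,m_{s,t})=\Pi(t,s,m_{s,t}) \text{ for } s\neq t,\ m_{s,t}\neq\infty\rangle$, and the Coxeter group $W[\Gamma]$ is the quotient of $A[\Gamma]$ by the relations $s^2=1$, $s\in S$. The graph $\Gamma$ is of spherical type if $W[\Gamma]$ is finite. Two groups $G_1,G_2$ are commensurable if there are finite index subgroups $H_1\le G_1$ and $H_2\le G_2$ with $H_1\simeq H_2$. *)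

theory Defs
  imports "HOL-Algebra.Coset" "HOL-Library.Extended_Nat" "HOL-Combinatorics.Permutations"
begin

section \<open>Group presentations\<close>

text \<open>The letter \<open>(s, True)\<close> stands for the generator \<open>s\<close> and \<open>(s, False)\<close> for its formal inverse.\<close>

type_synonym 'a word = "('a \<times> bool) list"

definition words :: "'a set \<Rightarrow> 'a word set" where
  "words S = lists (S \<times> UNIV)"

text \<open>A relation \<open>u = v\<close> is the pair \<open>(u, v)\<close>. The following is the congruence on
  \<open>words S\<close> generated by the relations and by the cancellations \<open>s s\<^sup>-\<^sup>1 = s\<^sup>-\<^sup>1 s = 1\<close>.\<close>

inductive pres_eq :: "'a set \<Rightarrow> ('a word \<times> 'a word) set \<Rightarrow> 'a word \<Rightarrow> 'a word \<Rightarrow> bool"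
  for S R where
  refl: "u \<in> words S \<Longrightarrow> pres_eq S R u u"
| sym: "pres_eq S R u v \<Longrightarrow> pres_eq S R v u"
| trans: "pres_eq S R u v \<Longrightarrow> pres_eq S R v w \<Longrightarrow> pres_eq S R u w"
| cancel: "u \<in> words S \<Longrightarrow> v \<in> words S \<Longrightarrow> s \<in> S \<Longrightarrow>
    pres_eq S R (u @ [(s, b), (s, \<not> b)] @ v) (u @ v)"
| rel: "u \<in> words S \<Longrightarrow> v \<in> words S \<Longrightarrow> (l, r) \<in> R \<Longrightarrow> l \<in> words S \<Longrightarrow> r \<in> words S \<Longrightarrow>
    pres_eq S R (u @ l @ v) (u @ r @ v)"

definition pres_class :: "'a set \<Rightarrow> ('a word \<times> 'a word) set \<Rightarrow> 'a word \<Rightarrow> 'a word set" where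
  "pres_class S R u = {v. pres_eq S R u v}"

definition presented_group :: "'a set \<Rightarrow> ('a word \<times> 'a word) set \<Rightarrow> 'a word set monoid" where
  "presented_group S R =
    \<lparr>carrier = pres_class S R ` words S,
     monoid.mult = (\<lambda>X Y. \<Union>x\<in>X. \<Union>y\<in>Y. pres_class S R (x @ y)),
     one = pres_class S R []\<rparr>"

lemma words_simps [simp]:
  "[] \<in> words S"
  "x # u \<in> words S \<longleftrightarrow> fst x \<in> S \<and> u \<in> words S"
  "u @ v \<in> words S \<longleftrightarrow> u \<in> words S \<and> v \<in> words S"
  by (cases x; auto simp: words_def)+

lemma pres_eq_words:
  assumes "pres_eq S R u v"
  shows "u \<in> words S \<and> v \<in> words S"
  using assms by induction auto

lemma pres_eq_append_left:
  assumes "pres_eq S R u v" "w \<in> words S"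
  shows "pres_eq S R (w @ u) (w @ v)"
  using assms
proof induction
  case (cancel u v s b)
  then show ?case using pres_eq.cancel[of "w @ u" S v s R b] by simp
next
  case (rel u v l r)
  then show ?case using pres_eq.rel[of "w @ u" S v l r R] by simp
next
  case (refl u)
  then show ?case by (simp add: pres_eq.refl)
next
  case (sym u v)
  then show ?case by (blast intro: pres_eq.sym)
next
  case (trans u v x)
  then show ?case by (metis pres_eq.trans)
qed

lemma pres_eq_append_right:
  assumes "pres_eq S R u v" "w \<in> words S"
  shows "pres_eq S R (u @ w) (v @ w)"
  using assms
proof induction
  case (cancel u v s b)
  then show ?case using pres_eq.cancel[of u S "v @ w" s R b] by simp
next
  case (rel u v l r)
  then show ?case using pres_eq.rel[of u S "v @ w" l r R] by simp
next
  case (refl u)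
  then show ?case by (simp add: pres_eq.refl)
next
  case (sym u v)
  then show ?case by (blast intro: pres_eq.sym)
next
  case (trans u v x)
  then show ?case by (metis pres_eq.trans)
qed

lemma pres_class_eq_iff:
  assumes "u \<in> words S"
  shows "pres_class S R u = pres_class S R v \<longleftrightarrow> pres_eq S R u v"
proof
  assume "pres_class S R u = pres_class S R v"
  then have "u \<in> pres_class S R v"
    using assms by (auto simp: pres_class_def intro: pres_eq.refl)
  then show "pres_eq S R u v" by (simp add: pres_class_def pres_eq.sym)
next
  assume *: "pres_eq S R u v"
  then have "pres_eq S R u w \<longleftrightarrow> pres_eq S R v w" for w
    by (metis pres_eq.sym pres_eq.trans)
  then show "pres_class S R u = pres_class S R v" by (simp add: pres_class_def)
qed

lemma presented_group_mult:
  assumes "u \<in> words S" "v \<in> words S"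
  shows "pres_class S R u \<otimes>\<^bsub>presented_group S R\<^esub> pres_class S R v = pres_class S R (u @ v)"
proof -
  have "pres_class S R (x @ y) = pres_class S R (u @ v)"
    if "pres_eq S R u x" "pres_eq S R v y" for x y
  proof -
    have "pres_eq S R (u @ v) (x @ y)"
      using pres_eq.trans[OF pres_eq_append_right[OF that(1) assms(2)] pres_eq_append_left[OF that(2)]]
        pres_eq_words[OF that(1)] by simp
    then have "pres_class S R (u @ v) = pres_class S R (x @ y)"
      using assms by (subst pres_class_eq_iff) simp_all
    then show ?thesis ..
  qed
  then have *: "pres_class S R (x @ y) = pres_class S R (u @ v)"
    if "x \<in> pres_class S R u" "y \<in> pres_class S R v" for x y
    using that by (simp add: pres_class_def)
  have "pres_class S R u \<noteq> {}" "pres_class S R v \<noteq> {}"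
    using assms pres_eq.refl by (auto simp: pres_class_def)
  then have "(\<Union>x\<in>pres_class S R u. \<Union>y\<in>pres_class S R v. pres_class S R (x @ y))
      = pres_class S R (u @ v)"
    by (simp add: * cong: SUP_cong)
  then show ?thesis by (simp add: presented_group_def)
qed

lemma pres_eq_inverse_right:
  "u \<in> words S \<Longrightarrow> pres_eq S R (u @ rev (map (\<lambda>(s, b). (s, \<not> b)) u)) []"
proof (induction u)
  case Nil
  then show ?case by (simp add: pres_eq.refl)
next
  case (Cons a u)
  obtain s b where a: "a = (s, b)" by force
  let ?u' = "rev (map (\<lambda>(s, b). (s, \<not> b)) u)"
  have s: "s \<in> S" and u: "u \<in> words S" using Cons.prems a by auto
  have "pres_eq S R (([a] @ (u @ ?u')) @ [(s, \<not> b)]) (([a] @ []) @ [(s, \<not> b)])"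
    using Cons.IH[OF u] s a by (intro pres_eq_append_right pres_eq_append_left) auto
  moreover have "pres_eq S R ([] @ [(s, b), (s, \<not> b)] @ []) ([] @ [])"
    using s by (intro pres_eq.cancel) auto
  ultimately have "pres_eq S R ((([a] @ (u @ ?u')) @ [(s, \<not> b)])) []"
    unfolding a by (simp only: append.simps append_Nil2) (erule (1) pres_eq.trans)
  then show ?case using a by simp
qed

lemma group_presented_group: "group (presented_group S R)"
proof (rule groupI)
  fix X assume "X \<in> carrier (presented_group S R)"
  then obtain u where u: "u \<in> words S" "X = pres_class S R u"
    by (auto simp: presented_group_def)
  let ?i = "\<lambda>u::'a word. rev (map (\<lambda>(s, b). (s, \<not> b)) u)"
  have w: "?i u \<in> words S" using u(1) by (induction u) auto
  have ii: "?i (?i u) = u" by (induction u) auto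
  have "pres_eq S R (?i u @ u) []"
    using pres_eq_inverse_right[OF w, of R] unfolding ii .
  then have "pres_class S R (?i u) \<otimes>\<^bsub>presented_group S R\<^esub> X = \<one>\<^bsub>presented_group S R\<^esub>"
    unfolding u(2) presented_group_mult[OF w u(1)] using u(1) w
    by (simp add: presented_group_def pres_class_eq_iff)
  then show "\<exists>Y\<in>carrier (presented_group S R). Y \<otimes>\<^bsub>presented_group S R\<^esub> X = \<one>\<^bsub>presented_group S R\<^esub>"
    using w by (auto simp: presented_group_def)
next
  fix X Y assume "X \<in> carrier (presented_group S R)" "Y \<in> carrier (presented_group S R)"
  then obtain u v where "u \<in> words S" "X = pres_class S R u" "v \<in> words S" "Y = pres_class S R v"
    by (auto simp: presented_group_def)
  moreover from this have "pres_class S R (u @ v) \<in> carrier (presented_group S R)"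
    by (simp add: presented_group_def)
  ultimately show "X \<otimes>\<^bsub>presented_group S R\<^esub> Y \<in> carrier (presented_group S R)"
    by (simp add: presented_group_mult)
next
  fix X Y Z
  assume "X \<in> carrier (presented_group S R)" "Y \<in> carrier (presented_group S R)"
    "Z \<in> carrier (presented_group S R)"
  then obtain u v w where "u \<in> words S" "X = pres_class S R u" "v \<in> words S" "Y = pres_class S R v"
    "w \<in> words S" "Z = pres_class S R w"
    by (auto simp: presented_group_def)
  then show "X \<otimes>\<^bsub>presented_group S R\<^esub> Y \<otimes>\<^bsub>presented_group S R\<^esub> Z
      = X \<otimes>\<^bsub>presented_group S R\<^esub> (Y \<otimes>\<^bsub>presented_group S R\<^esub> Z)"
    by (simp add: presented_group_mult)
next
  fix X assume "X \<in> carrier (presented_group S R)"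
  then obtain u where "u \<in> words S" "X = pres_class S R u" by (auto simp: presented_group_def)
  moreover have "\<one>\<^bsub>presented_group S R\<^esub> = pres_class S R []" by (simp add: presented_group_def)
  ultimately show "\<one>\<^bsub>presented_group S R\<^esub> \<otimes>\<^bsub>presented_group S R\<^esub> X = X"
    by (simp add: presented_group_mult)
next
  show "\<one>\<^bsub>presented_group S R\<^esub> \<in> carrier (presented_group S R)"
    by (simp add: presented_group_def)
qed


section \<open>Coxeter matrices and Coxeter graphs\<close>

text \<open>A Coxeter graph and its Coxeter matrix determine each other, so a Coxeter graph is given
  by the pair \<open>S\<close>, \<open>m\<close>. Only the entries of \<open>m\<close> on \<open>S \<times> S\<close> matter; hence the full subgraph
  on \<open>C \<subseteq> S\<close> is given by the pair \<open>C\<close>, \<open>m\<close>.\<close>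

locale coxeter_matrix =
  fixes S :: "'a set" and m :: "'a \<Rightarrow> 'a \<Rightarrow> enat"
  assumes finite_S: "finite S"
    and diag: "s \<in> S \<Longrightarrow> m s s = 1"
    and symm: "s \<in> S \<Longrightarrow> t \<in> S \<Longrightarrow> s \<noteq> t \<Longrightarrow> m s t = m t s"
    and off_diag: "s \<in> S \<Longrightarrow> t \<in> S \<Longrightarrow> s \<noteq> t \<Longrightarrow> 2 \<le> m s t"

definition coxeter_edges :: "'a set \<Rightarrow> ('a \<Rightarrow> 'a \<Rightarrow> enat) \<Rightarrow> ('a \<times> 'a) set" where
  "coxeter_edges S m = {(s, t). s \<in> S \<and> t \<in> S \<and> s \<noteq> t \<and> 3 \<le> m s t}"

text \<open>Vertex sets of the connected components.\<close>

definition coxeter_components :: "'a set \<Rightarrow> ('a \<Rightarrow> 'a \<Rightarrow> enat) \<Rightarrow> 'a set set" where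
  "coxeter_components S m = S // (coxeter_edges S m)\<^sup>*"


section \<open>Artin groups and Coxeter groups\<close>

primrec alt_word :: "'a \<Rightarrow> 'a \<Rightarrow> nat \<Rightarrow> 'a word" where
  "alt_word s t 0 = []"
| "alt_word s t (Suc k) = (s, True) # alt_word t s k"

definition artin_relations :: "'a set \<Rightarrow> ('a \<Rightarrow> 'a \<Rightarrow> enat) \<Rightarrow> ('a word \<times> 'a word) set" where
  "artin_relations S m =
    {(alt_word s t k, alt_word t s k) |s t k. s \<in> S \<and> t \<in> S \<and> s \<noteq> t \<and> m s t = enat k}"

definition artin_group :: "'a set \<Rightarrow> ('a \<Rightarrow> 'a \<Rightarrow> enat) \<Rightarrow> 'a word set monoid" where
  "artin_group S m = presented_group S (artin_relations S m)"

definition artin_gen :: "'a set \<Rightarrow> ('a \<Rightarrow> 'a \<Rightarrow> enat) \<Rightarrow> 'a \<Rightarrow> 'a word set" where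
  "artin_gen S m s = pres_class S (artin_relations S m) [(s, True)]"

definition normal_closure :: "('g, 'x) monoid_scheme \<Rightarrow> 'g set \<Rightarrow> 'g set" where
  "normal_closure G X = \<Inter>{N. N \<lhd> G \<and> X \<subseteq> N}"

definition coxeter_group :: "'a set \<Rightarrow> ('a \<Rightarrow> 'a \<Rightarrow> enat) \<Rightarrow> 'a word set set monoid" where
  "coxeter_group S m =
    artin_group S m Mod
      normal_closure (artin_group S m)
        ((\<lambda>s. artin_gen S m s [^]\<^bsub>artin_group S m\<^esub> (2::nat)) ` S)"

definition spherical_type :: "'a set \<Rightarrow> ('a \<Rightarrow> 'a \<Rightarrow> enat) \<Rightarrow> bool" where
  "spherical_type S m \<longleftrightarrow> finite (carrier (coxeter_group S m))"


section \<open>Commensurability\<close>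

definition finite_index_subgroup :: "'g set \<Rightarrow> ('g, 'x) monoid_scheme \<Rightarrow> bool" where
  "finite_index_subgroup H G \<longleftrightarrow> subgroup H G \<and> finite (rcosets\<^bsub>G\<^esub> H)"

definition commensurable :: "('g, 'x) monoid_scheme \<Rightarrow> ('h, 'y) monoid_scheme \<Rightarrow> bool" where
  "commensurable G1 G2 \<longleftrightarrow>
    (\<exists>H1 H2. finite_index_subgroup H1 G1 \<and> finite_index_subgroup H2 G2 \<and>
      G1\<lparr>carrier := H1\<rparr> \<cong> G2\<lparr>carrier := H2\<rparr>)"

end

theory Submission imports Defs Complex_Main "HOL-Library.FuncSet"
begin

text \<open>The group \<open>A[\<Gamma>]\<close> is the direct product of the groups of its components, so one direction only says
  that commensurability is compatible with finite products (\<open>comm_sub_product\<close>). The other one is a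
  Krull-Schmidt theorem up to finite index. Such a theorem needs a strong form of indecomposability of the
  factors: if two commuting subgroups \<open>H\<close> and \<open>K\<close> of an irreducible Artin group of spherical type are such
  that every element has a power in \<open>H K\<close>, then \<open>H\<close> or \<open>K\<close> is central (\<open>strongly_indecomposable\<close>). Given
  an isomorphism \<open>\<phi>\<close> between subgroups of finite index of two products, the composition of \<open>\<phi>\<close> with the
  projection to a factor \<open>j\<close> is then non-central on at most one factor \<open>i\<close> of the source, and
  this matches the non-abelian factors of the two products. Matched factors are commensurable modulo their
  centres. They are also commensurable themselves, because the centre of an irreducible factor is
  infinite cyclic and is detected by the length homomorphism, which allows one to
  correct \<open>\<phi>\<close> by central elements (\<open>commensurable_mod_centre\<close>). The abelian factors are infinite cyclic,
  hence pairwise commensurable, and the rank of the centre shows that their numbers agree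
  (\<open>card_factors_le\<close>, \<open>factors_matched\<close>).

  Strong indecomposability is proved with Garside elements. Let \<open>\<Delta>\<close> be the Garside element of the
  whole group and \<open>\<Delta>\<^sub>J\<close> that of an irreducible parabolic subgroup \<open>A\<^sub>J\<close> which omits a single generator
  \<open>s\<close>. A power of \<open>\<Delta>\<^sub>J\<close> splits as \<open>h k\<close> with \<open>h\<close> in \<open>H\<close> and \<open>k\<close> in \<open>K\<close>, and \<open>h\<close> and \<open>k\<close> commute with
  all of \<open>A\<^sub>J\<close>. The centralizer of a power of \<open>\<Delta>\<^sub>J\<close> consists of elements of
  \<open>A\<^sub>J\<close> times powers of \<open>\<Delta>\<close> (\<open>centralizer_Delta_power\<close>), so \<open>h\<close> and \<open>k\<close> are products of powers of \<open>\<Delta>\<^sub>J\<close>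
  and \<open>\<Delta>\<close>. At least one of them, say \<open>h\<close>, involves \<open>\<Delta>\<^sub>J\<close>; then \<open>K\<close> commutes with a
  power of \<open>\<Delta>\<^sub>J\<close> and lies in \<open>A\<^sub>J\<close> up to powers of \<open>\<Delta>\<close>. On the other hand \<open>K\<close> is normalized by powers of
  all generators, and a subgroup of this kind that lies in a proper parabolic subgroup up to the
  centre is central (\<open>normalized_in_parabolic_central\<close>). All this rests on one fact about
  divisibility in the positive monoid: if the generator \<open>s\<close> divides \<open>\<Delta>\<^sub>J\<^sup>n z\<close>, then
  \<open>\<Delta>\<^sub>J\<inverse> \<Delta>\<close> divides \<open>z\<close> (\<open>ldvd_Delta_power\<close>).

  To compute with the positive monoid inside the Artin group one has to know that the monoid is
  cancellative, has least common multiples of elements with a common multiple, and embeds into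
  the group. Cancellation is Garside's theorem (\<open>garside_property_all\<close>). It is deduced here from
  Matsumoto's theorem (\<open>reduced_ceq_imp_beq\<close>), which follows from the exchange condition. The embedding
  (\<open>positive_embedding\<close>) writes elements of the group as fractions with a central denominator. Finiteness
  of the Coxeter group enters through a longest reduced word, which makes all generators have a common
  multiple (\<open>spherical_diagram_total\<close>).\<close>

section \<open>Coxeter words\<close>

primrec alt :: "'a \<Rightarrow> 'a \<Rightarrow> nat \<Rightarrow> 'a list" where
  "alt s t 0 = []"
| "alt s t (Suc k) = s # alt t s k"

lemma length_alt [simp]: "length (alt s t k) = k"
  by (induction k arbitrary: s t) auto

lemma alt_add: "alt s t (i + j) = alt s t i @ (if even i then alt s t j else alt t s j)"
  by (induction i arbitrary: s t) auto

lemma alt_Suc_right: "alt s t (Suc k) = alt s t k @ [if even k then s else t]"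
  using alt_add[of s t k 1] by simp

lemma rev_alt: "rev (alt s t k) = (if even k then alt t s k else alt s t k)"
proof (induction k arbitrary: s t)
  case (Suc k)
  have "rev (alt s t (Suc k)) = rev (alt t s k) @ [s]" by simp
  also have "\<dots> = (if even (Suc k) then alt t s (Suc k) else alt s t (Suc k))"
    unfolding Suc.IH alt_Suc_right by simp
  finally show ?case .
qed simp

lemma set_alt_subset: "set (alt s t k) \<subseteq> {s, t}"
  by (induction k arbitrary: s t) (simp, force)

lemma set_alt: "2 \<le> k \<Longrightarrow> set (alt s t k) = {s, t}"
proof -
  assume "2 \<le> k"
  then obtain j where "k = Suc (Suc j)" by (metis add_2_eq_Suc le_Suc_ex)
  then show ?thesis using set_alt_subset[of s t k] by auto
qed

locale coxeter_diagram =
  fixes M :: "'a \<Rightarrow> 'a \<Rightarrow> enat"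
  assumes M_sym: "M s t = M t s"
    and M_ge2: "s \<noteq> t \<Longrightarrow> 2 \<le> M s t"
begin

text \<open>Signs of letters are dropped, so words are lists of generators: \<open>ceq\<close> is equality in the Coxeter group.\<close>

inductive ceq :: "'a list \<Rightarrow> 'a list \<Rightarrow> bool" where
  ceq_refl [simp]: "ceq u u"
| ceq_sym: "ceq u v \<Longrightarrow> ceq v u"
| ceq_trans: "ceq u v \<Longrightarrow> ceq v w \<Longrightarrow> ceq u w"
| ceq_cancel: "ceq (u @ [s, s] @ v) (u @ v)"
| ceq_braid: "s \<noteq> t \<Longrightarrow> M s t = enat k \<Longrightarrow> ceq (u @ alt s t k @ v) (u @ alt t s k @ v)"

declare ceq_trans [trans]

lemma M_enat_ge2: "s \<noteq> t \<Longrightarrow> M s t = enat k \<Longrightarrow> 2 \<le> k"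
  using M_ge2[of s t] by (metis enat_ord_simps(1) numeral_eq_enat)

lemma ceq_context: "ceq u v \<Longrightarrow> ceq (a @ u @ b) (a @ v @ b)"
proof (induction rule: ceq.induct)
  case (ceq_cancel u s v)
  show ?case using ceq.ceq_cancel[of "a @ u" s "v @ b"] by simp
next
  case (ceq_braid s t k u v)
  then show ?case using ceq.ceq_braid[of s t k "a @ u" "v @ b"] by simp
qed (auto intro: ceq_sym ceq_trans)

lemma ceq_append: "ceq u u' \<Longrightarrow> ceq v v' \<Longrightarrow> ceq (u @ v) (u' @ v')"
  using ceq_context[of u u' "[]" v] ceq_context[of v v' u' "[]"] by (simp add: ceq_trans)

lemma ceq_cong: "ceq u v \<Longrightarrow> ceq u r \<longleftrightarrow> ceq v r"
  using ceq_sym ceq_trans by blast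

lemma ceq_Cons: "ceq u v \<Longrightarrow> ceq (s # u) (s # v)"
  using ceq_append[of "[s]" "[s]"] by simp

lemma ceq_ss: "ceq (s # s # u) u"
  using ceq_cancel[of "[]" s u] by simp

lemma ceq_ss_right: "ceq (u @ [s, s]) u"
  using ceq_cancel[of u s "[]"] by simp

lemma ceq_alt: "s \<noteq> t \<Longrightarrow> M s t = enat k \<Longrightarrow> ceq (alt s t k) (alt t s k)"
  using ceq_braid[of s t k "[]" "[]"] by simp

lemma ceq_rev: "ceq u v \<Longrightarrow> ceq (rev u) (rev v)"
proof (induction rule: ceq.induct)
  case (ceq_cancel u s v)
  show ?case using ceq.ceq_cancel[of "rev v" s "rev u"] by simp
next
  case (ceq_braid s t k u v)
  have "M t s = enat k" using ceq_braid M_sym by simp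
  then show ?case
    using ceq.ceq_braid[of s t k "rev v" "rev u"] ceq.ceq_braid[of t s k "rev v" "rev u"] ceq_braid
    by (simp add: rev_alt)
qed (auto intro: ceq_sym ceq_trans)

lemma ceq_rev_append: "ceq (rev u @ u @ v) v"
proof (induction u arbitrary: v)
  case (Cons s u)
  have "ceq (rev u @ [s] @ s # u @ v) (rev u @ u @ v)"
    using ceq_cancel[of "rev u" s "u @ v"] by simp
  then show ?case using Cons.IH[of v] ceq_trans by fastforce
qed simp

lemma ceq_append_rev: "ceq (u @ rev u @ v) v"
  using ceq_rev_append[of "rev u" v] by simp

lemma ceq_append_cancel_left: "ceq (a @ u) (a @ v) \<longleftrightarrow> ceq u v"
proof
  assume "ceq (a @ u) (a @ v)"
  then have "ceq (rev a @ a @ u) (rev a @ a @ v)" by (rule ceq_append[OF ceq_refl])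
  then show "ceq u v" using ceq_rev_append[of a u] ceq_rev_append[of a v] by (meson ceq_sym ceq_trans)
qed (simp add: ceq_append)

lemma ceq_Cons_cancel: "ceq (s # u) (s # v) \<longleftrightarrow> ceq u v"
  using ceq_append_cancel_left[of "[s]"] by simp

lemma ceq_append_cancel_right: "ceq (u @ b) (v @ b) \<longleftrightarrow> ceq u v"
  using ceq_append_cancel_left[of "rev b" "rev u" "rev v"] ceq_rev by (metis rev_append rev_rev_ident)

lemma ceq_length_parity: "ceq u v \<Longrightarrow> even (length u) \<longleftrightarrow> even (length v)"
  by (induction rule: ceq.induct) auto

subsection \<open>The exchange condition\<close>

text \<open>Write the \<open>i\<close>-th reflection of a word \<open>s\<^sub>1 \<dots> s\<^sub>n\<close> for \<open>s\<^sub>1 \<dots> s\<^sub>i \<dots> s\<^sub>1\<close>. Modulo 2, the number of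
  times that a given element occurs among the reflections of a word depends only on the element of the
  Coxeter group that the word represents: both sides of a defining relation have the same
  reflections. On a reduced word the reflections are pairwise distinct, and comparing the two
  facts yields the exchange condition.\<close>

primrec refl_parity :: "'a list \<Rightarrow> 'a list \<Rightarrow> bool" where
  "refl_parity [] r = False"
| "refl_parity (s # u) r = (ceq [s] r \<noteq> refl_parity u (s # r @ [s]))"

lemma refl_parity_cong: "ceq r r' \<Longrightarrow> refl_parity u r = refl_parity u r'"
proof (induction u arbitrary: r r')
  case (Cons s u)
  have "ceq (s # r @ [s]) (s # r' @ [s])"
    using ceq_context[OF Cons.prems, of "[s]" "[s]"] by simp
  moreover have "ceq [s] r = ceq [s] r'" using Cons.prems ceq_sym ceq_trans by blast
  ultimately show ?case using Cons.IH by auto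
qed simp

lemma refl_parity_append:
  "refl_parity (u @ v) r = (refl_parity u r \<noteq> refl_parity v (rev u @ r @ u))"
  by (induction u arbitrary: r) auto

lemma ceq_conj_move: "ceq u (s # r @ [s]) \<longleftrightarrow> ceq (s # u @ [s]) r"
proof -
  have "ceq (s # (s # r @ [s]) @ [s]) r"
    using ceq_ss[of s "r @ [s, s]"] ceq_ss_right[of r s] ceq_trans by fastforce
  moreover have "ceq u (s # r @ [s]) \<longleftrightarrow> ceq (s # u @ [s]) (s # (s # r @ [s]) @ [s])"
    by (metis ceq_Cons_cancel ceq_append_cancel_right)
  ultimately show ?thesis using ceq_sym ceq_trans by blast
qed

lemma refl_parity_alt:
  "refl_parity (alt s t k) r = odd (\<Sum>i<k. of_bool (ceq (alt s t (2 * i + 1)) r) :: nat)"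
proof (induction k arbitrary: s t r)
  case (Suc k)
  have conj: "ceq (alt t s (2 * i + 1)) (s # r @ [s]) = ceq (alt s t (2 * Suc i + 1)) r" for i
  proof -
    have "alt s t (2 * Suc i + 1) = s # alt t s (Suc (Suc (2 * i)))" by simp
    also have "alt t s (Suc (Suc (2 * i))) = alt t s (2 * i + 1) @ [s]"
      unfolding alt_Suc_right[of t s "Suc (2 * i)"] by simp
    finally show ?thesis unfolding ceq_conj_move by simp
  qed
  have "refl_parity (alt s t (Suc k)) r =
      (ceq [s] r \<noteq> odd (\<Sum>i<k. of_bool (ceq (alt s t (2 * Suc i + 1)) r) :: nat))"
    by (simp only: alt.simps refl_parity.simps Suc.IH conj)
  also have "\<dots> = odd (\<Sum>i<Suc k. of_bool (ceq (alt s t (2 * i + 1)) r) :: nat)"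
    unfolding sum.lessThan_Suc_shift by (cases "ceq [s] r") (simp_all add: o_def)
  finally show ?case .
qed simp

text \<open>The \<open>i\<close>-th reflection of one side of a braid relation is the \<open>(k - 1 - i)\<close>-th one of the other side.\<close>

lemma alt_reflections_reverse:
  assumes "s \<noteq> t" "M s t = enat k" "i < k"
  shows "ceq (alt t s (2 * i + 1)) (alt s t (2 * (k - Suc i) + 1))"
proof -
  let ?j = "2 * (k - Suc i) + 1"
  have k: "2 * k = (2 * i + 1) + ?j" using assms(3) by auto
  have "alt t s (2 * k) = alt t s (2 * i + 1) @ rev (alt s t ?j)"
    unfolding k alt_add[of t s "2 * i + 1"] rev_alt by simp
  moreover have "alt t s (2 * k) = alt t s k @ rev (alt s t k)"
    using alt_add[of t s k k] by (simp add: rev_alt mult_2)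
  moreover have "ceq (alt t s k @ rev (alt s t k)) (alt s t k @ rev (alt s t k))"
    using ceq_alt[OF assms(1,2)] by (intro ceq_append) (auto intro: ceq_sym)
  ultimately have "ceq (alt t s (2 * i + 1) @ rev (alt s t ?j)) (alt s t ?j @ rev (alt s t ?j))"
    using ceq_append_rev[of "alt s t k" "[]"] ceq_append_rev[of "alt s t ?j" "[]"]
    by (metis append_Nil2 ceq_sym ceq_trans)
  then show ?thesis unfolding ceq_append_cancel_right .
qed

text \<open>A braid relation reverses the reflections of its two sides, and a cancellation \<open>s s\<close> contributes the same
  reflection twice.\<close>

lemma refl_parity_ceq: "ceq u v \<Longrightarrow> refl_parity u r = refl_parity v r"
proof (induction arbitrary: r rule: ceq.induct)
  case (ceq_cancel u s v)
  let ?r = "rev u @ r @ u"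
  have "ceq (s # s # ?r @ [s, s]) ?r"
    using ceq_ss[of s "?r @ [s, s]"] ceq_ss_right[of ?r s] ceq_trans by blast
  then have "refl_parity v (s # s # ?r @ [s, s]) = refl_parity v ?r" by (rule refl_parity_cong)
  moreover have "ceq [s] (s # ?r @ [s]) \<longleftrightarrow> ceq [s] ?r"
    unfolding ceq_conj_move using ceq_ss[of s "[s]"] ceq_sym ceq_trans by (metis append_Cons append_Nil)
  ultimately show ?case by (cases "ceq [s] ?r") (simp_all add: refl_parity_append)
next
  case (ceq_braid s t k u v)
  let ?r = "rev u @ r @ u"
  have "(\<Sum>i<k. of_bool (ceq (alt t s (2 * i + 1)) ?r)) =
      (\<Sum>i<k. of_bool (ceq (alt s t (2 * (k - Suc i) + 1)) ?r) :: nat)"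
    by (intro sum.cong refl arg_cong[where f = of_bool] ceq_cong alt_reflections_reverse[OF ceq_braid])
      simp_all
  also have "\<dots> = (\<Sum>i<k. of_bool (ceq (alt s t (2 * i + 1)) ?r))"
    by (rule sum.nat_diff_reindex)
  finally have "refl_parity (alt s t k) ?r = refl_parity (alt t s k) ?r"
    unfolding refl_parity_alt by simp
  moreover have "ceq (rev (alt s t k) @ ?r @ alt s t k) (rev (alt t s k) @ ?r @ alt t s k)"
    using ceq_alt[OF ceq_braid] by (intro ceq_append ceq_rev ceq_refl)
  then have "refl_parity v (rev (alt s t k) @ ?r @ alt s t k) =
      refl_parity v (rev (alt t s k) @ ?r @ alt t s k)"
    by (rule refl_parity_cong)
  ultimately show ?case by (simp add: refl_parity_append)
qed auto

text \<open>An odd number of occurrences is positive, so there is an occurrence.\<close>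

lemma refl_parity_imp_reflection:
  "refl_parity u r \<Longrightarrow> \<exists>a c b. u = a @ c # b \<and> ceq (a @ [c] @ rev a) r"
proof (induction u arbitrary: r)
  case (Cons s u)
  show ?case
  proof (cases "ceq [s] r")
    case True
    then have "s # u = [] @ s # u \<and> ceq ([] @ [s] @ rev []) r" by simp
    then show ?thesis by blast
  next
    case False
    then have "refl_parity u (s # r @ [s])" using Cons.prems by simp
    from Cons.IH[OF this] obtain a c b
      where abc: "u = a @ c # b" "ceq (a @ [c] @ rev a) (s # r @ [s])" by blast
    have "s # u = (s # a) @ c # b" "ceq ((s # a) @ [c] @ rev (s # a)) r"
      using abc ceq_conj_move by auto
    then show ?thesis by blast
  qed
qed simp

definition reduced :: "'a list \<Rightarrow> bool" where
  "reduced u \<longleftrightarrow> (\<forall>v. ceq u v \<longrightarrow> length u \<le> length v)"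

lemma reducedD: "reduced u \<Longrightarrow> ceq u v \<Longrightarrow> length u \<le> length v"
  by (simp add: reduced_def)

lemma reduced_ceq: "reduced u \<Longrightarrow> ceq u v \<Longrightarrow> length v \<le> length u \<Longrightarrow> reduced v"
  unfolding reduced_def by (meson ceq_trans le_trans)

lemma ceq_reduced_length: "reduced u \<Longrightarrow> reduced v \<Longrightarrow> ceq u v \<Longrightarrow> length u = length v"
  by (meson ceq_sym le_antisym reducedD)

lemma reduced_appendD:
  assumes "reduced (u @ v)"
  shows "reduced u" "reduced v"
proof -
  show "reduced u" unfolding reduced_def
  proof (intro allI impI)
    fix w assume "ceq u w"
    then have "ceq (u @ v) (w @ v)" by (simp add: ceq_append)
    from reducedD[OF assms this] show "length u \<le> length w" by simp
  qed
  show "reduced v" unfolding reduced_def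
  proof (intro allI impI)
    fix w assume "ceq v w"
    then have "ceq (u @ v) (u @ w)" by (simp add: ceq_append)
    from reducedD[OF assms this] show "length v \<le> length w" by simp
  qed
qed

lemma reduced_ConsD: "reduced (s # u) \<Longrightarrow> reduced u"
  using reduced_appendD(2)[of "[s]"] by simp

lemma reduced_rev [simp]: "reduced (rev u) \<longleftrightarrow> reduced u"
proof -
  have "reduced (rev u)" if "reduced u" for u
    unfolding reduced_def
  proof (intro allI impI)
    fix v assume "ceq (rev u) v"
    then have "ceq u (rev v)" using ceq_rev by fastforce
    from reducedD[OF that this] show "length (rev u) \<le> length v" by simp
  qed
  then show ?thesis by (metis rev_rev_ident)
qed

lemma ex_reduced: "\<exists>w. ceq u w \<and> reduced w"
proof -
  obtain w where w: "ceq u w" "\<forall>v. ceq u v \<longrightarrow> length w \<le> length v"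
    using ex_has_least_nat[of "ceq u" u length] by auto
  have "reduced w" unfolding reduced_def using w by (meson ceq_trans)
  then show ?thesis using w by blast
qed

lemma not_reduced_square [simp]: "\<not> reduced (u @ s # s # v)"
  using reducedD[OF _ ceq_cancel[of u s v]] by auto

text \<open>Deleting the letter of a second occurrence of the reflection \<open>s\<close> together with the first letter would give
  a shorter word, so in a reduced word \<open>s\<close> occurs once.\<close>

lemma reduced_first_reflection:
  assumes "reduced (s # x)"
  shows "refl_parity (s # x) [s]"
proof -
  have "\<not> refl_parity x [s]"
  proof
    assume "refl_parity x [s]"
    then obtain a c b where abc: "x = a @ c # b" "ceq (a @ [c] @ rev a) [s]"
      using refl_parity_imp_reflection by blast
    have "ceq ([s] @ a @ c # b) ((a @ [c] @ rev a) @ a @ c # b)"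
      by (rule ceq_append[OF ceq_sym[OF abc(2)] ceq_refl])
    also have "(a @ [c] @ rev a) @ a @ c # b = (a @ [c]) @ (rev a @ a @ c # b)" by simp
    also have "ceq \<dots> ((a @ [c]) @ c # b)" by (rule ceq_append[OF ceq_refl ceq_rev_append])
    also have "(a @ [c]) @ c # b = a @ [c, c] @ b" by simp
    also have "ceq \<dots> (a @ b)" by (rule ceq_cancel)
    finally have "ceq (s # x) (a @ b)" by (simp add: abc(1))
    from reducedD[OF assms this] show False by (simp add: abc)
  qed
  moreover have "ceq (s # [s] @ [s]) [s]" using ceq_ss by simp
  ultimately have "\<not> refl_parity x (s # [s] @ [s])" using refl_parity_cong by blast
  then show ?thesis by simp
qed

text \<open>As \<open>s u\<close> represents the same element as a shorter reduced word that can be extended by \<open>s\<close> on the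
  left, the parity of the reflection \<open>s\<close> is odd for \<open>u\<close>; a letter of \<open>u\<close> that produces it is the one to
  exchange.\<close>

lemma exchange:
  assumes "reduced u" "\<not> reduced (s # u)"
  shows "\<exists>a c b. u = a @ c # b \<and> ceq (s # a) (a @ [c])"
proof -
  obtain w where w: "ceq (s # u) w" "reduced w" using ex_reduced by blast
  have "length w < length (s # u)"
    using assms(2) w by (metis ceq_sym le_less_linear reduced_ceq)
  moreover have "length w \<noteq> length u" using ceq_length_parity[OF w(1)] by auto
  ultimately have len: "length (s # w) \<le> length u" by simp
  have u: "ceq u (s # w)"
    using ceq_Cons[OF w(1), of s] ceq_ss[of s u] ceq_sym ceq_trans by blast
  have "reduced (s # w)" using reduced_ceq[OF assms(1) u len] .
  then have "refl_parity u [s]"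
    using reduced_first_reflection refl_parity_ceq[OF u] by simp
  then obtain a c b where abc: "u = a @ c # b" "ceq (a @ [c] @ rev a) [s]"
    using refl_parity_imp_reflection by blast
  have "ceq ([s] @ a) ((a @ [c] @ rev a) @ a)" by (rule ceq_append[OF ceq_sym[OF abc(2)] ceq_refl])
  also have "(a @ [c] @ rev a) @ a = (a @ [c]) @ (rev a @ a @ [])" by simp
  also have "ceq \<dots> ((a @ [c]) @ [])" by (rule ceq_append[OF ceq_refl ceq_rev_append])
  finally have "ceq (s # a) (a @ [c])" by simp
  then show ?thesis using abc(1) by blast
qed

lemma exchange_word:
  assumes "reduced u" "\<not> reduced (s # u)"
  shows "\<exists>w. reduced (s # w) \<and> ceq u (s # w)"
proof -
  obtain a c b where abc: "u = a @ c # b" "ceq (s # a) (a @ [c])" using exchange assms by blast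
  have "ceq ((a @ [c]) @ b) ((s # a) @ b)" by (rule ceq_append[OF ceq_sym[OF abc(2)] ceq_refl])
  then have "ceq u (s # a @ b)" using abc(1) by simp
  moreover have "length (s # a @ b) \<le> length u" using abc(1) by simp
  ultimately show ?thesis using assms(1) reduced_ceq by blast
qed

subsection \<open>The order of a product of two generators\<close>

text \<open>A relation between alternating words that are shorter than the braid relation would make
  Matsumoto's theorem fail. To exclude it, let the Coxeter group act on all real functions
  on the generators by the contragredient of the geometric representation. The number \<open>K\<close> replaces the
  infinite labels; it is arbitrary because these labels contribute no relation.\<close>

definition theta :: "nat \<Rightarrow> 'a \<Rightarrow> 'a \<Rightarrow> real" where
  "theta K s t = pi / (case M s t of enat k \<Rightarrow> real k | \<infinity> \<Rightarrow> real K)"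

definition gcoef :: "nat \<Rightarrow> 'a \<Rightarrow> 'a \<Rightarrow> real" where
  "gcoef K s t = (if s = t then -2 else 2 * cos (theta K s t))"

definition greflect :: "nat \<Rightarrow> 'a \<Rightarrow> ('a \<Rightarrow> real) \<Rightarrow> 'a \<Rightarrow> real" where
  "greflect K s f = (\<lambda>t. f t + gcoef K s t * f s)"

primrec gact :: "nat \<Rightarrow> 'a list \<Rightarrow> ('a \<Rightarrow> real) \<Rightarrow> 'a \<Rightarrow> real" where
  "gact K [] f = f"
| "gact K (s # u) f = gact K u (greflect K s f)"

lemma gact_append: "gact K (u @ v) f = gact K v (gact K u f)"
  by (induction u arbitrary: f) auto

lemma theta_sym: "theta K s t = theta K t s"
  by (simp add: theta_def M_sym)

lemma theta_bounds:
  assumes "s \<noteq> t" "2 \<le> K"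
  shows "0 < theta K s t" "theta K s t \<le> pi / 2"
proof -
  have *: "2 \<le> (case M s t of enat k \<Rightarrow> real k | \<infinity> \<Rightarrow> real K)"
    using M_enat_ge2[OF assms(1)] assms(2) by (auto split: enat.split)
  show "0 < theta K s t" unfolding theta_def using * by (intro divide_pos_pos) auto
  show "theta K s t \<le> pi / 2" unfolding theta_def using * by (intro divide_left_mono) auto
qed

lemma sin_theta_pos: "s \<noteq> t \<Longrightarrow> 2 \<le> K \<Longrightarrow> 0 < sin (theta K s t)"
  using theta_bounds[of s t K] pi_half_gt_zero by (intro sin_gt_zero) linarith+

lemma gact_alt:
  assumes "s \<noteq> t" "2 \<le> K"
  defines "\<theta> \<equiv> theta K s t"
  shows "sin \<theta> * gact K (alt s t k) f (if even k then s else t)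
      = f s * sin ((real k + 1) * \<theta>) + f t * sin (real k * \<theta>)"
    and "sin \<theta> * gact K (alt s t k) f (if even k then t else s)
      = - (f s * sin (real k * \<theta>) + f t * sin ((real k - 1) * \<theta>))"
proof -
  let ?S = "\<lambda>x. sin (x * \<theta>)"
  have "sin \<theta> * gact K (alt s t k) f (if even k then s else t) = f s * ?S (real k + 1) + f t * ?S (real k) \<and>
    sin \<theta> * gact K (alt s t k) f (if even k then t else s) = - (f s * ?S (real k) + f t * ?S (real k - 1))"
    using assms(1) meta_eq_to_obj_eq[OF \<theta>_def]
  proof (induction k arbitrary: s t f)
    case (Suc k)
    let ?f = "greflect K s f"
    have f: "?f s = - f s" "?f t = f t + 2 * cos \<theta> * f s"
      using Suc.prems(1) by (simp_all add: greflect_def gcoef_def Suc.prems(2))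
    have \<theta>: "\<theta> = theta K t s" using Suc.prems theta_sym by simp
    have IH: "sin \<theta> * gact K (alt t s k) ?f (if even k then t else s) = ?f t * ?S (real k + 1) + ?f s * ?S (real k)"
      "sin \<theta> * gact K (alt t s k) ?f (if even k then s else t) = - (?f t * ?S (real k) + ?f s * ?S (real k - 1))"
      using Suc.IH[of t s ?f] Suc.prems \<theta> by auto
    \<comment> \<open>the recursion of the sines: \<open>sin ((j + 1) \<theta>) + sin ((j - 1) \<theta>) = 2 cos \<theta> sin (j \<theta>)\<close>\<close>
    have S: "?S (x + 1) = 2 * cos \<theta> * ?S x - ?S (x - 1)" for x
      by (simp add: distrib_right left_diff_distrib sin_add sin_diff)
    have S1: "?S (real (Suc k) + 1) = 2 * cos \<theta> * ?S (real k + 1) - ?S (real k)"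
      using S[of "real k + 1"] by (simp add: add.commute)
    have S2: "?S (real k - 1) = 2 * cos \<theta> * ?S (real k) - ?S (real k + 1)"
      using S[of "real k"] by simp
    have Suc_k: "real (Suc k) = real k + 1" "real (Suc k) - 1 = real k" by simp_all
    have "sin \<theta> * gact K (alt t s k) ?f (if even k then t else s)
        = f s * ?S (real (Suc k) + 1) + f t * ?S (real (Suc k))"
      unfolding IH(1) f S1 by (simp add: Suc_k(1) algebra_simps)
    moreover have "sin \<theta> * gact K (alt t s k) ?f (if even k then s else t)
        = - (f s * ?S (real (Suc k)) + f t * ?S (real (Suc k) - 1))"
      unfolding IH(2) f S2 Suc_k(2) by (simp add: Suc_k(1) algebra_simps)
    ultimately show ?case by (cases "even k") simp_all
  qed (simp_all)
  then show "sin \<theta> * gact K (alt s t k) f (if even k then s else t)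
      = f s * sin ((real k + 1) * \<theta>) + f t * sin (real k * \<theta>)"
    and "sin \<theta> * gact K (alt s t k) f (if even k then t else s)
      = - (f s * sin (real k * \<theta>) + f t * sin ((real k - 1) * \<theta>))"
    by blast+
qed

text \<open>The two sides of a braid relation agree on \<open>f s\<close> and \<open>f t\<close> by trigonometry. For any other
  \<open>x\<close>, some combination \<open>f x + \<alpha> f s + \<beta> f t\<close> is invariant under both reflections, because
  the Gram matrix of the two simple roots is invertible; hence the sides agree on \<open>f x\<close>, too.\<close>

lemma gact_braid:
  assumes st: "s \<noteq> t" and k: "M s t = enat k" and K: "2 \<le> K"
  shows "gact K (alt s t k) f = gact K (alt t s k) f"
proof
  fix x
  let ?\<theta> = "theta K s t"
  have k2: "2 \<le> k" using M_enat_ge2[OF st k] .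
  have \<theta>: "real k * ?\<theta> = pi" using k k2 by (simp add: theta_def)
  have sk: "sin ((real k + 1) * ?\<theta>) = - sin ?\<theta>" "sin ((real k - 1) * ?\<theta>) = sin ?\<theta>"
    "sin (real k * ?\<theta>) = 0"
    using \<theta> by (simp_all add: distrib_right left_diff_distrib sin_add sin_diff)
  have pos: "0 < sin ?\<theta>" using sin_theta_pos[OF st K] .
  have neg: "sin ?\<theta> * a = - (b * sin ?\<theta>) \<longleftrightarrow> a = - b" for a b :: real
    using pos mult_cancel_left[of "sin ?\<theta>" a "- b"] by (simp add: mult.commute)
  note 1 = gact_alt[OF st K, of k f, unfolded sk]
    and 2 = gact_alt[OF st[symmetric] K, of k f, unfolded theta_sym[of K t s] sk]
  have fs: "gact K (alt s t k) f s = gact K (alt t s k) f s"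
    and ft: "gact K (alt s t k) f t = gact K (alt t s k) f t"
    using 1 2 pos by (auto simp: neg split: if_splits)
  let ?c = "2 * cos ?\<theta>"
  have c: "?c\<^sup>2 \<noteq> 4"
  proof
    assume "?c\<^sup>2 = 4"
    then have "(cos ?\<theta>)\<^sup>2 = 1" by (simp add: power_mult_distrib)
    then show False using pos sin_cos_squared_add[of ?\<theta>] by simp
  qed
  show "gact K (alt s t k) f x = gact K (alt t s k) f x"
  proof (cases "x = s \<or> x = t")
    case False
    define p q where "p = gcoef K s x" and "q = gcoef K t x"
    define \<alpha> \<beta> where "\<alpha> = (2 * p + ?c * q) / (4 - ?c\<^sup>2)" and "\<beta> = (2 * q + ?c * p) / (4 - ?c\<^sup>2)"
    have ab: "p - 2 * \<alpha> + ?c * \<beta> = 0" "q - 2 * \<beta> + ?c * \<alpha> = 0"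
      unfolding \<alpha>_def \<beta>_def using c by (simp_all add: field_simps power2_eq_square)
    define I where "I g = g x + \<alpha> * g s + \<beta> * g t" for g :: "'a \<Rightarrow> real"
    have Is: "I (greflect K s g) = I g" for g
    proof -
      have "I (greflect K s g) - I g = (p - 2 * \<alpha> + ?c * \<beta>) * g s"
        using st by (simp add: I_def greflect_def gcoef_def p_def algebra_simps)
      then show ?thesis using ab by simp
    qed
    have It: "I (greflect K t g) = I g" for g
    proof -
      have "I (greflect K t g) - I g = (q - 2 * \<beta> + ?c * \<alpha>) * g t"
        using st by (simp add: I_def greflect_def gcoef_def q_def theta_sym[of K t s] algebra_simps)
      then show ?thesis using ab by simp
    qed
    have "set u \<subseteq> {s, t} \<Longrightarrow> I (gact K u g) = I g" for u g
      by (induction u arbitrary: g) (use Is It in auto)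
    then have "I (gact K (alt s t k) f) = I (gact K (alt t s k) f)"
      using set_alt_subset[of s t k] set_alt_subset[of t s k] by (metis insert_commute)
    then show ?thesis using fs ft by (simp add: I_def)
  qed (use fs ft in auto)
qed

lemma gact_ceq: "ceq u v \<Longrightarrow> 2 \<le> K \<Longrightarrow> gact K u f = gact K v f"
proof (induction arbitrary: f rule: ceq.induct)
  case (ceq_cancel u s v)
  have "greflect K s (greflect K s g) = g" for g
    by (simp add: greflect_def gcoef_def fun_eq_iff algebra_simps)
  then show ?case by (simp add: gact_append)
next
  case (ceq_braid s t k u v)
  then show ?case using gact_braid[of s t k K] by (simp add: gact_append)
qed auto

text \<open>The word \<open>alt s t k\<close> acts on the plane of \<open>s\<close> and \<open>t\<close> through multiples of the angle \<open>\<theta> = \<pi> / m\<^sub>s\<^sub>t\<close>, and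
  the sines that occur do not vanish below \<open>m\<^sub>s\<^sub>t \<theta> = \<pi>\<close>.\<close>

lemma short_alt_not_ceq:
  assumes st: "s \<noteq> t" and k: "0 < k" "enat k < M s t"
  shows "\<not> ceq (alt s t k) (alt t s k)"
proof
  assume ceq: "ceq (alt s t k) (alt t s k)"
  define K where "K = Suc k"
  let ?\<theta> = "theta K s t"
  have K: "2 \<le> K" using k by (simp add: K_def)
  define f where "f x = (if x = s then 1 else 0 :: real)" for x
  have f: "f s = 1" "f t = 0" using st by (auto simp: f_def)
  have eq: "gact K (alt s t k) f = gact K (alt t s k) f" using gact_ceq[OF ceq K] .
  note 1 = gact_alt[OF st K, of k f, unfolded f] and
    2 = gact_alt[OF st[symmetric] K, of k f, unfolded f theta_sym[of K t s]]
  have "sin (real k * ?\<theta>) = 0"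
    using 1 2 unfolding eq by (cases "even k") auto
  moreover have "0 < real k * ?\<theta>" using theta_bounds[OF st K] k by simp
  moreover have "real k * ?\<theta> < pi"
  proof -
    have "real k < (case M s t of enat k \<Rightarrow> real k | \<infinity> \<Rightarrow> real K)"
      using k by (auto simp: K_def split: enat.split)
    then show ?thesis using k by (simp add: theta_def field_simps)
  qed
  ultimately show False using sin_gt_zero by fastforce
qed

subsection \<open>Common descents and Matsumoto's theorem\<close>

text \<open>By the exchange condition, \<open>t\<close> can be moved to the front at the cost of one letter. If this letter
  lies in \<open>w\<close>, the alternating prefix has grown. If it lies in the prefix, then two alternating words of
  length at most \<open>j\<close> are equal in the Coxeter group, so the prefix is a full braid relation.\<close>

lemma alt_extend_or_full:
  assumes st: "s \<noteq> t" and red: "reduced (alt s t j @ w)" and desc: "\<not> reduced (t # alt s t j @ w)"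
    and j: "0 < j"
  shows "M s t = enat j \<or> (\<exists>w'. reduced (alt t s (Suc j) @ w') \<and> ceq (alt s t j @ w) (alt t s (Suc j) @ w'))"
proof -
  let ?x = "alt s t j @ w"
  obtain a c b where abc: "?x = a @ c # b" "ceq (t # a) (a @ [c])"
    using exchange[OF red desc] by blast
  show ?thesis
  proof (cases "j \<le> length a")
    case True
    then obtain a' where a': "a = alt s t j @ a'" "w = a' @ c # b"
      using abc(1) by (metis (no_types, lifting) append_eq_append_conv_if append_take_drop_id length_alt
          append_eq_append_conv2 same_append_eq append_Nil2 append.assoc take_all_iff)
    have "ceq ((a @ [c]) @ b) ((t # a) @ b)" by (rule ceq_append[OF ceq_sym[OF abc(2)] ceq_refl])
    then have "ceq ?x (alt t s (Suc j) @ a' @ b)" using abc(1) a' by simp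
    moreover from this have "reduced (alt t s (Suc j) @ a' @ b)"
      using reduced_ceq[OF red] a' by simp
    ultimately show ?thesis by blast
  next
    case False
    define i where "i = length a"
    have ij: "Suc i \<le> j" using False i_def by simp
    then obtain l where l: "j = Suc i + l" using le_Suc_ex by blast
    have "alt s t j @ w = alt s t (Suc i) @ (if even (Suc i) then alt s t l else alt t s l) @ w"
      unfolding l alt_add[of s t "Suc i" l] by simp
    then have "(a @ [c]) @ b = alt s t (Suc i) @ (if even (Suc i) then alt s t l else alt t s l) @ w"
      using abc(1) by simp
    from arg_cong[OF this, of "take (Suc i)"] have ac: "a @ [c] = alt s t (Suc i)"
      by (simp add: i_def del: alt.simps)
    then have "a = alt s t i" unfolding alt_Suc_right by simp
    then have "ceq (alt t s (Suc i)) (alt s t (Suc i))" using abc(2) ac by simp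
    then have "\<not> enat (Suc i) < M s t"
      using short_alt_not_ceq[OF st, of "Suc i"] ceq_sym by blast
    then obtain k where k: "M s t = enat k" "k \<le> Suc i"
      by (metis enat_ile enat_ord_simps(1) not_less)
    have "\<not> k < j"
    proof
      assume "k < j"
      then obtain l' where "j = Suc k + l'" using less_imp_Suc_add by auto
      then have "reduced (alt s t (Suc k))"
        using red reduced_appendD(1) alt_add[of s t "Suc k" l'] by (metis append.assoc)
      then have "reduced (s # alt t s k)" by simp
      moreover have "ceq (s # alt t s k) (s # alt s t k)"
        using ceq_alt[OF st k(1)] ceq_Cons ceq_sym by blast
      ultimately have "reduced (s # alt s t k)" using reduced_ceq by simp
      moreover obtain k' where "k = Suc k'" using M_enat_ge2[OF st k(1)] by (cases k) auto
      ultimately show False using not_reduced_square[of "[]"] by simp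
    qed
    then show ?thesis using k ij by auto
  qed
qed

lemma not_reduced_Cons_ceq:
  assumes "reduced x" "reduced y" "ceq x y" "\<not> reduced (s # x)"
  shows "\<not> reduced (s # y)"
  using assms ceq_reduced_length by (metis ceq_Cons ceq_sym length_Cons order_refl reduced_ceq)

text \<open>If both \<open>s\<close> and \<open>t\<close> are left descents of an element, then exchanging alternately on both
  letters makes the alternating prefix grow until it is the longest word of the dihedral group.\<close>

lemma common_descents:
  assumes st: "s \<noteq> t" and x: "reduced x" "\<not> reduced (s # x)" "\<not> reduced (t # x)"
  shows "\<exists>k w. M s t = enat k \<and> reduced (alt s t k @ w) \<and> ceq x (alt s t k @ w)"
proof -
  have grow: "\<exists>k w. M s t = enat k \<and> reduced (alt s t k @ w) \<and> ceq x (alt s t k @ w)"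
    if "reduced (alt s t j @ w)" "ceq x (alt s t j @ w)" "0 < j" "s \<noteq> t"
      "\<not> reduced (s # x)" "\<not> reduced (t # x)" for s t j w
    using that
  proof (induction "length x - j" arbitrary: s t j w rule: less_induct)
    case less
    have "\<not> reduced (t # alt s t j @ w)"
      using not_reduced_Cons_ceq[OF x(1) less.prems(1,2)] less.prems(6) by blast
    from alt_extend_or_full[OF less.prems(4,1) this less.prems(3)] show ?case
    proof
      assume "\<exists>w'. reduced (alt t s (Suc j) @ w') \<and> ceq (alt s t j @ w) (alt t s (Suc j) @ w')"
      then obtain w' where w': "reduced (alt t s (Suc j) @ w')" "ceq x (alt t s (Suc j) @ w')"
        using less.prems ceq_trans by blast
      have "length x = Suc j + length w'" using ceq_reduced_length[OF x(1) w'] by simp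
      then have "length x - Suc j < length x - j" by simp
      from less.hyps[OF this w' _ not_sym[OF less.prems(4)] less.prems(6,5)] obtain k w where
        k: "M t s = enat k" "reduced (alt t s k @ w)" "ceq x (alt t s k @ w)"
        by auto
      have kst: "M s t = enat k" using k(1) M_sym[of s t] by simp
      have swap: "ceq (alt t s k @ w) (alt s t k @ w)"
        by (rule ceq_append[OF ceq_alt[OF not_sym[OF less.prems(4)] k(1)] ceq_refl])
      have "reduced (alt s t k @ w)" using reduced_ceq[OF k(2) swap] by simp
      then show ?thesis using kst ceq_trans[OF k(3) swap] by blast
    qed (use less.prems in blast)
  qed
  obtain w where "reduced (s # w)" "ceq x (s # w)" using exchange_word x by blast
  then show ?thesis using grow[of s t "Suc 0" w] st x by simp
qed

text \<open>Suppose that \<open>p alt s t j\<close> is reduced but cannot be extended to \<open>p alt s t (j + 1)\<close>. Then both \<open>s\<close> and \<open>t\<close>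
  are right descents of it, and it ends with the longest word in \<open>s\<close> and \<open>t\<close>. As \<open>j < k\<close>, cancelling
  the last \<open>j\<close> letters shows that \<open>p\<close> itself ends with \<open>s\<close> or \<open>t\<close>.\<close>

lemma reduced_join:
  assumes st: "s \<noteq> t" and k: "M s t = enat k" and ps: "reduced (p @ [s])" "reduced (p @ [t])"
  shows "reduced (p @ alt s t k)"
proof (rule ccontr)
  assume nr: "\<not> reduced (p @ alt s t k)"
  define j where "j = (LEAST j. \<not> reduced (p @ alt s t (Suc j)))"
  have k2: "2 \<le> k" using M_enat_ge2 st k by blast
  then have ex: "\<not> reduced (p @ alt s t (Suc (k - 1)))" using nr by simp
  have j: "\<not> reduced (p @ alt s t (Suc j))" unfolding j_def by (rule LeastI, rule ex)
  have "j \<le> k - 1" unfolding j_def by (rule Least_le, rule ex)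
  then have jk: "j < k" using k2 by simp
  have j0: "j \<noteq> 0"
  proof
    assume "j = 0"
    then show False using j ps(1) by simp
  qed
  then obtain j' where j': "j = Suc j'" by (cases j) auto
  have red: "reduced (p @ alt s t j)"
    using not_less_Least[of j' "\<lambda>j. \<not> reduced (p @ alt s t (Suc j))"] j' j_def by auto
  define r l where "r = (if even j then s else t)" and "l = (if even j then t else s)"
  let ?x = "rev (p @ alt s t j)"
  have x: "?x = alt l r j @ rev p" unfolding r_def l_def by (simp add: rev_alt)
  have rx: "reduced ?x" using red by (simp only: reduced_rev)
  have "\<not> reduced (rev (p @ alt s t (Suc j)))" using j by (simp only: reduced_rev not_False_eq_True)
  then have nr: "\<not> reduced (r # ?x)" unfolding alt_Suc_right r_def by simp
  have nl: "\<not> reduced (l # ?x)" unfolding x using j' not_reduced_square[of "[]"] by simp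
  have lr: "l \<noteq> r" "M l r = enat k" using st k M_sym[of s t] by (auto simp: l_def r_def)
  obtain w where w: "reduced (alt l r k @ w)" "ceq ?x (alt l r k @ w)"
    using common_descents[OF lr(1) rx nl nr] lr(2) by auto
  obtain i where i: "k = j + Suc i" using jk less_imp_Suc_add by auto
  have "alt l r k = alt l r j @ (if even j then alt l r (Suc i) else alt r l (Suc i))"
    unfolding i by (rule alt_add)
  moreover have "\<exists>q w'. q \<in> {s, t} \<and> (if even j then alt l r (Suc i) else alt r l (Suc i)) @ w = q # w'"
    by (auto simp: l_def r_def)
  ultimately obtain q w' where q: "q \<in> {s, t}" "alt l r k @ w = alt l r j @ q # w'" by auto
  have "ceq (rev p) (q # w')" using w(2) unfolding x q(2) ceq_append_cancel_left .
  then have "ceq (q # rev p) w'" using ceq_ss[of q w'] ceq_Cons ceq_trans by blast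
  moreover have "reduced (q # rev p)"
    using ps q(1) reduced_rev[of "p @ [q]"] by auto
  moreover have "length (rev p) = length (q # w')"
  proof -
    have "length ?x = length (alt l r k @ w)" using ceq_reduced_length[OF rx w] .
    then show ?thesis unfolding x q(2) by simp
  qed
  ultimately show False using reducedD by fastforce
qed

end

section \<open>The positive braid monoid\<close>

context coxeter_diagram
begin

text \<open>Equality in the positive monoid: the congruence generated by the braid relations alone, without
  cancellation.\<close>

inductive beq :: "'a list \<Rightarrow> 'a list \<Rightarrow> bool" where
  beq_refl [simp]: "beq u u"
| beq_sym: "beq u v \<Longrightarrow> beq v u"
| beq_trans [trans]: "beq u v \<Longrightarrow> beq v w \<Longrightarrow> beq u w"
| beq_braid: "s \<noteq> t \<Longrightarrow> M s t = enat k \<Longrightarrow> beq (u @ alt s t k @ v) (u @ alt t s k @ v)"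

lemma beq_context: "beq u v \<Longrightarrow> beq (a @ u @ b) (a @ v @ b)"
proof (induction rule: beq.induct)
  case (beq_braid s t k u v)
  then show ?case using beq.beq_braid[of s t k "a @ u" "v @ b"] by simp
qed (auto intro: beq_sym beq_trans)

lemma beq_append: "beq u u' \<Longrightarrow> beq v v' \<Longrightarrow> beq (u @ v) (u' @ v')"
  using beq_context[of u u' "[]" v] beq_context[of v v' u' "[]"] by (simp add: beq_trans)

lemma beq_append_left: "beq v v' \<Longrightarrow> beq (u @ v) (u @ v')"
  by (rule beq_append[OF beq_refl])

lemma beq_append_right: "beq u u' \<Longrightarrow> beq (u @ v) (u' @ v)"
  by (rule beq_append[OF _ beq_refl])

lemma beq_Cons: "beq u v \<Longrightarrow> beq (s # u) (s # v)"
  using beq_append_left[of u v "[s]"] by simp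

lemma beq_alt: "s \<noteq> t \<Longrightarrow> M s t = enat k \<Longrightarrow> beq (alt s t k @ u) (alt t s k @ u)"
  using beq_braid[of s t k "[]" u] by simp

lemma beq_rev: "beq u v \<Longrightarrow> beq (rev u) (rev v)"
proof (induction rule: beq.induct)
  case (beq_braid s t k u v)
  have "M t s = enat k" using beq_braid(2) M_sym[of t s] by simp
  then show ?case
    using beq.beq_braid[of s t k "rev v" "rev u"] beq.beq_braid[of t s k "rev v" "rev u"] beq_braid(1,2)
    by (simp add: rev_alt)
qed (auto intro: beq_sym beq_trans)

lemma beq_imp_ceq: "beq u v \<Longrightarrow> ceq u v"
  by (induction rule: beq.induct) (simp, erule ceq_sym, erule (1) ceq_trans, erule (1) ceq_braid)

lemma beq_length: "beq u v \<Longrightarrow> length u = length v"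
  by (induction rule: beq.induct) auto

lemma beq_set: "beq u v \<Longrightarrow> set u = set v"
proof (induction rule: beq.induct)
  case (beq_braid s t k u v)
  have "set (alt s t k) = set (alt t s k)"
    unfolding set_alt[OF M_enat_ge2[OF beq_braid]] by (rule insert_commute)
  then show ?case by simp
qed simp_all

lemma reduced_beq: "reduced u \<Longrightarrow> beq u v \<Longrightarrow> reduced v"
  using reduced_ceq beq_imp_ceq beq_length by (metis order_refl)

lemma M_Suc: "s \<noteq> t \<Longrightarrow> M s t = enat k \<Longrightarrow> \<exists>j. k = Suc j \<and> 0 < j"
  using M_enat_ge2[of s t k] by (cases k) auto

text \<open>Matsumoto's theorem. Two reduced words of the same element that start with different letters \<open>s\<close> and
  \<open>t\<close> are both compared with a word that starts with the longest word in \<open>s\<close> and \<open>t\<close>: this word can be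
  made to start with either letter by one braid relation, and words with equal first letters are
  handled by induction.\<close>

theorem reduced_ceq_imp_beq: "reduced u \<Longrightarrow> reduced v \<Longrightarrow> ceq u v \<Longrightarrow> beq u v"
proof (induction "length u" arbitrary: u v rule: less_induct)
  case less
  note len = ceq_reduced_length[OF less.prems]
  show ?case
  proof (cases u)
    case Nil
    then show ?thesis using len by simp
  next
    case (Cons s u')
    then obtain t v' where v: "v = t # v'" using len by (cases v) auto
    have IH: "beq x y" if "reduced (r # x)" "reduced (r # y)" "ceq (r # x) (r # y)" "length x < length u" for r x y
      using less.hyps[of x y] that reduced_ConsD ceq_Cons_cancel by blast
    show ?thesis
    proof (cases "s = t")
      case True
      then show ?thesis using IH[of s u' v'] less.prems Cons v beq_Cons by simp
    next
      case False
      have "ceq (t # u) v'" using less.prems(3) v ceq_Cons[of u v t] ceq_ss[of t v'] ceq_trans by blast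
      then have "\<not> reduced (t # u)" using reducedD[of "t # u" v'] len v by auto
      moreover have "\<not> reduced (s # u)" using Cons not_reduced_square[of "[]"] by simp
      ultimately obtain k w where k: "M s t = enat k" "reduced (alt s t k @ w)" "ceq u (alt s t k @ w)"
        using common_descents[OF False less.prems(1)] by blast
      obtain j where j: "k = Suc j" using M_Suc[OF False k(1)] by blast
      have swap: "beq (alt s t k @ w) (alt t s k @ w)" using beq_alt[OF False k(1)] .
      have "beq u' (alt t s j @ w)" using IH[of s u' "alt t s j @ w"] less.prems k Cons j by simp
      then have "beq u (alt s t k @ w)" using beq_Cons[of u' "alt t s j @ w" s] Cons j by simp
      moreover have "beq (alt s t j @ w) v'"
      proof (rule IH)
        show "reduced (t # alt s t j @ w)" using reduced_beq[OF k(2) swap] j by simp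
        show "ceq (t # alt s t j @ w) (t # v')"
          using beq_imp_ceq[OF swap] k(3) less.prems(3) v j by (metis alt.simps(2) append_Cons ceq_sym ceq_trans)
        show "length (alt s t j @ w) < length u"
          using ceq_reduced_length[OF less.prems(1) k(2,3)] j by simp
      qed (use less.prems v in simp)
      then have "beq (alt t s k @ w) v" using beq_Cons[of _ v' t] v j by simp
      ultimately show ?thesis using swap beq_trans by blast
    qed
  qed
qed

subsection \<open>Cancellation and common multiples\<close>

text \<open>Garside's key property: if \<open>s x = t y\<close> in the monoid, then the equality comes from a common
  multiple of \<open>s\<close> and \<open>t\<close> in the dihedral submonoid. It is proved by induction on the length \<open>n\<close> of \<open>x\<close>. The
  essential point is that the property is transitive: if \<open>s x = u v = t y\<close>, then \<open>v\<close> is divisible by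
  the complements of \<open>u\<close> in its joins with \<open>s\<close> and with \<open>t\<close>, and by induction \<open>u v\<close> is then divisible by
  one reduced word that has \<open>s\<close>, \<open>t\<close> and \<open>u\<close> as left descents. The combinatorics of that reduced word takes
  place in the Coxeter group, where Matsumoto's theorem applies.\<close>

definition dihedral_split :: "'a \<Rightarrow> 'a list \<Rightarrow> 'a \<Rightarrow> 'a list \<Rightarrow> bool" where
  "dihedral_split s x t y \<longleftrightarrow> s = t \<and> beq x y \<or>
    (\<exists>k z. s \<noteq> t \<and> M s t = enat (Suc k) \<and> beq x (alt t s k @ z) \<and> beq y (alt s t k @ z))"

definition garside_property :: "nat \<Rightarrow> bool" where
  "garside_property n \<longleftrightarrow>
    (\<forall>s x t y. length x = n \<longrightarrow> beq (s # x) (t # y) \<longrightarrow> dihedral_split s x t y)"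

lemma dihedral_split_sym: "dihedral_split s x t y \<Longrightarrow> dihedral_split t y s x"
  unfolding dihedral_split_def using M_sym beq_sym by metis

lemma dihedral_split_beq: "dihedral_split s x t y \<Longrightarrow> beq x' x \<Longrightarrow> dihedral_split s x' t y"
  unfolding dihedral_split_def using beq_trans by meson

text \<open>The case \<open>s = t\<close> of the property is cancellation of one letter.\<close>

lemma left_cancel_upto:
  assumes "\<forall>k<n. garside_property k" "beq (u @ a) (u @ b)" "length (u @ a) \<le> n"
  shows "beq a b"
  using assms(2,3)
proof (induction u)
  case (Cons s u)
  have "dihedral_split s (u @ a) s (u @ b)"
    using assms(1) Cons.prems unfolding garside_property_def by (auto simp: less_eq_Suc_le)
  then show ?case using Cons unfolding dihedral_split_def by auto
qed simp

text \<open>Two reduced words dividing \<open>v\<close> and starting with \<open>s\<close> and \<open>t\<close> are first joined with the longest word in \<open>s\<close>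
  and \<open>t\<close>, which divides \<open>v\<close> by the property for shorter words and remains reduced after the prefix \<open>p\<close> by
  \<open>reduced_join\<close>; then the two joins are joined over this longer prefix. The prefix makes the
  induction possible.\<close>

lemma reduced_divisors_upper_bound:
  assumes G: "\<forall>k<n. garside_property k"
  shows "reduced (p @ a) \<Longrightarrow> reduced (p @ b) \<Longrightarrow> beq v (a @ y) \<Longrightarrow> beq v (b @ y') \<Longrightarrow> length v \<le> n \<Longrightarrow>
    \<exists>c a' b' r. reduced (p @ c) \<and> beq c (a @ a') \<and> beq c (b @ b') \<and> beq v (c @ r)"
proof (induction "length v" arbitrary: p a b v y y' rule: less_induct)
  case less
  note cancel = left_cancel_upto[OF G]
  show ?case
  proof (cases "a = [] \<or> b = []")
    case True
    then show ?thesis using less.prems by (metis append.left_neutral append_Nil2 beq_refl)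
  next
    case False
    then obtain s a1 t b1 where ab: "a = s # a1" "b = t # b1" by (metis neq_Nil_conv)
    let ?v1 = "a1 @ y" and ?v2 = "b1 @ y'"
    have eq: "beq (s # ?v1) (t # ?v2)" using less.prems(3,4) ab beq_sym beq_trans by (metis append_Cons)
    have len: "length v = Suc (length ?v1)" "length ?v2 = length ?v1"
      using beq_length[OF less.prems(3)] beq_length[OF eq] ab by auto
    then have "garside_property (length ?v1)" using G less.prems(5) by auto
    then have "dihedral_split s ?v1 t ?v2" using eq unfolding garside_property_def by blast
    then consider "s = t" "beq ?v1 ?v2"
      | k z where "s \<noteq> t" "M s t = enat (Suc k)" "beq ?v1 (alt t s k @ z)" "beq ?v2 (alt s t k @ z)"
      unfolding dihedral_split_def by blast
    then show ?thesis
    proof cases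
      case 1
      have "\<exists>c a' b' r. reduced ((p @ [s]) @ c) \<and> beq c (a1 @ a') \<and> beq c (b1 @ b') \<and> beq ?v1 (c @ r)"
        using less.prems ab len 1 by (intro less.hyps[where v = "?v1" and y = y and y' = "y'"]) auto
      then obtain c a' b' r where c: "reduced (p @ s # c)" "beq c (a1 @ a')" "beq c (b1 @ b')" "beq ?v1 (c @ r)"
        by auto
      have "beq v (s # ?v1)" using less.prems(3) ab by simp
      then have "beq v ((s # c) @ r)" using beq_Cons[OF c(4), of s] beq_trans by auto
      moreover have "beq (s # c) (a @ a')" "beq (s # c) (b @ b')"
        using c 1 ab beq_Cons by fastforce+
      ultimately show ?thesis using c(1) by blast
    next
      case (2 k z)
      let ?D = "alt s t (Suc k)"
      have ps: "reduced (p @ [s])" "reduced (p @ [t])"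
        using less.prems(1,2) ab reduced_appendD(1)[of "p @ [s]" a1] reduced_appendD(1)[of "p @ [t]" b1]
        by auto
      have redD: "reduced (p @ ?D)" using reduced_join[OF 2(1,2) ps] .
      have MTS: "M t s = enat (Suc k)" using 2(2) M_sym[of t s] by simp
      have redD': "reduced (p @ alt t s (Suc k))" using reduced_join[OF not_sym[OF 2(1)] MTS ps(2,1)] .
      \<comment> \<open>join the rest of \<open>a\<close>, and likewise that of \<open>b\<close>, with the rest of the longest word \<open>?D\<close>\<close>
      have "\<exists>c a' b' r. reduced ((p @ [s]) @ c) \<and> beq c (a1 @ a') \<and> beq c (alt t s k @ b') \<and> beq ?v1 (c @ r)"
        using less.prems ab len 2 redD by (intro less.hyps[where v = "?v1" and y = y and y' = z]) auto
      then obtain c1 a1' e1 r1 where c1: "reduced (p @ s # c1)" "beq c1 (a1 @ a1')"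
          "beq c1 (alt t s k @ e1)" "beq ?v1 (c1 @ r1)"
        by auto
      have "\<exists>c a' b' r. reduced ((p @ [t]) @ c) \<and> beq c (b1 @ a') \<and> beq c (alt s t k @ b') \<and> beq ?v2 (c @ r)"
        using less.prems ab len 2 redD' by (intro less.hyps[where v = "?v2" and y = "y'" and y' = z]) auto
      then obtain c2 b1' e2 r2 where c2: "reduced (p @ t # c2)" "beq c2 (b1 @ b1')"
          "beq c2 (alt s t k @ e2)" "beq ?v2 (c2 @ r2)"
        by auto
      have z1: "beq z (e1 @ r1)"
      proof (rule cancel)
        have "beq (c1 @ r1) ((alt t s k @ e1) @ r1)" by (rule beq_append_right[OF c1(3)])
        then show "beq (alt t s k @ z) (alt t s k @ e1 @ r1)"
          using 2(3) c1(4) beq_sym beq_trans by (metis append.assoc)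
        show "length (alt t s k @ z) \<le> n" using beq_length[OF 2(3)] len less.prems(5) by simp
      qed
      have z2: "beq z (e2 @ r2)"
      proof (rule cancel)
        have "beq (c2 @ r2) ((alt s t k @ e2) @ r2)" by (rule beq_append_right[OF c2(3)])
        then show "beq (alt s t k @ z) (alt s t k @ e2 @ r2)"
          using 2(4) c2(4) beq_sym beq_trans by (metis append.assoc)
        show "length (alt s t k @ z) \<le> n" using beq_length[OF 2(4)] len less.prems(5) by simp
      qed
      have De1: "beq (p @ s # c1) ((p @ ?D) @ e1)"
        using beq_append_left[OF beq_Cons[OF c1(3)], of p s] by simp
      have "beq (p @ t # c2) (p @ alt t s (Suc k) @ e2)"
        using beq_append_left[OF beq_Cons[OF c2(3)], of p t] by simp
      then have De2: "beq (p @ t # c2) ((p @ ?D) @ e2)"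
        using beq_append_left[OF beq_alt[OF 2(1,2), of e2], of p] beq_sym beq_trans
        by (metis append.assoc)
      have lz: "length z < length v" using beq_length[OF 2(3)] len by simp
      \<comment> \<open>the cofactors of \<open>?D\<close> in these two joins divide \<open>z\<close> and are joined in turn\<close>
      have "\<exists>c a' b' r. reduced ((p @ ?D) @ c) \<and> beq c (e1 @ a') \<and> beq c (e2 @ b') \<and> beq z (c @ r)"
        using reduced_beq[OF c1(1) De1] reduced_beq[OF c2(1) De2] z1 z2 lz less.prems(5)
        by (intro less.hyps[where v = z and y = r1 and y' = r2]) auto
      then obtain c3 f1 f2 r3 where c3: "reduced ((p @ ?D) @ c3)" "beq c3 (e1 @ f1)" "beq c3 (e2 @ f2)"
          "beq z (c3 @ r3)" by auto
      let ?c = "?D @ c3"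
      have "beq ?c (s # alt t s k @ e1 @ f1)" using beq_append_left[OF c3(2), of ?D] by simp
      also have "beq \<dots> (s # c1 @ f1)"
        using beq_Cons[OF beq_append_right[OF beq_sym[OF c1(3)]], of s f1] by simp
      also have "beq \<dots> (a @ a1' @ f1)" using beq_Cons[OF beq_append_right[OF c1(2)], of s f1] ab by simp
      finally have ca: "beq ?c (a @ a1' @ f1)" .
      have "beq ?c (alt t s (Suc k) @ c3)" using beq_alt[OF 2(1,2)] .
      also have "beq \<dots> (t # alt s t k @ e2 @ f2)"
        using beq_append_left[OF c3(3), of "alt t s (Suc k)"] by simp
      also have "beq \<dots> (t # c2 @ f2)"
        using beq_Cons[OF beq_append_right[OF beq_sym[OF c2(3)]], of t f2] by simp
      also have "beq \<dots> (b @ b1' @ f2)" using beq_Cons[OF beq_append_right[OF c2(2)], of t f2] ab by simp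
      finally have cb: "beq ?c (b @ b1' @ f2)" .
      have "beq v (s # ?v1)" using less.prems(3) ab by simp
      also have "beq \<dots> (s # alt t s k @ z)" by (rule beq_Cons[OF 2(3)])
      also have "beq \<dots> (s # alt t s k @ c3 @ r3)" by (rule beq_Cons[OF beq_append_left[OF c3(4)]])
      finally have "beq v (?c @ r3)" by simp
      then show ?thesis using c3(1) ca cb by (metis append.assoc)
    qed
  qed
qed

lemma reduced_single [simp]: "reduced [s]"
  unfolding reduced_def using ceq_length_parity by (metis One_nat_def Suc_leI length_0_conv length_Cons length_greater_0_conv even_zero list.size(3) odd_one)

lemma reduced_alt: "s \<noteq> t \<Longrightarrow> M s t = enat k \<Longrightarrow> reduced (alt s t k)"
  using reduced_join[of s t k "[]"] by simp

text \<open>The remaining case is that of three different letters. The complements of \<open>u\<close> in its joins with \<open>s\<close> and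
  \<open>t\<close> divide \<open>v\<close>, so there is a reduced word \<open>u c\<close> with \<open>c\<close> dividing \<open>v\<close> that has \<open>s\<close> and \<open>t\<close> as left
  descents. By Matsumoto's theorem it starts, up to braid relations, with the longest word in \<open>s\<close> and \<open>t\<close>.\<close>

lemma dihedral_split_trans:
  assumes G: "\<forall>k<n. garside_property k" and len: "length x = n" "length v = n"
    and sp: "dihedral_split s x u v" "dihedral_split u v t y"
  shows "dihedral_split s x t y"
proof (cases "s = u \<or> u = t")
  case True
  then show ?thesis
  proof
    assume "s = u"
    then show ?thesis using sp dihedral_split_beq unfolding dihedral_split_def[of s x u v] by blast
  next
    assume "u = t"
    then have "beq y v" using sp(2) beq_sym unfolding dihedral_split_def by blast
    moreover have "dihedral_split t v s x" using sp(1) \<open>u = t\<close> dihedral_split_sym by blast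
    ultimately show ?thesis using dihedral_split_beq dihedral_split_sym by blast
  qed
next
  case False
  obtain k1 z1 where 1: "M s u = enat (Suc k1)" "beq x (alt u s k1 @ z1)" "beq v (alt s u k1 @ z1)"
    using sp(1) False unfolding dihedral_split_def by blast
  obtain k2 z2 where 2: "M u t = enat (Suc k2)" "beq v (alt t u k2 @ z2)" "beq y (alt u t k2 @ z2)"
    using sp(2) False unfolding dihedral_split_def by blast
  have Mus: "M u s = enat (Suc k1)" using 1(1) M_sym[of u s] by simp
  note cancel = left_cancel_upto[OF G]
  show ?thesis
  proof (cases "s = t")
    case True
    then have "k1 = k2" using Mus 2(1) by simp
    then have "beq (alt s u k1 @ z1) (alt s u k1 @ z2)" using 1(3) 2(2) True beq_sym beq_trans by blast
    moreover have "length (alt s u k1 @ z1) \<le> n" using beq_length[OF 1(3)] len by simp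
    ultimately have "beq z1 z2" using cancel by blast
    then have "beq (alt u s k1 @ z1) (alt u s k1 @ z2)" by (rule beq_append_left)
    then have "beq x y" using 1(2) 2(3) True \<open>k1 = k2\<close> beq_sym beq_trans by meson
    then show ?thesis using True unfolding dihedral_split_def by simp
  next
    case st: False
    have us: "u \<noteq> s" and ut: "u \<noteq> t" using False by auto
    have "\<exists>c a' b' r. reduced ([u] @ c) \<and> beq c (alt s u k1 @ a') \<and> beq c (alt t u k2 @ b') \<and> beq v (c @ r)"
      using reduced_alt[OF us Mus] reduced_alt[OF ut 2(1)] 1(3) 2(2) len
      by (intro reduced_divisors_upper_bound[OF G]) auto
    then obtain c a' b' r where c: "reduced (u # c)" "beq c (alt s u k1 @ a')" "beq c (alt t u k2 @ b')"
      "beq v (c @ r)" by auto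
    let ?\<alpha> = "alt u s k1 @ a'" and ?\<beta> = "alt u t k2 @ b'"
    have \<alpha>: "beq (u # c) (s # ?\<alpha>)"
      using beq_Cons[OF c(2), of u] beq_alt[OF us Mus, of a'] beq_trans by auto
    have \<beta>: "beq (u # c) (t # ?\<beta>)"
      using beq_Cons[OF c(3), of u] beq_alt[OF ut 2(1), of b'] beq_trans by auto
    have red: "reduced (s # ?\<alpha>)" "reduced (t # ?\<beta>)" using reduced_beq[OF c(1)] \<alpha> \<beta> by auto
    have eq: "ceq (s # ?\<alpha>) (t # ?\<beta>)" using \<alpha> \<beta> beq_imp_ceq beq_sym beq_trans by blast
    have "ceq (t # s # ?\<alpha>) ?\<beta>" using ceq_Cons[OF eq, of t] ceq_ss[of t ?\<beta>] ceq_trans by blast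
    then have "\<not> reduced (t # s # ?\<alpha>)"
      using reducedD[of "t # s # ?\<alpha>" ?\<beta>] ceq_reduced_length[OF red eq] by auto
    moreover have "\<not> reduced (s # s # ?\<alpha>)" using not_reduced_square[of "[]"] by simp
    ultimately obtain k g where g: "M s t = enat k" "reduced (alt s t k @ g)" "ceq (s # ?\<alpha>) (alt s t k @ g)"
      using common_descents[OF st red(1)] by blast
    obtain k3 where k3: "k = Suc k3" using M_Suc[OF st g(1)] by blast
    have swap: "beq (alt s t k @ g) (alt t s k @ g)" using beq_alt[OF st g(1)] .
    have "beq ?\<alpha> (alt t s k3 @ g)"
      using red(1) g(2,3) k3 reduced_ConsD ceq_Cons_cancel by (intro reduced_ceq_imp_beq) auto
    then have A: "beq (?\<alpha> @ r) (alt t s k3 @ g @ r)" using beq_append_right[of ?\<alpha> "alt t s k3 @ g" r] by simp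
    have "ceq (t # ?\<beta>) (t # alt s t k3 @ g)"
      using eq g(3) beq_imp_ceq[OF swap] k3 ceq_sym ceq_trans by (metis alt.simps(2) append_Cons)
    moreover have "reduced (t # alt s t k3 @ g)" using reduced_beq[OF g(2) swap] k3 by simp
    ultimately have "beq ?\<beta> (alt s t k3 @ g)"
      using red(2) reduced_ConsD ceq_Cons_cancel reduced_ceq_imp_beq by blast
    then have B: "beq (?\<beta> @ r) (alt s t k3 @ g @ r)" using beq_append_right[of ?\<beta> "alt s t k3 @ g" r] by simp
    have "beq z1 (a' @ r)"
    proof (rule cancel)
      show "beq (alt s u k1 @ z1) (alt s u k1 @ a' @ r)"
        using 1(3) c(4) beq_append_right[OF c(2), of r] beq_sym beq_trans by (metis append.assoc)
      show "length (alt s u k1 @ z1) \<le> n" using beq_length[OF 1(3)] len by simp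
    qed
    then have "beq (alt u s k1 @ z1) (?\<alpha> @ r)" using beq_append_left by simp
    then have "beq x (alt t s k3 @ g @ r)" using 1(2) A beq_trans by blast
    moreover have "beq z2 (b' @ r)"
    proof (rule cancel)
      show "beq (alt t u k2 @ z2) (alt t u k2 @ b' @ r)"
        using 2(2) c(4) beq_append_right[OF c(3), of r] beq_sym beq_trans by (metis append.assoc)
      show "length (alt t u k2 @ z2) \<le> n" using beq_length[OF 2(2)] len by simp
    qed
    then have "beq (alt u t k2 @ z2) (?\<beta> @ r)" using beq_append_left by simp
    then have "beq y (alt s t k3 @ g @ r)" using 2(3) B beq_trans by blast
    ultimately show ?thesis using st g(1) k3 unfolding dihedral_split_def by blast
  qed
qed

text \<open>Follow a derivation of \<open>s x = t y\<close> by braid relations: a single relation has the property because it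
  changes the first letter only if it is applied at the front, and compositions have it by
  \<open>dihedral_split_trans\<close>.\<close>

lemma garside_property_all: "garside_property n"
proof (induction n rule: less_induct)
  case (less n)
  have G: "\<forall>k<n. garside_property k" using less by blast
  have "dihedral_split s x t y"
    if "beq w w'" "w = s # x" "w' = t # y" "length x = n" for w w' s x t y
    using that
  proof (induction arbitrary: s x t y rule: beq.induct)
    case (beq_refl u)
    then show ?case by (simp add: dihedral_split_def)
  next
    case (beq_sym u v)
    then show ?case using beq_length[OF beq_sym(1)] dihedral_split_sym by fastforce
  next
    case (beq_trans u v w)
    have len: "length v = Suc n" using beq_length[OF beq_trans(1)] beq_trans.prems by simp
    then obtain r v' where v: "v = r # v'" by (cases v) auto
    then show ?case
      using dihedral_split_trans[OF G, of x v' s r t y] beq_trans.IH beq_trans.prems len by auto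
  next
    case (beq_braid a b k u v)
    obtain j where j: "k = Suc j" using M_Suc[OF beq_braid(1,2)] by blast
    show ?case
    proof (cases u)
      case Nil
      then have "s = a" "t = b" "x = alt b a j @ v" "y = alt a b j @ v" using beq_braid.prems j by auto
      then show ?thesis using beq_braid(1,2) j beq_refl unfolding dihedral_split_def by blast
    next
      case (Cons c u')
      then show ?thesis
        using beq_braid beq.beq_braid[of a b k u' v] unfolding dihedral_split_def by auto
    qed
  qed
  then show ?case unfolding garside_property_def by blast
qed

lemma beq_dihedral_split: "beq (s # x) (t # y) \<Longrightarrow> dihedral_split s x t y"
  using garside_property_all unfolding garside_property_def by blast

lemma beq_append_cancel_left: "beq (u @ a) (u @ b) \<longleftrightarrow> beq a b"
  using left_cancel_upto[of "length (u @ a)" u a b] garside_property_all beq_append_left by blast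

lemma beq_Cons_cancel: "beq (s # a) (s # b) \<longleftrightarrow> beq a b"
  using beq_append_cancel_left[of "[s]"] by simp

lemma beq_append_cancel_right: "beq (a @ u) (b @ u) \<longleftrightarrow> beq a b"
  using beq_append_cancel_left[of "rev u" "rev a" "rev b"] beq_rev by (metis rev_append rev_rev_ident)

definition divides :: "'a list \<Rightarrow> 'a list \<Rightarrow> bool" where
  "divides x z \<longleftrightarrow> (\<exists>v. beq z (x @ v))"

lemma divides_refl [simp]: "divides x x"
  unfolding divides_def by (metis append_Nil2 beq_refl)

lemma divides_Nil [simp]: "divides [] x"
  unfolding divides_def by (metis append_Nil beq_refl)

lemma divides_prefix [simp]: "divides u (u @ v)"
  unfolding divides_def using beq_refl by blast

lemma divides_trans: "divides x y \<Longrightarrow> divides y z \<Longrightarrow> divides x z"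
  unfolding divides_def using beq_append_right beq_trans by (metis append.assoc)

lemma divides_append_left: "divides (u @ x) (u @ z) \<longleftrightarrow> divides x z"
  unfolding divides_def by (simp add: beq_append_cancel_left)

lemma divides_Cons: "divides (s # x) (s # z) \<longleftrightarrow> divides x z"
  using divides_append_left[of "[s]"] by simp

lemma divides_beq: "beq z z' \<Longrightarrow> divides x z \<longleftrightarrow> divides x z'"
  unfolding divides_def using beq_sym beq_trans by blast

lemma divides_beq_left: "beq x x' \<Longrightarrow> divides x z \<longleftrightarrow> divides x' z"
  unfolding divides_def using beq_append_right beq_sym beq_trans by meson

lemma divides_two_letters:
  assumes "s \<noteq> t" "divides [s] z" "divides [t] z"
  shows "\<exists>k. M s t = enat (Suc k) \<and> divides (alt s t (Suc k)) z"
proof -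
  obtain x y where xy: "beq z (s # x)" "beq z (t # y)" using assms(2,3) unfolding divides_def by auto
  then have "dihedral_split s x t y" using beq_sym beq_trans beq_dihedral_split by blast
  then obtain k w where k: "M s t = enat (Suc k)" "beq x (alt t s k @ w)"
    using assms(1) unfolding dihedral_split_def by blast
  have "beq z (alt s t (Suc k) @ w)" using xy(1) beq_Cons[OF k(2), of s] beq_trans by simp
  then show ?thesis using k(1) unfolding divides_def by blast
qed

text \<open>Strip the first letters \<open>s\<close> and \<open>t\<close>. If they differ, the alternating word \<open>alt s t (Suc k)\<close> divides every
  common multiple, so one forms the least common multiples of \<open>x\<close> and of \<open>y\<close> with that word
  and then that of their cofactors; each time there is a shorter common multiple.\<close>

lemma lcm_exists:
  assumes "divides x z" "divides y z" "set x \<subseteq> X" "set y \<subseteq> X"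
  shows "\<exists>w. set w \<subseteq> X \<and> divides x w \<and> divides y w \<and> (\<forall>z'. divides x z' \<longrightarrow> divides y z' \<longrightarrow> divides w z')"
  using assms
proof (induction "length z" arbitrary: x y z rule: less_induct)
  case less
  show ?case
  proof (cases "x = [] \<or> y = []")
    case True
    then show ?thesis using less.prems by auto
  next
    case False
    then obtain s x' t y' where xy: "x = s # x'" "y = t # y'" by (metis neq_Nil_conv)
    obtain z1 z2 where z: "beq z (s # z1)" "divides x' z1" "beq z (t # z2)" "divides y' z2"
      using less.prems(1,2) unfolding xy divides_def by (metis append_Cons beq_refl)
    have lz: "length z1 < length z" "length z2 < length z" using beq_length[OF z(1)] beq_length[OF z(3)] by auto
    have sX: "s \<in> X" "t \<in> X" "set x' \<subseteq> X" "set y' \<subseteq> X" using less.prems(3,4) xy by auto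
    show ?thesis
    proof (cases "s = t")
      case True
      have "beq z1 z2" using z True beq_Cons_cancel beq_sym beq_trans by blast
      then have "divides y' z1" using z(4) divides_beq by blast
      then obtain w where w: "set w \<subseteq> X" "divides x' w" "divides y' w"
          "\<forall>z'. divides x' z' \<longrightarrow> divides y' z' \<longrightarrow> divides w z'"
        using less.hyps[OF lz(1) z(2) _ sX(3,4)] by blast
      have "divides (s # w) z'" if "divides x z'" "divides y z'" for z'
      proof -
        obtain v where v: "beq z' (s # x' @ v)" using \<open>divides x z'\<close> xy unfolding divides_def by auto
        have "divides y' (x' @ v)"
          using \<open>divides y z'\<close> divides_beq[OF v] xy True divides_Cons by simp
        moreover have "divides x' (x' @ v)" unfolding divides_def using beq_refl by blast
        ultimately have "divides w (x' @ v)" using w(4) by blast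
        then show ?thesis using divides_beq[OF v] divides_Cons by simp
      qed
      then show ?thesis using w sX xy True divides_Cons by (intro exI[of _ "s # w"]) auto
    next
      case st: False
      have dz: "divides [s] z'" "divides [t] z'" if "divides x z'" "divides y z'" for z'
        using that divides_trans xy unfolding divides_def by (metis append_Cons append_Nil beq_refl)+
      obtain k where k: "M s t = enat (Suc k)" "divides (alt s t (Suc k)) z"
        using divides_two_letters[OF st dz[OF less.prems(1,2)]] by blast
      have swap: "divides (alt t s (Suc k)) z' \<longleftrightarrow> divides (alt s t (Suc k)) z'" for z'
        using divides_beq_left[of "alt s t (Suc k)" "alt t s (Suc k)"] beq_alt[OF st k(1), of "[]"] by simp
      have "divides (alt s t (Suc k)) (s # z1)" "divides (alt t s (Suc k)) (t # z2)"
        using k(2) swap[of z] divides_beq[OF z(1)] divides_beq[OF z(3)] by blast+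
      then have "divides (alt t s k) z1" "divides (alt s t k) z2" by (simp_all add: divides_Cons)
      moreover have sa: "set (alt t s k) \<subseteq> X" "set (alt s t k) \<subseteq> X"
        using set_alt_subset[of t s k] set_alt_subset[of s t k] sX by auto
      ultimately obtain w1 w2 where
        w1: "set w1 \<subseteq> X" "divides x' w1" "divides (alt t s k) w1"
          "\<forall>z'. divides x' z' \<longrightarrow> divides (alt t s k) z' \<longrightarrow> divides w1 z'" and
        w2: "set w2 \<subseteq> X" "divides y' w2" "divides (alt s t k) w2"
          "\<forall>z'. divides y' z' \<longrightarrow> divides (alt s t k) z' \<longrightarrow> divides w2 z'"
        using less.hyps[OF lz(1) z(2) _ sX(3)] less.hyps[OF lz(2) z(4) _ sX(4)] by metis
      obtain c1 c2 where c: "beq w1 (alt t s k @ c1)" "beq w2 (alt s t k @ c2)"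
        using w1(3) w2(3) unfolding divides_def by blast
      have sc: "set c1 \<subseteq> X" "set c2 \<subseteq> X" using beq_set[OF c(1)] beq_set[OF c(2)] w1(1) w2(1) by auto
      \<comment> \<open>every common multiple of \<open>x\<close> and \<open>y\<close> is a multiple of \<open>alt s t (Suc k)\<close> whose cofactor is divisible by \<open>c1\<close>, \<open>c2\<close>\<close>
      have cof: "\<exists>z3. beq z' (alt s t (Suc k) @ z3) \<and> divides c1 z3 \<and> divides c2 z3"
        if dv: "divides x z'" "divides y z'" for z'
      proof -
        obtain z3 where z3: "beq z' (alt s t (Suc k) @ z3)"
          using divides_two_letters[OF st dz[OF dv]] k(1) unfolding divides_def by auto
        have z3': "beq z' (alt t s (Suc k) @ z3)" using z3 beq_alt[OF st k(1)] beq_trans by blast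
        have "divides x' (alt t s k @ z3)" using dv(1) divides_beq[OF z3] divides_Cons xy by simp
        then have "divides w1 (alt t s k @ z3)" using w1(4) divides_prefix by blast
        then have "divides c1 z3" using divides_beq_left[OF c(1)] divides_append_left by blast
        have "divides y' (alt s t k @ z3)" using dv(2) divides_beq[OF z3'] divides_Cons xy by simp
        then have "divides w2 (alt s t k @ z3)" using w2(4) divides_prefix by blast
        then have "divides c2 z3" using divides_beq_left[OF c(2)] divides_append_left by blast
        then show ?thesis using z3 \<open>divides c1 z3\<close> by blast
      qed
      obtain z3 where z3: "beq z (alt s t (Suc k) @ z3)" "divides c1 z3" "divides c2 z3"
        using cof[OF less.prems(1,2)] by blast
      have "length z3 < length z" using beq_length[OF z3(1)] by simp
      then obtain w3 where w3: "set w3 \<subseteq> X" "divides c1 w3" "divides c2 w3"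
          "\<forall>z'. divides c1 z' \<longrightarrow> divides c2 z' \<longrightarrow> divides w3 z'"
        using less.hyps[OF _ z3(2,3) sc] by blast
      let ?w = "alt s t (Suc k) @ w3"
      have "divides w1 (alt t s k @ w3)" "divides w2 (alt s t k @ w3)"
        using w3 divides_beq_left[OF c(1)] divides_beq_left[OF c(2)] divides_append_left by auto
      then have "divides x' (alt t s k @ w3)" "divides y' (alt s t k @ w3)"
        using w1(2) w2(2) divides_trans by blast+
      then have "divides x ?w" "divides y (alt t s (Suc k) @ w3)" using xy divides_Cons by auto
      then have "divides y ?w" using divides_beq[OF beq_alt[OF st k(1), of w3]] by blast
      moreover have "divides ?w z'" if "divides x z'" "divides y z'" for z'
        using cof[OF that] w3(4) divides_beq divides_append_left by blast
      moreover have "set ?w \<subseteq> X" using sX sa w3(1) by simp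
      ultimately show ?thesis using \<open>divides x ?w\<close> by blast
    qed
  qed
qed

end

subsection \<open>Garside elements\<close>

text \<open>A longest element of the Coxeter group is represented by a reduced word that every generator divides.\<close>

locale spherical_diagram = coxeter_diagram +
  fixes S :: "'a set"
  assumes finite_S: "finite S"
    and ex_common_multiple: "\<exists>z. reduced z \<and> (\<forall>s\<in>S. divides [s] z)"
begin

definition is_lcm :: "'a set \<Rightarrow> 'a list \<Rightarrow> bool" where
  "is_lcm X D \<longleftrightarrow> set D \<subseteq> X \<and> (\<forall>t\<in>X. divides [t] D) \<and> (\<forall>z. (\<forall>t\<in>X. divides [t] z) \<longrightarrow> divides D z)"

text \<open>Garside's fundamental element of the parabolic submonoid generated by \<open>X\<close>.\<close>

definition gword :: "'a set \<Rightarrow> 'a list" where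
  "gword X = (SOME D. is_lcm X D)"

text \<open>Add the generators one by one; at each step the element from \<open>ex_common_multiple\<close> is a common multiple.\<close>

lemma is_lcm_gword:
  assumes "X \<subseteq> S"
  shows "is_lcm X (gword X)"
proof -
  obtain z where z: "\<forall>s\<in>S. divides [s] z" using ex_common_multiple by blast
  have "finite X" using assms finite_S finite_subset by blast
  then have "\<exists>D. is_lcm X D" using assms
  proof (induction X rule: finite_induct)
    case empty
    show ?case by (rule exI[of _ "[]"]) (simp add: is_lcm_def)
  next
    case (insert s X)
    then obtain D where D: "is_lcm X D" by auto
    then have "divides D z" using z insert.prems unfolding is_lcm_def by blast
    moreover have "divides [s] z" using z insert.prems by blast
    ultimately obtain w where w: "set w \<subseteq> insert s X" "divides D w" "divides [s] w"
        "\<forall>z'. divides D z' \<longrightarrow> divides [s] z' \<longrightarrow> divides w z'"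
      using lcm_exists[of D z "[s]" "insert s X"] D unfolding is_lcm_def by auto
    have "divides [t] w" if "t \<in> insert s X" for t
    proof (cases "t = s")
      case False
      then have "divides [t] D" using that D unfolding is_lcm_def by blast
      then show ?thesis using w(2) divides_trans by blast
    qed (use w(3) in simp)
    moreover have "divides w z'" if "\<forall>t\<in>insert s X. divides [t] z'" for z'
      using that w(4) D unfolding is_lcm_def by blast
    ultimately have "is_lcm (insert s X) w" using w(1) unfolding is_lcm_def by blast
    then show ?case by blast
  qed
  then show ?thesis unfolding gword_def by (rule someI_ex)
qed

lemma set_gword: "X \<subseteq> S \<Longrightarrow> set (gword X) \<subseteq> X"
  and divides_gword: "X \<subseteq> S \<Longrightarrow> t \<in> X \<Longrightarrow> divides [t] (gword X)"
  and gword_least: "X \<subseteq> S \<Longrightarrow> (\<And>t. t \<in> X \<Longrightarrow> divides [t] z) \<Longrightarrow> divides (gword X) z"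
  using is_lcm_gword unfolding is_lcm_def by blast+

lemma reduced_gword: "X \<subseteq> S \<Longrightarrow> reduced (gword X)"
proof -
  assume X: "X \<subseteq> S"
  obtain z where z: "reduced z" "\<forall>s\<in>S. divides [s] z" using ex_common_multiple by blast
  then have "divides (gword X) z" using gword_least[OF X] X by blast
  then obtain v where "beq z (gword X @ v)" unfolding divides_def by blast
  then show ?thesis using reduced_beq[OF z(1)] reduced_appendD(1) by blast
qed

text \<open>Conjugation by a Garside element permutes its generators: every generator divides
  \<open>s \<Delta>\<close>, so \<open>s \<Delta>\<close> is a multiple of \<open>\<Delta>\<close>, and its cofactor has length one.\<close>

lemma gword_quasi_central:
  assumes X: "X \<subseteq> S" and s: "s \<in> X"
  shows "\<exists>s'\<in>X. beq (s # gword X) (gword X @ [s'])"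
proof -
  let ?D = "gword X"
  have "divides [t] (s # ?D)" if t: "t \<in> X" for t
  proof (cases "t = s")
    case True
    then show ?thesis using divides_prefix[of "[s]" ?D] by simp
  next
    case False
    obtain k where k: "M t s = enat (Suc k)" "divides (alt t s (Suc k)) ?D"
      using divides_two_letters[OF False] divides_gword[OF X] s t by blast
    then obtain z where z: "beq ?D (alt t s k @ (if even k then t else s) # z)"
      unfolding divides_def alt_Suc_right by auto
    let ?z = "(if even k then t else s) # z"
    have "beq (s # ?D) (alt s t (Suc k) @ ?z)" using beq_Cons[OF z, of s] by simp
    also have "beq \<dots> (alt t s (Suc k) @ ?z)" by (rule beq_sym[OF beq_alt[OF False k(1)]])
    finally have "beq (s # ?D) ([t] @ alt s t k @ ?z)" by simp
    then show ?thesis unfolding divides_def by blast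
  qed
  then have "divides ?D (s # ?D)" using gword_least[OF X] by blast
  then obtain e where e: "beq (s # ?D) (?D @ e)" unfolding divides_def by blast
  have "length e = 1" using beq_length[OF e] by simp
  then obtain s' where s': "e = [s']" by (metis One_nat_def length_0_conv length_Suc_conv)
  have "s' \<in> X" using beq_set[OF e] s set_gword[OF X] s' by auto
  then show ?thesis using e s' by blast
qed

lemma gword_right_divisor:
  assumes X: "X \<subseteq> S" and s: "s \<in> X"
  shows "\<exists>x. beq (gword X) (x @ [s])"
proof -
  let ?D = "gword X"
  have "\<forall>s\<in>X. \<exists>s'. s' \<in> X \<and> beq (s # ?D) (?D @ [s'])" using gword_quasi_central[OF X] by blast
  then obtain f where f: "\<forall>s\<in>X. f s \<in> X \<and> beq (s # ?D) (?D @ [f s])" by metis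
  have "inj_on f X"
  proof (rule inj_onI)
    fix s t assume st: "s \<in> X" "t \<in> X" "f s = f t"
    have "beq (s # ?D) (?D @ [f s])" "beq (t # ?D) (?D @ [f s])" using f st by auto
    then have "beq (s # ?D) (t # ?D)" using beq_trans[OF _ beq_sym] by blast
    then have "beq ([s] @ ?D) ([t] @ ?D)" by simp
    then have "beq [s] [t]" unfolding beq_append_cancel_right .
    then show "s = t" using beq_set[of "[s]" "[t]"] by simp
  qed
  moreover have "finite X" using X finite_S finite_subset by blast
  moreover have "f ` X \<subseteq> X" using f by blast
  ultimately have "f ` X = X" using endo_inj_surj by blast
  then have "s \<in> f ` X" using s by simp
  then obtain r where r: "r \<in> X" "f r = s" by (elim imageE) simp
  obtain x where x: "beq ?D (r # x)" using divides_gword[OF X r(1)] unfolding divides_def by auto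
  have "beq (r # ?D) (?D @ [s])" using f r by blast
  also have "beq \<dots> (r # x @ [s])" using beq_append_right[OF x, of "[s]"] by simp
  finally have "beq ?D (x @ [s])" unfolding beq_Cons_cancel .
  then show ?thesis by blast
qed

lemma gword_rev: "X \<subseteq> S \<Longrightarrow> beq (rev (gword X)) (gword X)"
proof -
  assume X: "X \<subseteq> S"
  have "divides [t] (rev (gword X))" if t: "t \<in> X" for t
  proof -
    obtain x where "beq (gword X) (x @ [t])" using gword_right_divisor[OF X t] by blast
    from beq_rev[OF this] show ?thesis unfolding divides_def by auto
  qed
  then have "divides (gword X) (rev (gword X))" using gword_least[OF X] by blast
  then obtain v where v: "beq (rev (gword X)) (gword X @ v)" unfolding divides_def by blast
  then show ?thesis using beq_length[OF v] by simp
qed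

lemma gword_twist:
  assumes X: "X \<subseteq> S" and s: "s \<in> X"
  shows "\<exists>s'\<in>X. beq (s # gword X) (gword X @ [s']) \<and> beq (s' # gword X) (gword X @ [s])"
proof -
  let ?D = "gword X"
  obtain s' where s': "s' \<in> X" "beq (s # ?D) (?D @ [s'])" using gword_quasi_central[OF X s] by blast
  have "beq (rev ?D @ [s]) (s' # rev ?D)" using beq_rev[OF s'(2)] by simp
  from beq_trans[OF beq_sym[OF this] beq_append_right[OF gword_rev[OF X]]]
  have "beq (s' # rev ?D) (?D @ [s])" .
  with beq_sym[OF beq_Cons[OF gword_rev[OF X]]] have "beq (s' # ?D) (?D @ [s])" by (rule beq_trans)
  then show ?thesis using s' by blast
qed

abbreviation gsquare :: "'a list" where "gsquare \<equiv> gword S @ gword S"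

lemma gsquare_central: "set u \<subseteq> S \<Longrightarrow> beq (u @ gsquare) (gsquare @ u)"
proof (induction u)
  case (Cons s u)
  let ?D = "gword S"
  obtain s' where s': "beq (s # ?D) (?D @ [s'])" "beq (s' # ?D) (?D @ [s])"
    using gword_twist[of S s] Cons.prems by auto
  have "beq (s # u @ gsquare) (s # gsquare @ u)" using Cons by (intro beq_Cons) simp
  also have "beq (s # gsquare @ u) (?D @ s' # ?D @ u)"
    using beq_append_right[OF s'(1), of "?D @ u"] by simp
  also have "beq \<dots> (?D @ (?D @ [s]) @ u)"
    using beq_append_left[OF beq_append_right[OF s'(2), of u], of ?D] by simp
  finally show ?case by simp
qed simp

text \<open>A positive word that inverts the generator \<open>s\<close> up to the central element \<open>gsquare\<close>.\<close>

lemma ex_colength_word: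
  assumes "s \<in> S"
  shows "\<exists>c. set c \<subseteq> S \<and> beq (s # c) gsquare \<and> beq (c @ [s]) gsquare"
proof -
  let ?D = "gword S"
  obtain x where x: "beq ?D (s # x)" using divides_gword[of S s] assms unfolding divides_def by auto
  have 1: "beq (s # x @ ?D) gsquare" using beq_append_right[OF beq_sym[OF x], of ?D] by simp
  have "beq (s # (x @ ?D) @ [s]) (gsquare @ [s])" using beq_append_right[OF 1, of "[s]"] by simp
  also have "beq \<dots> (s # gsquare)" using beq_sym[OF gsquare_central[of "[s]"]] assms by simp
  finally have "beq ((x @ ?D) @ [s]) gsquare" unfolding beq_Cons_cancel .
  moreover have "set (x @ ?D) \<subseteq> S" using beq_set[OF x] set_gword[of S] by auto
  ultimately show ?thesis using 1 by blast
qed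

definition coword :: "'a \<Rightarrow> 'a list" where
  "coword s = (SOME c. set c \<subseteq> S \<and> beq (s # c) gsquare \<and> beq (c @ [s]) gsquare)"

lemma coword:
  assumes "s \<in> S"
  shows "set (coword s) \<subseteq> S" "beq (s # coword s) gsquare" "beq (coword s @ [s]) gsquare"
  using someI_ex[OF ex_colength_word[OF assms]] unfolding coword_def by blast+

text \<open>Replacing each inverse letter by its \<open>coword\<close> and counting the replacements writes a group
  word as a fraction with a central denominator. Since the monoid is cancellative, comparing fractions
  by cross-multiplication is compatible with the group relations; so the positive monoid embeds into the
  Artin group.\<close>

primrec numer :: "'a word \<Rightarrow> 'a list" where
  "numer [] = []"
| "numer (x # u) = (if snd x then [fst x] else coword (fst x)) @ numer u"

primrec denom :: "'a word \<Rightarrow> 'a list" where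
  "denom [] = []"
| "denom (x # u) = (if snd x then [] else gsquare) @ denom u"

lemma numer_append [simp]: "numer (u @ v) = numer u @ numer v"
  by (induction u) auto

lemma denom_append [simp]: "denom (u @ v) = denom u @ denom v"
  by (induction u) auto

lemma numer_positive [simp]: "numer (map (\<lambda>s. (s, True)) u) = u"
  and denom_positive [simp]: "denom (map (\<lambda>s. (s, True)) u) = []"
  by (induction u) auto

lemma set_numer: "u \<in> words S \<Longrightarrow> set (numer u) \<subseteq> S"
  by (induction u) (use coword(1) in auto)

lemma set_denom: "set (denom u) \<subseteq> S"
  by (induction u) (use set_gword[of S] in auto)

lemma denom_central: "set u \<subseteq> S \<Longrightarrow> beq (u @ denom w) (denom w @ u)"
proof (induction w)
  case (Cons x w)
  show ?case
  proof (cases "snd x")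
    case False
    have "beq (u @ gsquare @ denom w) (gsquare @ u @ denom w)"
      using beq_append_right[OF gsquare_central[OF Cons.prems], of "denom w"] by simp
    also have "beq \<dots> (gsquare @ denom w @ u)" by (rule beq_append_left[OF Cons.IH[OF Cons.prems]])
    finally show ?thesis using False by simp
  qed (use Cons in simp)
qed simp

lemma alt_word_eq: "alt_word s t k = map (\<lambda>s. (s, True)) (alt s t k)"
  by (induction k arbitrary: s t) auto

text \<open>Both sides of a braid relation are positive with trivial denominators, and the fraction of \<open>s s\<inverse>\<close> is
  \<open>gsquare / gsquare\<close>. Cross-multiplication is transitive by cancellation.\<close>

lemma pres_eq_fraction:
  assumes "pres_eq S (artin_relations S m) u v"
    and m: "\<And>s t. s \<in> S \<Longrightarrow> t \<in> S \<Longrightarrow> s \<noteq> t \<Longrightarrow> M s t = m s t"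
  shows "beq (numer u @ denom v) (numer v @ denom u)"
  using assms(1)
proof induction
  case (sym u v)
  show ?case by (rule beq_sym[OF sym.IH])
next
  case (trans u v w)
  have S: "set (numer u) \<subseteq> S" "set (numer v) \<subseteq> S" "set (numer w) \<subseteq> S"
    using trans.hyps pres_eq_words set_numer by blast+
  have "beq ((numer u @ denom w) @ denom v) (numer u @ denom v @ denom w)"
    using beq_append_left[OF denom_central[OF set_denom, of w v], of "numer u"] by simp
  also have "beq \<dots> (numer v @ denom u @ denom w)"
    using beq_append_right[OF trans.IH(1), of "denom w"] by simp
  also have "beq \<dots> (numer v @ denom w @ denom u)"
    by (rule beq_append_left[OF denom_central[OF set_denom]])
  also have "beq \<dots> (numer w @ denom v @ denom u)"
    using beq_append_right[OF trans.IH(2), of "denom u"] by simp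
  also have "beq \<dots> ((numer w @ denom u) @ denom v)"
    using beq_append_left[OF denom_central[OF set_denom, of v u], of "numer w"] by simp
  finally show ?case unfolding beq_append_cancel_right .
next
  case (cancel u v s b)
  have c: "beq (numer [(s, b), (s, \<not> b)]) gsquare" using coword(2,3)[OF cancel(3)] by (cases b) auto
  have d: "denom [(s, b), (s, \<not> b)] = gsquare" by (cases b) auto
  have "set (numer v @ denom u @ denom v) \<subseteq> S" using set_numer[OF cancel(2)] set_denom by auto
  then have "beq ((numer v @ denom u @ denom v) @ gsquare) (gsquare @ numer v @ denom u @ denom v)"
    by (rule gsquare_central)
  have "beq (numer (u @ [(s, b), (s, \<not> b)] @ v) @ denom (u @ v))
      (numer u @ gsquare @ numer v @ denom u @ denom v)"
    using beq_append_left[OF beq_append_right[OF c, of "numer v @ denom u @ denom v"], of "numer u"]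
    unfolding numer_append denom_append append.assoc .
  also have "beq \<dots> (numer u @ numer v @ gsquare @ denom u @ denom v)"
    using beq_append_left[OF beq_append_right[OF beq_sym[OF gsquare_central[OF set_numer[OF cancel(2)]]],
        of "denom u @ denom v"], of "numer u"] by simp
  also have "beq \<dots> (numer u @ numer v @ denom u @ gsquare @ denom v)"
    using beq_append_left[OF beq_append_right[OF beq_sym[OF gsquare_central[OF set_denom[of u]]],
        of "denom v"], of "numer u @ numer v"] by simp
  also have "\<dots> = numer (u @ v) @ denom (u @ [(s, b), (s, \<not> b)] @ v)" unfolding denom_append d by simp
  finally show ?case .
next
  case (rel u v l r)
  obtain s t k where st: "l = alt_word s t k" "r = alt_word t s k" "s \<in> S" "t \<in> S" "s \<noteq> t" "m s t = enat k"
    using rel(3) unfolding artin_relations_def by blast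
  have "M s t = enat k" using m st by simp
  from beq_braid[OF st(5) this, of "numer u" "numer v @ denom u @ denom v"]
  show ?case unfolding st(1,2) alt_word_eq by simp
qed simp

theorem positive_embedding:
  assumes "pres_eq S (artin_relations S m) (map (\<lambda>s. (s, True)) u) (map (\<lambda>s. (s, True)) v)"
    and "\<And>s t. s \<in> S \<Longrightarrow> t \<in> S \<Longrightarrow> s \<noteq> t \<Longrightarrow> M s t = m s t"
  shows "beq u v"
  using pres_eq_fraction[OF assms] by simp

end

section \<open>Groups as a type class\<close>

text \<open>Subgroups of a fixed ambient group are sets of elements of a type, so that the group laws
  hold for all elements and rewriting does not have to carry membership conditions.\<close>

class mult_group = monoid_mult + inverse +
  assumes inv_left [simp]: "inverse x * x = 1"
begin

lemma inv_cancel_left [simp]: "inverse x * (x * y) = y"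
  by (simp add: mult.assoc[symmetric])

lemma mult_cancel_left_iff [simp]: "x * y = x * z \<longleftrightarrow> y = z"
  by (metis inv_cancel_left)

lemma inv_right [simp]: "x * inverse x = 1"
  by (metis inv_cancel_left inv_left mult_1_right)

lemma inv_cancel_left' [simp]: "x * (inverse x * y) = y"
  by (simp add: mult.assoc[symmetric])

lemma mult_cancel_right_iff [simp]: "y * x = z * x \<longleftrightarrow> y = z"
  by (metis inv_right mult.assoc mult_1_right)

lemma inv_unique: "x * y = 1 \<Longrightarrow> inverse x = y"
  by (metis inv_cancel_left mult_1_right)

lemma inv_inv [simp]: "inverse (inverse x) = x"
  by (rule inv_unique) simp

lemma inv_one [simp]: "inverse 1 = 1"
  by (rule inv_unique) simp

lemma inv_mult: "inverse (x * y) = inverse y * inverse x"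
  by (rule inv_unique) (simp add: mult.assoc)

lemma eq_mult_iff_left: "x = y * z \<longleftrightarrow> inverse y * x = z"
  by auto

lemma eq_mult_iff_right: "x = y * z \<longleftrightarrow> x * inverse z = y"
  by (auto simp: mult.assoc)

end

definition commute :: "'g::mult_group \<Rightarrow> 'g \<Rightarrow> bool" where
  "commute x y \<longleftrightarrow> x * y = y * x"

lemma commute_sym: "commute x y \<Longrightarrow> commute y x"
  by (simp add: commute_def)

lemma commute_refl [simp]: "commute x x"
  and commute_one [simp]: "commute x 1" "commute 1 x"
  by (simp_all add: commute_def)

lemma commute_mult: "commute x y \<Longrightarrow> commute x z \<Longrightarrow> commute x (y * z)"
  unfolding commute_def by (metis mult.assoc)

lemma commute_inverse: "commute x y \<Longrightarrow> commute x (inverse y)"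
  unfolding commute_def by (metis inv_cancel_left inv_right mult.assoc mult_1_right)

lemma commute_power: "commute x y \<Longrightarrow> commute x (y ^ n)"
  by (induction n) (auto intro: commute_mult)

lemma commute_left:
  "commute x z \<Longrightarrow> commute y z \<Longrightarrow> commute (x * y) z"
  "commute x z \<Longrightarrow> commute (inverse x) z"
  "commute x z \<Longrightarrow> commute (x ^ n) z"
  by (rule commute_sym, rule commute_mult commute_inverse commute_power; erule commute_sym)+

lemma commute_mult_cancel: "commute x (y * z) \<Longrightarrow> commute x z \<Longrightarrow> commute x y"
  using commute_mult[of x "y * z" "inverse z"] commute_inverse[of x z] by (simp add: mult.assoc)

lemma commute_conj: "commute x y \<longleftrightarrow> inverse x * y * x = y"
  using eq_mult_iff_left[of "y * x" x y] by (auto simp: commute_def mult.assoc)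

lemma inverse_power: "inverse (x ^ n) = inverse (x::'g::mult_group) ^ n"
  by (induction n) (simp_all add: inv_mult power_commutes)

lemma powi_neg: "(x::'g::mult_group) powi (- k) = inverse (x powi k)"
  by (cases k) (auto simp: power_int_def inverse_power nat_minus_as_int)

lemma powi_1 [simp]: "(x::'g::mult_group) powi 1 = x"
  by (simp add: power_int_def)

lemma powi_0 [simp]: "(x::'g::mult_group) powi 0 = 1"
  by (simp add: power_int_def)

lemma powi_nat: "(x::'g::mult_group) powi int n = x ^ n"
  by (simp add: power_int_def)

lemma commute_powi: "commute x y \<Longrightarrow> commute x (y powi k)"
  unfolding power_int_def by (simp add: commute_power commute_inverse)

lemma powi_succ: "(x::'g::mult_group) powi (k + 1) = x powi k * x"
proof (cases "k \<ge> 0")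
  case True
  then show ?thesis by (simp add: power_int_def nat_add_distrib power_commutes)
next
  case False
  then obtain n where n: "k = - int (Suc n)" by (metis int_cases not_le_imp_less zero_le_imp_eq_int negD)
  have "x powi (k + 1) = inverse x ^ n"
    unfolding n by (cases n) (simp_all add: power_int_def nat_add_distrib)
  moreover have "x powi k = inverse x ^ Suc n" unfolding n powi_neg powi_nat inverse_power ..
  ultimately show ?thesis by (simp add: power_commutes[symmetric] mult.assoc power_Suc2 del: power_Suc)
qed

lemma powi_add: "(x::'g::mult_group) powi (k + l) = x powi k * x powi l"
proof (induction l rule: int_induct[where k = 0])
  case (step1 l)
  then show ?case using powi_succ[of x "k + l"] powi_succ[of x l] by (simp add: add.assoc mult.assoc)
next
  case (step2 l)
  have "x powi (k + l) = x powi (k + (l - 1)) * x" using powi_succ[of x "k + (l - 1)"] by (simp add: algebra_simps)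
  moreover have "x powi l = x powi (l - 1) * x" using powi_succ[of x "l - 1"] by simp
  ultimately have "x powi (k + (l - 1)) * x = (x powi k * x powi (l - 1)) * x"
    using step2 by (simp add: mult.assoc)
  then show ?case by simp
qed simp

lemma powi_double: "((x::'g::mult_group) * x) powi k = x powi (2 * k)"
proof (induction k rule: int_induct[where k = 0])
  case (step1 k)
  then show ?case
    using powi_succ[of "x * x" k] powi_add[of x "2 * k" 2] powi_add[of x 1 1] by (simp add: algebra_simps)
next
  case (step2 k)
  have "(x * x) powi (k - 1) * (x * x) = x powi (2 * (k - 1)) * (x * x)"
    using powi_succ[of "x * x" "k - 1"] powi_add[of x "2 * (k - 1)" 2] powi_add[of x 1 1] step2
    by (simp add: algebra_simps)
  then show ?case by simp
qed simp

definition subgp :: "'g::mult_group set \<Rightarrow> bool" where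
  "subgp H \<longleftrightarrow> 1 \<in> H \<and> (\<forall>x\<in>H. \<forall>y\<in>H. x * y \<in> H) \<and> (\<forall>x\<in>H. inverse x \<in> H)"

lemma subgpD:
  assumes "subgp H"
  shows "1 \<in> H" "x \<in> H \<Longrightarrow> y \<in> H \<Longrightarrow> x * y \<in> H" "x \<in> H \<Longrightarrow> inverse x \<in> H"
    "x \<in> H \<Longrightarrow> x ^ n \<in> H" "x \<in> H \<Longrightarrow> x powi k \<in> H"
proof -
  show 1: "1 \<in> H" and 2: "\<And>x y. x \<in> H \<Longrightarrow> y \<in> H \<Longrightarrow> x * y \<in> H" and 3: "\<And>x. x \<in> H \<Longrightarrow> inverse x \<in> H"
    using assms unfolding subgp_def by auto
  show 4: "x ^ n \<in> H" if "x \<in> H" for x n using that 1 2 by (induction n) auto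
  show "x powi k \<in> H" if "x \<in> H" unfolding power_int_def using 3 4 that by auto
qed

section \<open>The Artin group of a spherical diagram\<close>

text \<open>An arbitrary group in which the generators of the Artin group live, with just the two properties
  through which the presentation enters: positive words have equal values exactly if they are equal
  in the positive monoid, and there is a length homomorphism.\<close>

locale artin_model = spherical_diagram M S
  for M :: "'a \<Rightarrow> 'a \<Rightarrow> enat" and S :: "'a set" +
  fixes \<sigma> :: "'a \<Rightarrow> 'g::mult_group" and len :: "'g \<Rightarrow> int"
  assumes val_eq_iff: "set u \<subseteq> S \<Longrightarrow> set v \<subseteq> S \<Longrightarrow>
      prod_list (map \<sigma> u) = prod_list (map \<sigma> v) \<longleftrightarrow> beq u v"
    and len_mult: "\<And>x y. (\<And>H. subgp H \<Longrightarrow> \<sigma> ` S \<subseteq> H \<Longrightarrow> x \<in> H) \<Longrightarrow>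
      (\<And>H. subgp H \<Longrightarrow> \<sigma> ` S \<subseteq> H \<Longrightarrow> y \<in> H) \<Longrightarrow> len (x * y) = len x + len y"
    and len_gen: "s \<in> S \<Longrightarrow> len (\<sigma> s) = 1"
begin

definition val :: "'a list \<Rightarrow> 'g" where
  "val u = prod_list (map \<sigma> u)"

lemma val_simps [simp]: "val [] = 1" "val (s # u) = \<sigma> s * val u" "val (u @ v) = val u * val v"
  by (simp_all add: val_def)

lemma val_eq: "set u \<subseteq> S \<Longrightarrow> set v \<subseteq> S \<Longrightarrow> val u = val v \<longleftrightarrow> beq u v"
  unfolding val_def by (rule val_eq_iff)

definition P :: "'a set \<Rightarrow> 'g set" where
  "P X = val ` {u. set u \<subseteq> X}"

text \<open>The parabolic subgroup generated by \<open>X\<close>; \<open>P X\<close> is its positive monoid.\<close>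

inductive_set A :: "'a set \<Rightarrow> 'g set" for X where
  A_one: "1 \<in> A X"
| A_gen: "s \<in> X \<Longrightarrow> x \<in> A X \<Longrightarrow> \<sigma> s * x \<in> A X"
| A_gen_inv: "s \<in> X \<Longrightarrow> x \<in> A X \<Longrightarrow> inverse (\<sigma> s) * x \<in> A X"

definition \<Delta> :: "'a set \<Rightarrow> 'g" where
  "\<Delta> X = val (gword X)"

text \<open>Conjugation by \<open>\<Delta>\<close> is an involution on the generators, so the square is central.\<close>

definition \<delta> :: "'a set \<Rightarrow> 'g" where
  "\<delta> X = \<Delta> X * \<Delta> X"

definition ldvd :: "'g \<Rightarrow> 'g \<Rightarrow> bool" (infix \<open>\<preceq>\<close> 50) where
  "p \<preceq> z \<longleftrightarrow> inverse p * z \<in> P S"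

subsection \<open>Parabolic subgroups and their positive monoids\<close>

lemma A_mult: "x \<in> A X \<Longrightarrow> y \<in> A X \<Longrightarrow> x * y \<in> A X"
  by (induction rule: A.induct) (auto simp: mult.assoc intro: A.intros)

lemma A_sigma: "s \<in> X \<Longrightarrow> \<sigma> s \<in> A X" "s \<in> X \<Longrightarrow> inverse (\<sigma> s) \<in> A X"
  using A_gen[OF _ A_one] A_gen_inv[OF _ A_one] by fastforce+

lemma A_inverse: "x \<in> A X \<Longrightarrow> inverse x \<in> A X"
  by (induction rule: A.induct) (auto simp: inv_mult intro: A_one A_mult A_sigma)

lemma subgp_A: "subgp (A X)"
  unfolding subgp_def using A_one A_mult A_inverse by blast

lemmas A_power = subgpD(4)[OF subgp_A] and A_powi = subgpD(5)[OF subgp_A]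

lemma A_least: "subgp H \<Longrightarrow> \<sigma> ` X \<subseteq> H \<Longrightarrow> x \<in> A X \<Longrightarrow> x \<in> H"
  by (rotate_tac 2, induction rule: A.induct) (auto dest: subgpD)

lemma A_mono: "X \<subseteq> Y \<Longrightarrow> A X \<subseteq> A Y"
  using A_least[OF subgp_A, of X Y] A_sigma by blast

lemma len_mult_A: "x \<in> A S \<Longrightarrow> y \<in> A S \<Longrightarrow> len (x * y) = len x + len y"
  by (rule len_mult) (use A_least in blast)+

lemma len_one [simp]: "len 1 = 0"
  using len_mult_A[OF A_one A_one] by simp

lemma len_inverse: "x \<in> A S \<Longrightarrow> len (inverse x) = - len x"
  using len_mult_A[OF _ A_inverse, of x x] by simp

lemma len_power: "x \<in> A S \<Longrightarrow> len (x ^ n) = int n * len x"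
  by (induction n) (auto simp: len_mult_A A_power algebra_simps)

lemma len_powi: "x \<in> A S \<Longrightarrow> len (x powi k) = k * len x"
  unfolding power_int_def by (auto simp: len_power len_inverse A_inverse)

lemma P_one [simp]: "1 \<in> P X"
  unfolding P_def by (rule image_eqI[of _ _ "[]"]) auto

lemma P_mult: "p \<in> P X \<Longrightarrow> q \<in> P X \<Longrightarrow> p * q \<in> P X"
proof -
  assume "p \<in> P X" "q \<in> P X"
  then obtain u v where "p = val u" "set u \<subseteq> X" "q = val v" "set v \<subseteq> X" unfolding P_def by blast
  then have "p * q = val (u @ v)" "set (u @ v) \<subseteq> X" by auto
  then show ?thesis unfolding P_def by blast
qed

lemma P_gen: "s \<in> X \<Longrightarrow> \<sigma> s \<in> P X"
  unfolding P_def by (rule image_eqI[of _ _ "[s]"]) auto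

lemma P_power: "p \<in> P X \<Longrightarrow> p ^ n \<in> P X"
  by (induction n) (auto intro: P_mult)

lemma P_mono: "X \<subseteq> Y \<Longrightarrow> p \<in> P X \<Longrightarrow> p \<in> P Y"
  unfolding P_def by blast

lemma val_in_A: "set u \<subseteq> X \<Longrightarrow> val u \<in> A X"
  by (induction u) (auto intro: A.intros)

lemma P_in_A: "p \<in> P X \<Longrightarrow> p \<in> A X"
  unfolding P_def using val_in_A by blast

lemma len_val: "set u \<subseteq> S \<Longrightarrow> len (val u) = int (length u)"
  by (induction u) (auto simp: len_mult_A A_sigma val_in_A len_gen)

lemma len_P: "p \<in> P S \<Longrightarrow> 0 \<le> len p"
  unfolding P_def using len_val by auto

lemma P_cases:
  assumes "p \<in> P X"
  obtains "p = 1" | s q where "s \<in> X" "q \<in> P X" "p = \<sigma> s * q"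
proof -
  obtain u where u: "p = val u" "set u \<subseteq> X" using assms unfolding P_def by blast
  show ?thesis
  proof (cases u)
    case (Cons s v)
    then show ?thesis using u that(2)[of s "val v"] unfolding P_def by auto
  qed (use u that in auto)
qed

lemma len_P_pos: "p \<in> P S \<Longrightarrow> p \<noteq> 1 \<Longrightarrow> 0 < len p"
  by (erule P_cases) (auto simp: len_mult_A A_sigma P_in_A len_gen dest: len_P)

text \<open>Braid relations do not change the set of letters of a word.\<close>

lemma P_support:
  assumes "p \<in> P S" "q \<in> P S" "p * q \<in> P X" "X \<subseteq> S"
  shows "p \<in> P X" "q \<in> P X"
proof -
  obtain u v w where uvw: "p = val u" "set u \<subseteq> S" "q = val v" "set v \<subseteq> S" "p * q = val w" "set w \<subseteq> X"
    using assms unfolding P_def by blast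
  then have "val (u @ v) = val w" by simp
  then have "beq (u @ v) w" using val_eq[of "u @ v" w] uvw assms(4) by auto
  then have "set u \<union> set v = set w" using beq_set by fastforce
  then have "set u \<subseteq> X" "set v \<subseteq> X" using uvw(6) by blast+
  then show "p \<in> P X" "q \<in> P X" using uvw(1,3) unfolding P_def by blast+
qed

lemma sigma_in_P: "s \<in> S \<Longrightarrow> \<sigma> s \<in> P X \<Longrightarrow> X \<subseteq> S \<Longrightarrow> s \<in> X"
proof -
  assume s: "s \<in> S" "\<sigma> s \<in> P X" "X \<subseteq> S"
  then obtain w where w: "\<sigma> s = val w" "set w \<subseteq> X" unfolding P_def by blast
  then have "beq [s] w" using val_eq[of "[s]" w] s by auto
  then show ?thesis using beq_set w(2) by fastforce
qed

lemma sigma_inj: "s \<in> S \<Longrightarrow> t \<in> S \<Longrightarrow> \<sigma> s = \<sigma> t \<Longrightarrow> s = t"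
  using sigma_in_P[of s "{t}"] P_gen[of t "{t}"] by simp

lemma divides_val:
  assumes "set u \<subseteq> S" "set z \<subseteq> S"
  shows "divides u z \<longleftrightarrow> val u \<preceq> val z"
proof
  assume "divides u z"
  then obtain v where v: "beq z (u @ v)" unfolding divides_def by blast
  then have S: "set v \<subseteq> S" using beq_set assms by fastforce
  then have "val z = val u * val v" using val_eq[of z "u @ v"] v assms by simp
  then show "val u \<preceq> val z" unfolding ldvd_def P_def using S by auto
next
  assume "val u \<preceq> val z"
  then obtain v where "inverse (val u) * val z = val v" "set v \<subseteq> S" unfolding ldvd_def P_def by blast
  then have "val z = val (u @ v)" by (simp add: eq_mult_iff_left)
  then have "beq z (u @ v)" using val_eq[of z "u @ v"] \<open>set v \<subseteq> S\<close> assms by simp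
  then show "divides u z" unfolding divides_def by blast
qed

lemma ldvd_mult [simp]: "q \<in> P S \<Longrightarrow> p \<preceq> p * q"
  by (simp add: ldvd_def)

lemma ldvdE: "p \<preceq> z \<Longrightarrow> (\<And>q. q \<in> P S \<Longrightarrow> z = p * q \<Longrightarrow> thesis) \<Longrightarrow> thesis"
  unfolding ldvd_def by (metis inv_cancel_left')

lemma ldvd_cancel [simp]: "x * p \<preceq> x * z \<longleftrightarrow> p \<preceq> z"
  by (simp add: ldvd_def inv_mult mult.assoc)

lemma ldvd_trans: "p \<preceq> q \<Longrightarrow> q \<preceq> z \<Longrightarrow> p \<preceq> z"
  by (elim ldvdE) (simp add: mult.assoc P_mult)

lemma ldvd_mult_right: "p \<preceq> z \<Longrightarrow> q \<in> P S \<Longrightarrow> p \<preceq> z * q"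
  using ldvd_trans ldvd_mult by blast

lemma ldvd_one: "p \<in> P S \<Longrightarrow> p \<preceq> 1 \<Longrightarrow> p = 1"
proof (rule ccontr)
  assume p: "p \<in> P S" "p \<preceq> 1" "p \<noteq> 1"
  then obtain q where q: "q \<in> P S" "1 = p * q" by (elim ldvdE)
  then have "len p + len q = 0" using len_mult_A[of p q] p(1) P_in_A by (metis len_one)
  then show False using len_P_pos[OF p(1,3)] len_P[OF q(1)] by simp
qed

lemma braid:
  assumes "s \<in> S" "t \<in> S" "s \<noteq> t" "M s t = enat k"
  shows "val (alt s t k) = val (alt t s k)"
  using beq_alt[OF assms(3,4), of "[]"] val_eq[of "alt s t k" "alt t s k"] assms(1,2)
    set_alt_subset[of s t k] set_alt_subset[of t s k] by auto

lemma sigma_commute: "s \<in> S \<Longrightarrow> t \<in> S \<Longrightarrow> M s t = 2 \<Longrightarrow> commute (\<sigma> s) (\<sigma> t)"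
proof (cases "s = t")
  case False
  assume "s \<in> S" "t \<in> S" "M s t = 2"
  then have "val (alt s t 2) = val (alt t s 2)"
    using braid[OF _ _ False] by (simp add: numeral_eq_enat)
  then show ?thesis by (simp add: numeral_2_eq_2 commute_def)
qed simp

lemma dihedral:
  assumes "s \<in> S" "t \<in> S" "s \<noteq> t" "\<sigma> s \<preceq> z" "\<sigma> t \<preceq> z" "z \<in> P S"
  shows "\<exists>k. M s t = enat (Suc k) \<and> 0 < k \<and> val (alt s t (Suc k)) \<preceq> z"
proof -
  obtain u where u: "z = val u" "set u \<subseteq> S" using assms(6) unfolding P_def by blast
  have "divides [s] u" "divides [t] u"
    using divides_val[of "[s]" u] divides_val[of "[t]" u] u assms by simp_all
  then obtain k where k: "M s t = enat (Suc k)" "divides (alt s t (Suc k)) u"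
    using divides_two_letters[OF assms(3)] by blast
  then have "val (alt s t (Suc k)) \<preceq> z"
    using divides_val[of "alt s t (Suc k)" u] u set_alt_subset[of s t "Suc k"] assms(1,2) by blast
  moreover have "0 < k" using M_Suc[OF assms(3) k(1)] by blast
  ultimately show ?thesis using k(1) by blast
qed

text \<open>The least common multiple involves no further generators.\<close>

lemma common_multiple_in_P:
  assumes "p \<in> P X" "q \<in> P X" "X \<subseteq> S" "p \<preceq> z" "q \<preceq> z" "z \<in> P S"
  shows "\<exists>p'\<in>P X. \<exists>q'\<in>P X. p * p' = q * q' \<and> p * p' \<preceq> z"
proof -
  obtain u v x where u: "p = val u" "set u \<subseteq> X" "q = val v" "set v \<subseteq> X" "z = val x" "set x \<subseteq> S"
    using assms unfolding P_def by blast
  then have uS: "set u \<subseteq> S" "set v \<subseteq> S" using assms(3) by auto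
  have "divides u x" "divides v x" using divides_val assms(4,5) u uS by blast+
  then obtain w where w: "set w \<subseteq> X" "divides u w" "divides v w" "divides w x"
    using lcm_exists[of u x v X] u by blast
  have wS: "set w \<subseteq> S" using w(1) assms(3) by blast
  then have d: "p \<preceq> val w" "q \<preceq> val w" "val w \<preceq> z"
    using divides_val w u uS by blast+
  obtain p' where p': "p' \<in> P S" "val w = p * p'" using d(1) by (elim ldvdE)
  obtain q' where q': "q' \<in> P S" "val w = q * q'" using d(2) by (elim ldvdE)
  have "val w \<in> P X" using w(1) unfolding P_def by blast
  then have "p' \<in> P X" "q' \<in> P X"
    using P_support p' q' P_mono[OF assms(3)] assms(1,2,3) by metis+
  then show ?thesis using p'(2) q'(2) d(3) by metis
qed

lemma Delta_in_P: "X \<subseteq> S \<Longrightarrow> \<Delta> X \<in> P X"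
  unfolding \<Delta>_def P_def using set_gword by blast

lemma Delta_in_A: "X \<subseteq> S \<Longrightarrow> \<Delta> X \<in> A X"
  using Delta_in_P P_in_A by blast

lemma sigma_ldvd_Delta: "X \<subseteq> S \<Longrightarrow> t \<in> X \<Longrightarrow> \<sigma> t \<preceq> \<Delta> X"
  unfolding \<Delta>_def using divides_gword divides_val[of "[t]" "gword X"] set_gword[of X] by auto

lemma Delta_least:
  assumes "X \<subseteq> S" "z \<in> P S" "\<And>t. t \<in> X \<Longrightarrow> \<sigma> t \<preceq> z"
  shows "\<Delta> X \<preceq> z"
proof -
  obtain u where u: "z = val u" "set u \<subseteq> S" using assms(2) unfolding P_def by blast
  have "divides (gword X) u"
    using assms u divides_val[of "[_]" u] by (intro gword_least) auto
  then show ?thesis unfolding \<Delta>_def u(1) using divides_val u(2) set_gword[OF assms(1)] assms(1) by blast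
qed

text \<open>The word of a Garside element is reduced, and so is every word equal to it in the positive monoid.\<close>

lemma Delta_squarefree:
  assumes "X \<subseteq> S" "p \<in> P S" "q \<in> P S" "t \<in> S"
  shows "\<Delta> X \<noteq> p * (\<sigma> t * (\<sigma> t * q))"
proof
  assume eq: "\<Delta> X = p * (\<sigma> t * (\<sigma> t * q))"
  obtain u v where u: "p = val u" "set u \<subseteq> S" "q = val v" "set v \<subseteq> S" using assms unfolding P_def by blast
  have "val (gword X) = val (u @ t # t # v)" using eq u unfolding \<Delta>_def by simp
  then have "beq (gword X) (u @ t # t # v)"
    using val_eq[of "gword X" "u @ t # t # v"] u set_gword[OF assms(1)] assms(1,4) by auto
  then show False using reduced_beq[OF reduced_gword[OF assms(1)]] not_reduced_square by blast
qed

lemma Delta_twist: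
  assumes "X \<subseteq> S" "s \<in> X"
  shows "\<exists>s'\<in>X. \<sigma> s * \<Delta> X = \<Delta> X * \<sigma> s' \<and> \<sigma> s' * \<Delta> X = \<Delta> X * \<sigma> s"
proof -
  obtain s' where s': "s' \<in> X" "beq (s # gword X) (gword X @ [s'])" "beq (s' # gword X) (gword X @ [s])"
    using gword_twist[OF assms] by blast
  have "val (s # gword X) = val (gword X @ [s'])" "val (s' # gword X) = val (gword X @ [s])"
    using s' set_gword[OF assms(1)] assms by (subst val_eq; auto)+
  then show ?thesis using s'(1) unfolding \<Delta>_def by auto
qed

lemma delta_central: "X \<subseteq> S \<Longrightarrow> x \<in> A X \<Longrightarrow> commute x (\<delta> X)"
proof -
  assume X: "X \<subseteq> S"
  have "commute (\<sigma> s) (\<delta> X)" if "s \<in> X" for s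
    using Delta_twist[OF X that] unfolding commute_def \<delta>_def by (metis mult.assoc)
  then have "\<sigma> ` X \<subseteq> {x. commute x (\<delta> X)}" by blast
  moreover have "subgp {x. commute x (\<delta> X)}" unfolding subgp_def by (auto intro: commute_left)
  ultimately show "x \<in> A X \<Longrightarrow> commute x (\<delta> X)" using A_least by blast
qed

lemma delta_in_P: "X \<subseteq> S \<Longrightarrow> \<delta> X \<in> P X"
  unfolding \<delta>_def using Delta_in_P P_mult by blast

lemma delta_in_A: "X \<subseteq> S \<Longrightarrow> \<delta> X \<in> A X"
  using delta_in_P P_in_A by blast

lemma delta_power: "\<delta> X ^ n = \<Delta> X ^ (2 * n)"
  unfolding \<delta>_def by (simp add: power_mult power2_eq_square)

lemma delta_powi: "\<delta> X powi k = \<Delta> X powi (2 * k)"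
  unfolding \<delta>_def by (rule powi_double)

text \<open>The inverse of a generator becomes positive after multiplication with the central element \<open>\<delta> X\<close>.\<close>

lemma delta_numerator:
  assumes X: "X \<subseteq> S" and x: "x \<in> A X"
  shows "\<exists>n. \<forall>m\<ge>n. x * \<delta> X ^ m \<in> P X"
  using x
proof (induction rule: A.induct)
  case A_one
  then show ?case using P_power[OF delta_in_P[OF X]] by simp
next
  case (A_gen s x)
  then show ?case by (metis P_gen P_mult mult.assoc)
next
  case (A_gen_inv s x)
  then obtain n where n: "\<forall>m\<ge>n. x * \<delta> X ^ m \<in> P X" by blast
  obtain q where q: "q \<in> P S" "\<Delta> X = \<sigma> s * q" using sigma_ldvd_Delta[OF X A_gen_inv(1)] by (elim ldvdE)
  have "q \<in> P X" using P_support(2)[of "\<sigma> s" q X] q Delta_in_P[OF X] P_gen A_gen_inv(1) X by auto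
  then have "inverse (\<sigma> s) * \<delta> X \<in> P X"
    unfolding \<delta>_def by (subst q(2)) (auto simp: mult.assoc intro: P_mult Delta_in_P[OF X])
  moreover have "(inverse (\<sigma> s) * x) * \<delta> X ^ Suc m = (inverse (\<sigma> s) * \<delta> X) * (x * \<delta> X ^ m)" for m
    using delta_central[OF X A_gen_inv(2)] unfolding commute_def by (metis mult.assoc power_Suc)
  ultimately have "(inverse (\<sigma> s) * x) * \<delta> X ^ m \<in> P X" if "Suc n \<le> m" for m
    using that n P_mult by (cases m) auto
  then show ?case by blast
qed

lemma A_cap_P: "x \<in> P S \<Longrightarrow> x \<in> A X \<Longrightarrow> X \<subseteq> S \<Longrightarrow> x \<in> P X"
  using delta_numerator[of X x] P_support(1)[of x "\<delta> X ^ _" X] P_power[OF delta_in_P, of X] P_mono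
  by (metis order_refl)

end

context artin_model
begin

subsection \<open>Divisibility across a power of a Garside element\<close>

lemma alt_in_P: "s \<in> X \<Longrightarrow> t \<in> X \<Longrightarrow> val (alt s t k) \<in> P X"
  using set_alt_subset[of s t k] unfolding P_def by (intro imageI) auto

lemma Delta_right:
  assumes X: "X \<subseteq> S" and s: "s \<in> X"
  shows "\<exists>g\<in>P X. \<Delta> X = g * \<sigma> s"
proof -
  obtain s' where s': "s' \<in> X" "\<sigma> s' * \<Delta> X = \<Delta> X * \<sigma> s" using Delta_twist[OF X s] by blast
  obtain q where q: "q \<in> P S" "\<Delta> X = \<sigma> s' * q" using sigma_ldvd_Delta[OF X s'(1)] by (elim ldvdE)
  have "\<sigma> s' * \<Delta> X = \<sigma> s' * (q * \<sigma> s)" using s'(2) q(2) by (simp add: mult.assoc)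
  then have "\<Delta> X = q * \<sigma> s" by simp
  moreover have "q \<in> P X"
    using P_support(2)[of "\<sigma> s'" q X] q Delta_in_P[OF X] P_gen s'(1) X by auto
  ultimately show ?thesis by blast
qed

text \<open>The complement of \<open>\<Delta>\<^sub>J\<close> in the Garside element of \<open>J \<union> {t}\<close>; it conjugates one parabolic subgroup
  to another one.\<close>

definition ribbon :: "'a set \<Rightarrow> 'a \<Rightarrow> 'g" where
  "ribbon J t = inverse (\<Delta> J) * \<Delta> (insert t J)"

lemma Delta_insert: "\<Delta> (insert t J) = \<Delta> J * ribbon J t"
  by (simp add: ribbon_def)

lemma ribbon_in_P:
  assumes "insert t J \<subseteq> S"
  shows "ribbon J t \<in> P (insert t J)"
proof -
  have J: "J \<subseteq> S" using assms by blast
  have D: "\<Delta> (insert t J) \<in> P S" using Delta_in_P[OF assms] P_mono[OF assms] by blast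
  have "\<Delta> J \<preceq> \<Delta> (insert t J)"
    by (rule Delta_least[OF J D]) (use sigma_ldvd_Delta[OF assms] in blast)
  then have "ribbon J t \<in> P S" unfolding ldvd_def ribbon_def .
  then show ?thesis
    using P_support(2)[of "\<Delta> J" "ribbon J t" "insert t J"] Delta_insert[of t J] Delta_in_P[OF assms]
      Delta_in_P[OF J] P_mono[OF J] assms by simp
qed

text \<open>Since \<open>\<Delta>\<close> is square-free, a ribbon starts with no generator but the added one.\<close>

lemma ribbon_first:
  assumes X: "insert t J \<subseteq> S" and t: "t \<notin> J" and v: "ribbon J t = \<sigma> v * r" "v \<in> insert t J" "r \<in> P S"
  shows "v = t"
proof (rule ccontr)
  assume "v \<noteq> t"
  then have vJ: "v \<in> J" using v by blast
  have J: "J \<subseteq> S" using X by blast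
  obtain g where g: "g \<in> P J" "\<Delta> J = g * \<sigma> v" using Delta_right[OF J vJ] by blast
  have "\<Delta> (insert t J) = g * (\<sigma> v * (\<sigma> v * r))" unfolding Delta_insert g(2) v(1) by (simp add: mult.assoc)
  then show False using Delta_squarefree[OF X P_mono[OF J g(1)] v(3)] vJ J by blast
qed

lemma ribbon_starts:
  assumes X: "insert t J \<subseteq> S" and t: "t \<notin> J"
  shows "\<sigma> t \<preceq> ribbon J t" "ribbon J t \<noteq> 1"
proof -
  have J: "J \<subseteq> S" using X by blast
  show ne: "ribbon J t \<noteq> 1"
  proof
    assume "ribbon J t = 1"
    then have "\<Delta> (insert t J) = \<Delta> J" unfolding Delta_insert by simp
    then obtain q where "q \<in> P S" "\<Delta> J = \<sigma> t * q" using sigma_ldvd_Delta[OF X] by (metis insertI1 ldvdE)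
    then have "\<sigma> t \<in> P J" using P_support(1)[of "\<sigma> t" q J] Delta_in_P[OF J] P_gen X J by auto
    then show False using sigma_in_P t X J by blast
  qed
  show "\<sigma> t \<preceq> ribbon J t"
  proof (rule P_cases[OF ribbon_in_P[OF X]])
    fix v r assume v: "v \<in> insert t J" "r \<in> P (insert t J)" "ribbon J t = \<sigma> v * r"
    then have "v = t" using ribbon_first[OF X t v(3,1)] P_mono[OF X] by blast
    then show ?thesis using v P_mono[OF X] by simp
  qed (use ne in simp)
qed

text \<open>If \<open>t\<close> divides \<open>\<Delta>\<^sub>J\<^sup>n z\<close>, then so does every generator of \<open>J\<close>, hence \<open>\<Delta>\<close> of all of them
  divides; for larger \<open>n\<close> one peels off one factor at a time, because the ribbon again starts with \<open>t\<close>.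
  This is the tool with which all centralizers are computed.\<close>

lemma ldvd_Delta_power:
  assumes X: "insert t J \<subseteq> S" and t: "t \<notin> J" and z: "z \<in> P S" and n: "0 < n"
    and dvd: "\<sigma> t \<preceq> \<Delta> J ^ n * z"
  shows "ribbon J t \<preceq> z"
proof -
  have J: "J \<subseteq> S" using X by blast
  have DJ: "\<Delta> J \<in> P S" using Delta_in_P[OF J] P_mono[OF J] by blast
  have one: "ribbon J t \<preceq> w" if "w \<in> P S" "\<sigma> t \<preceq> \<Delta> J * w" for w
  proof -
    have "\<sigma> u \<preceq> \<Delta> J * w" if "u \<in> insert t J" for u
      using that \<open>\<sigma> t \<preceq> \<Delta> J * w\<close> sigma_ldvd_Delta[OF J, of u] ldvd_mult_right[OF _ \<open>w \<in> P S\<close>] by blast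
    then have "\<Delta> (insert t J) \<preceq> \<Delta> J * w" using Delta_least[OF X] P_mult[OF DJ that(1)] by blast
    then show ?thesis unfolding Delta_insert by simp
  qed
  show ?thesis using n dvd
  proof (induction n rule: nat_induct_non_zero)
    case 1
    then show ?case using one[OF z] by simp
  next
    case (Suc n)
    have w: "\<Delta> J ^ n * z \<in> P S" using P_mult P_power DJ z by blast
    have "ribbon J t \<preceq> \<Delta> J ^ n * z" using one[OF w] Suc.prems by (simp add: mult.assoc)
    then have "\<sigma> t \<preceq> \<Delta> J ^ n * z" using ribbon_starts(1)[OF X t] ldvd_trans by blast
    then show ?case by (rule Suc.IH)
  qed
qed

lemma Delta_singleton: "s \<in> S \<Longrightarrow> \<Delta> {s} = \<sigma> s"
proof -
  assume s: "s \<in> S"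
  have X: "{s} \<subseteq> S" using s by simp
  have "\<Delta> {s} \<preceq> \<sigma> s"
    using Delta_least[OF X P_gen[OF s]] ldvd_mult[of 1 "\<sigma> s"] by simp
  then obtain q where q: "q \<in> P S" "\<sigma> s = \<Delta> {s} * q" by (elim ldvdE)
  obtain r where r: "r \<in> P S" "\<Delta> {s} = \<sigma> s * r" using sigma_ldvd_Delta[OF X, of s] by (auto elim: ldvdE)
  have "\<sigma> s * (r * q) = \<sigma> s * 1" using q(2) r(2) by (metis mult.assoc mult_1_right)
  then have rq: "r * q = 1" unfolding mult_cancel_left_iff .
  then have "r \<preceq> 1" using ldvd_mult[OF q(1), of r] by simp
  then show ?thesis using ldvd_one[OF r(1)] r(2) by simp
qed

text \<open>Let \<open>u\<close> be the first letter of \<open>x\<close>. If \<open>u = s\<close>, it can be cancelled. Otherwise \<open>u\<close> divides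
  \<open>x \<sigma>\<^sub>t\<^sup>n = \<sigma>\<^sub>s\<^sup>n x\<close>, so \<open>x\<close> starts with the ribbon of \<open>u\<close> over \<open>s\<close>, which conjugates \<open>\<sigma>\<^sub>s\<close> to another
  generator.\<close>

lemma sigma_power_conj_positive:
  assumes "x \<in> P S" "s \<in> S" "t \<in> S" "0 < n" "\<sigma> s ^ n * x = x * \<sigma> t ^ n"
  shows "\<sigma> s * x = x * \<sigma> t"
  using assms(1,2,5)
proof (induction "nat (len x)" arbitrary: x s rule: less_induct)
  case less
  have len1: "len (\<sigma> u ^ n) = int n" if "u \<in> S" for u
    using that len_power[of "\<sigma> u" n] A_sigma len_gen by simp
  have small: "nat (len q) < nat (len x)" if "p \<in> P S" "q \<in> P S" "p \<noteq> 1" "x = p * q" for p q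
    using that len_mult_A[of p q] P_in_A len_P_pos[of p] len_P[of q] by simp
  show ?case
  proof (rule P_cases[OF less.prems(1)])
    assume x: "x = 1"
    then have "\<sigma> s ^ n = \<sigma> t ^ n" using less.prems(3) by simp
    moreover obtain n' where "n = Suc n'" using assms(4) by (cases n) auto
    ultimately have "\<sigma> s * \<sigma> s ^ n' \<in> P {t}" using P_power[OF P_gen[of t "{t}"], of n] by simp
    then have "\<sigma> s \<in> P {t}"
      using P_support(1)[of "\<sigma> s" "\<sigma> s ^ n'" "{t}"] P_gen P_power less.prems(2) assms(3) by auto
    then have "s = t" using sigma_in_P[of s "{t}"] less.prems(2) assms(3) by simp
    then show ?thesis using x by simp
  next
    fix u x' assume u: "u \<in> S" "x' \<in> P S" "x = \<sigma> u * x'"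
    show ?thesis
    proof (cases "u = s")
      case True
      have "\<sigma> s * (\<sigma> s ^ n * x') = \<sigma> s * (x' * \<sigma> t ^ n)"
        using less.prems(3) u True by (metis mult.assoc power_commutes)
      then have "\<sigma> s ^ n * x' = x' * \<sigma> t ^ n" by simp
      moreover have "\<sigma> u \<noteq> 1" using len_gen[OF u(1)] by auto
      ultimately have "\<sigma> s * x' = x' * \<sigma> t"
        using less.hyps[OF small[OF P_gen[OF u(1)] u(2)] u(2) less.prems(2)] u(3) by simp
      then show ?thesis using u True by (metis mult.assoc)
    next
      case False
      let ?X = "insert u {s}" and ?r = "ribbon {s} u"
      have X: "?X \<subseteq> S" using u less.prems(2) by simp
      have us: "u \<notin> {s}" using False by simp
      have "\<sigma> u \<preceq> x * \<sigma> t ^ n"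
        using u ldvd_mult[of "x' * \<sigma> t ^ n" "\<sigma> u"] P_mult P_power P_gen assms(3) by (simp add: mult.assoc)
      then have "\<sigma> u \<preceq> \<Delta> {s} ^ n * x" using less.prems(2,3) Delta_singleton by simp
      then have "?r \<preceq> x" using ldvd_Delta_power[OF X us less.prems(1) assms(4)] by blast
      then obtain x'' where x'': "x'' \<in> P S" "x = ?r * x''" by (elim ldvdE)
      obtain s' where s': "s' \<in> ?X" "\<sigma> s * \<Delta> ?X = \<Delta> ?X * \<sigma> s'" using Delta_twist[OF X, of s] by blast
      have D: "\<Delta> ?X = \<sigma> s * ?r" using Delta_insert[of u "{s}"] Delta_singleton[OF less.prems(2)] by simp
      have rs: "\<sigma> s * ?r = ?r * \<sigma> s'" using s'(2) unfolding D by (simp add: mult.assoc)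
      have rsn: "\<sigma> s ^ k * ?r = ?r * \<sigma> s' ^ k" for k
        by (induction k) (simp_all add: mult.assoc, metis mult.assoc rs)
      have "?r * (\<sigma> s' ^ n * x'') = ?r * (x'' * \<sigma> t ^ n)"
        using less.prems(3) rsn[of n] unfolding x''(2) by (metis mult.assoc)
      then have "\<sigma> s' ^ n * x'' = x'' * \<sigma> t ^ n" by simp
      moreover have "?r \<in> P S" using ribbon_in_P[OF X] P_mono[OF X] by blast
      moreover have "?r \<noteq> 1" using ribbon_starts(2)[OF X us] .
      ultimately have "\<sigma> s' * x'' = x'' * \<sigma> t"
        using less.hyps[of x'' s'] small[of ?r x''] x'' s'(1) X by blast
      then show ?thesis unfolding x''(2) by (metis mult.assoc rs)
    qed
  qed
qed

text \<open>Multiplication with a central element reduces the claim to positive \<open>x\<close>.\<close>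

lemma commute_sigma_power:
  assumes "x \<in> A S" "t \<in> S" "0 < n" "commute x (\<sigma> t ^ n)"
  shows "commute x (\<sigma> t)"
proof -
  obtain k where k: "x * \<delta> S ^ k \<in> P S" using delta_numerator[of S x] assms(1) by blast
  have "commute (\<sigma> t) (\<delta> S)" using delta_central[of S "\<sigma> t"] A_sigma(1)[OF assms(2)] by blast
  then have d: "commute (\<delta> S ^ k) (\<sigma> t)" by (rule commute_sym[OF commute_power])
  have "commute (x * \<delta> S ^ k) (\<sigma> t ^ n)" by (rule commute_left(1)[OF assms(4) commute_power[OF d]])
  then have "\<sigma> t * (x * \<delta> S ^ k) = (x * \<delta> S ^ k) * \<sigma> t"
    using sigma_power_conj_positive[OF k assms(2,2,3)] unfolding commute_def by simp
  then have "commute (\<sigma> t) (x * \<delta> S ^ k)" unfolding commute_def .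
  then have "commute (\<sigma> t) x" by (rule commute_mult_cancel[OF _ commute_sym[OF d]])
  then show ?thesis by (rule commute_sym)
qed

subsection \<open>Conjugation by a Garside element\<close>

definition twist :: "'a set \<Rightarrow> 'g \<Rightarrow> 'g" where
  "twist X x = inverse (\<Delta> X) * x * \<Delta> X"

lemma twist_mult: "twist X (x * y) = twist X x * twist X y"
  by (simp add: twist_def mult.assoc)

lemma twist_one [simp]: "twist X 1 = 1"
  by (simp add: twist_def)

lemma twist_eq: "x * \<Delta> X = \<Delta> X * twist X x"
  by (simp add: twist_def mult.assoc)

lemma twist_power: "twist X (x ^ n) = twist X x ^ n"
  by (induction n) (simp_all add: twist_mult)

lemma twist_sigma:
  assumes "X \<subseteq> S" "s \<in> X"
  shows "\<exists>s'\<in>X. twist X (\<sigma> s) = \<sigma> s' \<and> twist X (\<sigma> s') = \<sigma> s"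
  using Delta_twist[OF assms] unfolding twist_def by (metis inv_cancel_left mult.assoc)

lemma twist_P: "X \<subseteq> S \<Longrightarrow> x \<in> P X \<Longrightarrow> twist X x \<in> P X"
proof -
  assume X: "X \<subseteq> S" and "x \<in> P X"
  then obtain u where u: "x = val u" "set u \<subseteq> X" unfolding P_def by blast
  have "twist X (val u) \<in> P X" using u(2)
  proof (induction u)
    case (Cons s u)
    then show ?case using twist_sigma[OF X, of s] P_gen P_mult by (fastforce simp: twist_mult)
  qed simp
  then show ?thesis using u by simp
qed

lemma len_twist: "X \<subseteq> S \<Longrightarrow> x \<in> A S \<Longrightarrow> len (twist X x) = len x"
  unfolding twist_def using len_mult_A A_mult A_inverse len_inverse Delta_in_A A_mono by (smt (verit) subsetD)

text \<open>Twisting is an automorphism of the positive monoid that permutes the generators, so it maps least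
  common multiples to least common multiples.\<close>

lemma twist_Delta:
  assumes X: "X \<subseteq> S" and s: "s \<in> X" "s' \<in> X" "twist X (\<sigma> s) = \<sigma> s'" "twist X (\<sigma> s') = \<sigma> s"
  shows "twist X (\<Delta> (X - {s})) = \<Delta> (X - {s'})"
proof -
  have sub: "X - {u} \<subseteq> S" for u using X by blast
  have DP: "\<Delta> (X - {u}) \<in> P X" for u using Delta_in_P[OF sub] P_mono[of "X - {u}" X] by blast
  have half: "\<Delta> (X - {s'}) \<preceq> twist X (\<Delta> (X - {s}))"
    if s: "s \<in> X" "s' \<in> X" "twist X (\<sigma> s) = \<sigma> s'" "twist X (\<sigma> s') = \<sigma> s" for s s'
  proof (rule Delta_least[OF sub])
    show "twist X (\<Delta> (X - {s})) \<in> P S" using twist_P[OF X DP] P_mono[OF X] by blast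
    fix t assume t: "t \<in> X - {s'}"
    obtain u where u: "u \<in> X" "twist X (\<sigma> t) = \<sigma> u" "twist X (\<sigma> u) = \<sigma> t" using twist_sigma[OF X] t by blast
    have tS: "t \<in> S" "s' \<in> S" using t s(2) X by blast+
    have "u \<noteq> s"
    proof
      assume "u = s"
      then have "\<sigma> t = \<sigma> s'" using u(3) s(3) by simp
      then show False using sigma_inj[OF tS] t by blast
    qed
    then have "\<sigma> u \<preceq> \<Delta> (X - {s})" using sigma_ldvd_Delta[OF sub] u(1) by blast
    then obtain q where q: "q \<in> P S" "\<Delta> (X - {s}) = \<sigma> u * q" by (elim ldvdE)
    have "q \<in> P X" using P_support(2)[of "\<sigma> u" q X] q DP[of s] P_gen u(1) X by auto
    then have "twist X q \<in> P S" using twist_P[OF X] P_mono[OF X] by blast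
    then show "\<sigma> t \<preceq> twist X (\<Delta> (X - {s}))" unfolding q(2) twist_mult u(3) by simp
  qed
  obtain q where q: "q \<in> P S" "twist X (\<Delta> (X - {s})) = \<Delta> (X - {s'}) * q" using half[OF s] by (elim ldvdE)
  obtain q' where q': "q' \<in> P S" "twist X (\<Delta> (X - {s'})) = \<Delta> (X - {s}) * q'"
    using half[OF s(2,1,4,3)] by (elim ldvdE)
  have DA: "\<Delta> (X - {u}) \<in> A S" for u using DP P_in_A A_mono[OF X] by blast
  have "len (\<Delta> (X - {s})) = len (\<Delta> (X - {s'})) + len q"
    using len_twist[OF X DA] q len_mult_A[OF DA P_in_A[OF q(1)]] by metis
  moreover have "len (\<Delta> (X - {s'})) = len (\<Delta> (X - {s})) + len q'"
    using len_twist[OF X DA] q' len_mult_A[OF DA P_in_A[OF q'(1)]] by metis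
  ultimately have "len q = 0" using len_P[OF q(1)] len_P[OF q'(1)] by simp
  then have "q = 1" using len_P_pos[OF q(1)] by fastforce
  then show ?thesis using q(2) by simp
qed

lemma Delta_powi_sigma:
  assumes X: "X \<subseteq> S" and s: "s \<in> X"
  shows "\<exists>s'\<in>X. \<Delta> X powi i * \<sigma> s = \<sigma> s' * \<Delta> X powi i"
  using s
proof (induction i arbitrary: s rule: int_induct[where k = 0])
  case base
  then show ?case by auto
next
  case (step1 i)
  obtain s1 where s1: "s1 \<in> X" "\<sigma> s1 * \<Delta> X = \<Delta> X * \<sigma> s" using Delta_twist[OF X step1.prems] by blast
  obtain s2 where s2: "s2 \<in> X" "\<Delta> X powi i * \<sigma> s1 = \<sigma> s2 * \<Delta> X powi i" using step1.IH[OF s1(1)] by blast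
  have "\<Delta> X powi (i + 1) * \<sigma> s = \<sigma> s2 * \<Delta> X powi (i + 1)"
    unfolding powi_succ using s1(2) s2(2) by (metis mult.assoc)
  then show ?case using s2(1) by blast
next
  case (step2 i)
  obtain s1 where s1: "s1 \<in> X" "\<sigma> s * \<Delta> X = \<Delta> X * \<sigma> s1" using Delta_twist[OF X step2.prems] by blast
  obtain s2 where s2: "s2 \<in> X" "\<Delta> X powi i * \<sigma> s1 = \<sigma> s2 * \<Delta> X powi i" using step2.IH[OF s1(1)] by blast
  have i: "\<Delta> X powi i = \<Delta> X powi (i - 1) * \<Delta> X" using powi_succ[of "\<Delta> X" "i - 1"] by simp
  have "(\<Delta> X powi (i - 1) * \<sigma> s) * \<Delta> X = (\<sigma> s2 * \<Delta> X powi (i - 1)) * \<Delta> X"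
    using s1(2) s2(2) unfolding i by (metis mult.assoc)
  then show ?case using s2(1) by auto
qed

subsection \<open>Decomposing positive elements along a parabolic submonoid\<close>

lemma extract_parabolic:
  assumes "p \<in> P S" "Y \<subseteq> S"
  shows "\<exists>y\<in>P Y. \<exists>q\<in>P S. p = y * q \<and> (\<forall>u\<in>Y. \<not> \<sigma> u \<preceq> q)"
  using assms(1)
proof (induction "nat (len p)" arbitrary: p rule: less_induct)
  case less
  show ?case
  proof (cases "\<exists>u\<in>Y. \<sigma> u \<preceq> p")
    case True
    then obtain u p' where u: "u \<in> Y" "p' \<in> P S" "p = \<sigma> u * p'" by (auto elim: ldvdE)
    have "len p = 1 + len p'" using u assms(2) len_mult_A[of "\<sigma> u" p'] A_sigma P_in_A len_gen by auto
    then have "nat (len p') < nat (len p)" using len_P[OF u(2)] by simp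
    then obtain y q where "y \<in> P Y" "q \<in> P S" "p' = y * q" "\<forall>u\<in>Y. \<not> \<sigma> u \<preceq> q" using less.hyps u(2) by blast
    moreover from this have "p = (\<sigma> u * y) * q" using u(3) by (simp add: mult.assoc)
    moreover have "\<sigma> u * y \<in> P Y" using P_mult P_gen u(1) \<open>y \<in> P Y\<close> by blast
    ultimately show ?thesis by blast
  next
    case False
    then show ?thesis using less.prems P_one by (metis mult_1_left)
  qed
qed

text \<open>A common multiple \<open>a a' = b b'\<close> within \<open>P Y\<close> divides \<open>a z\<close>, so \<open>a'\<close> divides \<open>z\<close> and is trivial; likewise
  \<open>b'\<close>.\<close>

lemma parabolic_part_unique:
  assumes "Y \<subseteq> S" "a \<in> P Y" "b \<in> P Y" "z \<in> P S" "z' \<in> P S" "a * z = b * z'"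
    and z: "\<forall>u\<in>Y. \<not> \<sigma> u \<preceq> z" "\<forall>u\<in>Y. \<not> \<sigma> u \<preceq> z'"
  shows "a = b"
proof -
  have trivial: "c = 1" if "c \<in> P Y" "c \<preceq> w" "\<forall>u\<in>Y. \<not> \<sigma> u \<preceq> w" for c w
  proof (rule P_cases[OF that(1)])
    fix u d assume "u \<in> Y" "d \<in> P Y" "c = \<sigma> u * d"
    then have "\<sigma> u \<preceq> w" using ldvd_trans[OF _ that(2)] P_mono[OF assms(1)] ldvd_mult by blast
    then show ?thesis using that(3) \<open>u \<in> Y\<close> by blast
  qed
  have aS: "a \<in> P S" "b \<in> P S" using assms(2,3) P_mono[OF assms(1)] by blast+
  have "a \<preceq> a * z" using assms(4) by simp
  moreover have "b \<preceq> a * z" unfolding assms(6) using assms(5) by simp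
  ultimately
  obtain a' b' where ab: "a' \<in> P Y" "b' \<in> P Y" "a * a' = b * b'" "a * a' \<preceq> a * z"
    using common_multiple_in_P[OF assms(2,3,1)] P_mult[OF aS(1) assms(4)] by blast
  have "a' = 1" using trivial[OF ab(1) _ z(1)] ab(4) by simp
  moreover have "b * b' \<preceq> b * z'" using ab(3,4) assms(6) by simp
  then have "b' = 1" using trivial[OF ab(2) _ z(2)] by simp
  ultimately show ?thesis using ab(3) by simp
qed

text \<open>The common multiple of \<open>u\<close> and \<open>t\<close> that divides \<open>\<sigma>\<^sub>t d\<close> starts, after the first \<open>t\<close>, with \<open>u t\<close> unless the two
  letters commute; but the letter \<open>t\<close> does not occur in \<open>d\<close>.\<close>

lemma ldvd_sigma_power_mult:
  assumes "J \<subseteq> S" "t \<in> S" "t \<notin> J" "u \<in> J" "d \<in> P J" "\<sigma> u \<preceq> \<sigma> t ^ n * d" "0 < n"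
  shows "M t u = 2 \<and> \<sigma> u \<preceq> d"
  using assms(7,6)
proof (induction n rule: nat_induct_non_zero)
  have u: "u \<in> S" "t \<noteq> u" and d: "d \<in> P S" using assms P_mono by blast+
  have alt_dvd: "\<exists>k. M t u = enat (Suc k) \<and> 0 < k \<and> val (alt u t k) \<preceq> w"
    if w: "w \<in> P S" "\<sigma> u \<preceq> \<sigma> t * w" for w
  proof -
    have "\<sigma> t \<preceq> \<sigma> t * w" "\<sigma> t * w \<in> P S" using w(1) P_mult P_gen assms(2) by simp_all
    from dihedral[OF assms(2) u(1,2) this(1) w(2) this(2)] show ?thesis by auto
  qed
  {
    case 1
    then obtain k where k: "M t u = enat (Suc k)" "0 < k" "val (alt u t k) \<preceq> d" using alt_dvd[OF d] by auto
    have "k = 1"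
    proof (rule ccontr)
      assume "k \<noteq> 1"
      then obtain k' where "k = Suc (Suc k')" using k(2) by (metis One_nat_def Suc_diff_1 not0_implies_Suc)
      then have eq: "val (alt u t k) = \<sigma> u * (\<sigma> t * val (alt u t k'))" by simp
      obtain q where q: "q \<in> P S" "d = val (alt u t k) * q" using k(3) by (elim ldvdE)
      have v: "val (alt u t k') * q \<in> P S"
        by (rule P_mult[OF alt_in_P[OF u(1) assms(2)] q(1)])
      have "\<sigma> u * (\<sigma> t * (val (alt u t k') * q)) \<in> P J" using assms(5) q(2) eq by (simp add: mult.assoc)
      then have "\<sigma> t * (val (alt u t k') * q) \<in> P J"
        using P_support(2)[OF P_gen[OF u(1)] P_mult[OF P_gen[OF assms(2)] v]] assms(1) by blast
      then have "\<sigma> t \<in> P J" using P_support(1)[OF P_gen[OF assms(2)] v] assms(1) by blast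
      then show False using sigma_in_P assms(1-3) by blast
    qed
    then have "M t u = enat 2" using k(1) by (simp add: numeral_2_eq_2)
    moreover have "\<sigma> u \<preceq> d" using k(3) \<open>k = 1\<close> by simp
    ultimately show ?case by (simp add: numeral_eq_enat)
  next
    case (Suc n)
    have w: "\<sigma> t ^ n * d \<in> P S" using P_mult P_power P_gen assms(2) d by blast
    moreover have "\<sigma> u \<preceq> \<sigma> t * (\<sigma> t ^ n * d)" using Suc.prems by (simp add: mult.assoc)
    ultimately obtain k where k: "0 < k" "val (alt u t k) \<preceq> \<sigma> t ^ n * d" using alt_dvd by blast
    obtain k' where "k = Suc k'" using k(1) by (cases k) auto
    then have "\<sigma> u \<preceq> val (alt u t k)"
      using ldvd_mult[OF alt_in_P[OF assms(2) u(1)], of "\<sigma> u" k'] by simp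
    then show ?case using Suc.IH ldvd_trans[OF _ k(2)] by blast
  }
qed

end

lemma subgp_conj: "subgp H \<Longrightarrow> subgp {x. g * x * inverse g \<in> H}"
proof -
  assume H: "subgp H"
  have "g * (x * y) * inverse g = (g * x * inverse g) * (g * y * inverse g)" for x y
    by (simp add: mult.assoc)
  moreover have "g * inverse x * inverse g = inverse (g * x * inverse g)" for x
    by (simp add: inv_mult mult.assoc)
  ultimately show ?thesis unfolding subgp_def using subgpD[OF H] by auto
qed

lemma subgp_centralizer: "subgp {x. commute x y}"
  unfolding subgp_def by (auto intro: commute_left)

context artin_model
begin

subsection \<open>Centralizers of powers of Garside elements\<close>

lemma Delta_powi_conj_A:
  assumes X: "X \<subseteq> S" and s: "s \<in> X" "s' \<in> X" "twist X (\<sigma> s) = \<sigma> s'" and y: "y \<in> A (X - {s'})"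
  shows "\<Delta> X * y * inverse (\<Delta> X) \<in> A (X - {s})"
proof -
  have "\<sigma> ` (X - {s'}) \<subseteq> {x. \<Delta> X * x * inverse (\<Delta> X) \<in> A (X - {s})}"
  proof
    fix z assume "z \<in> \<sigma> ` (X - {s'})"
    then obtain t where t: "t \<in> X" "t \<noteq> s'" "z = \<sigma> t" by blast
    obtain u where u: "u \<in> X" "twist X (\<sigma> t) = \<sigma> u" "twist X (\<sigma> u) = \<sigma> t" using twist_sigma[OF X t(1)] by blast
    have "u \<noteq> s"
    proof
      assume "u = s"
      then have "\<sigma> t = \<sigma> s'" using u(3) s(3) by simp
      then show False using sigma_inj[of t s'] t(1,2) s(2) X by blast
    qed
    moreover have "\<Delta> X * \<sigma> t * inverse (\<Delta> X) = \<sigma> u"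
      using twist_eq[of "\<sigma> u" X] u(3) eq_mult_iff_right[of "\<Delta> X * \<sigma> t" "\<sigma> u" "\<Delta> X"] by simp
    ultimately show "z \<in> {x. \<Delta> X * x * inverse (\<Delta> X) \<in> A (X - {s})}" using u(1) t(3) A_sigma by simp
  qed
  then show ?thesis using A_least[OF subgp_conj[OF subgp_A]] y by blast
qed

text \<open>Split off the part \<open>y\<close> of \<open>x\<close> in the parabolic subgroup of \<open>J = X - {s}\<close>; it commutes with \<open>\<delta>\<^sub>J\<close>. What
  remains can only start with \<open>s\<close>, and then by \<open>ldvd_Delta_power\<close> it starts with the ribbon
  \<open>\<Delta>\<^sub>J\<inverse> \<Delta>\<close>. The ribbon conjugates \<open>\<delta>\<^sub>J\<close> to the \<open>\<delta>\<close> of another maximal subset, namely the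
  twist of \<open>J\<close>, and is itself of the required form; so the statement with a varying left subset
  is suited for induction on the length.\<close>

lemma Delta_power_conj_positive:
  assumes X: "X \<subseteq> S" and n: "0 < n"
  shows "x \<in> P X \<Longrightarrow> s \<in> X \<Longrightarrow> \<delta> (X - {s}) ^ n * x = x * \<delta> (X - {s2}) ^ n \<Longrightarrow>
    \<exists>y\<in>A (X - {s}). \<exists>i. x = y * \<Delta> X powi i"
proof (induction "nat (len x)" arbitrary: x s rule: less_induct)
  case less
  let ?J = "X - {s}" and ?d2 = "\<delta> (X - {s2}) ^ n"
  let ?r = "ribbon ?J s"
  have J: "?J \<subseteq> S" and J2: "X - {s2} \<subseteq> S" and XJ: "insert s ?J = X" and sJ: "s \<notin> ?J"
    using X less.prems(2) by auto
  have xS: "x \<in> P S" using less.prems(1) P_mono[OF X] by blast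
  obtain y x' where y: "y \<in> P ?J" "x' \<in> P S" "x = y * x'" "\<forall>u\<in>?J. \<not> \<sigma> u \<preceq> x'"
    using extract_parabolic[OF xS J] by blast
  have yS: "y \<in> P S" using y(1) P_mono[OF J] by blast
  have x'X: "x' \<in> P X" using P_support(2)[OF yS y(2) _ X] y(3) less.prems(1) by simp
  have "commute y (\<delta> ?J ^ n)" using commute_power delta_central[OF J] P_in_A y(1) by blast
  then have "y * (\<delta> ?J ^ n * x') = y * (x' * ?d2)"
    using less.prems(3) unfolding y(3) commute_def by (metis mult.assoc)
  then have eq: "\<delta> ?J ^ n * x' = x' * ?d2" by simp
  show ?case
  proof (rule P_cases[OF x'X])
    assume "x' = 1"
    then have "x = y * \<Delta> X powi 0" using y(3) by simp
    then show ?thesis using y(1) P_in_A by blast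
  next
    fix v w assume v: "v \<in> X" "w \<in> P X" "x' = \<sigma> v * w"
    have "v = s"
    proof (rule ccontr)
      assume "v \<noteq> s"
      moreover have "\<sigma> v \<preceq> x'" unfolding v(3) using ldvd_mult[OF P_mono[OF X v(2)]] .
      ultimately show False using y(4) v(1) by blast
    qed
    have "?d2 \<in> P S" using P_power[OF delta_in_P[OF J2]] P_mono[OF J2] by blast
    then have "\<sigma> s \<preceq> x' * ?d2"
      using v \<open>v = s\<close> P_mono[OF X] ldvd_mult_right by (metis ldvd_mult)
    then have dvd: "\<sigma> s \<preceq> \<Delta> ?J ^ (2 * n) * x'" unfolding delta_power[symmetric] eq .
    have XJS: "insert s ?J \<subseteq> S" unfolding XJ by (rule X)
    have "?r \<preceq> x'" by (rule ldvd_Delta_power[OF XJS sJ y(2) _ dvd]) (use n in simp)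
    then obtain x'' where x'': "x'' \<in> P S" "x' = ?r * x''" by (elim ldvdE)
    have rX: "?r \<in> P X" using ribbon_in_P[OF XJS] unfolding XJ .
    have x''X: "x'' \<in> P X" using P_support(2)[of ?r x'' X] rX P_mono[OF X] x'' x'X X by simp
    obtain s' where s': "s' \<in> X" "twist X (\<sigma> s) = \<sigma> s'" "twist X (\<sigma> s') = \<sigma> s"
      using twist_sigma[OF X less.prems(2)] by blast
    have r: "?r = inverse (\<Delta> ?J) * \<Delta> X" unfolding ribbon_def XJ ..
    \<comment> \<open>move the power of \<open>\<delta>\<^sub>J\<close> past the ribbon, where it becomes that of the twisted subset\<close>
    have "commute (\<delta> ?J ^ n) (inverse (\<Delta> ?J))"
      unfolding delta_power by (intro commute_left(3) commute_inverse commute_refl)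
    then have "\<delta> ?J ^ n * ?r = inverse (\<Delta> ?J) * (\<Delta> ?J ^ (2 * n) * \<Delta> X)"
      unfolding r commute_def delta_power by (simp only: mult.assoc[symmetric])
    also have "\<dots> = ?r * twist X (\<Delta> ?J ^ (2 * n))" unfolding twist_eq[of "\<Delta> ?J ^ (2 * n)" X] r by (simp add: mult.assoc)
    also have "twist X (\<Delta> ?J ^ (2 * n)) = \<delta> (X - {s'}) ^ n"
      unfolding twist_power twist_Delta[OF X less.prems(2) s'] delta_power ..
    finally have "?r * (\<delta> (X - {s'}) ^ n * x'') = ?r * (x'' * ?d2)"
      using eq unfolding x''(2) by (simp add: mult.assoc[symmetric])
    then have eq'': "\<delta> (X - {s'}) ^ n * x'' = x'' * ?d2" by simp
    have "?r \<noteq> 1" by (rule ribbon_starts(2)[OF XJS sJ])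
    then have "0 < len ?r" using len_P_pos rX P_mono[OF X] by blast
    moreover have "len x = len y + (len ?r + len x'')"
      unfolding y(3) x''(2) using yS rX x''(1) P_mono[OF X] P_in_A A_mult by (simp add: len_mult_A)
    ultimately have "nat (len x'') < nat (len x)" using len_P[OF yS] len_P[OF x''(1)] by simp
    then obtain y'' i where y'': "y'' \<in> A (X - {s'})" "x'' = y'' * \<Delta> X powi i"
      using less.hyps[OF _ x''X s'(1) eq''] by blast
    let ?c = "\<Delta> X * y'' * inverse (\<Delta> X)"
    have "?c \<in> A ?J" using Delta_powi_conj_A[OF X less.prems(2) s'(1,2) y''(1)] .
    then have "y * inverse (\<Delta> ?J) * ?c \<in> A ?J"
      using A_mult A_inverse P_in_A[OF y(1)] Delta_in_A[OF J] by blast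
    moreover have "x = (y * inverse (\<Delta> ?J) * ?c) * \<Delta> X powi (1 + i)"
      unfolding y(3) x''(2) y''(2) r powi_add by (simp add: mult.assoc)
    ultimately show ?thesis by blast
  qed
qed

text \<open>Multiplying \<open>g\<close> with a power of the central element \<open>\<delta> X\<close> makes it positive.\<close>

lemma centralizer_Delta_power:
  assumes X: "X \<subseteq> S" and s: "s \<in> X" and n: "0 < n" and g: "g \<in> A X" "commute g (\<delta> (X - {s}) ^ n)"
  shows "\<exists>y\<in>A (X - {s}). \<exists>i. g = y * \<Delta> X powi i"
proof -
  obtain k where k: "g * \<delta> X ^ k \<in> P X" using delta_numerator[OF X g(1)] by blast
  let ?x = "g * \<delta> X ^ k" and ?d = "\<delta> (X - {s}) ^ n"
  have J: "X - {s} \<subseteq> S" "A (X - {s}) \<subseteq> A X" using X A_mono[of "X - {s}" X] by auto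
  have "?d \<in> A X" using A_power delta_in_A[OF J(1)] J(2) by blast
  then have "commute (\<delta> X ^ k) ?d" using delta_central[OF X] commute_sym commute_left(3) by blast
  then have "commute ?x ?d" using g(2) commute_left by blast
  then have "?d * ?x = ?x * ?d" unfolding commute_def by simp
  then obtain y i where y: "y \<in> A (X - {s})" "?x = y * \<Delta> X powi i"
    using Delta_power_conj_positive[OF X n k s] by blast
  have "\<delta> X ^ k = \<Delta> X powi int (2 * k)" unfolding powi_nat by (rule delta_power)
  then have "g * \<Delta> X powi int (2 * k) = (y * \<Delta> X powi (i - int (2 * k))) * \<Delta> X powi int (2 * k)"
    using y(2) powi_add[of "\<Delta> X" "i - int (2 * k)" "int (2 * k)"] by (simp add: mult.assoc)
  then have "g = y * \<Delta> X powi (i - int (2 * k))" by simp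
  then show ?thesis using y(1) by blast
qed

subsection \<open>Irreducible parabolic subgroups\<close>

definition irreducible :: "'a set \<Rightarrow> bool" where
  "irreducible X \<longleftrightarrow> (\<forall>Y. Y \<subseteq> X \<longrightarrow> Y \<noteq> {} \<longrightarrow> Y \<noteq> X \<longrightarrow> (\<exists>y\<in>Y. \<exists>t\<in>X - Y. M y t \<noteq> 2))"

lemma irreducibleE:
  assumes "irreducible X" "Y \<subseteq> X" "Y \<noteq> {}" "Y \<noteq> X"
  obtains y t where "y \<in> Y" "t \<in> X" "t \<notin> Y" "M y t \<noteq> 2"
  using assms unfolding irreducible_def by blast

lemma Delta_neq_1: "X \<subseteq> S \<Longrightarrow> X \<noteq> {} \<Longrightarrow> \<Delta> X \<noteq> 1"
proof
  assume X: "X \<subseteq> S" "X \<noteq> {}" "\<Delta> X = 1"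
  then obtain t where t: "t \<in> X" by blast
  have tS: "t \<in> S" using t X(1) by blast
  have "\<sigma> t \<preceq> 1" using sigma_ldvd_Delta[OF X(1) t] X(3) by simp
  then have "\<sigma> t = 1" by (rule ldvd_one[OF P_gen[OF tS]])
  then show False using len_gen[OF tS] by simp
qed

lemma len_Delta_pos: "X \<subseteq> S \<Longrightarrow> X \<noteq> {} \<Longrightarrow> 0 < len (\<Delta> X)"
  by (rule len_P_pos[OF P_mono[OF _ Delta_in_P] Delta_neq_1])

text \<open>If a quasi-central positive element is divisible by one generator, then by irreducibility it is
  divisible by all of them, so a factor \<open>\<Delta>\<close> splits off.\<close>

lemma quasi_central_positive:
  assumes X: "X \<subseteq> S" "irreducible X"
  shows "x \<in> P X \<Longrightarrow> (\<And>t. t \<in> X \<Longrightarrow> \<exists>t'\<in>X. \<sigma> t * x = x * \<sigma> t') \<Longrightarrow> \<exists>k::nat. x = \<Delta> X ^ k"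
proof (induction "nat (len x)" arbitrary: x rule: less_induct)
  case less
  show ?case
  proof (rule P_cases[OF less.prems(1)])
    assume "x = 1"
    then have "x = \<Delta> X ^ 0" by simp
    then show ?thesis by blast
  next
    fix s q assume s: "s \<in> X" "q \<in> P X" "x = \<sigma> s * q"
    have xS: "x \<in> P S" using less.prems(1) P_mono[OF X(1)] by blast
    define Y where "Y = {u \<in> X. \<sigma> u \<preceq> x}"
    have sY: "s \<in> Y" using s P_mono[OF X(1)] unfolding Y_def by simp
    have "Y = X"
    proof (rule ccontr)
      assume "Y \<noteq> X"
      then obtain y t where yt: "y \<in> Y" "t \<in> X" "t \<notin> Y" "M y t \<noteq> 2"
        using irreducibleE[OF X(2), of Y] sY unfolding Y_def by blast
      have yX: "y \<in> X" "\<sigma> y \<preceq> x" and tS: "t \<in> S" "y \<in> S" "t \<noteq> y" using yt X(1) unfolding Y_def by auto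
      obtain t' where t': "t' \<in> X" "\<sigma> t * x = x * \<sigma> t'" using less.prems(2)[OF yt(2)] by blast
      have "\<sigma> y \<preceq> \<sigma> t * x" unfolding t'(2) using ldvd_mult_right[OF yX(2)] P_gen t'(1) X(1) by blast
      moreover have "\<sigma> t \<preceq> \<sigma> t * x" "\<sigma> t * x \<in> P S" using xS P_mult P_gen tS by simp_all
      ultimately obtain k where k: "M t y = enat (Suc k)" "0 < k" "val (alt t y (Suc k)) \<preceq> \<sigma> t * x"
        using dihedral[OF tS] by blast
      \<comment> \<open>as \<open>y\<close> and \<open>t\<close> do not commute, \<open>x\<close> starts with \<open>y t\<close>; moving \<open>y\<close> through \<open>x\<close> then shows that \<open>t\<close> divides \<open>x\<close>\<close>
      have "k \<noteq> 1" using k(1) yt(4) M_sym[of y t] by (auto simp: numeral_2_eq_2 numeral_eq_enat)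
      then obtain j where j: "k = Suc (Suc j)" using k(2) by (metis One_nat_def Suc_diff_1 not0_implies_Suc)
      have "\<sigma> y * (\<sigma> t * val (alt y t j)) \<preceq> x" using k(3) unfolding j by simp
      then obtain z where z: "z \<in> P S" "x = \<sigma> y * (\<sigma> t * val (alt y t j)) * z" by (elim ldvdE)
      let ?w = "val (alt y t j) * z"
      have x: "x = \<sigma> y * (\<sigma> t * ?w)" using z(2) by (simp add: mult.assoc)
      obtain y' where y': "y' \<in> X" "\<sigma> y * x = x * \<sigma> y'" using less.prems(2)[OF yX(1)] by blast
      have "\<sigma> y * x = \<sigma> y * (\<sigma> t * (?w * \<sigma> y'))" using y'(2) x by (simp add: mult.assoc)
      then have "x = \<sigma> t * (?w * \<sigma> y')" by simp
      moreover have "?w * \<sigma> y' \<in> P S"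
        using P_mult[OF P_mult[OF alt_in_P[OF tS(2,1)] z(1)]] P_gen y'(1) X(1) by blast
      ultimately have "\<sigma> t \<preceq> x" using ldvd_mult by metis
      then show False using yt unfolding Y_def by blast
    qed
    then have "\<Delta> X \<preceq> x" using Delta_least[OF X(1) xS] unfolding Y_def by blast
    then obtain z where z: "z \<in> P S" "x = \<Delta> X * z" by (elim ldvdE)
    have DS: "\<Delta> X \<in> P S" using Delta_in_P[OF X(1)] P_mono[OF X(1)] by blast
    have zX: "z \<in> P X" using P_support(2)[OF DS z(1) _ X(1)] z(2) less.prems(1) by simp
    have "\<exists>t'\<in>X. \<sigma> t * z = z * \<sigma> t'" if tX: "t \<in> X" for t
    proof -
      obtain u where u: "u \<in> X" "\<sigma> u * \<Delta> X = \<Delta> X * \<sigma> t" using Delta_twist[OF X(1) tX] by blast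
      obtain t' where t': "t' \<in> X" "\<sigma> u * x = x * \<sigma> t'" using less.prems(2)[OF u(1)] by blast
      have "\<Delta> X * (\<sigma> t * z) = \<Delta> X * (z * \<sigma> t')" using u(2) t'(2) unfolding z(2) by (metis mult.assoc)
      then show ?thesis using t'(1) by auto
    qed
    moreover have "nat (len z) < nat (len x)"
    proof -
      have "0 < len (\<Delta> X)" using len_Delta_pos[OF X(1)] s(1) by blast
      then show ?thesis
        using len_P[OF z(1)] len_mult_A[OF P_in_A[OF DS] P_in_A[OF z(1)]] z(2) by simp
    qed
    ultimately obtain k where "z = \<Delta> X ^ k" using less.hyps zX by blast
    then have "x = \<Delta> X ^ Suc k" using z(2) by simp
    then show ?thesis by blast
  qed
qed

text \<open>Multiply with a power of \<open>\<delta> X\<close> to make the element positive.\<close>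

lemma quasi_central:
  assumes X: "X \<subseteq> S" "irreducible X" and x: "x \<in> A X" "\<And>t. t \<in> X \<Longrightarrow> \<exists>t'\<in>X. \<sigma> t * x = x * \<sigma> t'"
  shows "\<exists>k. x = \<Delta> X powi k"
proof -
  obtain n where n: "x * \<delta> X ^ n \<in> P X" using delta_numerator[OF X(1) x(1)] by blast
  have "\<exists>t'\<in>X. \<sigma> t * (x * \<delta> X ^ n) = (x * \<delta> X ^ n) * \<sigma> t'" if tX: "t \<in> X" for t
  proof -
    obtain t' where t': "t' \<in> X" "\<sigma> t * x = x * \<sigma> t'" using x(2)[OF tX] by blast
    have "commute (\<sigma> t') (\<delta> X ^ n)" using commute_power[OF delta_central[OF X(1) A_sigma(1)[OF t'(1)]]] .
    then have "\<sigma> t * (x * \<delta> X ^ n) = (x * \<delta> X ^ n) * \<sigma> t'"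
      using t'(2) unfolding commute_def by (metis mult.assoc)
    then show ?thesis using t'(1) by blast
  qed
  then obtain k where "x * \<delta> X ^ n = \<Delta> X ^ k" using quasi_central_positive[OF X n] by blast
  then have "x = \<Delta> X powi int k * inverse (\<Delta> X powi int (2 * n))"
    unfolding powi_nat delta_power using eq_mult_iff_right[of "\<Delta> X ^ k" x "\<Delta> X ^ (2 * n)"] by simp
  then show ?thesis unfolding powi_neg[symmetric] powi_add[symmetric] by blast
qed

subsection \<open>Conjugating one parabolic subgroup into another\<close>

text \<open>If \<open>\<Delta>\<close> divided \<open>b \<sigma>\<^sub>t\<^sup>n d\<close>, then the ribbon would divide \<open>\<sigma>\<^sub>t\<^sup>n d\<close>. The ribbon starts with \<open>t\<close> and
  then, as the diagram is irreducible, with a letter that does not commute with \<open>t\<close>; but the second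
  letter of \<open>\<sigma>\<^sub>t\<^sup>n d\<close> is again \<open>t\<close>.\<close>

lemma Delta_not_ldvd:
  assumes X: "X \<subseteq> S" "irreducible X" and t: "t \<in> X" "X \<noteq> {t}" and n: "2 \<le> n"
    and bd: "b \<in> P (X - {t})" "d \<in> P (X - {t})"
  shows "\<not> \<Delta> X \<preceq> b * (\<sigma> t ^ n * d)"
proof
  let ?J = "X - {t}"
  let ?r = "ribbon ?J t"
  assume dvd: "\<Delta> X \<preceq> b * (\<sigma> t ^ n * d)"
  have J: "?J \<subseteq> S" and XJ: "insert t ?J = X" and tJ: "t \<notin> ?J" and tS: "t \<in> S" using X t by auto
  have dS: "d \<in> P S" and zS: "\<sigma> t ^ n * d \<in> P S" using bd(2) P_mono[OF J] P_mult P_power P_gen[OF tS] by blast+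
  obtain m where "\<forall>k\<ge>m. inverse b * \<delta> ?J ^ k \<in> P ?J"
    using delta_numerator[OF J A_inverse[OF P_in_A[OF bd(1)]]] by blast
  moreover have "m \<le> Suc m" by simp
  ultimately have c: "inverse b * \<delta> ?J ^ Suc m \<in> P ?J" by blast
  let ?c = "inverse b * \<delta> ?J ^ Suc m"
  have "commute b (\<delta> ?J ^ Suc m)" using commute_power delta_central[OF J P_in_A[OF bd(1)]] by blast
  then have cb: "?c * b = \<delta> ?J ^ Suc m" unfolding commute_def by (metis inv_cancel_left mult.assoc)
  obtain w where w: "w \<in> P S" "b * (\<sigma> t ^ n * d) = \<Delta> X * w" using dvd by (elim ldvdE)
  have "?c \<in> P X" using c P_mono[of ?J X] by blast
  then have tc: "twist X ?c \<in> P S" using twist_P[OF X(1)] P_mono[OF X(1)] by blast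
  have "\<delta> ?J ^ Suc m * (\<sigma> t ^ n * d) = ?c * (\<Delta> X * w)" using w(2) cb by (metis mult.assoc)
  also have "\<dots> = \<Delta> X * (twist X ?c * w)" using twist_eq[of ?c X] by (metis mult.assoc)
  finally have "\<Delta> X \<preceq> \<delta> ?J ^ Suc m * (\<sigma> t ^ n * d)" using P_mult[OF tc w(1)] by simp
  then have tdvd: "\<sigma> t \<preceq> \<Delta> ?J ^ (2 * Suc m) * (\<sigma> t ^ n * d)"
    using ldvd_trans[OF sigma_ldvd_Delta[OF X(1) t(1)]] unfolding delta_power by blast
  have XJS: "insert t ?J \<subseteq> S" unfolding XJ by (rule X(1))
  then have "?r \<preceq> \<sigma> t ^ n * d" by (rule ldvd_Delta_power[OF _ tJ zS _ tdvd]) simp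
  then obtain z' where z': "z' \<in> P S" "\<sigma> t ^ n * d = ?r * z'" by (elim ldvdE)
  have rX: "?r \<in> P X" using ribbon_in_P[OF XJS] unfolding XJ .
  have "\<sigma> t \<preceq> ?r" by (rule ribbon_starts(1)[OF XJS tJ])
  then obtain r1 where r1: "r1 \<in> P S" "?r = \<sigma> t * r1" by (elim ldvdE)
  have r1X: "r1 \<in> P X" using P_support(2)[OF P_gen[OF tS] r1(1) _ X(1)] r1(2) rX by simp
  have DX: "\<Delta> X = \<Delta> ?J * ?r" using Delta_insert[of t ?J] XJ by simp
  have DJ: "\<Delta> ?J \<in> P S" using Delta_in_P[OF J] P_mono[OF J] by blast
  show False
  proof (rule P_cases[OF r1X])
    \<comment> \<open>the ribbon is more than the letter \<open>t\<close>, since a generator \<open>u\<close> of \<open>J\<close> does not commute with \<open>t\<close>\<close>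
    assume "r1 = 1"
    then have DX: "\<Delta> X = \<Delta> ?J * \<sigma> t" using DX r1(2) by simp
    obtain u where u: "u \<in> X" "u \<noteq> t" "M t u \<noteq> 2" using irreducibleE[OF X(2), of "{t}"] t by blast
    have uJ: "u \<in> ?J" and uS: "u \<in> S" "t \<noteq> u" using u X by auto
    obtain j where j: "j \<in> ?J" "\<sigma> j * \<Delta> ?J = \<Delta> ?J * \<sigma> u" using Delta_twist[OF J uJ] by blast
    obtain v where v: "v \<in> X" "\<sigma> j * \<Delta> X = \<Delta> X * \<sigma> v" using Delta_twist[OF X(1), of j] j(1) by blast
    have "\<Delta> ?J * (\<sigma> u * \<sigma> t) = \<Delta> ?J * (\<sigma> t * \<sigma> v)" using v(2) j(2) unfolding DX by (metis mult.assoc)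
    then have ut: "\<sigma> u * \<sigma> t = \<sigma> t * \<sigma> v" by simp
    have vS: "v \<in> S" using v X by blast
    have "\<sigma> t \<preceq> \<sigma> u * \<sigma> t" unfolding ut using P_gen[OF vS] by simp
    moreover have "\<sigma> u \<preceq> \<sigma> u * \<sigma> t" "\<sigma> u * \<sigma> t \<in> P S" using P_gen[OF tS] P_gen[OF uS(1)] P_mult by simp_all
    ultimately obtain k where k: "M t u = enat (Suc k)" "0 < k" "val (alt t u (Suc k)) \<preceq> \<sigma> u * \<sigma> t"
      using dihedral[OF tS uS] by blast
    obtain q where q: "q \<in> P S" "\<sigma> u * \<sigma> t = val (alt t u (Suc k)) * q" using k(3) by (elim ldvdE)
    have "val (alt t u (Suc k)) \<in> P S" using alt_in_P[OF tS uS(1)] .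
    then have "len (\<sigma> u * \<sigma> t) = len (val (alt t u (Suc k))) + len q"
      unfolding q(2) using len_mult_A P_in_A q(1) by blast
    moreover have "len (val (alt t u (Suc k))) = int (Suc k)"
    proof -
      have "set (alt t u (Suc k)) \<subseteq> S" using set_alt_subset[of t u "Suc k"] tS uS(1) by blast
      from len_val[OF this] show ?thesis unfolding length_alt .
    qed
    moreover have "len (\<sigma> u * \<sigma> t) = 2" using len_mult_A A_sigma tS uS(1) len_gen by simp
    ultimately have "k = 1" using len_P[OF q(1)] k(2) by simp
    then show False using k(1) u(3) by (simp add: numeral_2_eq_2 numeral_eq_enat)
  next
    fix v r2 assume v: "v \<in> X" "r2 \<in> P X" "r1 = \<sigma> v * r2"
    have r2S: "r2 \<in> P S" and vS: "v \<in> S" using v P_mono[OF X(1)] X by blast+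
    obtain n' where n': "n = Suc n'" "0 < n'" using n by (cases n) auto
    have "\<sigma> t * (\<sigma> t ^ n' * d) = \<sigma> t * (r1 * z')" using z'(2) r1(2) n' by (simp add: mult.assoc)
    then have "\<sigma> t ^ n' * d = r1 * z'" by simp
    moreover have "\<sigma> v \<preceq> r1 * z'" unfolding v(3) using P_mult[OF r2S z'(1)] by (simp add: mult.assoc)
    ultimately have dv: "\<sigma> v \<preceq> \<sigma> t ^ n' * d" by simp
    show False
    proof (cases "v = t")
      case True
      then have "\<Delta> X = \<Delta> ?J * (\<sigma> t * (\<sigma> t * r2))" using DX r1(2) v(3) by simp
      then show False using Delta_squarefree[OF X(1) DJ r2S tS] by blast
    next
      case False
      then have vJ: "v \<in> ?J" using v(1) by blast
      then have "M t v = 2" using ldvd_sigma_power_mult[OF J tS tJ vJ bd(2) dv n'(2)] by blast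
      then have "commute (\<sigma> t) (\<sigma> v)" using sigma_commute tS vS by blast
      then have "?r = \<sigma> v * (\<sigma> t * r2)" using r1(2) v(3) unfolding commute_def by (metis mult.assoc)
      then have "v = t" using ribbon_first[OF XJS tJ, of v] v(1) XJ P_mult[OF P_gen[OF tS] r2S] by blast
      then show False using False by blast
    qed
  qed
qed

text \<open>Write the equation with positive elements as \<open>b \<sigma>\<^sub>t\<^sup>n d = a \<sigma>\<^sub>t\<^sup>n c \<delta>\<^sup>q\<close>. Since \<open>\<Delta>\<close> does not divide the left side,
  \<open>q = 0\<close>. The letters of \<open>d\<close> and \<open>c\<close> that commute with \<open>t\<close> can be moved across \<open>\<sigma>\<^sub>t\<^sup>n\<close>; thereafter the two
  sides are decomposed along the parabolic submonoid of \<open>Y\<close>, and this decomposition is unique.\<close>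

lemma conj_into_parabolic_nat:
  assumes X: "X \<subseteq> S" "irreducible X" and Y: "Y \<subseteq> X" and t: "t \<in> X" "t \<notin> Y" and n: "2 \<le> n"
    and y: "y \<in> A Y" "z \<in> A Y" "inverse (\<sigma> t ^ n) * y * \<sigma> t ^ n = z * \<delta> X ^ q"
  shows "y \<in> A {u \<in> Y. M t u = 2}"
proof (cases "Y = {}")
  case False
  let ?Y' = "{u \<in> Y. M t u = 2}" and ?J = "X - {t}"
  have YS: "Y \<subseteq> S" and Y'S: "?Y' \<subseteq> S" and tS: "t \<in> S" and YJ: "Y \<subseteq> ?J" and Xt: "X \<noteq> {t}"
    using X Y t False by auto
  have YY: "A Y \<subseteq> A X" "\<And>p. p \<in> P Y \<Longrightarrow> p \<in> P S" "\<And>p. p \<in> P ?Y' \<Longrightarrow> p \<in> P S" "\<And>p. p \<in> P ?Y' \<Longrightarrow> p \<in> P Y"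
    using A_mono[OF Y] P_mono[OF YS] P_mono[OF Y'S] P_mono[of ?Y' Y] by blast+
  have tP: "\<sigma> t ^ k \<in> P S" for k using P_power P_gen[OF tS] by blast
  \<comment> \<open>write \<open>y = a\<inverse> b\<close> and \<open>z = c d\<inverse>\<close> with positive \<open>a, b, c, d\<close>\<close>
  obtain i j where ij: "y * \<delta> Y ^ i \<in> P Y" "z * \<delta> Y ^ j \<in> P Y"
    using delta_numerator[OF YS] y(1,2) by blast
  define a b c d where "a = \<delta> Y ^ i" and "b = y * \<delta> Y ^ i" and "c = z * \<delta> Y ^ j" and "d = \<delta> Y ^ j"
  have ad: "a \<in> P Y" "d \<in> P Y" unfolding a_def d_def using P_power[OF delta_in_P[OF YS]] by blast+
  have bc: "b \<in> P Y" "c \<in> P Y" using ij unfolding b_def c_def .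
  have "commute y a" unfolding a_def using commute_power delta_central[OF YS y(1)] by blast
  then have b: "b = a * y" unfolding b_def a_def commute_def .
  have "commute d (\<delta> X ^ q)"
    using commute_power delta_central[OF X(1)] P_in_A[OF ad(2)] YY(1) by blast
  then have "z * \<delta> X ^ q * d = c * \<delta> X ^ q" unfolding c_def d_def commute_def by (simp add: mult.assoc)
  moreover have "y * \<sigma> t ^ n = \<sigma> t ^ n * (z * \<delta> X ^ q)" using y(3) by (simp add: eq_mult_iff_left mult.assoc)
  ultimately have eq: "b * (\<sigma> t ^ n * d) = a * (\<sigma> t ^ n * (c * \<delta> X ^ q))" unfolding b by (metis mult.assoc)
  \<comment> \<open>move the letters commuting with \<open>t\<close> to the left of \<open>\<sigma>\<^sub>t\<^sup>n\<close>\<close>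
  have part: "\<exists>f\<in>P ?Y'. \<exists>e\<in>P Y. \<sigma> t ^ n * g = f * (\<sigma> t ^ n * e) \<and> (\<forall>u\<in>Y. \<not> \<sigma> u \<preceq> \<sigma> t ^ n * e)"
    if g: "g \<in> P Y" for g
  proof -
    obtain f e where f: "f \<in> P ?Y'" "e \<in> P S" "g = f * e" "\<forall>u\<in>?Y'. \<not> \<sigma> u \<preceq> e"
      using extract_parabolic[OF YY(2)[OF g] Y'S] by blast
    have e: "e \<in> P Y" using P_support(2)[OF YY(3)[OF f(1)] f(2) _ YS] g f(3) by simp
    have "\<sigma> ` ?Y' \<subseteq> {x. commute x (\<sigma> t ^ n)}"
      using sigma_commute[OF tS] YS commute_power commute_sym by blast
    then have "commute f (\<sigma> t ^ n)" using A_least[OF subgp_centralizer] P_in_A[OF f(1)] by blast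
    then have "\<sigma> t ^ n * g = f * (\<sigma> t ^ n * e)" unfolding f(3) commute_def by (metis mult.assoc)
    moreover have "\<not> \<sigma> u \<preceq> \<sigma> t ^ n * e" if "u \<in> Y" for u
      using ldvd_sigma_power_mult[OF YS tS t(2) that e] f(4) that n by fastforce
    ultimately show ?thesis using f(1) e by blast
  qed
  obtain f d1 where f: "f \<in> P ?Y'" "d1 \<in> P Y" "\<sigma> t ^ n * d = f * (\<sigma> t ^ n * d1)"
      "\<forall>u\<in>Y. \<not> \<sigma> u \<preceq> \<sigma> t ^ n * d1" using part[OF ad(2)] by blast
  obtain e c1 where e: "e \<in> P ?Y'" "c1 \<in> P Y" "\<sigma> t ^ n * c = e * (\<sigma> t ^ n * c1)"
      "\<forall>u\<in>Y. \<not> \<sigma> u \<preceq> \<sigma> t ^ n * c1" using part[OF bc(2)] by blast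
  have bf: "b * f \<in> P Y" "a * e \<in> P Y" using bc ad P_mult YY(4) f(1) e(1) by blast+
  have eq': "(b * f) * (\<sigma> t ^ n * d1) = (a * e) * (\<sigma> t ^ n * c1) * \<delta> X ^ q"
    using eq f(3) e(3) by (metis mult.assoc)
  \<comment> \<open>otherwise \<open>\<Delta>\<close> divides the right hand side, contrary to \<open>Delta_not_ldvd\<close>\<close>
  have "q = 0"
  proof (rule ccontr)
    assume "q \<noteq> 0"
    then obtain q' where q': "q = Suc q'" by (cases q) auto
    let ?w = "(a * e) * (\<sigma> t ^ n * c1)"
    have wS: "?w \<in> P S" by (rule P_mult[OF YY(2)[OF bf(2)] P_mult[OF tP YY(2)[OF e(2)]]])
    have "?w \<in> A X"
      by (rule A_mult[OF subsetD[OF YY(1) P_in_A[OF bf(2)]]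
            A_mult[OF A_power[OF A_sigma(1)[OF t(1)]] subsetD[OF YY(1) P_in_A[OF e(2)]]]])
    then have "commute ?w (\<delta> X ^ q)" using commute_power delta_central[OF X(1)] by blast
    then have "?w * \<delta> X ^ q = \<Delta> X * (\<Delta> X * (\<delta> X ^ q' * ?w))"
      unfolding commute_def q' by (simp add: \<delta>_def mult.assoc)
    moreover have "\<Delta> X * (\<delta> X ^ q' * ?w) \<in> P S"
      by (rule P_mult[OF P_mono[OF X(1) Delta_in_P[OF X(1)]]
            P_mult[OF P_power[OF P_mono[OF X(1) delta_in_P[OF X(1)]]] wS]])
    ultimately have "\<Delta> X \<preceq> (b * f) * (\<sigma> t ^ n * d1)" unfolding eq' by simp
    then show False
      using Delta_not_ldvd[OF X t(1) Xt n] bf(1) f(2) P_mono[OF YJ] by blast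
  qed
  then have "(b * f) * (\<sigma> t ^ n * d1) = (a * e) * (\<sigma> t ^ n * c1)" using eq' by simp
  then have "b * f = a * e"
    using parabolic_part_unique[OF YS bf _ _ _ f(4) e(4)] tP P_mult YY(2) f(2) e(2) by blast
  then have "y * f = e" unfolding b by (simp add: mult.assoc)
  then have "y = e * inverse f" using eq_mult_iff_right[of e y f] by simp
  then show ?thesis using A_mult A_inverse P_in_A f(1) e(1) by blast
qed (use y(1) A_mono[of "{}"] in auto)

text \<open>For negative exponents \<open>k\<close> pass to the inverses of \<open>y\<close> and \<open>z\<close>.\<close>

lemma conj_into_parabolic:
  assumes X: "X \<subseteq> S" "irreducible X" and Y: "Y \<subseteq> X" and t: "t \<in> X" "t \<notin> Y" and n: "2 \<le> n"
    and y: "y \<in> A Y" "z \<in> A Y" "inverse (\<sigma> t ^ n) * y * \<sigma> t ^ n = z * \<delta> X powi k"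
  shows "y \<in> A {u \<in> Y. M t u = 2}"
proof (cases "k \<ge> 0")
  case True
  then have "\<delta> X powi k = \<delta> X ^ nat k" by (simp add: power_int_def)
  then show ?thesis using conj_into_parabolic_nat[OF X Y t n y(1,2)] y(3) by simp
next
  case False
  have "commute (inverse z) (\<delta> X powi (- k))"
    using commute_powi delta_central[OF X(1)] A_inverse[OF y(2)] A_mono[OF Y] by blast
  then have "inverse (z * \<delta> X powi k) = inverse z * \<delta> X powi (- k)"
    unfolding inv_mult powi_neg commute_def by simp
  also have "\<delta> X powi (- k) = \<delta> X ^ nat (- k)" using False by (simp add: power_int_def)
  finally have "inverse (\<sigma> t ^ n) * inverse y * \<sigma> t ^ n = inverse z * \<delta> X ^ nat (- k)"
    unfolding y(3)[symmetric] by (simp add: inv_mult mult.assoc)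
  then have "inverse y \<in> A {u \<in> Y. M t u = 2}"
    using conj_into_parabolic_nat[OF X Y t n A_inverse[OF y(1)] A_inverse[OF y(2)]] by blast
  then show ?thesis using A_inverse by fastforce
qed

end

context artin_model
begin

subsection \<open>Indecomposability\<close>

text \<open>A maximal proper irreducible subset stays irreducible after adding an adjacent vertex, so this addition
  must give all of \<open>X\<close>.\<close>

lemma irreducible_corank_one:
  assumes X: "irreducible X" "finite X" "X \<noteq> {}" and not_single: "\<And>s. X \<noteq> {s}"
  shows "\<exists>J s. J \<noteq> {} \<and> irreducible J \<and> s \<notin> J \<and> X = insert s J"
proof -
  define C where "C = {J. J \<subset> X \<and> J \<noteq> {} \<and> irreducible J}"
  obtain x where "x \<in> X" using X(3) by blast
  then have "{x} \<in> C" unfolding C_def irreducible_def using not_single by blast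
  moreover have "\<forall>J. J \<in> C \<longrightarrow> card J < Suc (card X)"
    using X(2) unfolding C_def by (auto simp: less_Suc_eq_le intro: card_mono)
  ultimately obtain J where J: "J \<in> C" "\<And>J'. J' \<in> C \<Longrightarrow> card J' \<le> card J"
    using ex_has_greatest_nat[of "\<lambda>J. J \<in> C" "{x}" card "Suc (card X)"] by blast
  have JX: "J \<subset> X" "J \<noteq> {}" "irreducible J" using J(1) unfolding C_def by auto
  obtain y t where yt: "y \<in> J" "t \<in> X" "t \<notin> J" "M y t \<noteq> 2" using irreducibleE[OF X(1), of J] JX by blast
  have "\<exists>y\<in>Y. \<exists>u\<in>insert t J - Y. M y u \<noteq> 2" if Y: "Y \<subseteq> insert t J" "Y \<noteq> {}" "Y \<noteq> insert t J" for Y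
  proof (cases "t \<in> Y")
    case True
    show ?thesis
    proof (cases "Y \<inter> J = {}")
      case True
      then have "Y = {t}" using Y by blast
      then show ?thesis using yt M_sym[of y t] by force
    next
      case False
      then show ?thesis using irreducibleE[OF JX(3), of "Y \<inter> J"] Y \<open>t \<in> Y\<close> by (metis Diff_iff IntE IntI Int_lower2 Un_Int_eq(2) insert_iff subsetI subset_antisym insert_subset)
    qed
  next
    case False
    then have YJ: "Y \<subseteq> J" using Y(1) by blast
    show ?thesis
    proof (cases "Y = J")
      case True
      then show ?thesis using yt by blast
    next
      case False
      then show ?thesis using irreducibleE[OF JX(3) YJ Y(2)] by blast
    qed
  qed
  then have "irreducible (insert t J)" unfolding irreducible_def by blast
  moreover have "card (insert t J) > card J" using yt(3) finite_subset[of J X] JX(1) X(2) by simp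
  ultimately have "insert t J \<notin> C" using J(2) by fastforce
  then have "X = insert t J" using \<open>irreducible (insert t J)\<close> yt(2) JX(1) unfolding C_def by blast
  then show ?thesis using JX yt(3) by blast
qed

lemma commute_all:
  assumes "\<And>t. t \<in> X \<Longrightarrow> commute x (\<sigma> t)" "y \<in> A X"
  shows "commute x y"
proof -
  have "\<sigma> ` X \<subseteq> {y. commute y x}" using assms(1) commute_sym by blast
  then have "commute y x" using A_least[OF subgp_centralizer _ assms(2)] by blast
  then show ?thesis by (rule commute_sym)
qed

lemma A_singleton_abelian: "x \<in> A {s} \<Longrightarrow> y \<in> A {s} \<Longrightarrow> commute x y"
proof -
  assume xy: "x \<in> A {s}" "y \<in> A {s}"
  have "commute (\<sigma> s) x" by (rule commute_all[of "{s}"]) (use xy in auto)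
  then show ?thesis using commute_all[of "{s}" x y] commute_sym xy by blast
qed

text \<open>An element that commutes with powers of all generators is central: powers of a generator have
  the same centralizer as the generator.\<close>

lemma virtually_central:
  assumes X: "X \<subseteq> S" and x: "x \<in> A X" "\<And>t. t \<in> X \<Longrightarrow> \<exists>n>0. commute x (\<sigma> t ^ n)" and y: "y \<in> A X"
  shows "commute x y"
  using commute_all[OF _ y] commute_sigma_power x A_mono[OF X] X by blast

lemma central_powi:
  assumes X: "X \<subseteq> S" "irreducible X" and x: "x \<in> A X" "\<And>t. t \<in> X \<Longrightarrow> commute x (\<sigma> t)"
  shows "\<exists>k. x = \<Delta> X powi k"
  using quasi_central[OF X x(1)] x(2) unfolding commute_def by metis

text \<open>The centre consists of powers of \<open>\<Delta>\<close>, and \<open>\<Delta>\<close> has positive length.\<close>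

lemma central_len_zero:
  assumes X: "X \<subseteq> S" "irreducible X" and x: "x \<in> A X" "\<And>t. t \<in> X \<Longrightarrow> commute x (\<sigma> t)" "len x = 0"
  shows "x = 1"
proof (cases "X = {}")
  case True
  then show ?thesis using x(1) by (auto elim: A.cases)
next
  case False
  obtain k where k: "x = \<Delta> X powi k" using central_powi[OF X x(1,2)] by blast
  have "len (\<Delta> X powi k) = k * len (\<Delta> X)" using len_powi Delta_in_A[OF X(1)] A_mono[OF X(1)] by blast
  then have "k = 0" using len_Delta_pos[OF X(1) False] x(3) k by simp
  then show ?thesis using k by simp
qed

text \<open>A subgroup that is normalized by powers of all generators cannot lie in a proper parabolic
  subgroup, except for central elements: consider a smallest parabolic subgroup containing it and
  conjugate by a generator that is adjacent to that subgroup in the diagram.\<close>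

lemma normalized_in_parabolic_central:
  assumes X: "X \<subseteq> S" "irreducible X"
    and N: "\<And>x t. x \<in> N \<Longrightarrow> t \<in> X \<Longrightarrow> \<exists>n\<ge>2. inverse (\<sigma> t ^ n) * x * \<sigma> t ^ n \<in> N"
    and Y: "Y \<subset> X" "\<And>x. x \<in> N \<Longrightarrow> \<exists>y\<in>A Y. \<exists>i. x = y * \<delta> X powi i"
    and x: "x \<in> N"
  shows "\<exists>i. x = \<delta> X powi i"
proof -
  define C where "C = {Y. Y \<subset> X \<and> (\<forall>x\<in>N. \<exists>y\<in>A Y. \<exists>i. x = y * \<delta> X powi i)}"
  have "Y \<in> C" using Y unfolding C_def by blast
  then obtain Z where Z: "Z \<in> C" "\<And>Z'. Z' \<in> C \<Longrightarrow> card Z \<le> card Z'"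
    using ex_has_least_nat[of "\<lambda>Y. Y \<in> C" Y card] by blast
  have ZX: "Z \<subset> X" and ZN: "\<And>x. x \<in> N \<Longrightarrow> \<exists>y\<in>A Z. \<exists>i. x = y * \<delta> X powi i"
    using Z(1) unfolding C_def by auto
  have "Z = {}"
  proof (rule ccontr)
    assume "Z \<noteq> {}"
    then obtain u t where ut: "u \<in> Z" "t \<in> X" "t \<notin> Z" "M u t \<noteq> 2" using irreducibleE[OF X(2), of Z] ZX by blast
    let ?Z' = "{u \<in> Z. M t u = 2}"
    have "\<exists>y\<in>A ?Z'. \<exists>i. x = y * \<delta> X powi i" if x: "x \<in> N" for x
    proof -
      obtain y i where y: "y \<in> A Z" "x = y * \<delta> X powi i" using ZN[OF x] by blast
      obtain n where n: "n \<ge> 2" "inverse (\<sigma> t ^ n) * x * \<sigma> t ^ n \<in> N" using N[OF x ut(2)] by blast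
      obtain z j where z: "z \<in> A Z" "inverse (\<sigma> t ^ n) * x * \<sigma> t ^ n = z * \<delta> X powi j" using ZN[OF n(2)] by blast
      have "commute (\<sigma> t ^ n) (\<delta> X powi i)"
        using commute_powi[OF delta_central[OF X(1) A_power[OF A_sigma(1)[OF ut(2)]]]] .
      then have "inverse (\<sigma> t ^ n) * y * \<sigma> t ^ n * \<delta> X powi i = z * \<delta> X powi j"
        using z(2) unfolding y(2) commute_def by (simp add: mult.assoc)
      then have "inverse (\<sigma> t ^ n) * y * \<sigma> t ^ n = z * \<delta> X powi (j - i)"
        using powi_add[of "\<delta> X" "j - i" i] by (metis diff_add_cancel mult.assoc mult_cancel_right_iff)
      then have "y \<in> A ?Z'" using conj_into_parabolic[OF X _ ut(2,3) n(1) y(1) z(1)] ZX by blast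
      then show ?thesis using y(2) by blast
    qed
    then have "?Z' \<in> C" unfolding C_def using ZX by blast
    moreover have "card ?Z' < card Z"
    proof (rule psubset_card_mono)
      show "finite Z" by (rule finite_subset[OF _ finite_S]) (use ZX X(1) in blast)
      show "?Z' \<subset> Z" using ut M_sym[of u t] by auto
    qed
    ultimately show False using Z(2) by fastforce
  qed
  then obtain y i where "y \<in> A {}" "x = y * \<delta> X powi i" using ZN[OF x] by blast
  moreover from this have "y = 1" by (auto elim: A.cases)
  ultimately show ?thesis by auto
qed

lemma Delta_powi_conj_P:
  assumes X: "X \<subseteq> S" and v: "v \<in> P X"
  shows "\<Delta> X powi i * v * inverse (\<Delta> X powi i) \<in> P X"
proof -
  let ?D = "\<Delta> X powi i"
  obtain l where l: "v = val l" "set l \<subseteq> X" using v unfolding P_def by blast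
  have "?D * val l * inverse ?D \<in> P X" using l(2)
  proof (induction l)
    case (Cons a l)
    obtain b where b: "b \<in> X" "?D * \<sigma> a = \<sigma> b * ?D"
      using Delta_powi_sigma[OF X, of a i] Cons.prems by auto
    have "?D * val (a # l) * inverse ?D = (?D * \<sigma> a) * val l * inverse ?D" by (simp add: mult.assoc)
    also have "\<dots> = \<sigma> b * (?D * val l * inverse ?D)" unfolding b(2) by (simp add: mult.assoc)
    finally show ?case using P_mult[OF P_gen[OF b(1)]] Cons by simp
  qed simp
  then show ?thesis using l(1) by simp
qed

text \<open>Elements of \<open>K\<close> have the form \<open>y \<Delta>\<^sup>i\<close> with \<open>y\<close> in the parabolic subgroup of \<open>J = X - {s}\<close>. Those in
  which \<open>\<Delta>\<^sup>i\<close> may be taken to be a power of the central element \<open>\<delta>\<close> form a set \<open>K0\<close> that is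
  normalized by \<open>K\<close>, and hence by powers of all generators, as \<open>H\<close> commutes with \<open>K\<close>. So \<open>K0\<close> is central,
  and from this it follows that \<open>K\<close> is abelian. Being abelian and commuting with \<open>H\<close>, the elements of \<open>K\<close>
  commute with powers of all generators.\<close>

lemma parabolic_factor_central:
  assumes X: "X \<subseteq> S" "irreducible X" and s: "s \<in> X"
    and H: "subgp H" "H \<subseteq> A X" and K: "subgp K" "K \<subseteq> A X"
    and HK: "\<And>h k. h \<in> H \<Longrightarrow> k \<in> K \<Longrightarrow> commute h k"
    and full: "\<And>x. x \<in> A X \<Longrightarrow> \<exists>n>0. \<exists>h\<in>H. \<exists>k\<in>K. x ^ n = h * k"
    and n: "0 < n" and cent: "\<And>k. k \<in> K \<Longrightarrow> commute k (\<delta> (X - {s}) ^ n)"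
    and k: "k \<in> K" and x: "x \<in> A X"
  shows "commute k x"
proof -
  let ?J = "X - {s}" and ?D = "\<Delta> X"
  have J: "?J \<subseteq> S" "?J \<subset> X" "A ?J \<subseteq> A X" using X s A_mono[of ?J X] by auto
  define K0 where "K0 = {k \<in> K. \<exists>y\<in>A ?J. \<exists>i. k = y * \<delta> X powi i}"
  have form: "\<exists>y\<in>A ?J. \<exists>i. k = y * ?D powi i" if "k \<in> K" for k
    by (rule centralizer_Delta_power[OF X(1) s n subsetD[OF K(2) that] cent[OF that]])
  \<comment> \<open>the powers of \<open>\<Delta>\<close> that occur normalize the parabolic subgroup, as they commute with \<open>\<Delta>\<^sub>J\<^sup>n\<close>\<close>
  have norm: "?D powi i * w * inverse (?D powi i) \<in> A ?J"
    if k: "k \<in> K" "y \<in> A ?J" "k = y * ?D powi i" and w: "w \<in> A ?J" for k y i w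
  proof -
    have "commute y (\<delta> ?J ^ n)" using commute_power[OF delta_central[OF J(1) k(2)]] .
    then have "commute (inverse y * k) (\<delta> ?J ^ n)" using cent[OF k(1)] commute_left by blast
    then have c: "commute (?D powi i) (\<delta> ?J ^ n)" unfolding k(3) by simp
    have "\<sigma> ` ?J \<subseteq> {x. ?D powi i * x * inverse (?D powi i) \<in> A ?J}"
    proof
      fix z assume "z \<in> \<sigma> ` ?J"
      then obtain t where t: "t \<in> ?J" "z = \<sigma> t" by blast
      obtain u where u: "u \<in> X" "?D powi i * \<sigma> t = \<sigma> u * ?D powi i"
        using Delta_powi_sigma[OF X(1), of t i] t(1) by blast
      obtain m where m: "n = Suc m" using n by (cases n) auto
      obtain q where q: "q \<in> P S" "\<Delta> ?J = \<sigma> t * q" using sigma_ldvd_Delta[OF J(1) t(1)] by (elim ldvdE)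
      have tX: "t \<in> X" "t \<in> S" using t(1) X(1) by blast+
      have DJ: "\<Delta> ?J \<in> P X" "\<delta> ?J ^ m \<in> P X" "q \<in> P X"
        using Delta_in_P[OF J(1)] P_power[OF delta_in_P[OF J(1)]] P_mono[of ?J X]
          P_support(2)[OF P_gen[OF tX(2)] q(1) _ X(1)] q(2) by auto
      let ?w = "q * (\<Delta> ?J * \<delta> ?J ^ m)"
      have dJ: "\<delta> ?J ^ n = \<sigma> t * ?w"
      proof -
        have "\<delta> ?J ^ n = \<Delta> ?J * (\<Delta> ?J * \<delta> ?J ^ m)" unfolding m by (simp add: \<delta>_def mult.assoc)
        then show ?thesis using q(2) by (metis mult.assoc)
      qed
      have cw: "?D powi i * ?w * inverse (?D powi i) \<in> P X"
        by (rule Delta_powi_conj_P[OF X(1) P_mult[OF DJ(3) P_mult[OF DJ(1,2)]]])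
      have "\<delta> ?J ^ n = ?D powi i * \<delta> ?J ^ n * inverse (?D powi i)"
        using c unfolding commute_def by (simp add: mult.assoc)
      also have "\<dots> = \<sigma> u * (?D powi i * ?w * inverse (?D powi i))"
        unfolding dJ using u(2) by (simp add: mult.assoc[symmetric])
      finally have eq: "\<delta> ?J ^ n = \<sigma> u * (?D powi i * ?w * inverse (?D powi i))" .
      have uS: "u \<in> S" using u(1) X(1) by blast
      have "\<delta> ?J ^ n \<in> P ?J" using P_power[OF delta_in_P[OF J(1)]] .
      then have "\<sigma> u \<in> P ?J"
        using P_support(1)[OF P_gen[OF uS] P_mono[OF X(1) cw] _ J(1)] eq by simp
      then have "u \<in> ?J" using sigma_in_P[OF uS _ J(1)] by blast
      moreover have "?D powi i * \<sigma> t * inverse (?D powi i) = \<sigma> u" using u(2) by (simp add: mult.assoc)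
      ultimately show "z \<in> {x. ?D powi i * x * inverse (?D powi i) \<in> A ?J}" using t(2) A_sigma by simp
    qed
    then show ?thesis using A_least[OF subgp_conj[OF subgp_A] _ w] by blast
  qed
  have dcent: "commute z (\<delta> X powi i)" if "z \<in> A X" for z i using commute_powi[OF delta_central[OF X(1) that]] .
  have K0_conj: "k * x * inverse k \<in> K0" if k: "k \<in> K" and x: "x \<in> K0" for k x
  proof -
    obtain y i where y: "y \<in> A ?J" "k = y * ?D powi i" using form[OF k] by blast
    obtain w j where w: "w \<in> A ?J" "x = w * \<delta> X powi j" using x unfolding K0_def by blast
    let ?c = "?D powi i * w * inverse (?D powi i)"
    have c: "?c \<in> A ?J" using norm[OF k y w(1)] .
    have "commute (inverse k) (\<delta> X powi j)" by (rule dcent[OF A_inverse[OF subsetD[OF K(2) k]]])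
    then have "k * x * inverse k = k * w * inverse k * \<delta> X powi j"
      unfolding w(2) commute_def by (simp add: mult.assoc)
    also have "k * w * inverse k = y * ?c * inverse y" unfolding y(2) by (simp add: inv_mult mult.assoc)
    finally have "k * x * inverse k = (y * ?c * inverse y) * \<delta> X powi j" .
    moreover have "y * ?c * inverse y \<in> A ?J" by (rule A_mult[OF A_mult[OF y(1) c] A_inverse[OF y(1)]])
    moreover have "x \<in> K" using x unfolding K0_def by blast
    then have "k * x * inverse k \<in> K" by (intro subgpD(2)[OF K(1)] subgpD(3)[OF K(1)] k)
    ultimately show ?thesis unfolding K0_def by blast
  qed
  have K0_normal: "\<exists>n\<ge>2. inverse (\<sigma> t ^ n) * x * \<sigma> t ^ n \<in> K0" if x: "x \<in> K0" and t: "t \<in> X" for x t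
  proof -
    obtain m h k where m: "0 < m" "h \<in> H" "k \<in> K" "\<sigma> t ^ m = h * k" using full A_sigma(1)[OF t] by blast
    have "\<sigma> t ^ (m + m) = h * (k * h) * k" unfolding power_add m(4) by (simp add: mult.assoc)
    also have "k * h = h * k" using HK[OF m(2,3)] unfolding commute_def by simp
    finally have hk: "\<sigma> t ^ (m + m) = (h * h) * (k * k)" by (simp add: mult.assoc)
    have "commute h x" using HK[OF m(2)] x unfolding K0_def by blast
    from commute_left(1)[OF this this] have hx: "inverse (h * h) * x * (h * h) = x" unfolding commute_conj .
    have "inverse (\<sigma> t ^ (m + m)) * x * \<sigma> t ^ (m + m) = inverse (k * k) * (inverse (h * h) * x * (h * h)) * (k * k)"
      unfolding hk by (simp add: inv_mult mult.assoc)
    also have "\<dots> = inverse (k * k) * x * inverse (inverse (k * k))" unfolding hx by simp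
    also have "\<dots> \<in> K0" by (rule K0_conj[OF subgpD(3)[OF K(1) subgpD(2)[OF K(1) m(3,3)]] x])
    finally show ?thesis using m(1) by (intro exI[of _ "m + m"]) auto
  qed
  have K0_central: "\<exists>i. z = \<delta> X powi i" if "z \<in> K0" for z
    using normalized_in_parabolic_central[OF X K0_normal J(2) _ that] unfolding K0_def by blast
  have K0_comm: "commute z x" if "z \<in> K0" "x \<in> A X" for z x
    using K0_central[OF that(1)] commute_sym[OF dcent[OF that(2)]] by blast
  \<comment> \<open>elements of \<open>K\<close> outside \<open>K0\<close> involve odd powers of \<open>\<Delta>\<close>, so a product of two of them is in \<open>K0\<close>\<close>
  have K_abelian: "commute k1 k2" if k: "k1 \<in> K" "k2 \<in> K" for k1 k2
  proof -
    obtain y1 i1 where 1: "y1 \<in> A ?J" "k1 = y1 * ?D powi i1" using form[OF k(1)] by blast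
    obtain y2 i2 where 2: "y2 \<in> A ?J" "k2 = y2 * ?D powi i2" using form[OF k(2)] by blast
    have even: "kk \<in> K0" if "kk \<in> K" "y \<in> A ?J" "kk = y * ?D powi i" "even i" for kk y i
    proof -
      obtain l where "i = 2 * l" using \<open>even i\<close> by (elim evenE)
      then have "kk = y * \<delta> X powi l" using that(3) delta_powi[of X l] by simp
      then show ?thesis unfolding K0_def using that(1,2) by blast
    qed
    have kA: "k1 \<in> A X" "k2 \<in> A X" using k K(2) by blast+
    show ?thesis
    proof (cases "even i1 \<or> even i2")
      case True
      then have "k1 \<in> K0 \<or> k2 \<in> K0" using even k 1 2 by blast
      then show ?thesis using K0_comm[OF _ kA(2)] commute_sym[OF K0_comm[OF _ kA(1)]] by blast
    next
      case False
      let ?c = "?D powi i1 * y2 * inverse (?D powi i1)"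
      have "k1 * k2 = (y1 * ?c) * ?D powi (i1 + i2)" unfolding 1(2) 2(2) powi_add by (simp add: mult.assoc)
      moreover have "y1 * ?c \<in> A ?J" using A_mult[OF 1(1) norm[OF k(1) 1 2(1)]] .
      ultimately have "k1 * k2 \<in> K0" using even[of "k1 * k2"] False subgpD(2)[OF K(1) k] by simp
      then have "commute k1 (k1 * k2)" by (rule commute_sym[OF K0_comm[OF _ kA(1)]])
      then show ?thesis unfolding commute_def by (simp add: mult.assoc)
    qed
  qed
  show ?thesis
  proof (rule virtually_central[OF X(1) _ _ x])
    show "k \<in> A X" using k K(2) by blast
    fix t assume t: "t \<in> X"
    obtain m h k' where m: "0 < m" "h \<in> H" "k' \<in> K" "\<sigma> t ^ m = h * k'" using full A_sigma(1)[OF t] by blast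
    have "commute k (h * k')" by (rule commute_mult[OF commute_sym[OF HK[OF m(2) k]] K_abelian[OF k m(3)]])
    then show "\<exists>n>0. commute k (\<sigma> t ^ n)" unfolding m(4)[symmetric] using m(1) by blast
  qed
qed

text \<open>The core of the proof: two commuting subgroups whose product has finite index in an irreducible
  Artin group cannot both be non-central. For an irreducible parabolic subgroup \<open>J\<close> of corank one, write a
  power of \<open>\<Delta>\<^sub>J\<close> as \<open>h k\<close>. Both factors commute with (powers of) everything that commutes
  with \<open>\<Delta>\<^sub>J\<close>, so they are products of powers of \<open>\<Delta>\<^sub>J\<close> and \<open>\<Delta>\<close>, and one of them, say \<open>h\<close>, involves
  \<open>\<Delta>\<^sub>J\<close>. The other subgroup centralizes a power of \<open>\<Delta>\<^sub>J\<close>, hence lies in the subgroup of \<open>J\<close> up to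
  powers of \<open>\<Delta>\<close>; being normal in a subgroup of finite index, it is central.\<close>

theorem strongly_indecomposable:
  assumes X: "X \<subseteq> S" "irreducible X"
    and H: "subgp H" "H \<subseteq> A X" and K: "subgp K" "K \<subseteq> A X"
    and HK: "\<And>h k. h \<in> H \<Longrightarrow> k \<in> K \<Longrightarrow> commute h k"
    and full: "\<And>x. x \<in> A X \<Longrightarrow> \<exists>n>0. \<exists>h\<in>H. \<exists>k\<in>K. x ^ n = h * k"
  shows "(\<forall>h\<in>H. \<forall>x\<in>A X. commute h x) \<or> (\<forall>k\<in>K. \<forall>x\<in>A X. commute k x)"
proof -
  consider (empty) "X = {}" | (single) s where "X = {s}" | (large) "X \<noteq> {}" "\<And>s. X \<noteq> {s}" by blast
  then show ?thesis
  proof cases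
    case empty
    then have "x = 1" if "x \<in> A X" for x using that by (auto elim: A.cases)
    then have "h = 1" if "h \<in> H" for h using H(2) that by blast
    then show ?thesis using commute_one(2) by blast
  next
    case single
    then show ?thesis using A_singleton_abelian H(2) by blast
  next
    case large
    obtain J s where Js: "J \<noteq> {}" "irreducible J" "s \<notin> J" "X = insert s J"
      using irreducible_corank_one[OF X(2) finite_subset[OF X(1) finite_S] large] by blast
    have JX: "X - {s} = J" "s \<in> X" "J \<subseteq> S" "s \<in> S" and AJ: "A J \<subseteq> A X" using Js X(1) A_mono[of J X] by auto
    have AX: "A X \<subseteq> A S" by (rule A_mono[OF X(1)])
    \<comment> \<open>elements of \<open>H \<inter> K\<close> are central, and there are no central elements of length zero\<close>
    have trivial_commutator: "c = 1" if c: "c \<in> H" "c \<in> K" "len c = 0" for c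
    proof (rule central_len_zero[OF X _ _ c(3)])
      show cA: "c \<in> A X" using c(1) H(2) by blast
      fix t assume t: "t \<in> X"
      show "commute c (\<sigma> t)"
      proof (rule virtually_central[OF X(1) cA _ A_sigma(1)[OF t]])
        fix t assume t: "t \<in> X"
        obtain m h k where m: "0 < m" "h \<in> H" "k \<in> K" "\<sigma> t ^ m = h * k" using full A_sigma(1)[OF t] by blast
        have "commute c (h * k)"
          by (rule commute_mult[OF commute_sym[OF HK[OF m(2) c(2)]] HK[OF c(1) m(3)]])
        then show "\<exists>n>0. commute c (\<sigma> t ^ n)" unfolding m(4)[symmetric] using m(1) by blast
      qed
    qed
    \<comment> \<open>the commutator of \<open>h\<close> and \<open>h'\<close> is inverse to that of \<open>k\<close> and \<open>k'\<close>, so it lies in \<open>H \<inter> K\<close>\<close>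
    have components_commute: "commute h h' \<and> commute k k'"
      if m: "h \<in> H" "k \<in> K" "h' \<in> H" "k' \<in> K" "commute (h * k) (h' * k')" for h k h' k'
    proof -
      have 1: "k * h' = h' * k" "k' * h = h * k'" using HK[OF m(3,2)] HK[OF m(1,4)] unfolding commute_def by simp_all
      have "h * (k * h') * k' = h' * (k' * h) * k" using m(5) unfolding commute_def by (simp add: mult.assoc)
      then have eq: "(h * h') * (k * k') = (h' * h) * (k' * k)" unfolding 1 by (simp add: mult.assoc)
      let ?c = "inverse (h' * h) * (h * h')"
      have "?c = (k' * k) * inverse (k * k')"
        using eq eq_mult_iff_left[of "(h * h') * (k * k')" "h' * h" "k' * k"]
          eq_mult_iff_right[of "k' * k" ?c "k * k'"] by (simp add: mult.assoc)
      moreover have "(k' * k) * inverse (k * k') \<in> K"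
        by (intro subgpD(2)[OF K(1)] subgpD(3)[OF K(1)] m(2,4))
      ultimately have "?c \<in> K" by simp
      moreover have "?c \<in> H" by (intro subgpD(2)[OF H(1)] subgpD(3)[OF H(1)] m(1,3))
      moreover have "h \<in> A S" "h' \<in> A S" using m(1,3) H(2) AX by blast+
      then have "len ?c = 0" by (simp add: len_mult_A len_inverse A_mult A_inverse)
      ultimately have "?c = 1" using trivial_commutator by blast
      then have hh: "commute h h'" using eq_mult_iff_left[of "h * h'" "h' * h" 1] unfolding commute_def by simp
      then have "k * k' = k' * k" using eq unfolding commute_def by simp
      then show ?thesis using hh unfolding commute_def by simp
    qed
    obtain n h k where n: "0 < n" "h \<in> H" "k \<in> K" "\<delta> J ^ n = h * k"
      using full[of "\<delta> J"] delta_in_A[OF JX(3)] AJ by blast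
    have hkA: "h \<in> A X" "k \<in> A X" using n H(2) K(2) by blast+
    have sigma_comm: "commute h (\<sigma> t) \<and> commute k (\<sigma> t)" if t: "t \<in> J" for t
    proof -
      have tX: "t \<in> X" "t \<in> S" using t Js(4) X(1) by auto
      obtain m h' k' where m: "0 < m" "h' \<in> H" "k' \<in> K" "\<sigma> t ^ m = h' * k'" using full A_sigma(1)[OF tX(1)] by blast
      have "commute (\<sigma> t ^ m) (\<delta> J ^ n)"
        using commute_left(3)[OF commute_power[OF delta_central[OF JX(3) A_sigma(1)[OF t]]]] .
      then have "commute (h * k) (h' * k')" unfolding n(4)[symmetric] m(4)[symmetric] by (rule commute_sym)
      from components_commute[OF n(2,3) m(2,3) this] have hh': "commute h h'" "commute k k'" by simp_all
      have "commute h (\<sigma> t ^ m)" "commute k (\<sigma> t ^ m)" unfolding m(4)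
        by (rule commute_mult[OF hh'(1) HK[OF n(2) m(3)]],
            rule commute_mult[OF commute_sym[OF HK[OF m(2) n(3)]] hh'(2)])
      then show ?thesis using commute_sigma_power[OF subsetD[OF AX] tX(2) m(1)] hkA by blast
    qed
    \<comment> \<open>centralizers of \<open>A J\<close>: the part of \<open>g\<close> in \<open>A J\<close> is quasi-central, hence a power of \<open>\<Delta> J\<close>\<close>
    have shape: "\<exists>a i. g = \<Delta> J powi a * \<Delta> X powi i"
      if g: "g \<in> A X" "\<And>t. t \<in> J \<Longrightarrow> commute g (\<sigma> t)" for g
    proof -
      have "commute g (\<delta> (X - {s}) ^ n)"
        unfolding JX(1) by (rule commute_power[OF commute_all[OF g(2) delta_in_A[OF JX(3)]]])
      then obtain y i where y: "y \<in> A J" "g = y * \<Delta> X powi i"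
        using centralizer_Delta_power[OF X(1) JX(2) n(1) g(1)] unfolding JX(1) by blast
      have "\<exists>t'\<in>J. \<sigma> t * y = y * \<sigma> t'" if t: "t \<in> J" for t
      proof -
        have tX: "t \<in> X" using t Js(4) by blast
        obtain u where u: "u \<in> X" "\<Delta> X powi i * \<sigma> t = \<sigma> u * \<Delta> X powi i" using Delta_powi_sigma[OF X(1) tX] by blast
        have "(\<sigma> t * y) * \<Delta> X powi i = (y * \<sigma> u) * \<Delta> X powi i"
          using g(2)[OF t] u(2) unfolding y(2) commute_def by (simp add: mult.assoc)
        then have eq: "\<sigma> t * y = y * \<sigma> u" by simp
        then have "\<sigma> u = inverse y * (\<sigma> t * y)" by simp
        then have "\<sigma> u \<in> A J" using A_mult[OF A_inverse[OF y(1)] A_mult[OF A_sigma(1)[OF t] y(1)]] by simp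
        moreover have uS: "u \<in> S" using u(1) X(1) by blast
        ultimately have "\<sigma> u \<in> P J" using A_cap_P[OF P_gen[OF uS]] JX(3) by blast
        then have "u \<in> J" using sigma_in_P[OF uS _ JX(3)] by blast
        then show ?thesis using eq by blast
      qed
      then obtain a where "y = \<Delta> J powi a" using quasi_central[OF JX(3) Js(2) y(1)] by blast
      then show ?thesis using y(2) by blast
    qed
    \<comment> \<open>stated for variable \<open>H\<close> and \<open>K\<close>, because their roles are exchanged if \<open>k\<close> is the factor that involves \<open>\<Delta> J\<close>\<close>
    have finish: "\<forall>k\<in>K. \<forall>x\<in>A X. commute k x"
      if H: "subgp H" "H \<subseteq> A X" and K: "subgp K" "K \<subseteq> A X"
        and HK: "\<And>h k. h \<in> H \<Longrightarrow> k \<in> K \<Longrightarrow> commute h k"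
        and full: "\<And>x. x \<in> A X \<Longrightarrow> \<exists>n>0. \<exists>h\<in>H. \<exists>k\<in>K. x ^ n = h * k"
        and h: "h \<in> H" "\<And>t. t \<in> J \<Longrightarrow> commute h (\<sigma> t)" "h = \<Delta> J powi a * \<Delta> X powi i" "a \<noteq> 0"
      for H K h a i
    proof (intro ballI)
      fix k x assume kx: "k \<in> K" "x \<in> A X"
      have DJ: "\<Delta> J \<in> A J" using Delta_in_A[OF JX(3)] .
      have hD: "commute h (\<Delta> J powi a)" by (rule commute_powi[OF commute_all[OF h(2) DJ]])
      then have "commute (\<Delta> J powi a) (\<Delta> J powi a * \<Delta> X powi i)" unfolding h(3) by (rule commute_sym)
      then have "\<Delta> J powi a * \<Delta> X powi i = \<Delta> X powi i * \<Delta> J powi a"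
        unfolding commute_def by (simp add: mult.assoc)
      then have "h * h = (\<Delta> J powi a * \<Delta> J powi a) * (\<Delta> X powi i * \<Delta> X powi i)"
        unfolding h(3) by (metis mult.assoc)
      then have hh: "h * h = \<delta> J powi a * \<delta> X powi i" unfolding delta_powi powi_add[symmetric] mult_2 .
      let ?n = "nat \<bar>a\<bar>"
      have "commute k' (\<delta> (X - {s}) ^ ?n)" if k': "k' \<in> K" for k'
      proof -
        have "commute k' (h * h)" by (rule commute_mult; rule commute_sym[OF HK[OF h(1) k']])
        moreover have "commute k' (\<delta> X powi i)"
          by (rule commute_powi[OF delta_central[OF X(1) subsetD[OF K(2) k']]])
        ultimately have c: "commute k' (\<delta> J powi a)" unfolding hh by (rule commute_mult_cancel)
        have "\<delta> J ^ ?n = \<delta> J powi a \<or> \<delta> J ^ ?n = inverse (\<delta> J powi a)"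
          using powi_nat[of "\<delta> J" ?n] powi_neg[of "\<delta> J" a] by (cases "a \<ge> 0") auto
        then show ?thesis unfolding JX(1) using c commute_inverse[OF c] by auto
      qed
      moreover have "0 < ?n" using h(4) by simp
      ultimately show "commute k x"
        using parabolic_factor_central[OF X JX(2) H K HK full _ _ kx] by blast
    qed
    obtain a i where hs: "h = \<Delta> J powi a * \<Delta> X powi i" using shape[OF hkA(1)] sigma_comm by blast
    obtain b j where ks: "k = \<Delta> J powi b * \<Delta> X powi j" using shape[OF hkA(2)] sigma_comm by blast
    \<comment> \<open>otherwise a power of \<open>\<Delta> J\<close> is a positive power of \<open>\<Delta> X\<close>, in which the letter \<open>s\<close> occurs\<close>
    have "a \<noteq> 0 \<or> b \<noteq> 0"
    proof (rule ccontr)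
      assume "\<not> (a \<noteq> 0 \<or> b \<noteq> 0)"
      then have eq: "\<delta> J ^ n = \<Delta> X powi (i + j)" unfolding n(4) hs ks by (simp add: powi_add)
      have dP: "\<delta> J ^ n \<in> P J" using P_power[OF delta_in_P[OF JX(3)]] .
      have DJ: "\<Delta> J \<in> A S" using Delta_in_A[OF JX(3)] A_mono[OF JX(3)] by blast
      then have "len (\<delta> J ^ n) = int n * (2 * len (\<Delta> J))"
        using len_power[of "\<delta> J" n] len_mult_A[OF DJ DJ] A_mult[OF DJ DJ] unfolding \<delta>_def by simp
      moreover have "len (\<Delta> X powi (i + j)) = (i + j) * len (\<Delta> X)"
        using len_powi Delta_in_A[OF X(1)] AX by blast
      moreover have "0 < len (\<Delta> J)" "0 < len (\<Delta> X)" using len_Delta_pos JX(3) Js(1) X(1) large(1) by blast+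
      ultimately have "0 < (i + j) * len (\<Delta> X)" "0 < len (\<Delta> X)" using eq n(1) by auto
      then have "0 < i + j" by (rule zero_less_mult_pos2)
      then obtain m where m: "i + j = int (Suc m)" using zero_less_imp_eq_int[of "i + j"] gr0_implies_Suc by blast
      have "\<delta> J ^ n = \<Delta> X * \<Delta> X ^ m" unfolding eq m powi_nat by simp
      moreover obtain q where q: "q \<in> P S" "\<Delta> X = \<sigma> s * q" using sigma_ldvd_Delta[OF X(1) JX(2)] by (elim ldvdE)
      ultimately have "\<delta> J ^ n = \<sigma> s * (q * \<Delta> X ^ m)" by (simp add: mult.assoc)
      moreover have "q * \<Delta> X ^ m \<in> P S" using P_mult[OF q(1) P_power[OF P_mono[OF X(1) Delta_in_P[OF X(1)]]]] .
      ultimately have "\<sigma> s \<in> P J" using P_support(1)[OF P_gen[OF JX(4)] _ _ JX(3)] dP by metis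
      then show False using sigma_in_P[OF JX(4) _ JX(3)] Js(3) by blast
    qed
    then show ?thesis
    proof
      assume "a \<noteq> 0"
      then show ?thesis using finish[OF H K HK full n(2) _ hs] sigma_comm by blast
    next
      assume "b \<noteq> 0"
      have full': "\<exists>n>0. \<exists>k\<in>K. \<exists>h\<in>H. x ^ n = k * h" if "x \<in> A X" for x
      proof -
        obtain n h k where n: "0 < n" "h \<in> H" "k \<in> K" "x ^ n = h * k" using full[OF \<open>x \<in> A X\<close>] by blast
        then have "x ^ n = k * h" using HK[OF n(2,3)] unfolding commute_def by simp
        then show ?thesis using n(1-3) by blast
      qed
      show ?thesis
        using finish[OF K H commute_sym[OF HK] full' n(3) _ ks \<open>b \<noteq> 0\<close>] sigma_comm by blast
    qed
  qed
qed

end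

section \<open>Subgroups of finite index\<close>

text \<open>The part of the left coset \<open>x H\<close> that lies in \<open>G\<close>; so \<open>fin_index\<close> also makes sense if \<open>H\<close> is not a subset of
  \<open>G\<close>.\<close>

definition coset_class :: "'g::mult_group set \<Rightarrow> 'g set \<Rightarrow> 'g \<Rightarrow> 'g set" where
  "coset_class H G x = {y \<in> G. inverse x * y \<in> H}"

definition fin_index :: "'g::mult_group set \<Rightarrow> 'g set \<Rightarrow> bool" where
  "fin_index H G \<longleftrightarrow> finite (coset_class H G ` G)"

text \<open>Finite index is mostly shown by exhibiting a function with finitely many values that separates the
  cosets.\<close>

lemma fin_indexI:
  assumes "subgp H" "finite (c ` G)" "\<And>x y. x \<in> G \<Longrightarrow> y \<in> G \<Longrightarrow> c x = c y \<Longrightarrow> inverse x * y \<in> H"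
  shows "fin_index H G"
proof -
  define F where "F k = {y \<in> G. \<exists>x\<in>G. c x = k \<and> inverse x * y \<in> H}" for k
  have "coset_class H G x = F (c x)" if x: "x \<in> G" for x
    unfolding coset_class_def
  proof
    show "F (c x) \<subseteq> {y \<in> G. inverse x * y \<in> H}"
    proof
      fix y assume "y \<in> F (c x)"
      then obtain x' where x': "x' \<in> G" "c x' = c x" "inverse x' * y \<in> H" "y \<in> G" unfolding F_def by blast
      have "(inverse x * x') * (inverse x' * y) \<in> H"
        using subgpD(2)[OF assms(1) assms(3)[OF x x'(1)] x'(3)] x'(2) by simp
      then show "y \<in> {y \<in> G. inverse x * y \<in> H}" using x'(4) by (simp add: mult.assoc)
    qed
  qed (use x in \<open>auto simp: F_def\<close>)
  then have "coset_class H G ` G \<subseteq> F ` c ` G" by blast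
  then show ?thesis unfolding fin_index_def using assms(2) finite_subset by blast
qed

lemma fin_index_coset_class:
  assumes "fin_index H G" "subgp H"
  shows "finite (coset_class H G ` G)"
    "x \<in> G \<Longrightarrow> y \<in> G \<Longrightarrow> coset_class H G x = coset_class H G y \<Longrightarrow> inverse x * y \<in> H"
proof -
  show "finite (coset_class H G ` G)" using assms(1) unfolding fin_index_def .
  assume xy: "x \<in> G" "y \<in> G" "coset_class H G x = coset_class H G y"
  have "y \<in> coset_class H G y" unfolding coset_class_def using xy(2) subgpD(1)[OF assms(2)] by simp
  then show "inverse x * y \<in> H" unfolding xy(3)[symmetric] by (simp add: coset_class_def)
qed

text \<open>Two of the powers of \<open>x\<close> lie in the same coset.\<close>

lemma fin_index_power:
  assumes "fin_index H G" "subgp H" "subgp G" "x \<in> G"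
  shows "\<exists>n>0. x ^ n \<in> H"
proof -
  define c where "c = coset_class H G"
  note c = fin_index_coset_class[OF assms(1,2), folded c_def]
  have G: "x ^ n \<in> G" for n using subgpD(4)[OF assms(3,4)] .
  have "\<not> inj (\<lambda>n. c (x ^ n))"
  proof
    assume "inj (\<lambda>n. c (x ^ n))"
    then have "infinite (range (\<lambda>n. c (x ^ n)))" using finite_imageD infinite_UNIV_nat by blast
    moreover have "range (\<lambda>n. c (x ^ n)) \<subseteq> c ` G" using G by blast
    ultimately show False using c(1) finite_subset by blast
  qed
  then obtain m n where "m \<noteq> n" "c (x ^ m) = c (x ^ n)" unfolding inj_on_def by blast
  then obtain m n where mn: "m < n" "c (x ^ m) = c (x ^ n)" by (metis linorder_neqE_nat)
  then obtain k where k: "n = m + k" "0 < k" using less_imp_add_positive by blast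
  have "inverse (x ^ m) * x ^ n \<in> H" using c(2)[OF G G mn(2)] .
  then have "x ^ k \<in> H" unfolding k(1) power_add by simp
  then show ?thesis using k(2) by blast
qed

lemma fin_index_trans:
  assumes "fin_index H K" "fin_index K G" "subgp H" "subgp K" "subgp G"
  shows "fin_index H G"
proof -
  define c where "c = coset_class K G"
  note c = fin_index_coset_class[OF assms(2,4), folded c_def]
  define d where "d = coset_class H K"
  note d = fin_index_coset_class[OF assms(1,3), folded d_def]
  define r where "r k = (SOME x. x \<in> G \<and> c x = k)" for k
  have r: "r (c x) \<in> G" "c (r (c x)) = c x" if "x \<in> G" for x
    unfolding r_def using someI[of "\<lambda>y. y \<in> G \<and> c y = c x" x] that by blast+
  let ?t = "\<lambda>x. inverse (r (c x)) * x"
  have t: "?t x \<in> K" if "x \<in> G" for x using c(2)[OF r(1)[OF that] that r(2)[OF that]] .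
  show ?thesis
  proof (rule fin_indexI[where c = "\<lambda>x. (c x, d (?t x))"])
    have "(\<lambda>x. (c x, d (?t x))) ` G \<subseteq> c ` G \<times> d ` K" using t by blast
    then show "finite ((\<lambda>x. (c x, d (?t x))) ` G)" using c(1) d(1) finite_subset by blast
    fix x y assume xy: "x \<in> G" "y \<in> G" "(c x, d (?t x)) = (c y, d (?t y))"
    then have "inverse (?t x) * ?t y \<in> H" using d(2)[OF t t] by blast
    then show "inverse x * y \<in> H" using xy(3) by (simp add: inv_mult mult.assoc)
  qed (rule assms(3))
qed

lemma fin_index_Int:
  assumes "fin_index H G" "subgp H" "subgp A" "A \<subseteq> G"
  shows "fin_index (H \<inter> A) A"
proof -
  define c where "c = coset_class H G"
  note c = fin_index_coset_class[OF assms(1,2), folded c_def]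
  show ?thesis
  proof (rule fin_indexI)
    show "subgp (H \<inter> A)" using assms(2,3) unfolding subgp_def by blast
    show "finite (c ` A)" using c(1) assms(4) finite_subset[OF image_mono] by blast
    fix x y assume xy: "x \<in> A" "y \<in> A" "c x = c y"
    have "inverse x * y \<in> H" using c(2) xy assms(4) by blast
    moreover have "inverse x * y \<in> A" by (rule subgpD(2)[OF assms(3) subgpD(3)[OF assms(3) xy(1)] xy(2)])
    ultimately show "inverse x * y \<in> H \<inter> A" by blast
  qed
qed

definition hom_on :: "'g::mult_group set \<Rightarrow> ('g \<Rightarrow> 'h::mult_group) \<Rightarrow> bool" where
  "hom_on G f \<longleftrightarrow> (\<forall>x\<in>G. \<forall>y\<in>G. f (x * y) = f x * f y)"

lemma hom_onD:
  assumes "hom_on G f" "subgp G"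
  shows "x \<in> G \<Longrightarrow> y \<in> G \<Longrightarrow> f (x * y) = f x * f y" "f 1 = 1" "x \<in> G \<Longrightarrow> f (inverse x) = inverse (f x)"
    "x \<in> G \<Longrightarrow> f (x ^ n) = f x ^ n" "x \<in> G \<Longrightarrow> f (x powi k) = f x powi k"
proof -
  show 1: "f (x * y) = f x * f y" if "x \<in> G" "y \<in> G" for x y using that assms(1) unfolding hom_on_def by blast
  have "f 1 * f 1 = f 1 * 1" using 1[of 1 1] subgpD(1)[OF assms(2)] by simp
  then show 2: "f 1 = 1" unfolding mult_cancel_left_iff .
  show 3: "f (inverse x) = inverse (f x)" if "x \<in> G" for x
    using 1[OF that subgpD(3)[OF assms(2) that]] 2 by (intro inv_unique[symmetric]) simp
  show 4: "f (x ^ n) = f x ^ n" if "x \<in> G" for x n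
    using that by (induction n) (simp_all add: 1 2 subgpD(4)[OF assms(2)])
  show "f (x powi k) = f x powi k" if "x \<in> G"
    unfolding power_int_def using 3 4 that subgpD(3)[OF assms(2)] by simp
qed

lemma subgp_image: "hom_on G f \<Longrightarrow> subgp G \<Longrightarrow> H \<subseteq> G \<Longrightarrow> subgp H \<Longrightarrow> subgp (f ` H)"
proof -
  assume f: "hom_on G f" "subgp G" "H \<subseteq> G" "subgp H"
  have "1 \<in> f ` H" using hom_onD(2)[OF f(1,2)] subgpD(1)[OF f(4)] by (metis imageI)
  moreover have "f x * f y \<in> f ` H" if "x \<in> H" "y \<in> H" for x y
    using hom_onD(1)[OF f(1,2), of x y] subgpD(2)[OF f(4) that] that f(3) by (metis imageI subsetD)
  moreover have "inverse (f x) \<in> f ` H" if "x \<in> H" for x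
    using hom_onD(3)[OF f(1,2), of x] subgpD(3)[OF f(4) that] that f(3) by (metis imageI subsetD)
  ultimately show ?thesis unfolding subgp_def by blast
qed

lemma hom_on_commute: "hom_on G f \<Longrightarrow> x \<in> G \<Longrightarrow> y \<in> G \<Longrightarrow> commute x y \<Longrightarrow> commute (f x) (f y)"
  unfolding hom_on_def commute_def by metis

lemma hom_on_subset: "hom_on G f \<Longrightarrow> H \<subseteq> G \<Longrightarrow> hom_on H f"
  unfolding hom_on_def by blast

definition comm_sub :: "'g::mult_group set \<Rightarrow> 'h::mult_group set \<Rightarrow> bool" where
  "comm_sub A B \<longleftrightarrow> (\<exists>H K \<phi>. subgp H \<and> H \<subseteq> A \<and> fin_index H A \<and> subgp K \<and> K \<subseteq> B \<and> fin_index K B \<and>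
    hom_on H \<phi> \<and> inj_on \<phi> H \<and> \<phi> ` H = K)"

section \<open>Direct decompositions into indecomposable factors\<close>

definition central_in :: "'g::mult_group set \<Rightarrow> 'g \<Rightarrow> bool" where
  "central_in A x \<longleftrightarrow> (\<forall>y\<in>A. commute x y)"

lemma central_in_closed:
  "central_in A x \<Longrightarrow> central_in A y \<Longrightarrow> central_in A (x * y)"
  "central_in A x \<Longrightarrow> central_in A (inverse x)"
  "central_in A x \<Longrightarrow> central_in A (x powi k)"
  "central_in A 1"
  unfolding central_in_def power_int_def by (auto intro: commute_left)

text \<open>The properties of an irreducible Artin group of spherical type that the uniqueness of the
  decomposition uses. They say in particular that the centre is virtually infinite cyclic and splits
  off virtually, being detected by the length.\<close>

definition indecomposable_group :: "'g::mult_group set \<Rightarrow> ('g \<Rightarrow> int) \<Rightarrow> 'g \<Rightarrow> bool" where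
  "indecomposable_group A l z \<longleftrightarrow> subgp A \<and>
    (\<forall>x\<in>A. \<forall>y\<in>A. l (x * y) = l x + l y) \<and> z \<in> A \<and> central_in A z \<and> 0 < l z \<and>
    (\<forall>x\<in>A. central_in A x \<longrightarrow> l x = 0 \<longrightarrow> x = 1) \<and>
    (\<forall>x\<in>A. (\<forall>y\<in>A. \<exists>n>0. commute x (y ^ n)) \<longrightarrow> central_in A x) \<and>
    (\<forall>H K. subgp H \<longrightarrow> H \<subseteq> A \<longrightarrow> subgp K \<longrightarrow> K \<subseteq> A \<longrightarrow> (\<forall>h\<in>H. \<forall>k\<in>K. commute h k) \<longrightarrow>
      (\<forall>x\<in>A. \<exists>n>0. \<exists>h\<in>H. \<exists>k\<in>K. x ^ n = h * k) \<longrightarrow>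
      (\<forall>h\<in>H. central_in A h) \<or> (\<forall>k\<in>K. central_in A k))"

locale indec =
  fixes A :: "'g::mult_group set" and l :: "'g \<Rightarrow> int" and z :: 'g
  assumes indecomposable: "indecomposable_group A l z"
begin

lemma sub: "subgp A"
  and l_mult: "x \<in> A \<Longrightarrow> y \<in> A \<Longrightarrow> l (x * y) = l x + l y"
  and z: "z \<in> A" "central_in A z" "0 < l z"
  and central_l_zero: "x \<in> A \<Longrightarrow> central_in A x \<Longrightarrow> l x = 0 \<Longrightarrow> x = 1"
  and virtually_central: "x \<in> A \<Longrightarrow> (\<And>y. y \<in> A \<Longrightarrow> \<exists>n>0. commute x (y ^ n)) \<Longrightarrow> central_in A x"
  using indecomposable unfolding indecomposable_group_def by simp_all

lemma split:
  assumes "subgp H" "H \<subseteq> A" "subgp K" "K \<subseteq> A" "\<And>h k. h \<in> H \<Longrightarrow> k \<in> K \<Longrightarrow> commute h k"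
    "\<And>x. x \<in> A \<Longrightarrow> \<exists>n>0. \<exists>h\<in>H. \<exists>k\<in>K. x ^ n = h * k"
  shows "(\<forall>h\<in>H. central_in A h) \<or> (\<forall>k\<in>K. central_in A k)"
  using indecomposable assms unfolding indecomposable_group_def by simp

lemma l_one [simp]: "l 1 = 0"
  using l_mult[of 1 1] subgpD(1)[OF sub] by simp

lemma l_inverse: "x \<in> A \<Longrightarrow> l (inverse x) = - l x"
  using l_mult[of x "inverse x"] subgpD(3)[OF sub] by simp

lemma l_power: "x \<in> A \<Longrightarrow> l (x ^ n) = int n * l x"
  by (induction n) (simp_all add: l_mult subgpD(4)[OF sub] algebra_simps)

lemma l_powi: "x \<in> A \<Longrightarrow> l (x powi k) = k * l x"
  unfolding power_int_def by (simp add: l_power l_inverse subgpD(3)[OF sub])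

lemma central_multiple:
  assumes "x \<in> A" "central_in A x" "l z dvd l x"
  shows "\<exists>k. x = z powi k"
proof -
  obtain k where k: "l x = l z * k" using assms(3) by (elim dvdE)
  let ?y = "x * z powi (- k)"
  have "?y \<in> A" using subgpD(2)[OF sub assms(1) subgpD(5)[OF sub z(1)]] .
  moreover have "central_in A ?y" by (rule central_in_closed(1)[OF assms(2) central_in_closed(3)[OF z(2)]])
  moreover have "l ?y = 0" using l_mult[OF assms(1) subgpD(5)[OF sub z(1)]] l_powi[OF z(1)] k by simp
  ultimately have "?y = 1" by (rule central_l_zero)
  then have "x = z powi k" unfolding powi_neg using eq_mult_iff_right[of 1 x "inverse (z powi k)"] by simp
  then show ?thesis by blast
qed

end

text \<open>By assumption \<open>\<psi>\<close> induces an embedding modulo the centres with an image of finite index. Let \<open>E\<close> be a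
  power of \<open>z\<close> that lies in \<open>U\<close>. On the subgroup of finite index on which \<open>l\<close> is a multiple of \<open>l E\<close>, every
  element is uniquely a product of a power of \<open>E\<close> and an element of length zero. Define \<open>\<Phi>\<close> by \<open>\<psi>\<close> on the
  second factor and by \<open>E \<mapsto> z'\<close> on the first. It is injective, since the centres contain no
  elements of length zero, and its image has finite index, since the centre of \<open>B\<close> is virtually
  generated by \<open>z'\<close>.\<close>

lemma commensurable_mod_centre:
  assumes A: "indecomposable_group A l z" and B: "indecomposable_group B l' z'"
    and U: "subgp U" "U \<subseteq> A" "fin_index U A"
    and \<psi>: "hom_on U \<psi>" "\<psi> ` U \<subseteq> B"
    and ker: "\<And>x. x \<in> U \<Longrightarrow> central_in B (\<psi> x) \<Longrightarrow> central_in A x"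
    and cen: "\<And>x. x \<in> U \<Longrightarrow> central_in A x \<Longrightarrow> central_in B (\<psi> x)"
    and c: "finite (c ` B)"
      "\<And>x y. x \<in> B \<Longrightarrow> y \<in> B \<Longrightarrow> c x = c y \<Longrightarrow> \<exists>u\<in>U. \<exists>w\<in>B. central_in B w \<and> inverse x * y = \<psi> u * w"
  shows "comm_sub A B"
proof -
  interpret A: indec A l z by (rule indec.intro[OF A])
  interpret B: indec B l' z' by (rule indec.intro[OF B])
  note \<psi>D = hom_onD[OF \<psi>(1) U(1)]
  have \<psi>B: "\<psi> x \<in> B" if "x \<in> U" for x using \<psi>(2) that by blast
  obtain e0 where e0: "0 < e0" "z ^ e0 \<in> U" using fin_index_power[OF U(3,1) A.sub A.z(1)] by blast
  define a where "a = l' z'"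
  have a: "0 < a" unfolding a_def by (rule B.z(3))
  \<comment> \<open>the factor \<open>a\<close> makes \<open>l' (\<psi> E)\<close> a multiple of \<open>l' z'\<close>\<close>
  define e where "e = e0 * nat a"
  have e: "0 < e" unfolding e_def using e0(1) a by simp
  define E where "E = z ^ e"
  have "E = (z ^ e0) ^ nat a" unfolding E_def e_def by (rule power_mult)
  then have EU: "E \<in> U" and \<psi>E: "\<psi> E = \<psi> (z ^ e0) ^ nat a"
    using subgpD(4)[OF U(1) e0(2)] \<psi>D(4)[OF e0(2)] by simp_all
  have aE: "a dvd l' (\<psi> E)" unfolding \<psi>E using B.l_power[OF \<psi>B[OF e0(2)]] a by simp
  have EA: "E \<in> A" "central_in A E"
    unfolding E_def using subgpD(4)[OF A.sub A.z(1)] central_in_closed(3)[OF A.z(2), of "int e"] powi_nat by metis+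
  define b where "b = l E"
  have b: "0 < b" unfolding b_def E_def using A.l_power[OF A.z(1)] A.z(3) e by simp
  have Ecom: "commute x (E powi k)" if "x \<in> A" for x k
    using central_in_closed(3)[OF EA(2), of k] that commute_sym unfolding central_in_def by blast
  have \<psi>Ecen: "central_in B (\<psi> E)" by (rule cen[OF EU EA(2)])
  define U1 where "U1 = {x \<in> U. b dvd l x \<and> a dvd l' (\<psi> x)}"
  have U1U: "U1 \<subseteq> U" unfolding U1_def by blast
  have UA: "x \<in> A" if "x \<in> U" for x using U(2) that by blast
  have sub1: "subgp U1" unfolding subgp_def U1_def
    using subgpD[OF U(1)] \<psi>D(1-3) \<psi>B UA by (auto simp: A.l_mult A.l_inverse B.l_mult B.l_inverse)
  define kk where "kk x = l x div b" for x
  have kk: "l x = b * kk x" if "x \<in> U1" for x using that unfolding kk_def U1_def by simp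
  have kk_mult: "kk (x * y) = kk x + kk y" if "x \<in> U1" "y \<in> U1" for x y
    using kk[OF that(1)] kk[OF that(2)] kk[OF subgpD(2)[OF sub1 that]] A.l_mult[of x y] UA U1U that b
    by (metis distrib_left less_irrefl mult_cancel_left subsetD)
  define \<Phi> where "\<Phi> x = \<psi> (x * E powi (- kk x)) * z' powi kk x" for x
  have z'com: "commute y (z' powi k)" if "y \<in> B" for y k
    using central_in_closed(3)[OF B.z(2), of k] that commute_sym unfolding central_in_def by blast
  have red: "x * E powi k \<in> U" if "x \<in> U" for x k using subgpD(2)[OF U(1) that subgpD(5)[OF U(1) EU]] .
  have \<Phi>_hom: "hom_on U1 \<Phi>" unfolding hom_on_def
  proof (intro ballI)
    fix x y assume xy: "x \<in> U1" "y \<in> U1"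
    let ?x = "x * E powi (- kk x)" and ?y = "y * E powi (- kk y)"
    have xyU: "x \<in> U" "y \<in> U" using xy U1U by blast+
    have "(x * y) * E powi (- kk (x * y)) = x * (y * E powi (- kk x)) * E powi (- kk y)"
      unfolding kk_mult[OF xy] minus_add_distrib powi_add by (simp add: mult.assoc)
    also have "y * E powi (- kk x) = E powi (- kk x) * y" using Ecom[OF UA[OF xyU(2)]] unfolding commute_def .
    finally have 1: "(x * y) * E powi (- kk (x * y)) = ?x * ?y" by (simp add: mult.assoc)
    have "\<Phi> (x * y) = \<psi> ?x * (\<psi> ?y * z' powi kk x) * z' powi kk y"
      unfolding \<Phi>_def unfolding 1 unfolding \<psi>D(1)[OF red red, OF xyU] kk_mult[OF xy] powi_add
      by (simp add: mult.assoc)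
    also have "\<psi> ?y * z' powi kk x = z' powi kk x * \<psi> ?y"
      using z'com[OF \<psi>B[OF red[OF xyU(2)]]] unfolding commute_def .
    finally show "\<Phi> (x * y) = \<Phi> x * \<Phi> y" unfolding \<Phi>_def by (simp add: mult.assoc)
  qed
  have \<Phi>_inj: "x = 1" if x: "x \<in> U1" "\<Phi> x = 1" for x
  proof -
    let ?x = "x * E powi (- kk x)"
    have xU: "x \<in> U" using x(1) U1U by blast
    have "\<psi> ?x = z' powi (- kk x)"
      using x(2) eq_mult_iff_right[of 1 "\<psi> ?x" "z' powi kk x"] unfolding \<Phi>_def powi_neg by simp
    then have "central_in B (\<psi> ?x)" using central_in_closed(3)[OF B.z(2)] by simp
    then have "central_in A ?x" by (rule ker[OF red[OF xU]])
    moreover have "l ?x = 0"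
      using A.l_mult[OF UA[OF xU] subgpD(5)[OF A.sub EA(1)]] A.l_powi[OF EA(1)] kk[OF x(1)] by (simp add: b_def)
    ultimately have x1: "?x = 1" using A.central_l_zero UA[OF red[OF xU]] by blast
    then have "z' powi kk x = 1" using x(2) \<psi>D(2) unfolding \<Phi>_def by simp
    then have "kk x * l' z' = 0" using B.l_powi[OF B.z(1), of "kk x"] by simp
    then have "kk x = 0" using B.z(3) by simp
    then show ?thesis using x1 by simp
  qed
  have \<Phi>_inj_on: "inj_on \<Phi> U1"
  proof (rule inj_onI)
    fix x y assume xy: "x \<in> U1" "y \<in> U1" "\<Phi> x = \<Phi> y"
    have "\<Phi> (inverse x * y) = 1"
      using hom_onD(1,3)[OF \<Phi>_hom sub1] subgpD(3)[OF sub1] xy by simp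
    then have "inverse x * y = 1" using \<Phi>_inj subgpD(2)[OF sub1 subgpD(3)[OF sub1 xy(1)] xy(2)] by blast
    then show "x = y" using eq_mult_iff_left[of y x 1] by simp
  qed
  have \<Phi>B: "\<Phi> ` U1 \<subseteq> B"
    using \<psi>B red U1U subgpD(2,5)[OF B.sub] B.z(1) unfolding \<Phi>_def by blast
  have sub2: "subgp (\<Phi> ` U1)" by (rule subgp_image[OF \<Phi>_hom sub1 order_refl sub1])
  have fin1: "fin_index U1 A"
  proof (rule fin_index_trans[OF _ U(3) sub1 U(1) A.sub])
    show "fin_index U1 U"
    proof (rule fin_indexI[OF sub1, where c = "\<lambda>x. (l x mod b, l' (\<psi> x) mod a)"])
      have "(\<lambda>x. (l x mod b, l' (\<psi> x) mod a)) ` U \<subseteq> {0..<b} \<times> {0..<a}" using a b by auto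
      then show "finite ((\<lambda>x. (l x mod b, l' (\<psi> x) mod a)) ` U)" by (rule finite_subset) simp
      fix x y assume xy: "x \<in> U" "y \<in> U" "(l x mod b, l' (\<psi> x) mod a) = (l y mod b, l' (\<psi> y) mod a)"
      have "l (inverse x * y) = l y - l x" "l' (\<psi> (inverse x * y)) = l' (\<psi> y) - l' (\<psi> x)"
        using xy subgpD(3)[OF U(1)] UA \<psi>B subgpD(3)[OF A.sub] subgpD(3)[OF B.sub] \<psi>D(1,3)
        by (simp_all add: A.l_mult A.l_inverse B.l_mult B.l_inverse)
      then show "inverse x * y \<in> U1"
        unfolding U1_def using xy subgpD(2,3)[OF U(1)] by (auto simp: mod_eq_dvd_iff dvd_diff_commute)
    qed
  qed
  \<comment> \<open>elements of \<open>B\<close> of the form \<open>\<psi> u w\<close> with \<open>w\<close> central belong to the image if three residues vanish\<close>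
  have image: "\<psi> u * w \<in> \<Phi> ` U1"
    if u: "u \<in> U" "w \<in> B" "central_in B w" "b dvd l u" "a dvd l' (\<psi> u)" "a dvd l' w" for u w
  proof -
    define k where "k = l u div b"
    have k: "l u = b * k" using u(4) unfolding k_def by simp
    let ?xr = "u * E powi (- k)" and ?w = "\<psi> E powi k * w"
    have x0U: "?xr \<in> U" by (rule red[OF u(1)])
    have \<psi>Ek: "\<psi> E powi i \<in> B" "l' (\<psi> E powi i) = i * l' (\<psi> E)" for i
      using subgpD(5)[OF B.sub \<psi>B[OF EU]] B.l_powi[OF \<psi>B[OF EU]] by blast+
    have lx0: "l ?xr = 0"
      using A.l_mult[OF UA[OF u(1)] subgpD(5)[OF A.sub EA(1)]] A.l_powi[OF EA(1)] k by (simp add: b_def)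
    have \<psi>x0: "\<psi> ?xr = \<psi> u * \<psi> E powi (- k)"
      using \<psi>D(1)[OF u(1) subgpD(5)[OF U(1) EU]] \<psi>D(5)[OF EU] by simp
    have l\<psi>x0: "a dvd l' (\<psi> ?xr)"
      unfolding \<psi>x0 B.l_mult[OF \<psi>B[OF u(1)] \<psi>Ek(1)] \<psi>Ek(2) by (intro dvd_add u(5) dvd_mult aE)
    have "central_in B ?w" by (rule central_in_closed(1)[OF central_in_closed(3)[OF \<psi>Ecen] u(3)])
    moreover have "?w \<in> B" by (rule subgpD(2)[OF B.sub \<psi>Ek(1) u(2)])
    moreover have "l' z' dvd l' ?w"
      unfolding B.l_mult[OF \<psi>Ek(1) u(2)] \<psi>Ek(2) a_def[symmetric] by (intro dvd_add u(6) dvd_mult aE)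
    ultimately obtain k' where k': "?w = z' powi k'" using B.central_multiple by blast
    let ?x = "?xr * E powi k'"
    have lx: "l ?x = b * k'"
      using A.l_mult[OF UA[OF x0U] subgpD(5)[OF A.sub EA(1)]] A.l_powi[OF EA(1)] lx0 by (simp add: b_def)
    have "a dvd l' (\<psi> ?x)"
    proof -
      have "\<psi> ?x = \<psi> ?xr * \<psi> E powi k'"
        using \<psi>D(1)[OF x0U subgpD(5)[OF U(1) EU]] \<psi>D(5)[OF EU] by simp
      then have "l' (\<psi> ?x) = l' (\<psi> ?xr) + k' * l' (\<psi> E)" using B.l_mult[OF \<psi>B[OF x0U] \<psi>Ek(1)] \<psi>Ek(2) by simp
      then show ?thesis using l\<psi>x0 aE by simp
    qed
    then have x1: "?x \<in> U1" unfolding U1_def using red[OF x0U] lx by simp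
    have "kk ?x = k'" unfolding kk_def lx using b by simp
    then have "\<Phi> ?x = \<psi> ?xr * ?w" unfolding \<Phi>_def k' powi_neg by (simp add: mult.assoc)
    also have "\<dots> = \<psi> u * w" unfolding \<psi>x0 unfolding powi_neg by (simp add: mult.assoc)
    finally show ?thesis using x1 by (metis imageI)
  qed
  have fin2: "fin_index (\<Phi> ` U1) B"
  proof -
    \<comment> \<open>the image of \<open>U\<close> times the centre, which has finite index by assumption\<close>
    define T where "T = {\<psi> u * w |u w. u \<in> U \<and> w \<in> B \<and> central_in B w}"
    have Tsub: "subgp T" unfolding subgp_def
    proof (intro conjI ballI)
      show "1 \<in> T" unfolding T_def
        using \<psi>D(2) subgpD(1)[OF U(1)] subgpD(1)[OF B.sub] central_in_closed(4)[of B] by (metis (mono_tags, lifting) mem_Collect_eq mult_1_left)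
      fix x y assume "x \<in> T" "y \<in> T"
      then obtain u w v w2 where uw: "x = \<psi> u * w" "u \<in> U" "w \<in> B" "central_in B w"
          "y = \<psi> v * w2" "v \<in> U" "w2 \<in> B" "central_in B w2" unfolding T_def by blast
      have "w * \<psi> v = \<psi> v * w" using uw(4) \<psi>B[OF uw(6)] unfolding central_in_def commute_def by blast
      then have "x * y = \<psi> (u * v) * (w * w2)" unfolding uw(1,5) \<psi>D(1)[OF uw(2,6)] by (metis mult.assoc)
      then show "x * y \<in> T" unfolding T_def
        using subgpD(2)[OF U(1) uw(2,6)] subgpD(2)[OF B.sub uw(3,7)] central_in_closed(1)[OF uw(4,8)] by blast
      have "commute (inverse w) (\<psi> (inverse u))"
        using central_in_closed(2)[OF uw(4)] \<psi>B[OF subgpD(3)[OF U(1) uw(2)]] unfolding central_in_def by blast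
      then have "inverse x = \<psi> (inverse u) * inverse w"
        unfolding uw(1) inv_mult \<psi>D(3)[OF uw(2)] commute_def .
      then show "inverse x \<in> T" unfolding T_def
        using subgpD(3)[OF U(1) uw(2)] subgpD(3)[OF B.sub uw(3)] central_in_closed(2)[OF uw(4)] by blast
    qed
    have "fin_index T B" by (rule fin_indexI[OF Tsub c(1)]) (use c(2) in \<open>unfold T_def, blast\<close>)
    moreover have "fin_index (\<Phi> ` U1) T"
    proof -
      have "\<forall>y\<in>T. \<exists>uw. fst uw \<in> U \<and> snd uw \<in> B \<and> central_in B (snd uw) \<and> y = \<psi> (fst uw) * snd uw"
        unfolding T_def by fastforce
      then obtain p where p: "\<And>y. y \<in> T \<Longrightarrow> fst (p y) \<in> U \<and> snd (p y) \<in> B \<and> central_in B (snd (p y)) \<and> y = \<psi> (fst (p y)) * snd (p y)"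
        by metis
      let ?f = "\<lambda>y. fst (p y)" and ?s = "\<lambda>y. snd (p y)"
      let ?c = "\<lambda>y. (l (?f y) mod b, l' (\<psi> (?f y)) mod a, l' (?s y) mod a)"
      show ?thesis
      proof (rule fin_indexI[OF sub2, where c = ?c])
        have "?c ` T \<subseteq> {0..<b} \<times> {0..<a} \<times> {0..<a}" using a b by auto
        then show "finite (?c ` T)" by (rule finite_subset) simp
        fix x y assume xy: "x \<in> T" "y \<in> T" "?c x = ?c y"
        note px = p[OF xy(1)] and py = p[OF xy(2)]
        let ?u = "inverse (?f x) * ?f y" and ?w = "inverse (?s x) * ?s y"
        have inU: "inverse (?f x) \<in> U" "?f y \<in> U" using px py subgpD(3)[OF U(1)] by blast+
        have inB: "inverse (?s x) \<in> B" "?s y \<in> B" using px py subgpD(3)[OF B.sub] by blast+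
        have uU: "?u \<in> U" and wB: "?w \<in> B" using subgpD(2)[OF U(1) inU] subgpD(2)[OF B.sub inB] .
        have wc: "central_in B ?w" using central_in_closed(1)[OF central_in_closed(2)] px py by blast
        have com: "commute (inverse (?s x)) (\<psi> ?u)"
          using central_in_closed(2)[of B "?s x"] px \<psi>B[OF uU] unfolding central_in_def by blast
        have "inverse x * y = inverse (?s x) * (inverse (\<psi> (?f x)) * \<psi> (?f y)) * ?s y"
          using px py by (metis inv_mult mult.assoc)
        also have "inverse (\<psi> (?f x)) * \<psi> (?f y) = \<psi> ?u" using \<psi>D(1)[OF inU] \<psi>D(3) px by simp
        also have "inverse (?s x) * \<psi> ?u * ?s y = \<psi> ?u * ?w" using com unfolding commute_def by (simp add: mult.assoc)
        finally have eq: "inverse x * y = \<psi> ?u * ?w" .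
        have "l ?u = l (?f y) - l (?f x)" using A.l_mult[of "inverse (?f x)" "?f y"] A.l_inverse UA inU px by simp
        moreover have "l' (\<psi> ?u) = l' (\<psi> (?f y)) - l' (\<psi> (?f x))"
          using \<psi>D(1)[OF inU] \<psi>D(3) px B.l_mult[of "inverse (\<psi> (?f x))" "\<psi> (?f y)"] B.l_inverse \<psi>B inU
            subgpD(3)[OF B.sub] by simp
        moreover have "l' ?w = l' (?s y) - l' (?s x)" using B.l_mult[OF inB] B.l_inverse px by simp
        ultimately have "b dvd l ?u" "a dvd l' (\<psi> ?u)" "a dvd l' ?w" using xy(3) by (auto simp: mod_eq_dvd_iff dvd_diff_commute)
        then show "inverse x * y \<in> \<Phi> ` U1" unfolding eq by (rule image[OF uU wB wc])
      qed
    qed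
    ultimately show ?thesis using fin_index_trans[OF _ _ sub2 Tsub B.sub] by blast
  qed
  have "U1 \<subseteq> A" using U1U U(2) by blast
  then show ?thesis unfolding comm_sub_def using sub1 fin1 sub2 \<Phi>B fin2 \<Phi>_hom \<Phi>_inj_on by blast
qed

text \<open>An internal direct decomposition, given by the projections to the factors.\<close>

locale decomp =
  fixes G :: "'g::mult_group set" and I :: "'i set" and pr :: "'i \<Rightarrow> 'g \<Rightarrow> 'g"
  assumes subgp_G: "subgp G" and finite_I: "finite I"
    and pr_in: "i \<in> I \<Longrightarrow> x \<in> G \<Longrightarrow> pr i x \<in> G"
    and pr_hom: "i \<in> I \<Longrightarrow> hom_on G (pr i)"
    and pr_same: "i \<in> I \<Longrightarrow> x \<in> G \<Longrightarrow> pr i (pr i x) = pr i x"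
    and pr_other: "i \<in> I \<Longrightarrow> j \<in> I \<Longrightarrow> i \<noteq> j \<Longrightarrow> x \<in> G \<Longrightarrow> pr i (pr j x) = 1"
    and pr_trivial: "x \<in> G \<Longrightarrow> (\<And>i. i \<in> I \<Longrightarrow> pr i x = 1) \<Longrightarrow> x = 1"
begin

definition F :: "'i \<Rightarrow> 'g set" where "F i = pr i ` G"

lemmas prD = hom_onD[OF pr_hom subgp_G]

lemma F_subset: "i \<in> I \<Longrightarrow> F i \<subseteq> G"
  unfolding F_def using pr_in by blast

lemma pr_F: "i \<in> I \<Longrightarrow> x \<in> G \<Longrightarrow> pr i x \<in> F i"
  unfolding F_def by blast

lemma subgp_F: "i \<in> I \<Longrightarrow> subgp (F i)"
  unfolding F_def by (rule subgp_image[OF pr_hom subgp_G order_refl subgp_G])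

lemma pr_of_F: "i \<in> I \<Longrightarrow> x \<in> F i \<Longrightarrow> pr i x = x"
  unfolding F_def using pr_same by blast

lemma pr_of_other_F: "i \<in> I \<Longrightarrow> j \<in> I \<Longrightarrow> i \<noteq> j \<Longrightarrow> x \<in> F j \<Longrightarrow> pr i x = 1"
  unfolding F_def using pr_other by blast

lemma pr_eqI: "x \<in> G \<Longrightarrow> y \<in> G \<Longrightarrow> (\<And>i. i \<in> I \<Longrightarrow> pr i x = pr i y) \<Longrightarrow> x = y"
proof -
  assume xy: "x \<in> G" "y \<in> G" "\<And>i. i \<in> I \<Longrightarrow> pr i x = pr i y"
  have "inverse y * x = 1"
  proof (rule pr_trivial)
    show "inverse y * x \<in> G" by (rule subgpD(2)[OF subgp_G subgpD(3)[OF subgp_G xy(2)] xy(1)])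
    fix i assume i: "i \<in> I"
    show "pr i (inverse y * x) = 1"
      using prD(1)[OF i subgpD(3)[OF subgp_G xy(2)] xy(1)] prD(3)[OF i xy(2)] xy(3)[OF i] by simp
  qed
  then show "x = y" using eq_mult_iff_left[of x y 1] by simp
qed

lemma commute_iff_pr:
  assumes "x \<in> G" "y \<in> G"
  shows "commute x y \<longleftrightarrow> (\<forall>i\<in>I. commute (pr i x) (pr i y))"
proof
  assume "commute x y"
  then show "\<forall>i\<in>I. commute (pr i x) (pr i y)" using hom_on_commute[OF pr_hom assms] by blast
next
  assume *: "\<forall>i\<in>I. commute (pr i x) (pr i y)"
  show "commute x y" unfolding commute_def
  proof (rule pr_eqI)
    show "x * y \<in> G" "y * x \<in> G" using subgpD(2)[OF subgp_G] assms by blast+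
    fix i assume i: "i \<in> I"
    show "pr i (x * y) = pr i (y * x)"
      using * i prD(1)[OF i assms] prD(1)[OF i assms(2,1)] unfolding commute_def by simp
  qed
qed

lemma ex_with_components:
  assumes "\<And>i. i \<in> I \<Longrightarrow> f i \<in> F i"
  shows "\<exists>x\<in>G. \<forall>i\<in>I. pr i x = f i"
proof -
  have "\<exists>x\<in>G. \<forall>i\<in>I. pr i x = (if i \<in> J then f i else 1)" if "finite J" "J \<subseteq> I" for J
    using that
  proof (induction J rule: finite_induct)
    case empty
    show ?case using subgpD(1)[OF subgp_G] prD(2) by (intro bexI[of _ 1]) auto
  next
    case (insert j J)
    then obtain x where x: "x \<in> G" "\<forall>i\<in>I. pr i x = (if i \<in> J then f i else 1)" by auto
    have j: "j \<in> I" using insert.prems by blast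
    have fj: "f j \<in> F j" "f j \<in> G" using assms[OF j] F_subset[OF j] by blast+
    have "pr i (f j * x) = (if i \<in> insert j J then f i else 1)" if i: "i \<in> I" for i
      using prD(1)[OF i fj(2) x(1)] x(2) i pr_of_F[OF j fj(1)] pr_of_other_F[OF i j _ fj(1)] insert.hyps(2)
      by (cases "i = j") auto
    then show ?case using subgpD(2)[OF subgp_G fj(2) x(1)] by blast
  qed
  from this[OF finite_I order_refl] show ?thesis by auto
qed

lemma fin_index_components:
  assumes "\<And>i. i \<in> I \<Longrightarrow> subgp (H i)" "\<And>i. i \<in> I \<Longrightarrow> fin_index (H i) (F i)"
  shows "subgp {x \<in> G. \<forall>i\<in>I. pr i x \<in> H i}" "fin_index {x \<in> G. \<forall>i\<in>I. pr i x \<in> H i} G"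
proof -
  show sub: "subgp {x \<in> G. \<forall>i\<in>I. pr i x \<in> H i}"
    unfolding subgp_def using subgpD[OF subgp_G] subgpD[OF assms(1)] prD(1,2,3) by auto
  show "fin_index {x \<in> G. \<forall>i\<in>I. pr i x \<in> H i} G"
  proof (rule fin_indexI[OF sub, where c = "\<lambda>x. restrict (\<lambda>i. coset_class (H i) (F i) (pr i x)) I"])
    have "(\<lambda>x. restrict (\<lambda>i. coset_class (H i) (F i) (pr i x)) I) ` G \<subseteq> (\<Pi>\<^sub>E i\<in>I. coset_class (H i) (F i) ` F i)"
      using pr_F by auto
    moreover have "finite (\<Pi>\<^sub>E i\<in>I. coset_class (H i) (F i) ` F i)"
      using fin_index_coset_class(1)[OF assms(2,1)] finite_I by (intro finite_PiE) auto
    ultimately show "finite ((\<lambda>x. restrict (\<lambda>i. coset_class (H i) (F i) (pr i x)) I) ` G)"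
      by (rule finite_subset)
    fix x y assume xy: "x \<in> G" "y \<in> G" "restrict (\<lambda>i. coset_class (H i) (F i) (pr i x)) I
        = restrict (\<lambda>i. coset_class (H i) (F i) (pr i y)) I"
    have "pr i (inverse x * y) \<in> H i" if i: "i \<in> I" for i
    proof -
      have "coset_class (H i) (F i) (pr i x) = coset_class (H i) (F i) (pr i y)"
        using fun_cong[OF xy(3), of i] i by simp
      then have "inverse (pr i x) * pr i y \<in> H i"
        using fin_index_coset_class(2)[OF assms(2)[OF i] assms(1)[OF i] pr_F[OF i xy(1)] pr_F[OF i xy(2)]] by blast
      then show ?thesis using prD(1)[OF i subgpD(3)[OF subgp_G xy(1)] xy(2)] prD(3)[OF i xy(1)] by simp
    qed
    then show "inverse x * y \<in> {x \<in> G. \<forall>i\<in>I. pr i x \<in> H i}"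
      using subgpD(2)[OF subgp_G subgpD(3)[OF subgp_G xy(1)] xy(2)] by blast
  qed
qed

end

text \<open>The isomorphisms between subgroups of the factors combine to one between the subgroups of all elements
  whose components lie in these subgroups.\<close>

lemma comm_sub_product:
  assumes "decomp G I pr" "decomp G' J pr'" and \<pi>: "bij_betw \<pi> I J"
    and c: "\<And>i. i \<in> I \<Longrightarrow> comm_sub (decomp.F G pr i) (decomp.F G' pr' (\<pi> i))"
  shows "comm_sub G G'"
proof -
  interpret D: decomp G I pr by fact
  interpret D': decomp G' J pr' by fact
  have \<pi>J: "\<pi> i \<in> J" if "i \<in> I" for i using \<pi> that by (rule bij_betwE[THEN bspec])
  have \<pi>I: "\<exists>i\<in>I. j = \<pi> i" if "j \<in> J" for j using \<pi> that unfolding bij_betw_def by blast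
  have "\<forall>i\<in>I. \<exists>H K \<phi>. subgp H \<and> H \<subseteq> D.F i \<and> fin_index H (D.F i) \<and> subgp K \<and> K \<subseteq> D'.F (\<pi> i) \<and>
      fin_index K (D'.F (\<pi> i)) \<and> hom_on H \<phi> \<and> inj_on \<phi> H \<and> \<phi> ` H = K"
    using c unfolding comm_sub_def by blast
  then obtain H K0 \<phi> where h0: "\<forall>i\<in>I. subgp (H i) \<and> H i \<subseteq> D.F i \<and> fin_index (H i) (D.F i) \<and>
      subgp (K0 i) \<and> K0 i \<subseteq> D'.F (\<pi> i) \<and> fin_index (K0 i) (D'.F (\<pi> i)) \<and> hom_on (H i) (\<phi> i) \<and> inj_on (\<phi> i) (H i) \<and> \<phi> i ` H i = K0 i"
    by metis
  define \<rho> where "\<rho> = inv_into I \<pi>"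
  have \<rho>: "\<rho> (\<pi> i) = i" if "i \<in> I" for i
    unfolding \<rho>_def using \<pi> that by (simp add: bij_betw_def)
  define K where "K j = K0 (\<rho> j)" for j
  have h: "subgp (H i)" "fin_index (H i) (D.F i)" "hom_on (H i) (\<phi> i)" "inj_on (\<phi> i) (H i)" "\<phi> i ` H i = K (\<pi> i)"
    if "i \<in> I" for i using h0 that \<rho>[OF that] unfolding K_def by auto
  have k: "subgp (K j)" "fin_index (K j) (D'.F j)" "K j \<subseteq> D'.F j" if j: "j \<in> J" for j
  proof -
    obtain i where i: "i \<in> I" "j = \<pi> i" using \<pi>I[OF j] by blast
    show "subgp (K j)" "fin_index (K j) (D'.F j)" "K j \<subseteq> D'.F j" using h0 i \<rho>[OF i(1)] unfolding K_def by auto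
  qed
  let ?H = "{x \<in> G. \<forall>i\<in>I. pr i x \<in> H i}" and ?K = "{y \<in> G'. \<forall>j\<in>J. pr' j y \<in> K j}"
  have H: "subgp ?H" "fin_index ?H G" by (rule D.fin_index_components; use h in blast)+
  have K: "subgp ?K" "fin_index ?K G'" by (rule D'.fin_index_components; use k in blast)+
  define \<Phi> where "\<Phi> x = (SOME y. y \<in> G' \<and> (\<forall>i\<in>I. pr' (\<pi> i) y = \<phi> i (pr i x)))" for x
  have \<Phi>: "\<Phi> x \<in> G' \<and> (\<forall>i\<in>I. pr' (\<pi> i) (\<Phi> x) = \<phi> i (pr i x))" if x: "x \<in> ?H" for x
  proof -
    have "\<phi> (\<rho> j) (pr (\<rho> j) x) \<in> D'.F j" if j: "j \<in> J" for j
    proof -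
      obtain i where i: "i \<in> I" "j = \<pi> i" using \<pi>I[OF j] by blast
      have "pr i x \<in> H i" using x i(1) by blast
      then have "\<phi> i (pr i x) \<in> K j" using h(5)[OF i(1)] i(2) by blast
      then show ?thesis using k(3)[OF j] \<rho>[OF i(1)] i(2) by auto
    qed
    then obtain y where "y \<in> G'" "\<forall>j\<in>J. pr' j y = \<phi> (\<rho> j) (pr (\<rho> j) x)"
      using D'.ex_with_components[of "\<lambda>j. \<phi> (\<rho> j) (pr (\<rho> j) x)"] by blast
    then have "\<exists>y. y \<in> G' \<and> (\<forall>i\<in>I. pr' (\<pi> i) y = \<phi> i (pr i x))" using \<pi>J \<rho> by auto
    then show ?thesis unfolding \<Phi>_def by (rule someI_ex)
  qed
  have eqI: "y = y'" if "y \<in> G'" "y' \<in> G'" "\<And>i. i \<in> I \<Longrightarrow> pr' (\<pi> i) y = pr' (\<pi> i) y'" for y y'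
    using D'.pr_eqI[OF that(1,2)] that(3) \<pi>I by blast
  have hom: "hom_on ?H \<Phi>" unfolding hom_on_def
  proof (intro ballI)
    fix x y assume xy: "x \<in> ?H" "y \<in> ?H"
    have xyH: "x * y \<in> ?H" by (rule subgpD(2)[OF H(1) xy])
    note \<Phi>xy = \<Phi>[OF xy(1)] \<Phi>[OF xy(2)] \<Phi>[OF xyH]
    show "\<Phi> (x * y) = \<Phi> x * \<Phi> y"
    proof (rule eqI)
      show "\<Phi> (x * y) \<in> G'" "\<Phi> x * \<Phi> y \<in> G'" using \<Phi>xy subgpD(2)[OF D'.subgp_G] by blast+
      fix i assume i: "i \<in> I"
      have "pr' (\<pi> i) (\<Phi> x * \<Phi> y) = \<phi> i (pr i x) * \<phi> i (pr i y)"
        using D'.prD(1)[OF \<pi>J[OF i], of "\<Phi> x" "\<Phi> y"] \<Phi>xy i by simp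
      also have "\<dots> = \<phi> i (pr i x * pr i y)" using h(3)[OF i] xy i unfolding hom_on_def by simp
      also have "pr i x * pr i y = pr i (x * y)" using D.prD(1)[OF i] xy by simp
      finally show "pr' (\<pi> i) (\<Phi> (x * y)) = pr' (\<pi> i) (\<Phi> x * \<Phi> y)" using \<Phi>xy(3) i by simp
    qed
  qed
  have inj: "inj_on \<Phi> ?H"
  proof (rule inj_onI)
    fix x y assume xy: "x \<in> ?H" "y \<in> ?H" "\<Phi> x = \<Phi> y"
    have "pr i x = pr i y" if i: "i \<in> I" for i
    proof -
      have "\<phi> i (pr i x) = \<phi> i (pr i y)" using \<Phi>[OF xy(1)] \<Phi>[OF xy(2)] xy(3) i by metis
      then show ?thesis using inj_onD[OF h(4)[OF i]] xy(1,2) i by blast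
    qed
    then show "x = y" using D.pr_eqI xy(1,2) by blast
  qed
  have "\<Phi> ` ?H = ?K"
  proof
    show "\<Phi> ` ?H \<subseteq> ?K"
    proof
      fix y assume "y \<in> \<Phi> ` ?H"
      then obtain x where x: "x \<in> ?H" "y = \<Phi> x" by blast
      have "pr' j y \<in> K j" if j: "j \<in> J" for j
      proof -
        obtain i where i: "i \<in> I" "j = \<pi> i" using \<pi>I[OF j] by blast
        have "pr' j y = \<phi> i (pr i x)" "pr i x \<in> H i" using \<Phi>[OF x(1)] x i by auto
        then show ?thesis using h(5)[OF i(1)] i(2) by blast
      qed
      then show "y \<in> ?K" using \<Phi>[OF x(1)] x(2) by blast
    qed
    show "?K \<subseteq> \<Phi> ` ?H"
    proof
      fix y assume y: "y \<in> ?K"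
      have "\<exists>w. w \<in> H i \<and> \<phi> i w = pr' (\<pi> i) y" if i: "i \<in> I" for i
      proof -
        have "pr' (\<pi> i) y \<in> \<phi> i ` H i" unfolding h(5)[OF i] using y \<pi>J[OF i] by blast
        then show ?thesis by (elim imageE) auto
      qed
      then obtain f where f: "\<And>i. i \<in> I \<Longrightarrow> f i \<in> H i \<and> \<phi> i (f i) = pr' (\<pi> i) y" by metis
      have "f i \<in> D.F i" if "i \<in> I" for i using f[OF that] h0 that by blast
      then obtain x where x: "x \<in> G" "\<forall>i\<in>I. pr i x = f i" using D.ex_with_components by blast
      have xH: "x \<in> ?H" using x f by auto
      have "\<Phi> x = y"
      proof (rule eqI)
        show "\<Phi> x \<in> G'" "y \<in> G'" using \<Phi>[OF xH] y by blast+
        fix i assume i: "i \<in> I"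
        show "pr' (\<pi> i) (\<Phi> x) = pr' (\<pi> i) y" using \<Phi>[OF xH] x(2) f[OF i] i by simp
      qed
      then show "y \<in> \<Phi> ` ?H" using xH by blast
    qed
  qed
  moreover have "?H \<subseteq> G" "?K \<subseteq> G'" by blast+
  ultimately show ?thesis unfolding comm_sub_def using H K hom inj by blast
qed

section \<open>Uniqueness of the decomposition up to commensurability\<close>

text \<open>Gaussian elimination over the integers: more vectors than coordinates are linearly dependent.\<close>

lemma integer_relation:
  assumes "finite J"
  shows "finite I \<Longrightarrow> card J < card I \<Longrightarrow>
    \<exists>n :: 'i \<Rightarrow> int. (\<exists>i\<in>I. n i \<noteq> 0) \<and> (\<forall>j\<in>J. (\<Sum>i\<in>I. n i * v i j) = 0)"
  using assms
proof (induction J arbitrary: I v rule: finite_induct)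
  case empty
  then obtain i where "i \<in> I" by fastforce
  then show ?case by (intro exI[of _ "\<lambda>_. 1"]) auto
next
  case (insert j J)
  show ?case
  proof (cases "\<forall>i\<in>I. v i j = 0")
    case True
    have "card J < card I" using insert.prems(2) insert.hyps by simp
    then obtain n where n: "\<exists>i\<in>I. n i \<noteq> 0" "\<forall>j\<in>J. (\<Sum>i\<in>I. n i * v i j) = 0"
      using insert.IH[OF insert.prems(1), of v] by blast
    have "(\<Sum>i\<in>I. n i * v i j) = 0" using True by (intro sum.neutral) simp
    then show ?thesis using n by blast
  next
    case False
    then obtain i0 where i0: "i0 \<in> I" "v i0 j \<noteq> 0" by blast
    let ?I = "I - {i0}" and ?w = "\<lambda>i k. v i0 j * v i k - v i j * v i0 k"
    have "card J < card ?I" using insert.prems insert.hyps i0(1) by simp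
    then obtain n where n: "\<exists>i\<in>?I. n i \<noteq> 0" "\<forall>k\<in>J. (\<Sum>i\<in>?I. n i * ?w i k) = 0"
      using insert.IH[of ?I ?w] insert.prems(1) by blast
    define n' where "n' i = (if i = i0 then - (\<Sum>i\<in>?I. n i * v i j) else n i * v i0 j)" for i
    have sum: "(\<Sum>i\<in>I. n' i * v i k) = (\<Sum>i\<in>?I. n i * ?w i k)" for k
    proof -
      have "(\<Sum>i\<in>I. n' i * v i k) = n' i0 * v i0 k + (\<Sum>i\<in>?I. n' i * v i k)"
        using insert.prems(1) i0(1) by (rule sum.remove)
      also have "(\<Sum>i\<in>?I. n' i * v i k) = (\<Sum>i\<in>?I. n i * v i0 j * v i k)"
        by (intro sum.cong) (auto simp: n'_def)
      also have "n' i0 * v i0 k = - (\<Sum>i\<in>?I. n i * v i j * v i0 k)"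
        by (simp add: n'_def sum_distrib_right)
      finally show ?thesis by (simp add: sum_subtractf[symmetric] algebra_simps)
    qed
    have "(\<Sum>i\<in>I. n' i * v i k) = 0" if "k \<in> insert j J" for k
      using that n(2) sum[of k] by (cases "k = j") (auto simp: algebra_simps)
    moreover obtain i where "i \<in> ?I" "n i \<noteq> 0" using n(1) by blast
    then have "i \<in> I" "n' i \<noteq> 0" using i0(2) by (auto simp: n'_def)
    ultimately show ?thesis by blast
  qed
qed

locale good_decomp = decomp G I pr
  for G :: "'g::mult_group set" and I :: "'i set" and pr +
  fixes l :: "'i \<Rightarrow> 'g \<Rightarrow> int" and z :: "'i \<Rightarrow> 'g"
  assumes factor: "i \<in> I \<Longrightarrow> indecomposable_group (pr i ` G) (l i) (z i)"
begin

lemma indec: "i \<in> I \<Longrightarrow> indec (F i) (l i) (z i)"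
  unfolding F_def by (rule indec.intro[OF factor])

lemmas F_virtually_central = indec.virtually_central[OF indec]

definition nonabelian :: "'i \<Rightarrow> bool" where
  "nonabelian i \<longleftrightarrow> i \<in> I \<and> (\<exists>x\<in>F i. \<exists>y\<in>F i. \<not> commute x y)"

end

text \<open>An isomorphism between subgroups \<open>U\<close> and \<open>V\<close> of finite index of two decomposed groups.\<close>

locale virtual_iso = D: good_decomp G I pr l z + D': good_decomp G' J pr' l' z'
  for G :: "'g::mult_group set" and I :: "'i set" and pr l z
    and G' :: "'h::mult_group set" and J :: "'j set" and pr' l' z' +
  fixes U :: "'g set" and V :: "'h set" and \<phi> :: "'g \<Rightarrow> 'h"
  assumes U: "subgp U" "U \<subseteq> G" "fin_index U G" and V: "subgp V" "V \<subseteq> G'" "fin_index V G'"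
    and \<phi>_hom: "hom_on U \<phi>" and \<phi>_inj: "inj_on \<phi> U" and \<phi>_image: "\<phi> ` U = V"
begin

lemmas \<phi>D = hom_onD[OF \<phi>_hom U(1)]

lemma UG: "x \<in> U \<Longrightarrow> x \<in> G" using U(2) by blast

lemma \<phi>G: "x \<in> U \<Longrightarrow> \<phi> x \<in> G'" using \<phi>_image V(2) by blast

lemma \<phi>_one: "x \<in> U \<Longrightarrow> \<phi> x = 1 \<Longrightarrow> x = 1"
  using inj_onD[OF \<phi>_inj, of x 1] \<phi>D(2) subgpD(1)[OF U(1)] by simp

lemma \<phi>_commute_iff: "x \<in> U \<Longrightarrow> y \<in> U \<Longrightarrow> commute (\<phi> x) (\<phi> y) \<longleftrightarrow> commute x y"
proof
  assume xy: "x \<in> U" "y \<in> U" "commute (\<phi> x) (\<phi> y)"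
  then have "\<phi> (x * y) = \<phi> (y * x)" using \<phi>D(1) unfolding commute_def by simp
  then show "commute x y" unfolding commute_def
    by (rule inj_onD[OF \<phi>_inj _ subgpD(2)[OF U(1) xy(1,2)] subgpD(2)[OF U(1) xy(2,1)]])
qed (rule hom_on_commute[OF \<phi>_hom])

lemma power_in_U: "x \<in> G \<Longrightarrow> \<exists>n>0. x ^ n \<in> U"
  by (rule fin_index_power[OF U(3,1) D.subgp_G])

definition \<psi> :: "'j \<Rightarrow> 'g \<Rightarrow> 'h" where "\<psi> j x = pr' j (\<phi> x)"

lemma \<psi>_hom: "j \<in> J \<Longrightarrow> hom_on U (\<psi> j)"
  unfolding hom_on_def \<psi>_def using \<phi>D(1) D'.prD(1) \<phi>G by simp

lemma \<psi>_F: "j \<in> J \<Longrightarrow> x \<in> U \<Longrightarrow> \<psi> j x \<in> D'.F j"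
  unfolding \<psi>_def using D'.pr_F \<phi>G by blast

lemma power_in_\<psi>:
  assumes "j \<in> J" "y \<in> D'.F j"
  shows "\<exists>n>0. \<exists>x\<in>U. y ^ n = \<psi> j x"
proof -
  have yG: "y \<in> G'" using D'.F_subset[OF assms(1)] assms(2) by blast
  obtain n where n: "0 < n" "y ^ n \<in> V" using fin_index_power[OF V(3,1) D'.subgp_G yG] by blast
  have "y ^ n \<in> \<phi> ` U" unfolding \<phi>_image by (rule n(2))
  then obtain x where x: "x \<in> U" "\<phi> x = y ^ n" by (elim imageE) simp
  have "\<psi> j x = y ^ n" unfolding \<psi>_def x(2) D'.prD(4)[OF assms(1) yG] D'.pr_of_F[OF assms] ..
  then show ?thesis using n(1) x(1) by metis
qed

text \<open>The image of \<open>\<psi> j\<close> contains powers of all elements of the factor \<open>j\<close>.\<close>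

lemma \<psi>_central:
  assumes "j \<in> J" "y \<in> D'.F j" "\<And>x. x \<in> U \<Longrightarrow> commute y (\<psi> j x)"
  shows "central_in (D'.F j) y"
proof (rule D'.F_virtually_central[OF assms(1,2)])
  fix w assume "w \<in> D'.F j"
  then obtain n x where "0 < n" "x \<in> U" "w ^ n = \<psi> j x" using power_in_\<psi>[OF assms(1)] by blast
  then show "\<exists>n>0. commute y (w ^ n)" using assms(3) by metis
qed

text \<open>Up to finite index, \<open>U\<close> is the product of \<open>Ui i\<close> and its complement \<open>Ri i\<close>.\<close>

definition Ui :: "'i \<Rightarrow> 'g set" where "Ui i = U \<inter> D.F i"
definition Ri :: "'i \<Rightarrow> 'g set" where "Ri i = {x \<in> U. pr i x = 1}"

lemma subgp_Ui: "i \<in> I \<Longrightarrow> subgp (Ui i)"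
  unfolding Ui_def using subgpD[OF U(1)] subgpD[OF D.subgp_F] unfolding subgp_def by auto

lemma subgp_Ri: "i \<in> I \<Longrightarrow> subgp (Ri i)"
  unfolding Ri_def subgp_def using subgpD(1-3)[OF U(1)] D.prD(1-3) UG by auto

lemma fin_index_Ui: "i \<in> I \<Longrightarrow> fin_index (Ui i) (D.F i)"
  unfolding Ui_def by (rule fin_index_Int[OF U(3,1) D.subgp_F D.F_subset])

lemma Ui_Ri_commute: "i \<in> I \<Longrightarrow> u \<in> Ui i \<Longrightarrow> r \<in> Ri i \<Longrightarrow> commute u r"
proof -
  assume i: "i \<in> I" and ur: "u \<in> Ui i" "r \<in> Ri i"
  have u: "u \<in> G" "u \<in> D.F i" and r: "r \<in> G" "pr i r = 1" using ur UG unfolding Ui_def Ri_def by auto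
  show "commute u r" unfolding D.commute_iff_pr[OF u(1) r(1)]
  proof
    fix k assume k: "k \<in> I"
    show "commute (pr k u) (pr k r)" using r(2) D.pr_of_other_F[OF k i _ u(2)] by (cases "k = i") auto
  qed
qed

lemma power_splits: "i \<in> I \<Longrightarrow> x \<in> U \<Longrightarrow> \<exists>n>0. \<exists>u\<in>Ui i. \<exists>r\<in>Ri i. x ^ n = u * r"
proof -
  assume i: "i \<in> I" and x: "x \<in> U"
  obtain n where n: "0 < n" "pr i x ^ n \<in> U" using power_in_U[OF D.pr_in[OF i UG[OF x]]] by blast
  let ?u = "pr i x ^ n" and ?r = "inverse (pr i x ^ n) * x ^ n"
  have pF: "pr i x \<in> D.F i" "pr i x \<in> G" using D.pr_F[OF i UG[OF x]] D.pr_in[OF i UG[OF x]] .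
  have uF: "?u \<in> D.F i" by (rule subgpD(4)[OF D.subgp_F[OF i] pF(1)])
  have xn: "x ^ n \<in> U" by (rule subgpD(4)[OF U(1) x])
  have rU: "?r \<in> U" by (rule subgpD(2)[OF U(1) subgpD(3)[OF U(1) n(2)] xn])
  have "pr i ?r = inverse (pr i ?u) * pr i (x ^ n)"
    using D.prD(1)[OF i subgpD(3)[OF D.subgp_G UG[OF n(2)]] UG[OF xn]] D.prD(3)[OF i UG[OF n(2)]] by simp
  also have "pr i ?u = ?u" by (rule D.pr_of_F[OF i uF])
  also have "pr i (x ^ n) = ?u" by (rule D.prD(4)[OF i UG[OF x]])
  finally have "?r \<in> Ri i" unfolding Ri_def using rU by simp
  moreover have "?u \<in> Ui i" unfolding Ui_def using n(2) uF by blast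
  moreover have "x ^ n = ?u * ?r" by simp
  ultimately show ?thesis using n(1) by blast
qed

text \<open>Indecomposability of the factor \<open>j\<close>, applied to the images of \<open>U \<inter> F\<^sub>i\<close> and of its complement.\<close>

lemma \<psi>_dichotomy:
  assumes "i \<in> I" "j \<in> J"
  shows "(\<forall>u\<in>Ui i. central_in (D'.F j) (\<psi> j u)) \<or> (\<forall>r\<in>Ri i. central_in (D'.F j) (\<psi> j r))"
proof -
  have sub: "Ui i \<subseteq> U" "Ri i \<subseteq> U" unfolding Ui_def Ri_def by blast+
  note \<psi>D = hom_onD[OF \<psi>_hom[OF assms(2)] U(1)]
  have "(\<forall>h\<in>\<psi> j ` Ui i. central_in (D'.F j) h) \<or> (\<forall>k\<in>\<psi> j ` Ri i. central_in (D'.F j) k)"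
  proof (rule indec.split[OF D'.indec[OF assms(2)]])
    show "subgp (\<psi> j ` Ui i)" "subgp (\<psi> j ` Ri i)"
      using subgp_image[OF \<psi>_hom[OF assms(2)] U(1)] sub subgp_Ui[OF assms(1)] subgp_Ri[OF assms(1)] by blast+
    show "\<psi> j ` Ui i \<subseteq> D'.F j" "\<psi> j ` Ri i \<subseteq> D'.F j" using sub \<psi>_F[OF assms(2)] by blast+
    fix h k assume "h \<in> \<psi> j ` Ui i" "k \<in> \<psi> j ` Ri i"
    then obtain u r where ur: "u \<in> Ui i" "h = \<psi> j u" "r \<in> Ri i" "k = \<psi> j r" by blast
    then show "commute h k" using hom_on_commute[OF \<psi>_hom[OF assms(2)]] Ui_Ri_commute[OF assms(1)] sub by blast
  next
    fix y assume "y \<in> D'.F j"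
    then obtain n x where n: "0 < n" "x \<in> U" "y ^ n = \<psi> j x" using power_in_\<psi>[OF assms(2)] by blast
    obtain m u r where m: "0 < m" "u \<in> Ui i" "r \<in> Ri i" "x ^ m = u * r" using power_splits[OF assms(1) n(2)] by blast
    have "y ^ (n * m) = \<psi> j (x ^ m)" unfolding power_mult n(3) by (rule \<psi>D(4)[OF n(2), symmetric])
    also have "\<dots> = \<psi> j u * \<psi> j r" unfolding m(4) using \<psi>D(1) m(2,3) sub by blast
    finally show "\<exists>n>0. \<exists>h\<in>\<psi> j ` Ui i. \<exists>k\<in>\<psi> j ` Ri i. y ^ n = h * k"
      using n(1) m(1-3) by (intro exI[of _ "n * m"]) auto
  qed
  then show ?thesis by blast
qed

text \<open>Central images are disregarded, because the correspondence of the factors is only visible modulo the centres.\<close>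

definition meets :: "'i \<Rightarrow> 'j \<Rightarrow> bool" where
  "meets i j \<longleftrightarrow> i \<in> I \<and> j \<in> J \<and> (\<exists>u\<in>Ui i. \<not> central_in (D'.F j) (\<psi> j u))"

lemma meets_complement_central: "meets i j \<Longrightarrow> r \<in> Ri i \<Longrightarrow> central_in (D'.F j) (\<psi> j r)"
  using \<psi>_dichotomy unfolding meets_def by blast

lemma meets_unique:
  assumes "meets i j" "meets k j"
  shows "i = k"
proof (rule ccontr)
  assume "i \<noteq> k"
  have ik: "i \<in> I" "k \<in> I" using assms unfolding meets_def by auto
  have "Ui k \<subseteq> Ri i" unfolding Ui_def Ri_def using D.pr_of_other_F[OF ik \<open>i \<noteq> k\<close>] by blast
  then show False using meets_complement_central[OF assms(1)] assms(2) unfolding meets_def by blast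
qed

text \<open>If \<open>F i\<close> were abelian, then \<open>u\<close> would commute with \<open>Ui i\<close> and with \<open>Ri i\<close>, and therefore its image with
  powers of all elements of the factor \<open>j\<close>.\<close>

lemma meets_nonabelian:
  assumes "meets i j"
  shows "D.nonabelian i" "D'.nonabelian j"
proof -
  obtain u where ij: "i \<in> I" "j \<in> J" and u: "u \<in> Ui i" "\<not> central_in (D'.F j) (\<psi> j u)"
    using assms unfolding meets_def by blast
  have uU: "u \<in> U" "u \<in> D.F i" using u(1) unfolding Ui_def by auto
  show "D'.nonabelian j"
    unfolding D'.nonabelian_def using ij(2) u(2) \<psi>_F[OF ij(2) uU(1)] unfolding central_in_def by blast
  show "D.nonabelian i"
  proof (rule ccontr)
    assume "\<not> D.nonabelian i"
    then have ab: "commute x y" if "x \<in> D.F i" "y \<in> D.F i" for x y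
      using that ij(1) unfolding D.nonabelian_def by blast
    have "central_in (D'.F j) (\<psi> j u)"
    proof (rule D'.F_virtually_central[OF ij(2) \<psi>_F[OF ij(2) uU(1)]])
      fix y assume "y \<in> D'.F j"
      then obtain n x where n: "0 < n" "x \<in> U" "y ^ n = \<psi> j x" using power_in_\<psi>[OF ij(2)] by blast
      obtain m v r where m: "0 < m" "v \<in> Ui i" "r \<in> Ri i" "x ^ m = v * r" using power_splits[OF ij(1) n(2)] by blast
      have "commute u v" using ab uU(2) m(2) unfolding Ui_def by blast
      then have "commute u (x ^ m)" unfolding m(4) by (rule commute_mult[OF _ Ui_Ri_commute[OF ij(1) u(1) m(3)]])
      then have "commute (\<psi> j u) (\<psi> j (x ^ m))"
        by (rule hom_on_commute[OF \<psi>_hom[OF ij(2)] uU(1) subgpD(4)[OF U(1) n(2)]])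
      also have "\<psi> j (x ^ m) = y ^ (n * m)"
        unfolding power_mult n(3) by (rule hom_onD(4)[OF \<psi>_hom[OF ij(2)] U(1) n(2)])
      finally show "\<exists>n>0. commute (\<psi> j u) (y ^ n)" using n(1) m(1) by (intro exI[of _ "n * m"]) simp
    qed
    then show False using u(2) by blast
  qed
qed

text \<open>Two elements of \<open>Ui i\<close> that do not commute have images that do not commute, and this is visible in one of the
  components.\<close>

lemma nonabelian_meets:
  assumes "D.nonabelian i"
  shows "\<exists>j. meets i j"
proof -
  obtain x y where i: "i \<in> I" and xy: "x \<in> D.F i" "y \<in> D.F i" "\<not> commute x y"
    using assms unfolding D.nonabelian_def by blast
  \<comment> \<open>powers of all elements lie in \<open>U\<close>, and not all of these powers commute\<close>
  have "\<exists>u\<in>Ui i. \<exists>v\<in>Ui i. \<not> commute u v"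
  proof (rule ccontr)
    assume "\<not> ?thesis"
    then have com: "commute u v" if "u \<in> Ui i" "v \<in> Ui i" for u v using that by blast
    have power: "\<exists>n>0. w ^ n \<in> Ui i" if "w \<in> D.F i" for w
      using power_in_U[of w] D.F_subset[OF i] subgpD(4)[OF D.subgp_F[OF i] that] that unfolding Ui_def by blast
    obtain n where n: "0 < n" "x ^ n \<in> Ui i" using power[OF xy(1)] by blast
    have cen: "central_in (D.F i) u" if u: "u \<in> Ui i" for u
    proof (rule D.F_virtually_central[OF i])
      show "u \<in> D.F i" using u unfolding Ui_def by blast
      fix w assume "w \<in> D.F i"
      then show "\<exists>n>0. commute u (w ^ n)" using power com[OF u] by blast
    qed
    have "central_in (D.F i) y"
    proof (rule D.F_virtually_central[OF i xy(2)])
      fix w assume w: "w \<in> D.F i"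
      obtain m where "0 < m" "w ^ m \<in> Ui i" using power[OF w] by blast
      then show "\<exists>n>0. commute y (w ^ n)" using cen xy(2) commute_sym unfolding central_in_def by blast
    qed
    then have "commute y x" using xy(1) unfolding central_in_def by blast
    then show False using xy(3) commute_sym by blast
  qed
  then obtain u v where uv: "u \<in> Ui i" "v \<in> Ui i" "\<not> commute u v" by blast
  then have UV: "u \<in> U" "v \<in> U" unfolding Ui_def by auto
  have "\<not> commute (\<phi> u) (\<phi> v)" using \<phi>_commute_iff[OF UV] uv(3) by blast
  then obtain j where j: "j \<in> J" "\<not> commute (\<psi> j u) (\<psi> j v)"
    using D'.commute_iff_pr[OF \<phi>G \<phi>G, OF UV] unfolding \<psi>_def by blast
  then have "\<not> central_in (D'.F j) (\<psi> j u)" using \<psi>_F[OF j(1) UV(2)] unfolding central_in_def by blast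
  then show ?thesis unfolding meets_def using i j(1) uv(1) by blast
qed

lemma card_nonabelian_le: "card {i. D.nonabelian i} \<le> card {j. D'.nonabelian j}"
proof -
  have "\<forall>i. D.nonabelian i \<longrightarrow> (\<exists>j. meets i j)" using nonabelian_meets by blast
  then obtain g where g: "\<And>i. D.nonabelian i \<Longrightarrow> meets i (g i)" by metis
  show ?thesis
  proof (rule card_inj_on_le[where f = g])
    show "inj_on g {i. D.nonabelian i}" by (rule inj_onI) (use g meets_unique in \<open>metis mem_Collect_eq\<close>)
    show "g ` {i. D.nonabelian i} \<subseteq> {j. D'.nonabelian j}" using g meets_nonabelian(2) by blast
    show "finite {j. D'.nonabelian j}"
      using D'.finite_I by (rule finite_subset[rotated]) (auto simp: D'.nonabelian_def)
  qed
qed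

text \<open>Powers of the central elements \<open>z i\<close> lie in \<open>U\<close>. If there were more of them than factors of \<open>G'\<close>,
  an integral relation between the lengths of the components of their images would give a central
  element of \<open>U\<close> whose image has only components of length zero. The image is then trivial, but
  the element is not.\<close>

lemma card_factors_le: "card I \<le> card J"
proof (rule ccontr)
  assume "\<not> card I \<le> card J"
  then have less: "card J < card I" by simp
  have zF: "z i \<in> D.F i" "z i \<in> G" "central_in (D.F i) (z i)" "0 < l i (z i)" if "i \<in> I" for i
    using indec.z[OF D.indec[OF that]] D.F_subset[OF that] by auto
  have "\<forall>i\<in>I. \<exists>n>0. z i ^ n \<in> U" using power_in_U zF(2) by blast
  then obtain e where e: "\<And>i. i \<in> I \<Longrightarrow> 0 < e i \<and> z i ^ e i \<in> U" by metis
  let ?w = "\<lambda>i. z i ^ e i"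
  have wF: "?w i \<in> D.F i" if "i \<in> I" for i using subgpD(4)[OF D.subgp_F[OF that] zF(1)[OF that]] .
  have w_central: "commute (?w i) x" if i: "i \<in> I" and x: "x \<in> G" for i x
    unfolding D.commute_iff_pr[OF subsetD[OF D.F_subset[OF i] wF[OF i]] x]
  proof
    fix k assume k: "k \<in> I"
    have "commute (z i ^ e i) (pr i x)"
      using zF(3)[OF i] D.pr_F[OF i x] commute_left(3) unfolding central_in_def by blast
    then show "commute (pr k (?w i)) (pr k x)"
      using D.pr_of_F[OF i wF[OF i]] D.pr_of_other_F[OF k i _ wF[OF i]] by (cases "k = i") auto
  qed
  let ?v = "\<lambda>i j. l' j (\<psi> j (?w i))"
  obtain n where n: "\<exists>i\<in>I. n i \<noteq> 0" "\<forall>j\<in>J. (\<Sum>i\<in>I. n i * ?v i j) = 0"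
    using integer_relation[OF D'.finite_I D.finite_I less, of ?v] by blast
  have "\<exists>g\<in>U. (\<forall>i\<in>I. pr i g = (if i \<in> K then ?w i powi n i else 1)) \<and> (\<forall>x\<in>G. commute g x) \<and>
      (\<forall>j\<in>J. l' j (\<psi> j g) = (\<Sum>i\<in>K. n i * ?v i j))" if "finite K" "K \<subseteq> I" for K
    using that
  proof (induction K rule: finite_induct)
    case empty
    have "\<psi> j 1 = 1" if "j \<in> J" for j using hom_onD(2)[OF \<psi>_hom[OF that] U(1)] .
    then show ?case
      using subgpD(1)[OF U(1)] D.prD(2) indec.l_one[OF D'.indec] by (intro bexI[of _ 1]) auto
  next
    case (insert k K)
    then obtain g where g: "g \<in> U" "\<forall>i\<in>I. pr i g = (if i \<in> K then ?w i powi n i else 1)"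
        "\<forall>x\<in>G. commute g x" "\<forall>j\<in>J. l' j (\<psi> j g) = (\<Sum>i\<in>K. n i * ?v i j)" by auto
    have k: "k \<in> I" using insert.prems by blast
    let ?y = "?w k powi n k"
    have yU: "?y \<in> U" using subgpD(5)[OF U(1)] e[OF k] by blast
    have yF: "?y \<in> D.F k" using subgpD(5)[OF D.subgp_F[OF k] wF[OF k]] .
    have pr: "pr i (?y * g) = (if i \<in> insert k K then ?w i powi n i else 1)" if i: "i \<in> I" for i
      using D.prD(1)[OF i UG[OF yU] UG[OF g(1)]] g(2) i D.pr_of_F[OF k yF] D.pr_of_other_F[OF i k _ yF] insert.hyps(2)
      by (cases "i = k") auto
    have com: "commute (?y * g) x" if "x \<in> G" for x
      using commute_left(1)[OF commute_sym[OF commute_powi[OF commute_sym[OF w_central[OF k that]]]]] g(3) that by blast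
    have len: "l' j (\<psi> j (?y * g)) = (\<Sum>i\<in>insert k K. n i * ?v i j)" if j: "j \<in> J" for j
    proof -
      note \<psi>D = hom_onD[OF \<psi>_hom[OF j] U(1)]
      have wU: "?w k \<in> U" using e[OF k] by blast
      have "l' j (\<psi> j (?y * g)) = l' j (\<psi> j ?y) + l' j (\<psi> j g)"
        unfolding \<psi>D(1)[OF yU g(1)] by (rule indec.l_mult[OF D'.indec[OF j] \<psi>_F[OF j yU] \<psi>_F[OF j g(1)]])
      also have "l' j (\<psi> j ?y) = n k * ?v k j"
        unfolding \<psi>D(5)[OF wU] by (rule indec.l_powi[OF D'.indec[OF j] \<psi>_F[OF j wU]])
      finally show ?thesis using g(4) j insert.hyps by simp
    qed
    have "?y * g \<in> U" by (rule subgpD(2)[OF U(1) yU g(1)])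
    then show ?case using pr com len by blast
  qed
  from this[OF D.finite_I order_refl] obtain g where g: "g \<in> U" "\<forall>i\<in>I. pr i g = ?w i powi n i"
      "\<forall>x\<in>G. commute g x" "\<forall>j\<in>J. l' j (\<psi> j g) = (\<Sum>i\<in>I. n i * ?v i j)" by auto
  have "\<psi> j g = 1" if j: "j \<in> J" for j
  proof (rule indec.central_l_zero[OF D'.indec[OF j] \<psi>_F[OF j g(1)]])
    show "central_in (D'.F j) (\<psi> j g)"
    proof (rule \<psi>_central[OF j \<psi>_F[OF j g(1)]])
      fix x assume x: "x \<in> U"
      show "commute (\<psi> j g) (\<psi> j x)" using hom_on_commute[OF \<psi>_hom[OF j] g(1) x] g(3) UG[OF x] by blast
    qed
    show "l' j (\<psi> j g) = 0" using g(4) n(2) j by simp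
  qed
  then have "\<phi> g = 1" using D'.pr_trivial[OF \<phi>G[OF g(1)]] unfolding \<psi>_def by blast
  then have g1: "g = 1" by (rule \<phi>_one[OF g(1)])
  obtain i where i: "i \<in> I" "n i \<noteq> 0" using n(1) by blast
  have "?w i powi n i = 1" using g(2) i(1) g1 D.prD(2)[OF i(1)] by simp
  moreover have "l i (?w i powi n i) = n i * (int (e i) * l i (z i))"
    using indec.l_powi[OF D.indec[OF i(1)] wF[OF i(1)]] indec.l_power[OF D.indec[OF i(1)] zF(1)[OF i(1)]] by simp
  ultimately have "n i * (int (e i) * l i (z i)) = 0" using indec.l_one[OF D.indec[OF i(1)]] by simp
  then show False using i(2) e[OF i(1)] zF(4)[OF i(1)] by simp
qed

text \<open>The components of \<open>\<phi> u\<close> other than the \<open>j\<close>-th one are central for all \<open>u\<close> in \<open>Ui i\<close>, so \<open>u\<close> is central if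
  \<open>\<psi> j u\<close> is. As \<open>\<psi> j\<close> has central values on \<open>Ri i\<close>, the image of \<open>Ui i\<close> has finite index modulo the
  centre.\<close>

lemma meets_commensurable:
  assumes ij: "meets i j" and only: "\<And>k. meets i k \<Longrightarrow> k = j"
  shows "comm_sub (D.F i) (D'.F j)"
proof -
  have i: "i \<in> I" and j: "j \<in> J" using ij unfolding meets_def by auto
  note \<psi>D = hom_onD[OF \<psi>_hom[OF j] U(1)]
  have UiU: "Ui i \<subseteq> U" "Ui i \<subseteq> D.F i" unfolding Ui_def by auto
  have RiU: "Ri i \<subseteq> U" unfolding Ri_def by auto
  have V': "fin_index V G'" "subgp V" using V by blast+
  \<comment> \<open>write \<open>y = r y * \<phi> (x y)\<close> with a representative \<open>r y\<close> of its coset; \<open>c\<close> records this coset and that of the \<open>i\<close>-th component of \<open>x y\<close>\<close>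
  define c where "c y = (coset_class V G' y,
      coset_class (Ui i) (D.F i) (pr i (inv_into U \<phi> (inverse (SOME y'. y' \<in> D'.F j \<and> coset_class V G' y' = coset_class V G' y) * y))))" for y
  define r where "r y = (SOME y'. y' \<in> D'.F j \<and> coset_class V G' y' = coset_class V G' y)" for y
  have r: "r y \<in> D'.F j" "coset_class V G' (r y) = coset_class V G' y" if "y \<in> D'.F j" for y
    unfolding r_def using someI[of "\<lambda>y'. y' \<in> D'.F j \<and> coset_class V G' y' = coset_class V G' y" y] that by blast+
  define x where "x y = inv_into U \<phi> (inverse (r y) * y)" for y
  have FG: "y \<in> G'" if "y \<in> D'.F j" for y using D'.F_subset[OF j] that by blast
  have x: "x y \<in> U" "\<phi> (x y) = inverse (r y) * y" if y: "y \<in> D'.F j" for y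
  proof -
    have "inverse (r y) * y \<in> V" by (rule fin_index_coset_class(2)[OF V' FG[OF r(1)[OF y]] FG[OF y] r(2)[OF y]])
    then have "inverse (r y) * y \<in> \<phi> ` U" using \<phi>_image by simp
    then show "x y \<in> U" "\<phi> (x y) = inverse (r y) * y" unfolding x_def by (rule inv_into_into, rule f_inv_into_f)
  qed
  have c: "c y = (coset_class V G' y, coset_class (Ui i) (D.F i) (pr i (x y)))" for y
    unfolding c_def x_def r_def ..
  show ?thesis
  proof (rule commensurable_mod_centre[where U = "Ui i" and \<psi> = "\<psi> j" and c = c])
    show "indecomposable_group (D.F i) (l i) (z i)" "indecomposable_group (D'.F j) (l' j) (z' j)"
      unfolding D.F_def D'.F_def by (rule D.factor[OF i], rule D'.factor[OF j])
    show "subgp (Ui i)" "Ui i \<subseteq> D.F i" "fin_index (Ui i) (D.F i)"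
      by (rule subgp_Ui[OF i], rule UiU(2), rule fin_index_Ui[OF i])
    show "hom_on (Ui i) (\<psi> j)" by (rule hom_on_subset[OF \<psi>_hom[OF j] UiU(1)])
    show "\<psi> j ` Ui i \<subseteq> D'.F j" using \<psi>_F[OF j] UiU(1) by blast
    fix u assume u: "u \<in> Ui i"
    then have uU: "u \<in> U" "u \<in> D.F i" using UiU by blast+
    show "central_in (D'.F j) (\<psi> j u)" if "central_in (D.F i) u"
    proof (rule D'.F_virtually_central[OF j \<psi>_F[OF j uU(1)]])
      fix y assume "y \<in> D'.F j"
      then obtain n w where n: "0 < n" "w \<in> U" "y ^ n = \<psi> j w" using power_in_\<psi>[OF j] by blast
      have "commute u (pr i w)" using that D.pr_F[OF i UG[OF n(2)]] unfolding central_in_def by blast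
      then have "commute (pr k u) (pr k w)" if "k \<in> I" for k
        using D.pr_of_F[OF i uU(2)] D.pr_of_other_F[OF that i _ uU(2)] by (cases "k = i") auto
      then have "commute u w" using D.commute_iff_pr[OF UG UG, OF uU(1) n(2)] by blast
      then have "commute (\<psi> j u) (y ^ n)" unfolding n(3) by (rule hom_on_commute[OF \<psi>_hom[OF j] uU(1) n(2)])
      then show "\<exists>n>0. commute (\<psi> j u) (y ^ n)" using n(1) by blast
    qed
    show "central_in (D.F i) u" if cen: "central_in (D'.F j) (\<psi> j u)"
    proof (rule D.F_virtually_central[OF i uU(2)])
      have all: "central_in (D'.F k) (\<psi> k u)" if "k \<in> J" for k
        using cen only u i that unfolding meets_def by blast
      fix w assume w: "w \<in> D.F i"
      obtain n where n: "0 < n" "w ^ n \<in> U" using power_in_U D.F_subset[OF i] w by blast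
      have "commute (\<psi> k u) (\<psi> k (w ^ n))" if "k \<in> J" for k
        using all[OF that] \<psi>_F[OF that n(2)] unfolding central_in_def by blast
      then have "commute (\<phi> u) (\<phi> (w ^ n))"
        unfolding D'.commute_iff_pr[OF \<phi>G \<phi>G, OF uU(1) n(2)] \<psi>_def by blast
      then show "\<exists>n>0. commute u (w ^ n)" using \<phi>_commute_iff[OF uU(1) n(2)] n(1) by blast
    qed
  next
    have "c ` D'.F j \<subseteq> (coset_class V G' ` G') \<times> (coset_class (Ui i) (D.F i) ` D.F i)"
      unfolding c using FG D.pr_F[OF i UG] x(1) by blast
    moreover have "finite ((coset_class V G' ` G') \<times> (coset_class (Ui i) (D.F i) ` D.F i))"
      using fin_index_coset_class(1)[OF V'] fin_index_coset_class(1)[OF fin_index_Ui[OF i] subgp_Ui[OF i]] by blast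
    ultimately show "finite (c ` D'.F j)" by (rule finite_subset)
  next
    fix y1 y2 assume y: "y1 \<in> D'.F j" "y2 \<in> D'.F j" "c y1 = c y2"
    have "r y1 = r y2" using y(3) unfolding c r_def by simp
    define g where "g = inverse (x y1) * x y2"
    have gU: "g \<in> U" unfolding g_def by (rule subgpD(2)[OF U(1) subgpD(3)[OF U(1) x(1)[OF y(1)]] x(1)[OF y(2)]])
    have "\<phi> g = inverse y1 * y2"
      unfolding g_def using \<phi>D(1)[OF subgpD(3)[OF U(1) x(1)[OF y(1)]] x(1)[OF y(2)]] \<phi>D(3)[OF x(1)[OF y(1)]]
        x(2)[OF y(1)] x(2)[OF y(2)] \<open>r y1 = r y2\<close> by (simp add: inv_mult mult.assoc)
    moreover have yF: "inverse y1 * y2 \<in> D'.F j"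
      by (rule subgpD(2)[OF D'.subgp_F[OF j] subgpD(3)[OF D'.subgp_F[OF j] y(1)] y(2)])
    ultimately have \<psi>g: "\<psi> j g = inverse y1 * y2" unfolding \<psi>_def using D'.pr_of_F[OF j] by simp
    have "inverse (pr i (x y1)) * pr i (x y2) \<in> Ui i"
      using fin_index_coset_class(2)[OF fin_index_Ui[OF i] subgp_Ui[OF i] D.pr_F D.pr_F]
        i UG x(1)[OF y(1)] x(1)[OF y(2)] y(3) unfolding c by simp
    also have "inverse (pr i (x y1)) * pr i (x y2) = pr i g"
      unfolding g_def using D.prD(1)[OF i subgpD(3)[OF D.subgp_G UG[OF x(1)[OF y(1)]]] UG[OF x(1)[OF y(2)]]]
        D.prD(3)[OF i UG[OF x(1)[OF y(1)]]] by simp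
    finally have u: "pr i g \<in> Ui i" .
    then have uU: "pr i g \<in> U" using UiU by blast
    let ?s = "inverse (pr i g) * g"
    have sU: "?s \<in> U" by (rule subgpD(2)[OF U(1) subgpD(3)[OF U(1) uU] gU])
    have "pr i ?s = 1"
      using D.prD(1)[OF i subgpD(3)[OF D.subgp_G UG[OF uU]] UG[OF gU]] D.prD(3)[OF i UG[OF uU]]
        D.pr_same[OF i UG[OF gU]] by simp
    then have "central_in (D'.F j) (\<psi> j ?s)"
      using meets_complement_central[OF ij] sU unfolding Ri_def by blast
    moreover have "\<psi> j g = \<psi> j (pr i g) * \<psi> j ?s" using \<psi>D(1)[OF uU sU] by simp
    ultimately show "\<exists>u\<in>Ui i. \<exists>w\<in>D'.F j. central_in (D'.F j) w \<and> inverse y1 * y2 = \<psi> j u * w"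
      using u \<psi>g \<psi>_F[OF j sU] by metis
  qed
qed

end

text \<open>Modulo the centre abelian groups are trivial, so the trivial homomorphism will do.\<close>

lemma abelian_factors_commensurable:
  assumes A: "indecomposable_group A l z" and B: "indecomposable_group B l' z'"
    and ab: "\<And>x y. x \<in> A \<Longrightarrow> y \<in> A \<Longrightarrow> commute x y" "\<And>x y. x \<in> B \<Longrightarrow> y \<in> B \<Longrightarrow> commute x y"
  shows "comm_sub A B"
proof (rule commensurable_mod_centre[OF A B, where U = A and \<psi> = "\<lambda>_. 1" and c = "\<lambda>_. ()"])
  interpret A: indec A l z by (rule indec.intro[OF A])
  interpret B: indec B l' z' by (rule indec.intro[OF B])
  show "subgp A" "A \<subseteq> A" by (rule A.sub, rule order_refl)
  show "fin_index A A"
    by (rule fin_indexI[OF A.sub, where c = "\<lambda>_. ()"]) (use subgpD[OF A.sub] in auto)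
  show "hom_on A (\<lambda>_. 1 :: 'b)" by (simp add: hom_on_def)
  show "(\<lambda>_. 1) ` A \<subseteq> B" using subgpD(1)[OF B.sub] by blast
  show "central_in A x" if "x \<in> A" for x using ab(1) that unfolding central_in_def by blast
  show "central_in B 1" by (rule central_in_closed(4))
  show "\<exists>u\<in>A. \<exists>w\<in>B. central_in B w \<and> inverse x * y = 1 * w" if "x \<in> B" "y \<in> B" for x y
  proof -
    have "inverse x * y \<in> B" by (rule subgpD(2)[OF B.sub subgpD(3)[OF B.sub that(1)] that(2)])
    then show ?thesis using ab(2) A.z(1) unfolding central_in_def by auto
  qed
qed simp

context virtual_iso
begin

lemma inverse_virtual_iso: "virtual_iso G' J pr' l' z' G I pr l z V U (inv_into U \<phi>)"
proof unfold_locales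
  let ?\<phi>' = "inv_into U \<phi>"
  have inv: "?\<phi>' (\<phi> x) = x" if "x \<in> U" for x using \<phi>_inj that by simp
  show "hom_on V ?\<phi>'" unfolding hom_on_def
  proof (intro ballI)
    fix a b assume "a \<in> V" "b \<in> V"
    then obtain x y where xy: "x \<in> U" "a = \<phi> x" "y \<in> U" "b = \<phi> y" unfolding \<phi>_image[symmetric] by (elim imageE) simp
    have "a * b = \<phi> (x * y)" using xy \<phi>D(1) by simp
    then show "?\<phi>' (a * b) = ?\<phi>' a * ?\<phi>' b" using inv xy subgpD(2)[OF U(1) xy(1,3)] by simp
  qed
  show "inj_on ?\<phi>' V" by (rule inj_on_inv_into) (simp add: \<phi>_image)
  show "?\<phi>' ` V = U" unfolding \<phi>_image[symmetric] using inv by force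
qed (rule U V)+

text \<open>The relation \<open>meets\<close> is a bijection between the non-abelian factors: it is injective by
  indecomposability, and by symmetry both groups have the same number of non-abelian factors. The
  abelian factors are virtually infinite cyclic, and their number is determined by the rank of the
  centre.\<close>

theorem factors_matched:
  "\<exists>\<pi>. bij_betw \<pi> I J \<and> (\<forall>i\<in>I. comm_sub (D.F i) (D'.F (\<pi> i)))"
proof -
  interpret inverse: virtual_iso G' J pr' l' z' G I pr l z V U "inv_into U \<phi>" by (rule inverse_virtual_iso)
  let ?N = "{i. D.nonabelian i}" and ?N' = "{j. D'.nonabelian j}"
  have NI: "?N \<subseteq> I" "?N' \<subseteq> J" unfolding D.nonabelian_def D'.nonabelian_def by auto
  then have fin: "finite ?N" "finite ?N'" using D.finite_I D'.finite_I finite_subset by blast+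
  have cards: "card ?N = card ?N'" "card I = card J"
    using card_nonabelian_le inverse.card_nonabelian_le card_factors_le inverse.card_factors_le by simp_all
  have "\<forall>i. D.nonabelian i \<longrightarrow> (\<exists>j. meets i j)" using nonabelian_meets by blast
  then obtain g where g: "\<And>i. D.nonabelian i \<Longrightarrow> meets i (g i)" by metis
  have "inj_on g ?N" by (rule inj_onI) (use g meets_unique in \<open>metis mem_Collect_eq\<close>)
  moreover have "g ` ?N \<subseteq> ?N'" using g meets_nonabelian(2) by blast
  ultimately have bij_g: "bij_betw g ?N ?N'"
    unfolding bij_betw_def using card_image[of g ?N] cards(1) card_subset_eq[OF fin(2)] by simp
  have only: "k = g i" if "meets i k" for i k
  proof -
    have "k \<in> ?N'" using meets_nonabelian(2)[OF that] by simp
    then obtain i' where i': "D.nonabelian i'" "k = g i'" using bij_g unfolding bij_betw_def by blast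
    then have "i' = i" using meets_unique[OF g[OF i'(1)]] that by simp
    then show ?thesis using i'(2) by simp
  qed
  have "card (I - ?N) = card (J - ?N')"
    using card_Diff_subset[OF fin(1) NI(1)] card_Diff_subset[OF fin(2) NI(2)] cards by simp
  then obtain h where h: "bij_betw h (I - ?N) (J - ?N')"
    using finite_same_card_bij[of "I - ?N" "J - ?N'"] D.finite_I D'.finite_I by blast
  define \<pi> where "\<pi> i = (if i \<in> ?N then g i else h i)" for i
  have "bij_betw \<pi> (?N \<union> (I - ?N)) (?N' \<union> (J - ?N'))"
  proof (rule bij_betw_combine)
    show "bij_betw \<pi> ?N ?N'" using bij_g by (rule bij_betw_cong[THEN iffD1, rotated]) (simp add: \<pi>_def)
    show "bij_betw \<pi> (I - ?N) (J - ?N')" using h by (rule bij_betw_cong[THEN iffD1, rotated]) (simp add: \<pi>_def)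
  qed blast
  moreover have "?N \<union> (I - ?N) = I" "?N' \<union> (J - ?N') = J" using NI by blast+
  ultimately have "bij_betw \<pi> I J" by simp
  moreover have "comm_sub (D.F i) (D'.F (\<pi> i))" if i: "i \<in> I" for i
  proof (cases "D.nonabelian i")
    case True
    then have "comm_sub (D.F i) (D'.F (g i))" using meets_commensurable[OF g[OF True] only] by blast
    then show ?thesis using True unfolding \<pi>_def by simp
  next
    case False
    then have hi: "h i \<in> J" "\<not> D'.nonabelian (h i)" using bij_betwE[OF h] i by auto
    have "comm_sub (D.F i) (D'.F (h i))"
    proof (rule abelian_factors_commensurable)
      show "indecomposable_group (D.F i) (l i) (z i)" unfolding D.F_def by (rule D.factor[OF i])
      show "indecomposable_group (D'.F (h i)) (l' (h i)) (z' (h i))" unfolding D'.F_def by (rule D'.factor[OF hi(1)])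
    qed (use False hi i in \<open>auto simp: D.nonabelian_def D'.nonabelian_def\<close>)
    then show ?thesis using False unfolding \<pi>_def by simp
  qed
  ultimately show ?thesis by blast
qed

end

lemma comm_sub_factors_matched:
  assumes "good_decomp G I pr l z" "good_decomp G' J pr' l' z'" "comm_sub G G'"
  shows "\<exists>\<pi>. bij_betw \<pi> I J \<and> (\<forall>i\<in>I. comm_sub (decomp.F G pr i) (decomp.F G' pr' (\<pi> i)))"
proof -
  obtain H K \<phi> where "subgp H" "H \<subseteq> G" "fin_index H G" "subgp K" "K \<subseteq> G'" "fin_index K G'"
      "hom_on H \<phi>" "inj_on \<phi> H" "\<phi> ` H = K"
    using assms(3) unfolding comm_sub_def by blast
  then have "virtual_iso G I pr l z G' J pr' l' z' H K \<phi>"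
    using assms(1,2) unfolding virtual_iso_def virtual_iso_axioms_def by blast
  then show ?thesis by (rule virtual_iso.factors_matched)
qed

section \<open>Passing from carrier-based groups to the type class\<close>

text \<open>By Cayley's theorem every group is a group of bijections of its elements; the bijections of a type
  form a group in the sense of the type class.\<close>

typedef 'a bijection = "{f :: 'a \<Rightarrow> 'a. bij f}" by auto

setup_lifting type_definition_bijection

instantiation bijection :: (type) mult_group
begin

lift_definition one_bijection :: "'a bijection" is id by simp

lift_definition times_bijection :: "'a bijection \<Rightarrow> 'a bijection \<Rightarrow> 'a bijection" is "(\<circ>)" by (rule bij_comp)

lift_definition inverse_bijection :: "'a bijection \<Rightarrow> 'a bijection" is "inv_into UNIV" by (rule bij_imp_bij_inv)

definition divide_bijection :: "'a bijection \<Rightarrow> 'a bijection \<Rightarrow> 'a bijection" where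
  "divide_bijection x y = x * inverse y"

instance by standard (transfer, simp add: fun_eq_iff bij_is_inj)+

end

definition group_embedding :: "('a, 'x) monoid_scheme \<Rightarrow> ('a \<Rightarrow> 'g::mult_group) \<Rightarrow> 'g set \<Rightarrow> bool" where
  "group_embedding G f A \<longleftrightarrow> group G \<and> inj_on f (carrier G) \<and>
    (\<forall>x\<in>carrier G. \<forall>y\<in>carrier G. f (x \<otimes>\<^bsub>G\<^esub> y) = f x * f y) \<and> f ` carrier G = A"

lemma cayley:
  assumes "group G"
  shows "\<exists>(f :: 'a \<Rightarrow> 'a bijection) A. group_embedding G f A"
proof -
  interpret group G by fact
  define act where "act X Y = (if Y \<in> carrier G then X \<otimes>\<^bsub>G\<^esub> Y else Y)" for X Y
  have bij: "bij (act X)" if X: "X \<in> carrier G" for X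
  proof (rule o_bij)
    show "act (inv\<^bsub>G\<^esub> X) \<circ> act X = id" using X by (auto simp: act_def fun_eq_iff m_assoc[symmetric])
    show "act X \<circ> act (inv\<^bsub>G\<^esub> X) = id" using X by (auto simp: act_def fun_eq_iff m_assoc[symmetric])
  qed
  define f where "f X = Abs_bijection (act X)" for X
  have rep: "Rep_bijection (f X) = act X" if "X \<in> carrier G" for X
    unfolding f_def using bij[OF that] by (simp add: Abs_bijection_inverse)
  have "inj_on f (carrier G)"
  proof (rule inj_onI)
    fix X Y assume XY: "X \<in> carrier G" "Y \<in> carrier G" "f X = f Y"
    then have "act X \<one>\<^bsub>G\<^esub> = act Y \<one>\<^bsub>G\<^esub>" using rep by metis
    then show "X = Y" using XY by (simp add: act_def)
  qed
  moreover have "f (X \<otimes>\<^bsub>G\<^esub> Y) = f X * f Y" if XY: "X \<in> carrier G" "Y \<in> carrier G" for X Y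
  proof -
    have "Rep_bijection (f (X \<otimes>\<^bsub>G\<^esub> Y)) = Rep_bijection (f X * f Y)"
      unfolding times_bijection.rep_eq rep[OF XY(1)] rep[OF XY(2)] rep[OF m_closed[OF XY]]
      using XY by (auto simp: act_def fun_eq_iff m_assoc)
    then show ?thesis by (simp add: Rep_bijection_inject)
  qed
  ultimately show ?thesis unfolding group_embedding_def using assms by blast
qed

text \<open>If \<open>d\<close> factors through \<open>c\<close>, it has at most as many values.\<close>

lemma finite_image_factor:
  assumes "finite (c ` A)" "\<And>x y. x \<in> A \<Longrightarrow> y \<in> A \<Longrightarrow> c x = c y \<Longrightarrow> d x = d y"
  shows "finite (d ` A)"
proof -
  have "d ` A \<subseteq> (\<lambda>k. d (SOME x. x \<in> A \<and> c x = k)) ` c ` A"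
  proof
    fix w assume "w \<in> d ` A"
    then obtain x where x: "x \<in> A" "w = d x" by blast
    let ?y = "SOME y. y \<in> A \<and> c y = c x"
    have "?y \<in> A \<and> c ?y = c x" by (rule someI[of "\<lambda>y. y \<in> A \<and> c y = c x" x]) (use x in simp)
    then have "d ?y = w" using assms(2)[of ?y x] x by simp
    then show "w \<in> (\<lambda>k. d (SOME x. x \<in> A \<and> c x = k)) ` c ` A" using x(1) by blast
  qed
  then show ?thesis using assms(1) finite_surj by blast
qed

locale embedded_group = group G for G (structure) +
  fixes f :: "'a \<Rightarrow> 'g::mult_group" and A :: "'g set"
  assumes emb: "group_embedding G f A"
begin

lemma f_inj: "inj_on f (carrier G)"
  and f_mult: "x \<in> carrier G \<Longrightarrow> y \<in> carrier G \<Longrightarrow> f (x \<otimes> y) = f x * f y"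
  and f_image: "f ` carrier G = A"
  using emb unfolding group_embedding_def by auto

lemma f_one: "f \<one> = 1"
proof -
  have "f \<one> * f \<one> = f \<one> * 1" using f_mult[of \<one> \<one>] by simp
  then show ?thesis unfolding mult_cancel_left_iff .
qed

lemma f_inv: "x \<in> carrier G \<Longrightarrow> f (inv x) = inverse (f x)"
  using f_mult[of x "inv x"] f_one by (intro mult_group_class.inv_unique[symmetric]) simp

lemma f_eq_iff: "x \<in> carrier G \<Longrightarrow> y \<in> carrier G \<Longrightarrow> f x = f y \<longleftrightarrow> x = y"
  using f_inj by (auto dest: inj_onD)

lemma f_mem_iff: "x \<in> carrier G \<Longrightarrow> H \<subseteq> carrier G \<Longrightarrow> f x \<in> f ` H \<longleftrightarrow> x \<in> H"
  using f_inj inj_on_image_mem_iff by metis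

lemma subgroup_iff:
  assumes H: "H \<subseteq> carrier G"
  shows "subgroup H G \<longleftrightarrow> subgp (f ` H)"
proof
  assume "subgroup H G"
  then interpret H: subgroup H G .
  have "1 \<in> f ` H" using f_one H.one_closed by (metis imageI)
  moreover have "f x * f y \<in> f ` H" if "x \<in> H" "y \<in> H" for x y
    using f_mult[of x y] that H H.m_closed by (metis imageI subsetD)
  moreover have "inverse (f x) \<in> f ` H" if "x \<in> H" for x
    using f_inv[of x] that H H.m_inv_closed by (metis imageI subsetD)
  ultimately show "subgp (f ` H)" unfolding subgp_def by blast
next
  assume s: "subgp (f ` H)"
  show "subgroup H G"
  proof
    show "\<one> \<in> H" using subgpD(1)[OF s] f_mem_iff[OF one_closed H] f_one by simp
    show "x \<otimes> y \<in> H" if "x \<in> H" "y \<in> H" for x y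
    proof -
      have c: "x \<in> carrier G" "y \<in> carrier G" using that H by auto
      have "f (x \<otimes> y) \<in> f ` H" unfolding f_mult[OF c] using subgpD(2)[OF s] that by blast
      then show ?thesis using f_mem_iff[OF m_closed[OF c] H] by blast
    qed
    show "inv x \<in> H" if "x \<in> H" for x
    proof -
      have c: "x \<in> carrier G" using that H by auto
      have "f (inv x) \<in> f ` H" unfolding f_inv[OF c] using subgpD(3)[OF s] that by blast
      then show ?thesis using f_mem_iff[OF inv_closed[OF c] H] by blast
    qed
  qed (use H in blast)
qed

text \<open>Inversion exchanges right cosets, which define \<open>rcosets\<close>, and left cosets, which define \<open>fin_index\<close>.\<close>

lemma rcoset_inv_eq_iff:
  assumes "subgroup H G" "x \<in> carrier G" "y \<in> carrier G"
  shows "H #> inv x = H #> inv y \<longleftrightarrow> inv x \<otimes> y \<in> H"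
proof
  interpret H: subgroup H G by fact
  assume "H #> inv x = H #> inv y"
  then have "inv x \<in> H #> inv y" using rcos_self[OF inv_closed[OF assms(2)] assms(1)] by simp
  then obtain h where h: "h \<in> H" "inv x = h \<otimes> inv y" unfolding r_coset_def by blast
  have "inv x \<otimes> y = h" unfolding h(2) using H.mem_carrier[OF h(1)] assms(3) by (simp add: m_assoc)
  then show "inv x \<otimes> y \<in> H" using h(1) by simp
next
  interpret H: subgroup H G by fact
  assume h: "inv x \<otimes> y \<in> H"
  have "inv x = (inv x \<otimes> y) \<otimes> inv y" using assms(2,3) by (simp add: m_assoc)
  then have "inv x \<in> H #> inv y" unfolding r_coset_def using h by blast
  then show "H #> inv x = H #> inv y" using repr_independence[OF _ inv_closed[OF assms(3)] assms(1)] by metis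
qed

lemma finite_index_iff:
  assumes "subgroup H G"
  shows "finite (rcosets H) \<longleftrightarrow> fin_index (f ` H) A"
proof -
  interpret H: subgroup H G by fact
  have H: "H \<subseteq> carrier G" by (rule H.subset)
  have sub: "subgp (f ` H)" using subgroup_iff[OF H] assms by blast
  have mem: "inverse (f x) * f y \<in> f ` H \<longleftrightarrow> inv x \<otimes> y \<in> H" if "x \<in> carrier G" "y \<in> carrier G" for x y
    using f_mem_iff[OF m_closed[OF inv_closed[OF that(1)] that(2)] H] that by (simp add: f_mult f_inv)
  have cosets: "rcosets H = (\<lambda>x. H #> inv x) ` carrier G"
  proof -
    have "H #> x \<in> (\<lambda>x. H #> inv x) ` carrier G" if "x \<in> carrier G" for x
      using that by (intro image_eqI[of _ _ "inv x"]) auto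
    then show ?thesis unfolding RCOSETS_def by auto
  qed
  show ?thesis
  proof
    assume fin: "finite (rcosets H)"
    let ?g = "inv_into (carrier G) f"
    show "fin_index (f ` H) A"
    proof (rule fin_indexI[OF sub, where c = "\<lambda>y. H #> inv (?g y)"])
      show "finite ((\<lambda>y. H #> inv (?g y)) ` A)"
      proof (rule finite_subset[OF _ fin])
        show "(\<lambda>y. H #> inv (?g y)) ` A \<subseteq> rcosets H"
        proof
          fix w assume "w \<in> (\<lambda>y. H #> inv (?g y)) ` A"
          then obtain y where y: "y \<in> A" "w = H #> inv (?g y)" by (elim imageE)
          have "?g y \<in> carrier G" using y(1) unfolding f_image[symmetric] by (rule inv_into_into)
          then show "w \<in> rcosets H" unfolding cosets y(2) by (rule imageI)
        qed
      qed
      fix a b assume "a \<in> A" "b \<in> A" and c: "H #> inv (?g a) = H #> inv (?g b)"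
      then obtain x y where xy: "x \<in> carrier G" "a = f x" "y \<in> carrier G" "b = f y"
        unfolding f_image[symmetric] by (elim imageE) simp
      then have "H #> inv x = H #> inv y" using c f_inj by simp
      then show "inverse a * b \<in> f ` H" using rcoset_inv_eq_iff[OF assms xy(1,3)] mem[OF xy(1,3)] xy by simp
    qed
  next
    assume fin: "fin_index (f ` H) A"
    show "finite (rcosets H)" unfolding cosets
    proof (rule finite_image_factor)
      have "(\<lambda>x. coset_class (f ` H) A (f x)) ` carrier G = coset_class (f ` H) A ` A"
        unfolding f_image[symmetric] by blast
      then show "finite ((\<lambda>x. coset_class (f ` H) A (f x)) ` carrier G)"
        using fin_index_coset_class(1)[OF fin sub] by simp
      fix x y assume xy: "x \<in> carrier G" "y \<in> carrier G" "coset_class (f ` H) A (f x) = coset_class (f ` H) A (f y)"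
      have "inverse (f x) * f y \<in> f ` H"
        by (rule fin_index_coset_class(2)[OF fin sub _ _ xy(3)]) (simp_all add: f_image[symmetric] xy(1,2))
      then show "H #> inv x = H #> inv y" using rcoset_inv_eq_iff[OF assms xy(1,2)] mem[OF xy(1,2)] by blast
    qed
  qed
qed

end

lemma commensurable_iff_comm_sub:
  fixes G1 :: "('a, 'x) monoid_scheme" and G2 :: "('b, 'y) monoid_scheme"
  assumes "group_embedding G1 f1 A1" "group_embedding G2 f2 A2"
  shows "commensurable G1 G2 \<longleftrightarrow> comm_sub A1 A2"
proof -
  interpret E1: embedded_group G1 f1 A1
    using assms(1) unfolding embedded_group_def embedded_group_axioms_def group_embedding_def by blast
  interpret E2: embedded_group G2 f2 A2
    using assms(2) unfolding embedded_group_def embedded_group_axioms_def group_embedding_def by blast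
  show ?thesis
  proof
    assume "commensurable G1 G2"
    then obtain H1 H2 \<phi> where H: "subgroup H1 G1" "finite (rcosets\<^bsub>G1\<^esub> H1)" "subgroup H2 G2" "finite (rcosets\<^bsub>G2\<^esub> H2)"
      and \<phi>: "\<phi> \<in> hom (G1\<lparr>carrier := H1\<rparr>) (G2\<lparr>carrier := H2\<rparr>)" "bij_betw \<phi> H1 H2"
      unfolding commensurable_def finite_index_subgroup_def is_iso_def iso_def by auto
    have sub: "H1 \<subseteq> carrier G1" "H2 \<subseteq> carrier G2" using H subgroup.subset by blast+
    have \<phi>_mult: "\<phi> (x \<otimes>\<^bsub>G1\<^esub> y) = \<phi> x \<otimes>\<^bsub>G2\<^esub> \<phi> y" if "x \<in> H1" "y \<in> H1" for x y
      using \<phi>(1) that unfolding hom_def by simp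
    have \<phi>2: "\<phi> x \<in> H2" if "x \<in> H1" for x using bij_betwE[OF \<phi>(2)] that by blast
    let ?g = "inv_into (carrier G1) f1"
    let ?F = "\<lambda>a. f2 (\<phi> (?g a))"
    have g: "?g (f1 x) = x" if "x \<in> H1" for x using E1.f_inj that sub(1) by (simp add: subset_iff)
    have "hom_on (f1 ` H1) ?F" unfolding hom_on_def
    proof (intro ballI)
      fix a b assume "a \<in> f1 ` H1" "b \<in> f1 ` H1"
      then obtain x y where xy: "x \<in> H1" "a = f1 x" "y \<in> H1" "b = f1 y" by blast
      have c: "x \<in> carrier G1" "y \<in> carrier G1" using xy sub by auto
      have xyH: "x \<otimes>\<^bsub>G1\<^esub> y \<in> H1" by (rule subgroup.m_closed[OF H(1) xy(1,3)])
      have "a * b = f1 (x \<otimes>\<^bsub>G1\<^esub> y)" using xy E1.f_mult[OF c] by simp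
      then have "?F (a * b) = f2 (\<phi> x \<otimes>\<^bsub>G2\<^esub> \<phi> y)" using g[OF xyH] \<phi>_mult[OF xy(1,3)] by simp
      also have "\<dots> = f2 (\<phi> x) * f2 (\<phi> y)" by (rule E2.f_mult) (use \<phi>2 xy sub(2) in blast)+
      finally show "?F (a * b) = ?F a * ?F b" using xy g by simp
    qed
    moreover have "inj_on ?F (f1 ` H1)"
    proof (rule inj_onI)
      fix a b assume "a \<in> f1 ` H1" "b \<in> f1 ` H1" and ab: "?F a = ?F b"
      then obtain x y where xy: "x \<in> H1" "a = f1 x" "y \<in> H1" "b = f1 y" by blast
      then have "f2 (\<phi> x) = f2 (\<phi> y)" using ab g by simp
      then have "\<phi> x = \<phi> y" using E2.f_inj \<phi>2 xy sub(2) by (meson inj_onD subsetD)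
      then have "x = y" using \<phi>(2) xy unfolding bij_betw_def by (meson inj_onD)
      then show "a = b" using xy by simp
    qed
    moreover have "?F ` (f1 ` H1) = f2 ` H2"
    proof -
      have "?F ` (f1 ` H1) = f2 ` \<phi> ` H1" unfolding image_image using g by (intro image_cong) auto
      then show ?thesis using bij_betw_imp_surj_on[OF \<phi>(2)] by simp
    qed
    moreover have "subgp (f1 ` H1)" "subgp (f2 ` H2)" using E1.subgroup_iff E2.subgroup_iff sub H by blast+
    moreover have "fin_index (f1 ` H1) A1" "fin_index (f2 ` H2) A2"
      using E1.finite_index_iff[OF H(1)] E2.finite_index_iff[OF H(3)] H by blast+
    moreover have "f1 ` H1 \<subseteq> A1" "f2 ` H2 \<subseteq> A2" using sub E1.f_image E2.f_image by blast+
    ultimately show "comm_sub A1 A2" unfolding comm_sub_def by blast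
  next
    assume "comm_sub A1 A2"
    then obtain K1 K2 \<phi> where K: "subgp K1" "K1 \<subseteq> A1" "fin_index K1 A1" "subgp K2" "K2 \<subseteq> A2" "fin_index K2 A2"
      and \<phi>: "hom_on K1 \<phi>" "inj_on \<phi> K1" "\<phi> ` K1 = K2" unfolding comm_sub_def by blast
    define H1 H2 where "H1 = {x \<in> carrier G1. f1 x \<in> K1}" and "H2 = {x \<in> carrier G2. f2 x \<in> K2}"
    have sub: "H1 \<subseteq> carrier G1" "H2 \<subseteq> carrier G2" unfolding H1_def H2_def by auto
    have im: "f1 ` H1 = K1" "f2 ` H2 = K2"
      unfolding H1_def H2_def using K(2,5) E1.f_image E2.f_image by auto
    have H: "subgroup H1 G1" "subgroup H2 G2" using E1.subgroup_iff[OF sub(1)] E2.subgroup_iff[OF sub(2)] im K by simp_all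
    have fi: "finite (rcosets\<^bsub>G1\<^esub> H1)" "finite (rcosets\<^bsub>G2\<^esub> H2)"
      using E1.finite_index_iff[OF H(1)] E2.finite_index_iff[OF H(2)] im K by simp_all
    let ?g = "inv_into (carrier G2) f2"
    let ?F = "\<lambda>x. ?g (\<phi> (f1 x))"
    have F: "?F x \<in> H2" "f2 (?F x) = \<phi> (f1 x)" if "x \<in> H1" for x
    proof -
      have "\<phi> (f1 x) \<in> K2" using that im(1) \<phi>(3) by blast
      then have "\<phi> (f1 x) \<in> f2 ` carrier G2" using K(5) E2.f_image by blast
      then show "f2 (?F x) = \<phi> (f1 x)" by (rule f_inv_into_f)
      moreover have "?F x \<in> carrier G2" using \<open>\<phi> (f1 x) \<in> f2 ` carrier G2\<close> by (rule inv_into_into)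
      ultimately show "?F x \<in> H2" unfolding H2_def using \<open>\<phi> (f1 x) \<in> K2\<close> by simp
    qed
    have Fc: "?F x \<in> carrier G2" if "x \<in> H1" for x using F(1)[OF that] sub(2) by blast
    have eqI: "u = v" if "u \<in> carrier G2" "v \<in> carrier G2" "f2 u = f2 v" for u v using E2.f_eq_iff that by blast
    have "?F \<in> hom (G1\<lparr>carrier := H1\<rparr>) (G2\<lparr>carrier := H2\<rparr>)"
    proof (rule homI)
      fix x y assume "x \<in> carrier (G1\<lparr>carrier := H1\<rparr>)" "y \<in> carrier (G1\<lparr>carrier := H1\<rparr>)"
      then have xy: "x \<in> H1" "y \<in> H1" by simp_all
      have c: "x \<in> carrier G1" "y \<in> carrier G1" using xy sub by auto
      have xyH: "x \<otimes>\<^bsub>G1\<^esub> y \<in> H1" by (rule subgroup.m_closed[OF H(1) xy])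
      have "?F (x \<otimes>\<^bsub>G1\<^esub> y) = ?F x \<otimes>\<^bsub>G2\<^esub> ?F y"
      proof (rule eqI[OF Fc[OF xyH] E2.m_closed[OF Fc[OF xy(1)] Fc[OF xy(2)]]])
        have "f1 x \<in> K1" "f1 y \<in> K1" using xy im(1) by blast+
        then have "\<phi> (f1 x * f1 y) = \<phi> (f1 x) * \<phi> (f1 y)" using \<phi>(1) unfolding hom_on_def by blast
        then show "f2 (?F (x \<otimes>\<^bsub>G1\<^esub> y)) = f2 (?F x \<otimes>\<^bsub>G2\<^esub> ?F y)"
          unfolding F(2)[OF xyH] unfolding E2.f_mult[OF Fc[OF xy(1)] Fc[OF xy(2)]] F(2)[OF xy(1)] F(2)[OF xy(2)] E1.f_mult[OF c] .
      qed
      then show "?F (x \<otimes>\<^bsub>G1\<lparr>carrier := H1\<rparr>\<^esub> y) = ?F x \<otimes>\<^bsub>G2\<lparr>carrier := H2\<rparr>\<^esub> ?F y" by simp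
    qed (use F in simp)
    moreover have "bij_betw ?F H1 H2" unfolding bij_betw_def
    proof
      show "inj_on ?F H1"
      proof (rule inj_onI)
        fix x y assume xy: "x \<in> H1" "y \<in> H1" "?F x = ?F y"
        then have "\<phi> (f1 x) = \<phi> (f1 y)" using F(2) by metis
        then have "f1 x = f1 y" using \<phi>(2) xy im(1) by (meson imageI inj_onD)
        then show "x = y" using E1.f_eq_iff xy sub(1) by blast
      qed
      show "?F ` H1 = H2"
      proof
        show "?F ` H1 \<subseteq> H2" using F(1) by blast
        show "H2 \<subseteq> ?F ` H1"
        proof
          fix w assume w: "w \<in> H2"
          have "f2 w \<in> \<phi> ` f1 ` H1" unfolding im(1) \<phi>(3) using w im(2) by blast
          then obtain x where x: "x \<in> H1" "f2 w = \<phi> (f1 x)" by blast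
          have "w = ?F x" by (rule eqI) (use w sub(2) Fc[OF x(1)] F(2)[OF x(1)] x(2) in auto)
          then show "w \<in> ?F ` H1" using x(1) by blast
        qed
      qed
    qed
    ultimately have "?F \<in> iso (G1\<lparr>carrier := H1\<rparr>) (G2\<lparr>carrier := H2\<rparr>)" unfolding iso_def by simp
    then have "G1\<lparr>carrier := H1\<rparr> \<cong> G2\<lparr>carrier := H2\<rparr>" unfolding is_iso_def by blast
    then show "commensurable G1 G2" unfolding commensurable_def finite_index_subgroup_def using H fi by blast
  qed
qed

section \<open>Artin groups of spherical type\<close>

text \<open>Outside of \<open>S\<close> the matrix is made trivial, so that all letters of the type can be used.\<close>

definition total_matrix :: "'a set \<Rightarrow> ('a \<Rightarrow> 'a \<Rightarrow> enat) \<Rightarrow> 'a \<Rightarrow> 'a \<Rightarrow> enat" where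
  "total_matrix S m s t = (if s \<in> S \<and> t \<in> S then m s t else 2)"

lemma coxeter_diagram_total: "coxeter_matrix S m \<Longrightarrow> coxeter_diagram (total_matrix S m)"
proof -
  assume "coxeter_matrix S m"
  then interpret coxeter_matrix S m .
  show "coxeter_diagram (total_matrix S m)"
  proof
    fix s t :: 'a
    show "total_matrix S m s t = total_matrix S m t s"
      by (cases "s = t") (auto simp: total_matrix_def symm)
    show "2 \<le> total_matrix S m s t" if "s \<noteq> t" using off_diag that by (simp add: total_matrix_def)
  qed
qed

lemma total_matrix_eq: "s \<in> S \<Longrightarrow> t \<in> S \<Longrightarrow> total_matrix S m s t = m s t"
  by (simp add: total_matrix_def)

subsection \<open>Finiteness of the Coxeter group\<close>

lemma pres_eq_imp_ceq:
  assumes "coxeter_matrix S m" "pres_eq S (artin_relations S m) u v"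
  shows "coxeter_diagram.ceq (total_matrix S m) (map fst u) (map fst v)"
proof -
  interpret coxeter_diagram "total_matrix S m" by (rule coxeter_diagram_total[OF assms(1)])
  have fst_alt: "map fst (alt_word s t k) = alt s t k" for s t :: 'a and k
    by (induction k arbitrary: s t) auto
  from assms(2) show ?thesis
  proof induction
    case (sym u v)
    show ?case by (rule ceq_sym[OF sym.IH])
  next
    case (trans u v w)
    show ?case by (rule ceq_trans[OF trans.IH])
  next
    case (cancel u v s b)
    show ?case using ceq_cancel[of "map fst u" s "map fst v"] by simp
  next
    case (rel u v l r)
    obtain s t k where st: "l = alt_word s t k" "r = alt_word t s k" "s \<in> S" "t \<in> S" "s \<noteq> t" "m s t = enat k"
      using rel(3) unfolding artin_relations_def by blast
    have "total_matrix S m s t = enat k" using st by (simp add: total_matrix_eq)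
    from ceq_braid[OF st(5) this, of "map fst u" "map fst v"] show ?case unfolding st(1,2) by (simp add: fst_alt)
  qed simp
qed

text \<open>The words whose letters, without signs, represent the trivial element of the Coxeter group
  form a normal subgroup that contains the squares. So reduced words of different lengths represent different
  elements of the Coxeter group.\<close>

lemma coset_eq_imp_ceq:
  assumes S: "coxeter_matrix S m" and uv: "u \<in> words S" "v \<in> words S"
  defines "G \<equiv> artin_group S m"
  assumes eq: "normal_closure G ((\<lambda>s. artin_gen S m s [^]\<^bsub>G\<^esub> (2::nat)) ` S) #>\<^bsub>G\<^esub> pres_class S (artin_relations S m) u
    = normal_closure G ((\<lambda>s. artin_gen S m s [^]\<^bsub>G\<^esub> (2::nat)) ` S) #>\<^bsub>G\<^esub> pres_class S (artin_relations S m) v"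
  shows "coxeter_diagram.ceq (total_matrix S m) (map fst u) (map fst v)"
proof -
  interpret coxeter_diagram "total_matrix S m" by (rule coxeter_diagram_total[OF S])
  let ?R = "artin_relations S m"
  let ?cl = "pres_class S ?R"
  interpret group G unfolding G_def artin_group_def by (rule group_presented_group)
  have carrier: "carrier G = ?cl ` words S" unfolding G_def artin_group_def presented_group_def by simp
  have mult: "?cl x \<otimes>\<^bsub>G\<^esub> ?cl y = ?cl (x @ y)" if "x \<in> words S" "y \<in> words S" for x y
    unfolding G_def artin_group_def by (rule presented_group_mult[OF that])
  have one: "\<one>\<^bsub>G\<^esub> = ?cl []" unfolding G_def artin_group_def presented_group_def by simp
  have cl_eq: "?cl x = ?cl y \<Longrightarrow> ceq (map fst x) (map fst y)" if "x \<in> words S" for x y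
    using pres_eq_imp_ceq[OF S] pres_class_eq_iff[OF that] by blast
  define N where "N = {?cl x |x. x \<in> words S \<and> ceq (map fst x) []}"
  have NI: "?cl x \<in> N \<longleftrightarrow> ceq (map fst x) []" if x: "x \<in> words S" for x
  proof
    assume "?cl x \<in> N"
    then obtain y where "?cl x = ?cl y" "ceq (map fst y) []" unfolding N_def by blast
    then show "ceq (map fst x) []" using cl_eq[OF x] ceq_trans by blast
  qed (use x in \<open>auto simp: N_def\<close>)
  define bar :: "'a word \<Rightarrow> 'a word" where "bar x = rev (map (\<lambda>(s, b). (s, \<not> b)) x)" for x
  have bar: "bar x \<in> words S" "map fst (bar x) = rev (map fst x)" "inv\<^bsub>G\<^esub> (?cl x) = ?cl (bar x)" if x: "x \<in> words S" for x
  proof -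
    show w: "bar x \<in> words S" using x unfolding bar_def by (induction x) auto
    show "map fst (bar x) = rev (map fst x)" unfolding bar_def by (induction x) auto
    have "pres_eq S ?R (x @ bar x) []" unfolding bar_def by (rule pres_eq_inverse_right[OF x])
    then have eq: "?cl x \<otimes>\<^bsub>G\<^esub> ?cl (bar x) = \<one>\<^bsub>G\<^esub>"
      unfolding mult[OF x w] one using x w by (subst pres_class_eq_iff) auto
    have c: "?cl x \<in> carrier G" "?cl (bar x) \<in> carrier G" unfolding carrier using x w by blast+
    have "inv\<^bsub>G\<^esub> (?cl (bar x)) = ?cl x" by (rule inv_equality[OF eq c(2,1)])
    then show "inv\<^bsub>G\<^esub> (?cl x) = ?cl (bar x)" using inv_inv[OF c(2)] by simp
  qed
  have "N \<lhd> G"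
  proof (rule normal_invI)
    show "subgroup N G"
    proof
      show "N \<subseteq> carrier G" unfolding N_def carrier by blast
      show "\<one>\<^bsub>G\<^esub> \<in> N" unfolding one using NI[of "[]"] by simp
    next
      fix X Y assume "X \<in> N" "Y \<in> N"
      then obtain x y where xy: "X = ?cl x" "x \<in> words S" "ceq (map fst x) []" "Y = ?cl y" "y \<in> words S" "ceq (map fst y) []"
        unfolding N_def by blast
      have "ceq (map fst (x @ y)) []" using ceq_append[OF xy(3,6)] by simp
      then show "X \<otimes>\<^bsub>G\<^esub> Y \<in> N" using xy mult NI[of "x @ y"] by simp
    next
      fix X assume "X \<in> N"
      then obtain x where x: "X = ?cl x" "x \<in> words S" "ceq (map fst x) []" unfolding N_def by blast
      then show "inv\<^bsub>G\<^esub> X \<in> N" using bar[OF x(2)] NI[of "bar x"] ceq_rev[OF x(3)] by simp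
    qed
    fix X Y assume "X \<in> carrier G" "Y \<in> N"
    then obtain x y where xy: "X = ?cl x" "x \<in> words S" "Y = ?cl y" "y \<in> words S" "ceq (map fst y) []"
      unfolding carrier N_def by blast
    have "ceq (map fst x @ map fst y @ rev (map fst x)) (map fst x @ [] @ rev (map fst x))"
      by (rule ceq_context[OF xy(5)])
    also have "ceq \<dots> []" using ceq_append_rev[of "map fst x" "[]"] by simp
    finally have "ceq (map fst ((x @ y) @ bar x)) []" using bar(2)[OF xy(2)] by simp
    then show "X \<otimes>\<^bsub>G\<^esub> Y \<otimes>\<^bsub>G\<^esub> inv\<^bsub>G\<^esub> X \<in> N"
      using xy bar[OF xy(2)] mult NI[of "(x @ y) @ bar x"] by simp
  qed
  moreover have "(\<lambda>s. artin_gen S m s [^]\<^bsub>G\<^esub> (2::nat)) ` S \<subseteq> N"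
  proof
    fix X assume "X \<in> (\<lambda>s. artin_gen S m s [^]\<^bsub>G\<^esub> (2::nat)) ` S"
    then obtain s where s: "s \<in> S" "X = ?cl [(s, True)] [^]\<^bsub>G\<^esub> (2::nat)" unfolding artin_gen_def by blast
    have w: "[(s, True)] \<in> words S" using s(1) by simp
    then have "?cl [(s, True)] \<in> carrier G" unfolding carrier by blast
    then have "X = ?cl [(s, True), (s, True)]" using s(2) mult[OF w w] by (simp add: numeral_2_eq_2)
    moreover have "ceq [s, s] []" using ceq_ss[of s "[]"] .
    ultimately show "X \<in> N" using NI[of "[(s, True), (s, True)]"] s(1) by simp
  qed
  ultimately have closure: "normal_closure G ((\<lambda>s. artin_gen S m s [^]\<^bsub>G\<^esub> (2::nat)) ` S) \<subseteq> N" (is "?C \<subseteq> N")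
    unfolding normal_closure_def by blast
  have one_C: "\<one>\<^bsub>G\<^esub> \<in> ?C"
    unfolding normal_closure_def using subgroup.one_closed[OF normal_imp_subgroup] by blast
  have "?cl u \<in> carrier G" using uv(1) unfolding carrier by blast
  then have "?cl u \<in> ?C #>\<^bsub>G\<^esub> ?cl u" unfolding r_coset_def using one_C by force
  then have "?cl u \<in> ?C #>\<^bsub>G\<^esub> ?cl v" unfolding eq .
  then obtain X where X: "X \<in> ?C" "?cl u = X \<otimes>\<^bsub>G\<^esub> ?cl v" unfolding r_coset_def by blast
  then obtain x where x: "X = ?cl x" "x \<in> words S" "ceq (map fst x) []" using closure unfolding N_def by blast
  have "?cl u = ?cl (x @ v)" using X(2) x mult uv(2) by simp
  then have "ceq (map fst u) (map fst x @ map fst v)" using cl_eq[OF uv(1)] by fastforce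
  also have "ceq \<dots> ([] @ map fst v)" by (rule ceq_append[OF x(3) ceq_refl])
  finally show ?thesis by simp
qed

text \<open>Reduced words of different lengths represent different elements of the finite Coxeter group, so there is a
  longest reduced word. Every generator is a left descent of it and hence, by Matsumoto's theorem, divides it.\<close>

lemma spherical_diagram_total:
  assumes S: "coxeter_matrix S m" "spherical_type S m"
  shows "spherical_diagram (total_matrix S m) S"
proof -
  interpret coxeter_diagram "total_matrix S m" by (rule coxeter_diagram_total[OF S(1)])
  let ?pos = "map (\<lambda>s. (s, True))"
  define G where "G = artin_group S m"
  define C where "C = normal_closure G ((\<lambda>s. artin_gen S m s [^]\<^bsub>G\<^esub> (2::nat)) ` S)"
  have pos: "?pos u \<in> words S" if "set u \<subseteq> S" for u using that by (induction u) auto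
  define L where "L = {length u |u. reduced u \<and> set u \<subseteq> S}"
  have "finite L"
  proof -
    have "\<forall>k\<in>L. \<exists>u. length u = k \<and> reduced u \<and> set u \<subseteq> S" unfolding L_def by blast
    then obtain r where r: "\<And>k. k \<in> L \<Longrightarrow> length (r k) = k \<and> reduced (r k) \<and> set (r k) \<subseteq> S" by metis
    let ?f = "\<lambda>k. C #>\<^bsub>G\<^esub> pres_class S (artin_relations S m) (?pos (r k))"
    have "inj_on ?f L"
    proof (rule inj_onI)
      fix k l assume kl: "k \<in> L" "l \<in> L" "?f k = ?f l"
      have "ceq (map fst (?pos (r k))) (map fst (?pos (r l)))"
        using coset_eq_imp_ceq[OF S(1) pos pos] r kl unfolding C_def G_def by blast
      then have "ceq (r k) (r l)" by (simp add: o_def)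
      then show "k = l" using ceq_reduced_length r kl by metis
    qed
    moreover have "?f ` L \<subseteq> carrier (coxeter_group S m)"
    proof
      fix X assume "X \<in> ?f ` L"
      then obtain k where k: "k \<in> L" "X = ?f k" by blast
      have "pres_class S (artin_relations S m) (?pos (r k)) \<in> carrier G"
        using pos r[OF k(1)] unfolding G_def artin_group_def presented_group_def by auto
      then show "X \<in> carrier (coxeter_group S m)"
        unfolding coxeter_group_def FactGroup_def RCOSETS_def k(2) C_def G_def by auto
    qed
    ultimately show ?thesis using S(2) unfolding spherical_type_def by (meson finite_imageD finite_subset)
  qed
  moreover have "reduced []" unfolding reduced_def by simp
  then have "0 \<in> L" unfolding L_def by force
  ultimately have max: "Max L \<in> L" "\<And>k. k \<in> L \<Longrightarrow> k \<le> Max L" using Max_in Max_ge by blast+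
  then obtain w where w: "reduced w" "set w \<subseteq> S" "length w = Max L" unfolding L_def by auto
  have longest: "length u \<le> length w" if "reduced u" "set u \<subseteq> S" for u
    using max(2)[of "length u"] that w(3) unfolding L_def by auto
  have "divides [s] w" if s: "s \<in> S" for s
  proof -
    have "\<not> reduced (s # w)" using w(2) longest[of "s # w"] s by auto
    then obtain x where "reduced (s # x)" "ceq w (s # x)" using exchange_word[OF w(1)] by blast
    then have "beq w ([s] @ x)" using reduced_ceq_imp_beq[OF w(1)] by simp
    then show ?thesis unfolding divides_def by blast
  qed
  then show ?thesis
    using w(1) coxeter_matrix.finite_S[OF S(1)] by unfold_locales blast+
qed

subsection \<open>Embedding the Artin group\<close>

lemma words_subset: "C \<subseteq> S \<Longrightarrow> u \<in> words C \<Longrightarrow> u \<in> words S"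
  by (induction u) auto

lemma pres_eq_subset:
  assumes "C \<subseteq> S" "pres_eq C (artin_relations C m) u v"
  shows "pres_eq S (artin_relations S m) u v"
  using assms(2)
proof induction
  case (refl u)
  then show ?case using words_subset[OF assms(1)] pres_eq.refl by blast
next
  case (sym u v)
  show ?case by (rule pres_eq.sym[OF sym.IH])
next
  case (trans u v w)
  show ?case by (rule pres_eq.trans[OF trans.IH])
next
  case (cancel u v s b)
  then show ?case using words_subset[OF assms(1)] assms(1) by (intro pres_eq.cancel) auto
next
  case (rel u v l r)
  then have "(l, r) \<in> artin_relations S m" using assms(1) unfolding artin_relations_def by blast
  then show ?case using rel words_subset[OF assms(1)] by (intro pres_eq.rel) auto
qed

text \<open>Deleting letters is compatible with the relations: in the braid relation of a letter in \<open>C\<close> and one outside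
  \<open>C\<close>, which is a commutation, a single letter is left on both sides.\<close>

lemma pres_eq_filter:
  assumes C: "C \<subseteq> S" "\<And>s t. s \<in> C \<Longrightarrow> t \<in> S - C \<Longrightarrow> m s t = 2 \<and> m t s = 2"
    and "pres_eq S (artin_relations S m) u v"
  shows "pres_eq C (artin_relations C m) (filter (\<lambda>x. fst x \<in> C) u) (filter (\<lambda>x. fst x \<in> C) v)"
  using assms(3)
proof induction
  have words: "filter (\<lambda>x. fst x \<in> C) u \<in> words C" for u :: "'a word" by (induction u) auto
  {
    case (refl u)
    show ?case by (rule pres_eq.refl[OF words])
  next
    case (sym u v)
    show ?case by (rule pres_eq.sym[OF sym.IH])
  next
    case (trans u v w)
    show ?case by (rule pres_eq.trans[OF trans.IH])
  next
    case (cancel u v s b)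
    show ?case
    proof (cases "s \<in> C")
      case True
      then show ?thesis using pres_eq.cancel[OF words words True, of "artin_relations C m" u b v] by simp
    next
      case False
      then show ?thesis using pres_eq.refl[OF words, of "artin_relations C m" "u @ v"] by simp
    qed
  next
    case (rel u v l r)
    obtain s t k where st: "l = alt_word s t k" "r = alt_word t s k" "s \<in> S" "t \<in> S" "s \<noteq> t" "m s t = enat k"
      using rel(3) unfolding artin_relations_def by blast
    have alt_words: "s \<in> C \<Longrightarrow> t \<in> C \<Longrightarrow> alt_word s t k \<in> words C \<and> filter (\<lambda>x. fst x \<in> C) (alt_word s t k) = alt_word s t k" for s t k
      by (induction k arbitrary: s t) auto
    have alt_none: "s \<notin> C \<Longrightarrow> t \<notin> C \<Longrightarrow> filter (\<lambda>x. fst x \<in> C) (alt_word s t k) = []" for s t k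
      by (induction k arbitrary: s t) auto
    have two: "k = 2" if "(s \<in> C) \<noteq> (t \<in> C)"
      using that C(2)[of s t] C(2)[of t s] st(3,4,6) by (auto simp: numeral_eq_enat)
    consider "s \<in> C" "t \<in> C" | "s \<notin> C" "t \<notin> C" | "(s \<in> C) \<noteq> (t \<in> C)" by blast
    then show ?case
    proof cases
      case 1
      then have "(l, r) \<in> artin_relations C m" using st unfolding artin_relations_def by blast
      moreover have "filter (\<lambda>x. fst x \<in> C) l = l" "filter (\<lambda>x. fst x \<in> C) r = r" "l \<in> words C" "r \<in> words C"
        using alt_words 1 st(1,2) by auto
      ultimately show ?thesis using pres_eq.rel[OF words words, of l r] by simp
    next
      case 2
      then have "filter (\<lambda>x. fst x \<in> C) l = []" "filter (\<lambda>x. fst x \<in> C) r = []" using alt_none st(1,2) by auto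
      then show ?thesis using pres_eq.refl[OF words, of "artin_relations C m" "u @ v"] by simp
    next
      case 3
      then have "filter (\<lambda>x. fst x \<in> C) l = filter (\<lambda>x. fst x \<in> C) r"
        unfolding st(1,2) two[OF 3] by (auto simp: numeral_2_eq_2)
      then show ?thesis using pres_eq.refl[OF words, of "artin_relations C m" "u @ r @ v"] by simp
    qed
  }
qed

text \<open>The exponent sum, from which the length homomorphism is obtained.\<close>

definition word_sum :: "'a word \<Rightarrow> int" where
  "word_sum u = sum_list (map (\<lambda>x. if snd x then 1 else -1) u)"

lemma word_sum_append [simp]: "word_sum (u @ v) = word_sum u + word_sum v"
  by (simp add: word_sum_def)

lemma word_sum_pres_eq: "pres_eq S (artin_relations S m) u v \<Longrightarrow> word_sum u = word_sum v"
proof (induction rule: pres_eq.induct)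
  case (cancel u v s b)
  then show ?case by (cases b) (auto simp: word_sum_def)
next
  case (rel u v l r)
  have "word_sum (alt_word s t k) = int k" for s t :: 'a and k
    by (induction k arbitrary: s t) (auto simp: word_sum_def)
  then show ?case using rel unfolding artin_relations_def by auto
qed simp_all

locale spherical_artin_group = coxeter_matrix S m for S :: "'a set" and m +
  fixes f :: "'a word set \<Rightarrow> 'g::mult_group" and A0 :: "'g set"
  assumes spherical: "spherical_type S m"
    and embedding: "group_embedding (artin_group S m) f A0"
begin

abbreviation "R \<equiv> artin_relations S m"
abbreviation "cl \<equiv> pres_class S R"

definition e :: "'a word \<Rightarrow> 'g" where "e u = f (cl u)"

sublocale embedded_group "artin_group S m" f A0
proof -
  have "group (artin_group S m)" using embedding unfolding group_embedding_def by blast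
  then show "embedded_group (artin_group S m) f A0"
    using embedding unfolding embedded_group_def embedded_group_axioms_def by blast
qed

lemma carrier_eq: "carrier (artin_group S m) = cl ` words S"
  unfolding artin_group_def presented_group_def by simp

lemma e_append: "u \<in> words S \<Longrightarrow> v \<in> words S \<Longrightarrow> e (u @ v) = e u * e v"
  unfolding e_def using presented_group_mult[of u S v R] f_mult[of "cl u" "cl v"] carrier_eq
  unfolding artin_group_def by auto

lemma e_Nil: "e [] = 1"
  unfolding e_def using f_one unfolding artin_group_def presented_group_def by simp

lemma e_eq_iff: "u \<in> words S \<Longrightarrow> v \<in> words S \<Longrightarrow> e u = e v \<longleftrightarrow> pres_eq S R u v"
  unfolding e_def using f_eq_iff[of "cl u" "cl v"] carrier_eq pres_class_eq_iff[of u S R v] by auto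

lemma A0_eq: "A0 = e ` words S"
  using f_image carrier_eq unfolding e_def by (simp add: image_image)

definition gen :: "'a \<Rightarrow> 'g" where "gen s = e [(s, True)]"

lemma e_inverse_letter: "s \<in> S \<Longrightarrow> e [(s, False)] = inverse (gen s)"
proof -
  assume s: "s \<in> S"
  have "pres_eq S R ([] @ [(s, True), (s, \<not> True)] @ []) ([] @ [])" using s by (intro pres_eq.cancel) auto
  then have "e ([(s, True)] @ [(s, False)]) = e []" using s by (subst e_eq_iff) auto
  then have "gen s * e [(s, False)] = 1" unfolding gen_def using e_append[of "[(s, True)]" "[(s, False)]"] s e_Nil by simp
  then show ?thesis by (rule mult_group_class.inv_unique[symmetric])
qed

definition elen :: "'g \<Rightarrow> int" where
  "elen x = (THE k. \<exists>u\<in>words S. x = e u \<and> k = word_sum u)"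

lemma elen_e:
  assumes u: "u \<in> words S"
  shows "elen (e u) = word_sum u"
  unfolding elen_def
proof (rule the_equality)
  show "\<exists>v\<in>words S. e u = e v \<and> word_sum u = word_sum v" using u by blast
  fix k assume "\<exists>v\<in>words S. e u = e v \<and> k = word_sum v"
  then obtain v where v: "v \<in> words S" "e u = e v" "k = word_sum v" by blast
  then have "pres_eq S R u v" using e_eq_iff[OF u v(1)] by simp
  then show "k = word_sum u" using word_sum_pres_eq v(3) by metis
qed

lemma subgp_A0: "subgp A0"
  using subgroup_iff[of "carrier (artin_group S m)"] subgroup_self f_image by simp

lemma e_positive: "set u \<subseteq> S \<Longrightarrow> e (map (\<lambda>s. (s, True)) u) = prod_list (map gen u) \<and> map (\<lambda>s. (s, True)) u \<in> words S"
proof (induction u)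
  case (Cons s u)
  then show ?case using e_append[of "[(s, True)]" "map (\<lambda>s. (s, True)) u"] unfolding gen_def by simp
qed (simp add: e_Nil)

sublocale spherical_diagram "total_matrix S m" S
  by (rule spherical_diagram_total[OF _ spherical]) unfold_locales

lemma beq_imp_pres_eq:
  "beq u v \<Longrightarrow> set u \<subseteq> S \<Longrightarrow> pres_eq S R (map (\<lambda>s. (s, True)) u) (map (\<lambda>s. (s, True)) v)"
proof (induction rule: beq.induct)
  case (beq_refl u)
  then show ?case using e_positive pres_eq.refl by blast
next
  case (beq_sym u v)
  then show ?case using beq_set[OF beq_sym(1)] pres_eq.sym by blast
next
  case (beq_trans u v w)
  then show ?case using beq_set[OF beq_trans(1)] pres_eq.trans by metis
next
  case (beq_braid s t k u v)
  obtain j where "k = Suc (Suc j)" using M_enat_ge2[OF beq_braid(1,2)] by (metis add_2_eq_Suc le_Suc_ex)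
  then have st: "s \<in> S" "t \<in> S" using beq_braid(3) by auto
  then have "m s t = enat k" using beq_braid(2) total_matrix_eq by metis
  then have rel: "(alt_word s t k, alt_word t s k) \<in> R" unfolding artin_relations_def using st beq_braid(1) by blast
  have w: "map (\<lambda>s. (s, True)) (alt s t k) \<in> words S" "map (\<lambda>s. (s, True)) (alt t s k) \<in> words S"
    "map (\<lambda>s. (s, True)) u \<in> words S" "map (\<lambda>s. (s, True)) v \<in> words S"
  proof -
    have "set (alt s t k) \<subseteq> S" "set (alt t s k) \<subseteq> S" "set u \<subseteq> S" "set v \<subseteq> S"
      using set_alt_subset[of s t k] set_alt_subset[of t s k] st beq_braid(3) by auto
    then show "map (\<lambda>s. (s, True)) (alt s t k) \<in> words S" "map (\<lambda>s. (s, True)) (alt t s k) \<in> words S"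
      "map (\<lambda>s. (s, True)) u \<in> words S" "map (\<lambda>s. (s, True)) v \<in> words S"
      using e_positive by blast+
  qed
  show ?case using pres_eq.rel[OF w(3,4) rel] w(1,2) unfolding alt_word_eq by simp
qed

text \<open>This adapts to the formulation of additivity of the length in \<open>artin_model\<close>.\<close>

lemma in_A0_if_in_all: "(\<And>H. subgp H \<Longrightarrow> gen ` S \<subseteq> H \<Longrightarrow> x \<in> H) \<Longrightarrow> x \<in> A0"
proof -
  assume *: "\<And>H. subgp H \<Longrightarrow> gen ` S \<subseteq> H \<Longrightarrow> x \<in> H"
  have "gen ` S \<subseteq> A0" unfolding A0_eq gen_def by (intro image_subsetI imageI) simp
  then show "x \<in> A0" using *[OF subgp_A0] by blast
qed

sublocale artin_model "total_matrix S m" S gen elen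
proof unfold_locales
  fix u v assume uv: "set u \<subseteq> S" "set v \<subseteq> S"
  have "prod_list (map gen u) = prod_list (map gen v) \<longleftrightarrow>
      pres_eq S R (map (\<lambda>s. (s, True)) u) (map (\<lambda>s. (s, True)) v)"
    using e_positive[OF uv(1)] e_positive[OF uv(2)] e_eq_iff by metis
  also have "\<dots> \<longleftrightarrow> beq u v"
    using beq_imp_pres_eq[OF _ uv(1)] positive_embedding[of m u v] total_matrix_eq by metis
  finally show "prod_list (map gen u) = prod_list (map gen v) \<longleftrightarrow> beq u v" .
next
  fix x y
  assume "\<And>H. subgp H \<Longrightarrow> gen ` S \<subseteq> H \<Longrightarrow> x \<in> H" "\<And>H. subgp H \<Longrightarrow> gen ` S \<subseteq> H \<Longrightarrow> y \<in> H"
  then have "x \<in> A0" "y \<in> A0" using in_A0_if_in_all by blast+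
  then obtain u v where uv: "u \<in> words S" "x = e u" "v \<in> words S" "y = e v" unfolding A0_eq by blast
  have "x * y = e (u @ v)" using e_append uv by simp
  then show "elen (x * y) = elen x + elen y" using elen_e uv by simp
next
  fix s assume "s \<in> S"
  then show "elen (gen s) = 1" unfolding gen_def using elen_e[of "[(s, True)]"] by (simp add: word_sum_def)
qed

lemma A_eq_image: "X \<subseteq> S \<Longrightarrow> A X = e ` words X"
proof
  assume X: "X \<subseteq> S"
  show "A X \<subseteq> e ` words X"
  proof
    fix x assume "x \<in> A X"
    then show "x \<in> e ` words X"
    proof (induction rule: A.induct)
      case A_one
      then show ?case using e_Nil by (intro image_eqI[of _ _ "[]"]) auto
    next
      case (A_gen s x)
      then obtain u where u: "u \<in> words X" "x = e u" by blast
      have "gen s * x = e ((s, True) # u)"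
        unfolding gen_def u(2) using e_append[of "[(s, True)]" u] words_subset[OF X u(1)] A_gen(1) X by auto
      then show ?case using u(1) A_gen(1) by (intro image_eqI[of _ _ "(s, True) # u"]) auto
    next
      case (A_gen_inv s x)
      then obtain u where u: "u \<in> words X" "x = e u" by blast
      have s: "s \<in> S" using A_gen_inv(1) X by blast
      have "inverse (gen s) * x = e ((s, False) # u)"
        unfolding e_inverse_letter[OF s, symmetric] u(2) using e_append[of "[(s, False)]" u] words_subset[OF X u(1)] s by simp
      then show ?case using u(1) A_gen_inv(1) by (intro image_eqI[of _ _ "(s, False) # u"]) auto
    qed
  qed
  show "e ` words X \<subseteq> A X"
  proof
    fix x assume "x \<in> e ` words X"
    then obtain u where u: "u \<in> words X" "x = e u" by blast
    have "e u \<in> A X" using u(1)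
    proof (induction u)
      case (Cons a u)
      obtain s b where a: "a = (s, b)" by force
      have s: "s \<in> X" "s \<in> S" "u \<in> words X" "u \<in> words S" using Cons.prems a X words_subset[OF X] by auto
      have "e (a # u) = e [a] * e u" using e_append[of "[a]" u] s a by simp
      moreover have "e [a] \<in> A X"
        using A_sigma[OF s(1)] e_inverse_letter[OF s(2)] unfolding a gen_def by (cases b) auto
      ultimately show ?case using A_mult Cons.IH s(3) by simp
    qed (simp add: e_Nil A_one)
    then show "x \<in> A X" using u(2) by simp
  qed
qed

text \<open>A collection of what is known about the centre of an irreducible Artin group and of strong
  indecomposability.\<close>

lemma indecomposable_parabolic:
  assumes X: "X \<subseteq> S" "X \<noteq> {}" "irreducible X"
  shows "indecomposable_group (A X) elen (\<delta> X)"
  unfolding indecomposable_group_def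
proof (intro conjI ballI allI impI)
  have AX: "A X \<subseteq> A S" by (rule A_mono[OF X(1)])
  show "subgp (A X)" by (rule subgp_A)
  show "\<And>x y. x \<in> A X \<Longrightarrow> y \<in> A X \<Longrightarrow> elen (x * y) = elen x + elen y" using len_mult_A AX by blast
  show "\<delta> X \<in> A X" by (rule delta_in_A[OF X(1)])
  show "central_in (A X) (\<delta> X)" unfolding central_in_def using commute_sym[OF delta_central[OF X(1)]] by blast
  have "elen (\<delta> X) = elen (\<Delta> X) + elen (\<Delta> X)"
    unfolding \<delta>_def using len_mult_A Delta_in_A[OF X(1)] AX by blast
  then show "0 < elen (\<delta> X)" using len_Delta_pos[OF X(1,2)] by simp
  show "x = 1" if "x \<in> A X" "central_in (A X) x" "elen x = 0" for x
    using central_len_zero[OF X(1,3) that(1) _ that(3)] that(2) A_sigma unfolding central_in_def by blast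
  show "central_in (A X) x" if "x \<in> A X" "\<forall>y\<in>A X. \<exists>n>0. commute x (y ^ n)" for x
    unfolding central_in_def using virtually_central[OF X(1) that(1)] that(2) A_sigma by blast
  show "(\<forall>h\<in>H. central_in (A X) h) \<or> (\<forall>k\<in>K. central_in (A X) k)"
    if "subgp H" "H \<subseteq> A X" "subgp K" "K \<subseteq> A X" "\<forall>h\<in>H. \<forall>k\<in>K. commute h k"
      "\<forall>x\<in>A X. \<exists>n>0. \<exists>h\<in>H. \<exists>k\<in>K. x ^ n = h * k" for H K
    unfolding central_in_def using strongly_indecomposable[OF X(1,3) that(1-4)] that(5,6) by blast
qed

end

subsection \<open>Decomposition into components\<close>

context spherical_artin_group
begin

abbreviation "components \<equiv> coxeter_components S m"

lemma edges_sym: "(s, t) \<in> (coxeter_edges S m)\<^sup>* \<Longrightarrow> (t, s) \<in> (coxeter_edges S m)\<^sup>*"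
proof -
  have "sym (coxeter_edges S m)" unfolding coxeter_edges_def using symm by (auto intro!: symI)
  then show "(s, t) \<in> (coxeter_edges S m)\<^sup>* \<Longrightarrow> (t, s) \<in> (coxeter_edges S m)\<^sup>*"
    by (meson symD sym_rtrancl)
qed

lemma reachable_in_S: "(s, t) \<in> (coxeter_edges S m)\<^sup>* \<Longrightarrow> s \<in> S \<Longrightarrow> t \<in> S"
  by (induction rule: rtrancl_induct) (auto simp: coxeter_edges_def)

lemma component_reachable:
  assumes "C \<in> components" "s \<in> C"
  shows "t \<in> C \<longleftrightarrow> (s, t) \<in> (coxeter_edges S m)\<^sup>*"
proof -
  obtain x where x: "x \<in> S" "C = (coxeter_edges S m)\<^sup>* `` {x}"
    using assms(1) unfolding coxeter_components_def by (rule quotientE)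
  then have "(x, s) \<in> (coxeter_edges S m)\<^sup>*" using assms(2) by simp
  then show ?thesis using x(2) edges_sym rtrancl_trans[of _ _ "coxeter_edges S m"] by (metis Image_singleton_iff)
qed

lemma component_subset: "C \<in> components \<Longrightarrow> C \<subseteq> S"
  unfolding coxeter_components_def using reachable_in_S by (auto elim!: quotientE)

lemma component_nonempty: "C \<in> components \<Longrightarrow> C \<noteq> {}"
  unfolding coxeter_components_def by (auto elim!: quotientE)

lemma components_cover: "s \<in> S \<Longrightarrow> \<exists>C\<in>components. s \<in> C"
  unfolding coxeter_components_def by (rule bexI[of _ "(coxeter_edges S m)\<^sup>* `` {s}"]) (auto intro: quotientI)

lemma components_disjoint: "C \<in> components \<Longrightarrow> D \<in> components \<Longrightarrow> C \<noteq> D \<Longrightarrow> C \<inter> D = {}"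
  using component_reachable by blast

lemma finite_components: "finite components"
  unfolding coxeter_components_def quotient_def using finite_S by simp

lemma not_adjacent: "s \<in> S \<Longrightarrow> t \<in> S \<Longrightarrow> s \<noteq> t \<Longrightarrow> (s, t) \<notin> coxeter_edges S m \<Longrightarrow> m s t = 2"
proof -
  assume st: "s \<in> S" "t \<in> S" "s \<noteq> t" "(s, t) \<notin> coxeter_edges S m"
  then have "2 \<le> m s t" "\<not> 3 \<le> m s t" using off_diag unfolding coxeter_edges_def by auto
  then show "m s t = 2" by (cases "m s t") (auto simp: numeral_eq_enat)
qed

lemma different_components_commute:
  assumes "C \<in> components" "s \<in> C" "t \<in> S - C"
  shows "m s t = 2 \<and> m t s = 2"
proof -
  have s: "s \<in> S" "t \<in> S" "s \<noteq> t" using assms component_subset by blast+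
  have "(s, t) \<notin> (coxeter_edges S m)\<^sup>*" using assms component_reachable by blast
  then have "(s, t) \<notin> coxeter_edges S m" by blast
  then have "m s t = 2" using not_adjacent s by blast
  then show ?thesis using symm[OF s] by simp
qed

text \<open>A subset without outgoing edges is closed under reachability.\<close>

lemma component_irreducible:
  assumes C: "C \<in> components"
  shows "irreducible C"
  unfolding irreducible_def
proof (intro allI impI)
  fix Y assume Y: "Y \<subseteq> C" "Y \<noteq> {}" "Y \<noteq> C"
  show "\<exists>y\<in>Y. \<exists>t\<in>C - Y. total_matrix S m y t \<noteq> 2"
  proof (rule ccontr)
    assume *: "\<not> ?thesis"
    obtain y0 where y0: "y0 \<in> Y" using Y(2) by blast
    have "t \<in> Y" if "(y0, t) \<in> (coxeter_edges S m)\<^sup>*" for t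
      using that
    proof (induction rule: rtrancl_induct)
      case (step y t)
      have "(y0, t) \<in> (coxeter_edges S m)\<^sup>*" using step.hyps by (rule rtrancl_into_rtrancl)
      then have "t \<in> C" using component_reachable[OF C] y0 Y(1) by blast
      moreover have "y \<in> S" "t \<in> S" "3 \<le> m y t" using step.hyps(2) unfolding coxeter_edges_def by auto
      then have "total_matrix S m y t \<noteq> 2" by (auto simp: total_matrix_eq numeral_eq_enat)
      ultimately show ?case using * step.IH by blast
    qed (rule y0)
    then have "C \<subseteq> Y" using component_reachable[OF C] y0 Y(1) by blast
    then show False using Y by blast
  qed
qed

text \<open>Delete all letters outside of \<open>C\<close>; the choice of the word does not matter by \<open>pres_eq_filter\<close>.\<close>

definition proj :: "'a set \<Rightarrow> 'g \<Rightarrow> 'g" where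
  "proj C x = e (filter (\<lambda>a. fst a \<in> C) (SOME u. u \<in> words S \<and> e u = x))"

lemma filter_words: "u \<in> words S \<Longrightarrow> filter Q u \<in> words S"
  by (induction u) auto

lemma filter_words_C: "filter (\<lambda>a. fst a \<in> C) u \<in> words C"
  by (induction u) auto

lemma filter_id: "u \<in> words C \<Longrightarrow> filter (\<lambda>a. fst a \<in> C) u = u"
  by (induction u) auto

lemma proj_e:
  assumes C: "C \<in> components" and u: "u \<in> words S"
  shows "proj C (e u) = e (filter (\<lambda>a. fst a \<in> C) u)"
proof -
  let ?v = "SOME v. v \<in> words S \<and> e v = e u"
  have v: "?v \<in> words S \<and> e ?v = e u" by (rule someI[of _ u]) (simp add: u)
  then have "pres_eq S R ?v u" using e_eq_iff u by blast
  then have "pres_eq C (artin_relations C m) (filter (\<lambda>a. fst a \<in> C) ?v) (filter (\<lambda>a. fst a \<in> C) u)"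
    by (rule pres_eq_filter[where m = m, OF component_subset[OF C], rotated]) (rule different_components_commute[OF C])
  then have "pres_eq S R (filter (\<lambda>a. fst a \<in> C) ?v) (filter (\<lambda>a. fst a \<in> C) u)"
    by (rule pres_eq_subset[OF component_subset[OF C]])
  then show ?thesis unfolding proj_def using e_eq_iff[OF filter_words filter_words] v u by blast
qed

text \<open>Letters outside of \<open>C\<close> commute with those in \<open>C\<close> and can be moved to the right.\<close>

lemma e_split:
  assumes C: "C \<in> components"
  shows "u \<in> words S \<Longrightarrow> e u = e (filter (\<lambda>a. fst a \<in> C) u) * e (filter (\<lambda>a. fst a \<notin> C) u)"
proof (induction u)
  case (Cons a u)
  let ?f = "filter (\<lambda>a. fst a \<in> C)" and ?g = "filter (\<lambda>a. fst a \<notin> C)"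
  have a: "fst a \<in> S" "[a] \<in> words S" "u \<in> words S" using Cons.prems by auto
  have cons: "e (a # w) = e [a] * e w" if "w \<in> words S" for w using e_append[OF a(2) that] by simp
  have IH: "e u = e (?f u) * e (?g u)" by (rule Cons.IH[OF a(3)])
  show ?case
  proof (cases "fst a \<in> C")
    case True
    then show ?thesis using cons[OF a(3)] cons[OF filter_words[OF a(3)]] IH by (simp add: mult.assoc)
  next
    case False
    obtain s b where sb: "a = (s, b)" by force
    have s: "s \<in> S" "s \<notin> C" using a(1) False sb by auto
    have "commute (gen s) (gen t)" if t: "t \<in> C" for t
    proof (rule sigma_commute)
      show "s \<in> S" "t \<in> S" using s t component_subset[OF C] by blast+
      then show "total_matrix S m s t = 2"
        using different_components_commute[OF C t, of s] s by (simp add: total_matrix_eq)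
    qed
    then have "commute (gen s) x" if "x \<in> A C" for x using commute_all that by blast
    moreover have "e (?f u) \<in> A C"
      unfolding A_eq_image[OF component_subset[OF C]] by (rule imageI[OF filter_words_C])
    ultimately have "commute (gen s) (e (?f u))" by blast
    then have "commute (e [a]) (e (?f u))"
      using e_inverse_letter[OF s(1)] commute_left(2)[of "gen s"] unfolding sb gen_def by (cases b) auto
    then have "e [a] * e (?f u) = e (?f u) * e [a]" unfolding commute_def .
    then show ?thesis
      using cons[OF a(3)] cons[OF filter_words[OF a(3)], of "\<lambda>a. fst a \<notin> C"] IH False
      by (simp add: mult.assoc[symmetric])
  qed
qed (simp add: e_Nil)

lemma e_trivial_if_components_trivial:
  assumes u: "u \<in> words S" and triv: "\<And>C. C \<in> components \<Longrightarrow> e (filter (\<lambda>a. fst a \<in> C) u) = 1"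
  shows "e u = 1"
proof -
  have "e (filter (\<lambda>a. fst a \<notin> \<Union>\<K>) u) = e u" if "finite \<K>" "\<K> \<subseteq> components" for \<K>
    using that
  proof (induction \<K> rule: finite_induct)
    case (insert C \<K>)
    let ?w = "filter (\<lambda>a. fst a \<notin> \<Union>\<K>) u"
    have C: "C \<in> components" using insert.prems by blast
    have disj: "C \<inter> \<Union>\<K> = {}" using components_disjoint[OF C] insert by blast
    have "filter (\<lambda>a. fst a \<in> C) ?w = filter (\<lambda>a. fst a \<in> C) u"
      unfolding filter_filter using disj by (intro filter_cong) auto
    moreover have "filter (\<lambda>a. fst a \<notin> C) ?w = filter (\<lambda>a. fst a \<notin> \<Union>(insert C \<K>)) u"
      unfolding filter_filter by (intro filter_cong) auto
    ultimately show ?case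
      using e_split[OF C filter_words[OF u], of "\<lambda>a. fst a \<notin> \<Union>\<K>"] triv[OF C] insert by simp
  qed simp
  from this[OF finite_components order_refl] have "e (filter (\<lambda>a. fst a \<notin> \<Union>components) u) = e u" .
  moreover have "filter (\<lambda>a. fst a \<notin> \<Union>components) u = []"
    using u components_cover by (induction u) auto
  ultimately show ?thesis using e_Nil by simp
qed

lemma proj_image: "C \<in> components \<Longrightarrow> proj C ` A S = A C"
proof -
  assume C: "C \<in> components"
  have S: "C \<subseteq> S" by (rule component_subset[OF C])
  show "proj C ` A S = A C"
    unfolding A_eq_image[OF order_refl] A_eq_image[OF S]
  proof
    show "proj C ` e ` words S \<subseteq> e ` words C" using proj_e[OF C] filter_words_C by auto
    show "e ` words C \<subseteq> proj C ` e ` words S"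
    proof
      fix x assume "x \<in> e ` words C"
      then obtain u where u: "u \<in> words C" "x = e u" by blast
      have w: "u \<in> words S" by (rule words_subset[OF S u(1)])
      then have "x = proj C (e u)" using proj_e[OF C w] filter_id[OF u(1)] u(2) by simp
      then show "x \<in> proj C ` e ` words S" using w by blast
    qed
  qed
qed

lemma good_decomp_components: "good_decomp (A S) components proj (\<lambda>_. elen) \<delta>"
proof
  have AS: "A S = e ` words S" by (rule A_eq_image[OF order_refl])
  show "subgp (A S)" by (rule subgp_A)
  show "finite components" by (rule finite_components)
  show "proj C x \<in> A S" if C: "C \<in> components" and "x \<in> A S" for C x
    using that(2) unfolding AS by (elim imageE) (simp add: proj_e[OF C] filter_words)
  show "hom_on (A S) (proj C)" if C: "C \<in> components" for C
    unfolding hom_on_def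
  proof (intro ballI)
    fix x y assume "x \<in> A S" "y \<in> A S"
    then obtain u v where uv: "u \<in> words S" "x = e u" "v \<in> words S" "y = e v" unfolding AS by blast
    have "x * y = e (u @ v)" using uv e_append by simp
    then show "proj C (x * y) = proj C x * proj C y"
      using proj_e[OF C, of "u @ v"] proj_e[OF C uv(1)] proj_e[OF C uv(3)] uv e_append[OF filter_words filter_words] by simp
  qed
  show "proj C (proj C x) = proj C x" if C: "C \<in> components" and "x \<in> A S" for C x
    using that(2) unfolding AS by (elim imageE) (simp add: proj_e[OF C] filter_words)
  show "proj C (proj D x) = 1" if CD: "C \<in> components" "D \<in> components" "C \<noteq> D" and "x \<in> A S" for C D x
  proof -
    have "x \<in> e ` words S" using that(4) unfolding AS .
    then obtain u where u: "u \<in> words S" "x = e u" by blast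
    have "filter (\<lambda>a. fst a \<in> C) (filter (\<lambda>a. fst a \<in> D) u) = []"
      using components_disjoint[OF CD] by (auto simp: filter_empty_conv)
    then show ?thesis using proj_e[OF CD(1) filter_words[OF u(1)]] proj_e[OF CD(2) u(1)] u(2) e_Nil by simp
  qed
  show "x = 1" if "x \<in> A S" "\<And>C. C \<in> components \<Longrightarrow> proj C x = 1" for x
  proof -
    have "x \<in> e ` words S" using that(1) unfolding AS .
    then obtain u where u: "u \<in> words S" "x = e u" by blast
    then show ?thesis using e_trivial_if_components_trivial[OF u(1)] that(2) proj_e[OF _ u(1)] by simp
  qed
  show "indecomposable_group (proj C ` A S) elen (\<delta> C)" if C: "C \<in> components" for C
    unfolding proj_image[OF C]
    by (rule indecomposable_parabolic[OF component_subset[OF C] component_nonempty[OF C] component_irreducible[OF C]])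
qed

lemma embedding_whole: "group_embedding (artin_group S m) f (A S)"
  using embedding A0_eq A_eq_image[OF order_refl] by simp

text \<open>The map from the Artin group of \<open>C\<close> to that of \<open>S\<close> is injective, because deleting letters is a
  retraction.\<close>

lemma embedding_component:
  assumes C: "C \<in> components"
  shows "\<exists>g. group_embedding (artin_group C m) g (A C)"
proof -
  let ?Q = "artin_relations C m"
  have CS: "C \<subseteq> S" by (rule component_subset[OF C])
  have carrier: "carrier (artin_group C m) = pres_class C ?Q ` words C"
    unfolding artin_group_def presented_group_def by simp
  define g where "g X = e (SOME u. u \<in> X)" for X
  have g: "g (pres_class C ?Q u) = e u" if u: "u \<in> words C" for u
  proof -
    let ?v = "SOME v. v \<in> pres_class C ?Q u"
    have "u \<in> pres_class C ?Q u" unfolding pres_class_def using pres_eq.refl[OF u] by simp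
    then have "?v \<in> pres_class C ?Q u" by (rule someI)
    then have v: "pres_eq C ?Q u ?v" unfolding pres_class_def by simp
    then have "pres_eq S R u ?v" by (rule pres_eq_subset[OF CS])
    moreover have "?v \<in> words S" using pres_eq_words[OF v] words_subset[OF CS] by blast
    ultimately have "e u = e ?v" using e_eq_iff[OF words_subset[OF CS u]] by blast
    then show ?thesis unfolding g_def by (rule HOL.sym)
  qed
  have "group (artin_group C m)" unfolding artin_group_def by (rule group_presented_group)
  moreover have "inj_on g (carrier (artin_group C m))"
  proof (rule inj_onI)
    fix X Y assume "X \<in> carrier (artin_group C m)" "Y \<in> carrier (artin_group C m)" and XY: "g X = g Y"
    then obtain u v where uv: "u \<in> words C" "X = pres_class C ?Q u" "v \<in> words C" "Y = pres_class C ?Q v"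
      unfolding carrier by blast
    have "pres_eq S R u v" using XY g uv e_eq_iff words_subset[OF CS] by simp
    then have "pres_eq C ?Q (filter (\<lambda>a. fst a \<in> C) u) (filter (\<lambda>a. fst a \<in> C) v)"
      by (rule pres_eq_filter[where m = m, OF CS, rotated]) (rule different_components_commute[OF C])
    then have "pres_eq C ?Q u v" unfolding filter_id[OF uv(1)] filter_id[OF uv(3)] .
    then show "X = Y" using uv pres_class_eq_iff[OF uv(1)] by blast
  qed
  moreover have "g (X \<otimes>\<^bsub>artin_group C m\<^esub> Y) = g X * g Y"
    if XY: "X \<in> carrier (artin_group C m)" "Y \<in> carrier (artin_group C m)" for X Y
  proof -
    obtain u v where uv: "u \<in> words C" "X = pres_class C ?Q u" "v \<in> words C" "Y = pres_class C ?Q v"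
      using XY unfolding carrier by blast
    have "X \<otimes>\<^bsub>artin_group C m\<^esub> Y = pres_class C ?Q (u @ v)"
      unfolding artin_group_def uv(2,4) by (rule presented_group_mult[OF uv(1,3)])
    then show ?thesis using g[of "u @ v"] g[OF uv(1)] g[OF uv(3)] uv e_append words_subset[OF CS] by simp
  qed
  moreover have "g ` carrier (artin_group C m) = A C"
    unfolding carrier A_eq_image[OF CS] image_image using g by (intro image_cong) auto
  ultimately show ?thesis unfolding group_embedding_def by blast
qed

end

lemma ex_spherical_artin_group:
  fixes S :: "'a set"
  assumes "coxeter_matrix S m" "spherical_type S m"
  shows "\<exists>(f :: 'a word set \<Rightarrow> 'a word set bijection) A0. spherical_artin_group S m f A0"
proof -
  have "group (artin_group S m)" unfolding artin_group_def by (rule group_presented_group)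
  from cayley[OF this] show ?thesis
    using assms unfolding spherical_artin_group_def spherical_artin_group_axioms_def by blast
qed

text \<open>Both groups are embedded into groups of permutations, where their decompositions into components are
  decompositions into indecomposable factors.\<close>

lemma commensurable_iff_components:
  fixes S :: "'a set" and T :: "'b set"
  assumes S: "coxeter_matrix S m" "spherical_type S m" and T: "coxeter_matrix T n" "spherical_type T n"
  shows "commensurable (artin_group S m) (artin_group T n) \<longleftrightarrow>
    (\<exists>\<rho>. bij_betw \<rho> (coxeter_components S m) (coxeter_components T n) \<and>
      (\<forall>C\<in>coxeter_components S m. commensurable (artin_group C m) (artin_group (\<rho> C) n)))"
proof -
  obtain f :: "'a word set \<Rightarrow> 'a word set bijection" and A0 where "spherical_artin_group S m f A0"
    using ex_spherical_artin_group[OF S] by blast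
  then interpret X: spherical_artin_group S m f A0 .
  obtain f' :: "'b word set \<Rightarrow> 'b word set bijection" and B0 where "spherical_artin_group T n f' B0"
    using ex_spherical_artin_group[OF T] by blast
  then interpret Y: spherical_artin_group T n f' B0 .
  note DX = X.good_decomp_components and DY = Y.good_decomp_components
  interpret DX: good_decomp "X.A S" "coxeter_components S m" X.proj "\<lambda>_. X.elen" X.\<delta> by (rule DX)
  interpret DY: good_decomp "Y.A T" "coxeter_components T n" Y.proj "\<lambda>_. Y.elen" Y.\<delta> by (rule DY)
  have F: "DX.F C = X.A C" if "C \<in> coxeter_components S m" for C
    unfolding DX.F_def by (rule X.proj_image[OF that])
  have F': "DY.F C = Y.A C" if "C \<in> coxeter_components T n" for C
    unfolding DY.F_def by (rule Y.proj_image[OF that])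
  have factor: "commensurable (artin_group C m) (artin_group D n) \<longleftrightarrow> comm_sub (DX.F C) (DY.F D)"
    if CD: "C \<in> coxeter_components S m" "D \<in> coxeter_components T n" for C D
  proof -
    obtain g where g: "group_embedding (artin_group C m) g (X.A C)" using X.embedding_component[OF CD(1)] by blast
    obtain g' where g': "group_embedding (artin_group D n) g' (Y.A D)" using Y.embedding_component[OF CD(2)] by blast
    show ?thesis unfolding F[OF CD(1)] F'[OF CD(2)] by (rule commensurable_iff_comm_sub[OF g g'])
  qed
  have whole: "commensurable (artin_group S m) (artin_group T n) \<longleftrightarrow> comm_sub (X.A S) (Y.A T)"
    by (rule commensurable_iff_comm_sub[OF X.embedding_whole Y.embedding_whole])
  show ?thesis
  proof
    assume "commensurable (artin_group S m) (artin_group T n)"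
    then have "comm_sub (X.A S) (Y.A T)" using whole by blast
    from comm_sub_factors_matched[OF DX DY this] obtain \<rho>
      where \<rho>: "bij_betw \<rho> (coxeter_components S m) (coxeter_components T n)"
        "\<forall>C\<in>coxeter_components S m. comm_sub (DX.F C) (DY.F (\<rho> C))" by blast
    then have "commensurable (artin_group C m) (artin_group (\<rho> C) n)" if "C \<in> coxeter_components S m" for C
      using factor[OF that bij_betwE[OF \<rho>(1), THEN bspec, OF that]] that by blast
    then show "\<exists>\<rho>. bij_betw \<rho> (coxeter_components S m) (coxeter_components T n) \<and>
      (\<forall>C\<in>coxeter_components S m. commensurable (artin_group C m) (artin_group (\<rho> C) n))" using \<rho>(1) by blast
  next
    assume "\<exists>\<rho>. bij_betw \<rho> (coxeter_components S m) (coxeter_components T n) \<and>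
      (\<forall>C\<in>coxeter_components S m. commensurable (artin_group C m) (artin_group (\<rho> C) n))"
    then obtain \<rho> where \<rho>: "bij_betw \<rho> (coxeter_components S m) (coxeter_components T n)"
      "\<forall>C\<in>coxeter_components S m. commensurable (artin_group C m) (artin_group (\<rho> C) n)" by blast
    have "comm_sub (X.A S) (Y.A T)"
    proof (rule comm_sub_product[OF DX.decomp_axioms DY.decomp_axioms \<rho>(1)])
      fix C assume C: "C \<in> coxeter_components S m"
      show "comm_sub (DX.F C) (DY.F (\<rho> C))"
        using factor[OF C bij_betwE[OF \<rho>(1), THEN bspec, OF C]] \<rho>(2) C by blast
    qed
    then show "commensurable (artin_group S m) (artin_group T n)" using whole by blast
  qed
qed

theorem theorem3:
  fixes S :: "'a set" and m :: "'a \<Rightarrow> 'a \<Rightarrow> enat"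
    and T :: "'b set" and n :: "'b \<Rightarrow> 'b \<Rightarrow> enat"
    and C :: "nat \<Rightarrow> 'a set" and D :: "nat \<Rightarrow> 'b set"
    and p q :: nat
  assumes "coxeter_matrix S m" and "coxeter_matrix T n"
    and "spherical_type S m" and "spherical_type T n"
    and "bij_betw C {1..p} (coxeter_components S m)"
    and "bij_betw D {1..q} (coxeter_components T n)"
  shows "commensurable (artin_group S m) (artin_group T n) \<longleftrightarrow>
    p = q \<and>
    (\<exists>\<pi>. \<pi> permutes {1..p} \<and>
      (\<forall>i\<in>{1..p}. commensurable (artin_group (C i) m) (artin_group (D (\<pi> i)) n)))"
proof -
  let ?X = "coxeter_components S m" and ?Y = "coxeter_components T n"
  note main = commensurable_iff_components[OF assms(1,3,2,4)]
  let ?D' = "inv_into {1..q} D" and ?C' = "inv_into {1..p} C"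
  have C': "bij_betw ?C' ?X {1..p}" and D': "bij_betw ?D' ?Y {1..q}"
    using bij_betw_inv_into[OF assms(5)] bij_betw_inv_into[OF assms(6)] .
  show ?thesis unfolding main
  proof
    assume "\<exists>\<rho>. bij_betw \<rho> ?X ?Y \<and> (\<forall>C\<in>?X. commensurable (artin_group C m) (artin_group (\<rho> C) n))"
    then obtain \<rho> where \<rho>: "bij_betw \<rho> ?X ?Y"
      "\<And>C. C \<in> ?X \<Longrightarrow> commensurable (artin_group C m) (artin_group (\<rho> C) n)" by blast
    have bij: "bij_betw (?D' \<circ> (\<rho> \<circ> C)) {1..p} {1..q}"
      by (rule bij_betw_trans[OF bij_betw_trans[OF assms(5) \<rho>(1)] D'])
    have pq: "p = q" using bij_betw_same_card[OF bij] by simp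
    define \<pi> where "\<pi> i = (if i \<in> {1..p} then ?D' (\<rho> (C i)) else i)" for i
    have "bij_betw \<pi> {1..p} {1..q}"
      using bij by (rule bij_betw_cong[THEN iffD1, rotated]) (simp add: \<pi>_def)
    then have "bij_betw \<pi> {1..p} {1..p}" using pq by simp
    then have "\<pi> permutes {1..p}" by (rule bij_imp_permutes) (auto simp: \<pi>_def)
    moreover have "commensurable (artin_group (C i) m) (artin_group (D (\<pi> i)) n)" if i: "i \<in> {1..p}" for i
    proof -
      have Ci: "C i \<in> ?X" using bij_betwE[OF assms(5)] i by blast
      then have "\<rho> (C i) \<in> ?Y" using bij_betwE[OF \<rho>(1)] by blast
      then have "D (?D' (\<rho> (C i))) = \<rho> (C i)" using assms(6) by (simp add: bij_betw_inv_into_right)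
      then show ?thesis using \<rho>(2)[OF Ci] i by (simp add: \<pi>_def)
    qed
    ultimately show "p = q \<and> (\<exists>\<pi>. \<pi> permutes {1..p} \<and>
      (\<forall>i\<in>{1..p}. commensurable (artin_group (C i) m) (artin_group (D (\<pi> i)) n)))" using pq by blast
  next
    assume "p = q \<and> (\<exists>\<pi>. \<pi> permutes {1..p} \<and>
      (\<forall>i\<in>{1..p}. commensurable (artin_group (C i) m) (artin_group (D (\<pi> i)) n)))"
    then obtain \<pi> where pq: "p = q" and \<pi>: "\<pi> permutes {1..p}"
      "\<And>i. i \<in> {1..p} \<Longrightarrow> commensurable (artin_group (C i) m) (artin_group (D (\<pi> i)) n)" by blast
    have D: "bij_betw D {1..p} ?Y" using assms(6) pq by simp
    have "bij_betw (D \<circ> (\<pi> \<circ> ?C')) ?X ?Y"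
      by (rule bij_betw_trans[OF bij_betw_trans[OF C' permutes_imp_bij[OF \<pi>(1)]] D])
    moreover have "commensurable (artin_group B m) (artin_group ((D \<circ> (\<pi> \<circ> ?C')) B) n)" if B: "B \<in> ?X" for B
    proof -
      have "?C' B \<in> {1..p}" using bij_betwE[OF C'] B by blast
      moreover have "C (?C' B) = B" using assms(5) B by (simp add: bij_betw_inv_into_right)
      ultimately show ?thesis using \<pi>(2)[of "?C' B"] by simp
    qed
    ultimately show "\<exists>\<rho>. bij_betw \<rho> ?X ?Y \<and> (\<forall>C\<in>?X. commensurable (artin_group C m) (artin_group (\<rho> C) n))"
      by blast
  qed
qed

end
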